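(* For a standard tableau $\Lambda$ of shape $\lambda\vdash m$, $m\geqslant1$, consider the series $$L_\Lambda(z)=\mathrm{tr}_{1,\ldots,m}\,L^-_1(ze^{-c_1(\Lambda)h})\cdots L^-_m(ze^{-c_m(\Lambda)h})\,D^{\otimes m}\,\mathcal{E}_\Lambda\in\mathrm{Y}_h(\mathfrak{gl}_N)[[z^{-1}]]$$ with coefficients in the $h$-Yangian $\mathrm{Y}_h(\mathfrak{gl}_N)$. The coefficients of all series $L_\Lambda(z)$ pairwise commute; that is, $L_\Lambda(z_1)L_\Gamma(z_2)=L_\Gamma(z_2)L_\Lambda(z_1)$ for any standard tableaux $\Lambda$ and $\Gamma$ (of arbitrary shapes and sizes).
   Context: $N\geqslant2$ is a fixed integer, $h$ a formal parameter, $e_{ij}\in\mathrm{End}\,\mathbb{C}^N$ are matrix units; subscripts of matrices indicate tensor factors and $\mathrm{tr}_{1,\ldots,m}$ is the trace over the matrix tensor factors $1,\ldots,m$. $R$-matrix: $$\overline R(z)=\sum_i e_{ii}\otimes e_{ii}+e^{-h/2}\tfrac{1-z}{1-ze^{-h}}\sum_{i\ne j}e_{ii}\otimes e_{jj}+\tfrac{(1-e^{-h})z}{1-ze^{-h}}\sum_{i>j}e_{ij}\otimes e_{ji}+\tfrac{1-e^{-h}}{1-ze^{-h}}\sum_{i<j}e_{ij}\otimes e_{ji}.$$ The $h$-Yangian $\mathrm{Y}_h(\mathfrak{gl}_N)$ is the associative algebra over $\mathbb{C}[[h]]$, assumed to be topologically free (in particular $h$-adically complete), generated by $\ell_{ij}^{(r)}$,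 $i,j=1,\ldots,N$, $r\geqslant0$, with defining relations $$R(z_1/z_2)L^-_1(z_1)L^-_2(z_2)=L^-_2(z_2)L^-_1(z_1)R(z_1/z_2),$$ where $L^-(z)=\sum_{i,j}e_{ij}\otimes\ell_{ij}(z)$, $\ell_{ij}(z)=\delta_{ij}-h\sum_{r\geqslant0}\ell_{ij}^{(r)}z^{-r}$, and $R(z)=f(z)\overline R(z)$ is expanded in nonnegative powers of $z$. Here $f(z)=f_q(z)|_{q=e^{h/2}}$ and $f_q(z)=1+\sum_{r\geqslant1}f_{q,r}\frac{z^r}{(1-z)^r}\in\mathbb{C}(q)[[z]]$ is the unique such series with all $f_{q,r}(q-1)^{-r}$ regular at $q=1$ and $f_q(zq^{2N})=f_q(z)\frac{(1-zq^2)(1-zq^{2N-2})}{(1-z)(1-zq^{2N})}$; the factor $f$ cancels, so $R$ may equivalently be replaced by $\overline R$ in the defining relations. $D=\mathrm{diag}(e^{(N-1)h/2},e^{(N-3)h/2},\ldots,e^{-(N-1)h/2})$. The idempotents $\mathcal{E}_\Lambda$. For a standard tableau $\Lambda$ of shape $\lambda\vdash m$, $c_k(\Lambda)$ is the content $j-i$ of the box $(i,j)$ occupied by $k$. Put $q=e^{h/2}$, $\check R(z)=\frac{e^{h/2}-e^{-h/2}z}{1-z}\overline R(z)$, $P=\sum_{i,j}e_{ij}\otimes e_{ji}$, and $$\check R_\Lambda(z_1,\ldots,z_m)=\prod_{(i,j)}^{\longrightarrow}P_{j-i\,j-i+1}\check R_{j-i\,j-i+1}(z_ie^{(c_i(\Lambda)-c_j(\Lambda))h}/z_j),$$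 the product over pairs $1\leqslant i<j\leqslant m$ ordered from left to right by $(i,j)\prec(i',j')$ iff $j<j'$, or $j=j'$ and $i<i'$. Let $\check R_0=\prod^{\longrightarrow}_{(i,j)}P_{j-i\,j-i+1}\check R_{j-i\,j-i+1}(0)$ with the same order (the image of the basis element of the Hecke algebra attached to the longest permutation), and $c_{\lambda'}=\prod_{\alpha\in\lambda}q^{-\mathrm{cont}(\alpha)}\frac{q^{\mathrm{hook}(\alpha)}-q^{-\mathrm{hook}(\alpha)}}{q-q^{-1}}$ (the Schur element of the conjugate partition $\lambda'$), with content and hook length of the boxes $\alpha$ of $\lambda$. Then $\mathcal{E}_\Lambda=\frac1{c_{\lambda'}}\check R_\Lambda(z_1,\ldots,z_m)\check R_0^{-1}\big|_{z_1=1}\big|_{z_2=1}\cdots\big|_{z_m=1}$ (consecutive evaluations) is a well-defined idempotent operator on $(\mathbb{C}^N)^{\otimes m}$. *)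

theory Defs
  imports
    Complex_Main
    "HOL-Library.Cardinality"
    "HOL-Library.Poly_Mapping"
    "HOL-Computational_Algebra.Formal_Power_Series"
    "HOL-Computational_Algebra.Fraction_Field"
begin

text \<open>
  The integer N is the cardinality of a finite linearly ordered index type \<open>'n\<close>.
  The ground ring of formal power series in h is \<^typ>\<open>complex fps\<close>; in it,
  \<^term>\<open>fps_exp a\<close> is the series \<open>e\<^sup>a\<^sup>h\<close>, so that \<open>q = e\<^sup>h\<^sup>/\<^sup>2\<close> is \<^term>\<open>fps_exp (1/2 :: complex)\<close>.
\<close>

section \<open>Operators on tensor powers\<close>

text \<open>
  An operator on the \<open>m\<close>-th tensor power is given by its matrix entries, rows and columns being
  indexed by lists of length \<open>m\<close> (entry \<open>x y\<close> is the coefficient of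
  \<open>e\<^bsub>x1 y1\<^esub> \<otimes> \<dots> \<otimes> e\<^bsub>xm ym\<^esub>\<close>). The entries lie in an arbitrary, possibly noncommutative, ring.
  Tensor factors are numbered from 1.
\<close>

type_synonym ('n, 'a) tmat = "'n list \<Rightarrow> 'n list \<Rightarrow> 'a"

definition tone :: "nat \<Rightarrow> ('n, 'a::{zero,one}) tmat" where
  "tone m x y = (if length x = m \<and> x = y then 1 else 0)"

definition tmult :: "nat \<Rightarrow> ('n, 'a::{comm_monoid_add,times}) tmat \<Rightarrow> ('n, 'a) tmat \<Rightarrow> ('n, 'a) tmat" where
  "tmult m A B x y =
     (if length x = m \<and> length y = m then \<Sum>z | length z = m. A x z * B z y else 0)"

definition tprod :: "nat \<Rightarrow> ('n, 'a::{comm_monoid_add,times,one}) tmat list \<Rightarrow> ('n, 'a) tmat" where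
  "tprod m As = foldr (tmult m) As (tone m)"

definition ttrace :: "nat \<Rightarrow> ('n, 'a::comm_monoid_add) tmat \<Rightarrow> 'a" where
  "ttrace m A = (\<Sum>x | length x = m. A x x)"

definition tmap :: "('a \<Rightarrow> 'b) \<Rightarrow> ('n, 'a) tmat \<Rightarrow> ('n, 'b) tmat" where
  "tmap \<phi> A x y = \<phi> (A x y)"

text \<open>
  Entries at lists of length other than \<open>m\<close> are ignored by \<^const>\<open>tmult\<close>, so the operator chosen
  here is determined up to such irrelevant entries.
\<close>

definition tinv :: "nat \<Rightarrow> ('n, 'a::{comm_monoid_add,times,one}) tmat \<Rightarrow> ('n, 'a) tmat" where
  "tinv m A = (SOME B. tmult m A B = tone m \<and> tmult m B A = tone m)"

definition site :: "nat \<Rightarrow> nat \<Rightarrow> ('n \<Rightarrow> 'n \<Rightarrow> 'a::zero) \<Rightarrow> ('n, 'a) tmat" where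
  "site m k A x y =
     (if length x = m \<and> length y = m \<and> (\<forall>l\<in>{1..m} - {k}. x ! (l - 1) = y ! (l - 1))
      then A (x ! (k - 1)) (y ! (k - 1)) else 0)"

definition site2 :: "nat \<Rightarrow> nat \<Rightarrow> nat \<Rightarrow> ('n, 'a::zero) tmat \<Rightarrow> ('n, 'a) tmat" where
  "site2 m k l A x y =
     (if length x = m \<and> length y = m \<and> (\<forall>r\<in>{1..m} - {k, l}. x ! (r - 1) = y ! (r - 1))
      then A [x ! (k - 1), x ! (l - 1)] [y ! (k - 1), y ! (l - 1)] else 0)"

text \<open>\<open>unit2 i j k l\<close> is \<open>e\<^bsub>ij\<^esub> \<otimes> e\<^bsub>kl\<^esub>\<close>.\<close>

definition unit2 :: "'n \<Rightarrow> 'n \<Rightarrow> 'n \<Rightarrow> 'n \<Rightarrow> ('n, 'a::{zero,one}) tmat" where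
  "unit2 i j k l x y = (if x = [i, k] \<and> y = [j, l] then 1 else 0)"

definition perm_op :: "('n::finite, 'a::comm_ring_1) tmat" where
  "perm_op x y = (\<Sum>(i, j)\<in>UNIV. unit2 i j j i x y)"

text \<open>
  The normalised R-matrix. The argument \<open>s\<close> stands for \<open>e\<^sup>-\<^sup>h\<^sup>/\<^sup>2\<close>. The definition is used both over
  the field of rational functions and for power series in \<open>z\<close> with coefficients in
  \<^typ>\<open>complex fps\<close>; there \<open>1 - z s\<^sup>2\<close> is a unit and the division is its geometric expansion.
\<close>

definition rbar :: "'a \<Rightarrow> 'a \<Rightarrow> ('n::{finite,linorder}, 'a::{comm_ring_1,inverse}) tmat" where
  "rbar s z x y =
     (\<Sum>i\<in>UNIV. unit2 i i i i x y)
     + s * ((1 - z) / (1 - z * s\<^sup>2)) * (\<Sum>(i, j) | i \<noteq> j. unit2 i i j j x y)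
     + ((1 - s\<^sup>2) * z) / (1 - z * s\<^sup>2) * (\<Sum>(i, j) | i > j. unit2 i j j i x y)
     + (1 - s\<^sup>2) / (1 - z * s\<^sup>2) * (\<Sum>(i, j) | i < j. unit2 i j j i x y)"

section \<open>Rational functions in the variables z\<close>

text \<open>
  The polynomial ring in variables \<open>z\<^sub>1, z\<^sub>2, \<dots>\<close> over \<^typ>\<open>complex fps\<close> and its field of fractions.
\<close>

type_synonym zpoly = "(nat \<Rightarrow>\<^sub>0 nat) \<Rightarrow>\<^sub>0 complex fps"
type_synonym zfun = "zpoly fract"

definition zconst :: "complex fps \<Rightarrow> zfun" where
  "zconst c = Fract (Poly_Mapping.single 0 c) 1"

definition zvar :: "nat \<Rightarrow> zfun" where
  "zvar k = Fract (Poly_Mapping.single (Poly_Mapping.single k 1) 1) 1"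

definition zexp :: "complex \<Rightarrow> zfun" where
  "zexp a = zconst (fps_exp a)"

definition subst_one :: "nat \<Rightarrow> zpoly \<Rightarrow> zpoly" where
  "subst_one k p =
     (\<Sum>t\<in>Poly_Mapping.keys p.
        Poly_Mapping.single (Poly_Mapping.update k 0 t) (Poly_Mapping.lookup p t))"

text \<open>
  \<open>eval_one k f\<close> is the value of \<open>f\<close> at \<open>z\<^sub>k = 1\<close>, a rational function in the remaining variables;
  it is meaningful if \<open>f\<close> can be written with a denominator not vanishing identically on \<open>z\<^sub>k = 1\<close>.
\<close>

definition regular_one :: "nat \<Rightarrow> zfun \<Rightarrow> bool" where
  "regular_one k f \<longleftrightarrow> (\<exists>a b. f = Fract a b \<and> subst_one k b \<noteq> 0)"

definition eval_one :: "nat \<Rightarrow> zfun \<Rightarrow> zfun" where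
  "eval_one k f =
     (THE v. \<exists>a b. f = Fract a b \<and> subst_one k b \<noteq> 0 \<and> v = Fract (subst_one k a) (subst_one k b))"

text \<open>
  An operator-valued function that is not regular at \<open>z\<^sub>k = 1\<close>, and likewise an operator whose entries
  are not constants from \<^typ>\<open>complex fps\<close>, gets the dummy value 0.
\<close>

definition teval_one :: "nat \<Rightarrow> ('n, zfun) tmat \<Rightarrow> ('n, zfun) tmat" where
  "teval_one k A = (if \<forall>x y. regular_one k (A x y) then tmap (eval_one k) A else (\<lambda>x y. 0))"

definition tconstant :: "('n, zfun) tmat \<Rightarrow> ('n, complex fps) tmat" where
  "tconstant A = (if \<forall>x y. A x y \<in> range zconst then tmap (inv zconst) A else (\<lambda>x y. 0))"

section \<open>Standard tableaux\<close>

text \<open>Rows and columns of a diagram are numbered from 0, which does not affect contents.\<close>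

definition partition_of :: "nat list \<Rightarrow> nat \<Rightarrow> bool" where
  "partition_of lam m \<longleftrightarrow> sorted_wrt (\<ge>) lam \<and> 0 \<notin> set lam \<and> sum_list lam = m"

definition diagram :: "nat list \<Rightarrow> (nat \<times> nat) set" where
  "diagram lam = {(i, j). i < length lam \<and> j < lam ! i}"

definition standard_tableau :: "nat list \<Rightarrow> (nat \<times> nat \<Rightarrow> nat) \<Rightarrow> bool" where
  "standard_tableau lam T \<longleftrightarrow>
     bij_betw T (diagram lam) {1..sum_list lam}
     \<and> (\<forall>i j. (i, Suc j) \<in> diagram lam \<longrightarrow> T (i, j) < T (i, Suc j))
     \<and> (\<forall>i j. (Suc i, j) \<in> diagram lam \<longrightarrow> T (i, j) < T (Suc i, j))"

definition cont :: "nat \<times> nat \<Rightarrow> int" where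
  "cont \<alpha> = int (snd \<alpha>) - int (fst \<alpha>)"

definition hook :: "nat list \<Rightarrow> nat \<times> nat \<Rightarrow> nat" where
  "hook lam \<alpha> =
     card {\<beta> \<in> diagram lam. fst \<beta> = fst \<alpha> \<and> snd \<alpha> \<le> snd \<beta> \<or> snd \<beta> = snd \<alpha> \<and> fst \<alpha> \<le> fst \<beta>}"

definition tab_cont :: "nat list \<Rightarrow> (nat \<times> nat \<Rightarrow> nat) \<Rightarrow> nat \<Rightarrow> int" where
  "tab_cont lam T k = cont (inv_into (diagram lam) T k)"

section \<open>The idempotents\<close>

definition rcheck :: "zfun \<Rightarrow> ('n::{finite,linorder}, zfun) tmat" where
  "rcheck z x y =
     (zexp (1/2) - zexp (- 1/2) * z) / (1 - z) * rbar (zexp (- 1/2)) z x y"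

definition fusion_factor :: "nat \<Rightarrow> nat \<Rightarrow> nat \<Rightarrow> zfun \<Rightarrow> ('n::{finite,linorder}, zfun) tmat" where
  "fusion_factor m i j z =
     tmult m (site2 m (j - i) (j - i + 1) perm_op) (site2 m (j - i) (j - i + 1) (rcheck z))"

text \<open>The list (1,2), (1,3), (2,3), (1,4), (2,4), (3,4), \<open>\<dots>\<close>\<close>

definition pair_list :: "nat \<Rightarrow> (nat \<times> nat) list" where
  "pair_list m = concat (map (\<lambda>j. map (\<lambda>i. (i, j)) [1..<j]) [1..<Suc m])"

definition fusion_op :: "nat \<Rightarrow> (nat \<Rightarrow> int) \<Rightarrow> ('n::{finite,linorder}, zfun) tmat" where
  "fusion_op m c =
     tprod m (map (\<lambda>(i, j). fusion_factor m i j (zvar i * zexp (of_int (c i - c j)) / zvar j))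
                  (pair_list m))"

definition fusion_op_zero :: "nat \<Rightarrow> ('n::{finite,linorder}, zfun) tmat" where
  "fusion_op_zero m = tprod m (map (\<lambda>(i, j). fusion_factor m i j 0) (pair_list m))"

definition schur_element_conj :: "nat list \<Rightarrow> zfun" where
  "schur_element_conj lam =
     (\<Prod>\<alpha>\<in>diagram lam. zexp (- of_int (cont \<alpha>) / 2)
        * ((zexp (of_nat (hook lam \<alpha>) / 2) - zexp (- of_nat (hook lam \<alpha>) / 2))
           / (zexp (1/2) - zexp (- 1/2))))"

text \<open>The evaluations are carried out in the order \<open>z\<^sub>1 = 1\<close>, then \<open>z\<^sub>2 = 1\<close>, and so on.\<close>

definition fusion_idempotent ::
    "nat list \<Rightarrow> (nat \<times> nat \<Rightarrow> nat) \<Rightarrow> ('n::{finite,linorder}, complex fps) tmat" where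
  "fusion_idempotent lam T =
     (let m = sum_list lam in
      tconstant (fold teval_one [1..<Suc m]
        (\<lambda>x y. 1 / schur_element_conj lam
               * tmult m (fusion_op m (tab_cont lam T)) (tinv m (fusion_op_zero m)) x y)))"

section \<open>The h-Yangian\<close>

text \<open>The free monoid, written additively in order to use the convolution ring \<open>\<Rightarrow>\<^sub>0\<close>.\<close>

datatype 'g word = Word (letters: "'g list")

instantiation word :: (type) monoid_add
begin

definition zero_word :: "'a word" where "zero_word = Word []"

definition plus_word :: "'a word \<Rightarrow> 'a word \<Rightarrow> 'a word" where
  "plus_word u v = Word (letters u @ letters v)"

instance by standard (simp_all add: zero_word_def plus_word_def)

end

text \<open>
  The h-adic completion of the free algebra over \<^typ>\<open>complex fps\<close> on the letters \<open>(i, j, r)\<close>: series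
  in h (the variable \<^const>\<open>fps_X\<close>) with coefficients in the free complex algebra.
\<close>

type_synonym 'n hfree = "(('n \<times> 'n \<times> nat) word \<Rightarrow>\<^sub>0 complex) fps"

definition free_scalar :: "complex fps \<Rightarrow> 'n hfree" where
  "free_scalar c = Abs_fps (\<lambda>n. Poly_Mapping.single 0 (fps_nth c n))"

definition free_gen :: "'n \<Rightarrow> 'n \<Rightarrow> nat \<Rightarrow> 'n hfree" where
  "free_gen i j r = fps_const (Poly_Mapping.single (Word [(i, j, r)]) 1)"

text \<open>The coefficient of \<open>z\<^sup>-\<^sup>r\<close> in \<open>\<ell>\<^bsub>ij\<^esub>(z)\<close>\<close>

definition free_lcoeff :: "nat \<Rightarrow> 'n \<Rightarrow> 'n \<Rightarrow> 'n hfree" where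
  "free_lcoeff r i j = (if r = 0 \<and> i = j then 1 else 0) - fps_X * free_gen i j r"

text \<open>The coefficient of \<open>z\<^sup>k\<close> in the expansion of the R-matrix in nonnegative powers of \<open>z\<close>\<close>

definition rbar_coeff :: "nat \<Rightarrow> ('n::{finite,linorder}, complex fps) tmat" where
  "rbar_coeff k x y =
     fps_nth (rbar (fps_const (fps_exp (- 1/2))) (fps_X :: complex fps fps) x y) k"

text \<open>
  The coefficient of \<open>z\<^sub>1\<^sup>-\<^sup>p z\<^sub>2\<^sup>-\<^sup>t\<close> in the difference of the two sides of the RLL relation, taken at the
  matrix entry \<open>x y\<close>. The factor \<open>(z\<^sub>1/z\<^sub>2)\<^sup>k\<close> comes from the R-matrix, \<open>z\<^sub>1\<^sup>-\<^sup>r\<close> from the first and \<open>z\<^sub>2\<^sup>-\<^sup>s\<close>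
  from the second L-matrix, so \<open>p\<close> may be negative and \<open>t\<close> is a natural number.
  A scalar normalising factor of the R-matrix cancels in this relation and is therefore omitted.
\<close>

definition rll_relator ::
    "int \<Rightarrow> nat \<Rightarrow> 'n::{finite,linorder} list \<Rightarrow> 'n list \<Rightarrow> 'n hfree" where
  "rll_relator p t x y =
     (\<Sum>(k, r, s) | int r = p + int k \<and> s + k = t.
        tprod 2 [tmap free_scalar (rbar_coeff k), site 2 1 (free_lcoeff r), site 2 2 (free_lcoeff s)] x y
        - tprod 2 [site 2 2 (free_lcoeff s), site 2 1 (free_lcoeff r), tmap free_scalar (rbar_coeff k)] x y)"

text \<open>
  The quotient of the completed free algebra by an h-adically closed two-sided ideal \<open>I\<close> satisfying
  \<open>h a \<in> I \<Longrightarrow> a \<in> I\<close> is separated, complete and torsion-free, that is, topologically free, and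
  conversely. Hence the topologically free algebra with the given generators and defining relations
  is the quotient by the least such ideal containing the relators.
\<close>

definition top_ideal :: "'n hfree set \<Rightarrow> bool" where
  "top_ideal I \<longleftrightarrow>
     0 \<in> I \<and> (\<forall>a\<in>I. \<forall>b\<in>I. a + b \<in> I) \<and> (\<forall>a\<in>I. \<forall>b. b * a \<in> I \<and> a * b \<in> I)
     \<and> (\<forall>a. (\<forall>n. \<exists>b\<in>I. \<exists>c. a = b + fps_X ^ n * c) \<longrightarrow> a \<in> I)
     \<and> (\<forall>a. fps_X * a \<in> I \<longrightarrow> a \<in> I)"

definition rll_ideal :: "'n::{finite,linorder} hfree set" where
  "rll_ideal = \<Inter>{I. top_ideal I \<and> (\<forall>p t x y. rll_relator p t x y \<in> I)}"

lemma top_idealD: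
  assumes "top_ideal I"
  shows "0 \<in> I"
    and "a \<in> I \<Longrightarrow> b \<in> I \<Longrightarrow> a + b \<in> I"
    and "a \<in> I \<Longrightarrow> c * a \<in> I"
    and "a \<in> I \<Longrightarrow> a * c \<in> I"
    and "(\<And>n. \<exists>b\<in>I. \<exists>c. a = b + fps_X ^ n * c) \<Longrightarrow> a \<in> I"
    and "fps_X * a \<in> I \<Longrightarrow> a \<in> I"
proof -
  note * = assms[unfolded top_ideal_def]
  note ** = *[THEN conjunct2] and *** = *[THEN conjunct2, THEN conjunct2]
    and c = *[THEN conjunct2, THEN conjunct2, THEN conjunct2]
  show "0 \<in> I" using * by (rule conjunct1)
  show "a \<in> I \<Longrightarrow> b \<in> I \<Longrightarrow> a + b \<in> I" by (rule **[THEN conjunct1, THEN bspec, THEN bspec])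
  show "a \<in> I \<Longrightarrow> c * a \<in> I"
    by (rule ***[THEN conjunct1, THEN bspec, THEN spec, THEN conjunct1])
  show "a \<in> I \<Longrightarrow> a * c \<in> I"
    by (rule ***[THEN conjunct1, THEN bspec, THEN spec, THEN conjunct2])
  show "(\<And>n. \<exists>b\<in>I. \<exists>c. a = b + fps_X ^ n * c) \<Longrightarrow> a \<in> I"
    by (rule c[THEN conjunct1, THEN spec, THEN mp]) (rule allI)
  show "fps_X * a \<in> I \<Longrightarrow> a \<in> I"
    by (rule c[THEN conjunct2, THEN spec, THEN mp])
qed

lemma in_rll_ideal_iff:
  "a \<in> rll_ideal \<longleftrightarrow> (\<forall>I. top_ideal I \<longrightarrow> (\<forall>p t x y. rll_relator p t x y \<in> I) \<longrightarrow> a \<in> I)"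
  unfolding rll_ideal_def by (simp only: Inter_iff mem_Collect_eq Ball_def imp_conjL)

lemma rll_ideal_zero: "0 \<in> rll_ideal"
  unfolding in_rll_ideal_iff by (intro allI impI, rule top_idealD(1)) simp_all

lemma rll_ideal_add: "a \<in> rll_ideal \<Longrightarrow> b \<in> rll_ideal \<Longrightarrow> a + b \<in> rll_ideal"
  unfolding in_rll_ideal_iff by (intro allI impI, rule top_idealD(2)) simp_all

lemma rll_ideal_mult_left: "a \<in> rll_ideal \<Longrightarrow> c * a \<in> rll_ideal"
  unfolding in_rll_ideal_iff by (intro allI impI, rule top_idealD(3)) simp_all

lemma rll_ideal_mult_right: "a \<in> rll_ideal \<Longrightarrow> a * c \<in> rll_ideal"
  unfolding in_rll_ideal_iff by (intro allI impI, rule top_idealD(4)) simp_all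

lemma rll_ideal_closed:
  assumes "\<And>n. \<exists>b\<in>rll_ideal. \<exists>c. a = b + fps_X ^ n * c"
  shows "(a :: 'n::{finite,linorder} hfree) \<in> rll_ideal"
  unfolding rll_ideal_def
proof (rule InterI)
  fix I :: "'n hfree set" assume I: "I \<in> {I. top_ideal I \<and> (\<forall>p t x y. rll_relator p t x y \<in> I)}"
  then have "rll_ideal \<subseteq> I" unfolding rll_ideal_def by (rule Inter_lower)
  with assms have "\<And>n. \<exists>b\<in>I. \<exists>c. a = b + fps_X ^ n * c" by (meson subsetD)
  then show "a \<in> I" using I by (intro top_idealD(5)) simp_all
qed

lemma rll_ideal_saturated: "fps_X * a \<in> rll_ideal \<Longrightarrow> a \<in> rll_ideal"
  unfolding in_rll_ideal_iff by (intro allI impI, rule top_idealD(6)) simp_all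

lemma rll_ideal_minus: "a \<in> rll_ideal \<Longrightarrow> - a \<in> rll_ideal"
  using rll_ideal_mult_left[of a "- 1"] by simp

lemma rll_relator_in_ideal: "rll_relator p t x y \<in> rll_ideal"
  unfolding in_rll_ideal_iff by simp

definition rll_cong :: "'n::{finite,linorder} hfree \<Rightarrow> 'n hfree \<Rightarrow> bool" where
  "rll_cong a b \<longleftrightarrow> a - b \<in> rll_ideal"

lemma equivp_rll_cong: "equivp rll_cong"
proof (rule equivpI)
  show "reflp rll_cong" by (simp add: reflp_def rll_cong_def rll_ideal_zero)
  show "symp rll_cong"
    unfolding symp_def rll_cong_def by (auto dest: rll_ideal_minus)
  show "transp rll_cong"
    unfolding transp_def rll_cong_def by (auto dest: rll_ideal_add)
qed

quotient_type (overloaded) 'n h_yangian = "'n::{finite,linorder} hfree" / rll_cong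
  by (rule equivp_rll_cong)

instantiation h_yangian :: ("{finite,linorder}") ring
begin

lift_definition zero_h_yangian :: "'a h_yangian" is 0 .

lift_definition plus_h_yangian :: "'a h_yangian \<Rightarrow> 'a h_yangian \<Rightarrow> 'a h_yangian" is "(+)"
proof -
  fix a b c d :: "'a hfree"
  assume "rll_cong a b" "rll_cong c d"
  moreover have "(a + c) - (b + d) = (a - b) + (c - d)" by simp
  ultimately show "rll_cong (a + c) (b + d)"
    unfolding rll_cong_def by (simp only: rll_ideal_add)
qed

lift_definition minus_h_yangian :: "'a h_yangian \<Rightarrow> 'a h_yangian \<Rightarrow> 'a h_yangian" is "(-)"
proof -
  fix a b c d :: "'a hfree"
  assume "rll_cong a b" "rll_cong c d"
  moreover have "(a - c) - (b - d) = (a - b) + - (c - d)" by simp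
  ultimately show "rll_cong (a - c) (b - d)"
    unfolding rll_cong_def by (simp only: rll_ideal_add rll_ideal_minus)
qed

lift_definition uminus_h_yangian :: "'a h_yangian \<Rightarrow> 'a h_yangian" is uminus
proof -
  fix a b :: "'a hfree"
  assume "rll_cong a b"
  moreover have "- a - - b = - (a - b)" by simp
  ultimately show "rll_cong (- a) (- b)"
    unfolding rll_cong_def by (simp only: rll_ideal_minus)
qed

lift_definition times_h_yangian :: "'a h_yangian \<Rightarrow> 'a h_yangian \<Rightarrow> 'a h_yangian" is "(*)"
proof -
  fix a b c d :: "'a hfree"
  assume "rll_cong a b" "rll_cong c d"
  moreover have "a * c - b * d = (a - b) * c + b * (c - d)" by (simp add: algebra_simps)
  ultimately show "rll_cong (a * c) (b * d)"
    unfolding rll_cong_def by (simp only: rll_ideal_add rll_ideal_mult_left rll_ideal_mult_right)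
qed

instance
  by standard (transfer, simp add: rll_cong_def rll_ideal_zero algebra_simps)+

end

text \<open>The augmentation \<open>\<ell>\<^bsub>ij\<^esub>\<^sup>(\<^sup>r\<^sup>) \<mapsto> 0\<close> shows that the quotient is not the zero ring.\<close>

definition aug :: "'n hfree \<Rightarrow> complex fps" where
  "aug a = Abs_fps (\<lambda>n. Poly_Mapping.lookup (fps_nth a n) 0)"

lemma word_add_eq_0_iff: "u + v = (0 :: 'g word) \<longleftrightarrow> u = 0 \<and> v = 0"
  by (cases u; cases v) (auto simp: zero_word_def plus_word_def)

lemma lookup_mult_0:
  fixes f g :: "'g word \<Rightarrow>\<^sub>0 complex"
  shows "Poly_Mapping.lookup (f * g) 0 = Poly_Mapping.lookup f 0 * Poly_Mapping.lookup g 0"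
proof -
  have "(\<Sum>q. Poly_Mapping.lookup g q when (0::'g word) = k + q)
        = (Poly_Mapping.lookup g 0 when k = 0)" for k
    by (auto simp: word_add_eq_0_iff eq_commute[of 0 "_ + _"] when_def cong: conj_cong)
  then show ?thesis
    by (simp add: lookup_mult mult_when)
qed

lemma aug_0: "aug 0 = 0" and aug_1: "aug 1 = 1"
  and aug_add: "aug (a + b) = aug a + aug b"
  and aug_diff: "aug (a - b) = aug a - aug b"
  by (auto simp: aug_def fps_eq_iff lookup_add lookup_minus Poly_Mapping.lookup_one)

lemma lookup_sum_poly_mapping:
  "Poly_Mapping.lookup (\<Sum>i\<in>A. f i) k = (\<Sum>i\<in>A. Poly_Mapping.lookup (f i) k)"
  by (induction A rule: infinite_finite_induct) (simp_all add: lookup_add)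

lemma aug_mult: "aug (a * b) = aug a * aug b"
  by (simp add: aug_def fps_eq_iff fps_mult_nth lookup_sum_poly_mapping lookup_mult_0)

lemma aug_sum: "aug (\<Sum>i\<in>A. f i) = (\<Sum>i\<in>A. aug (f i))"
  by (induction A rule: infinite_finite_induct) (simp_all add: aug_0 aug_add)

lemma aug_X: "aug fps_X = fps_X"
  by (auto simp: aug_def fps_eq_iff fps_X_def Poly_Mapping.lookup_one)

lemma aug_gen: "aug (free_gen i j r) = 0"
  by (auto simp: aug_def fps_eq_iff free_gen_def lookup_single zero_word_def when_def)

lemma tmap_aug_tmult: "tmap aug (tmult m A B) = tmult m (tmap aug A) (tmap aug B)"
  by (auto simp: fun_eq_iff tmap_def tmult_def aug_0 aug_sum aug_mult)

lemma tmap_aug_tone: "tmap aug (tone m) = tone m"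
  by (auto simp: fun_eq_iff tmap_def tone_def aug_0 aug_1)

lemma site_delta:
  assumes "k \<in> {1..m}"
  shows "site m k (\<lambda>i j. if i = j then c else 0) = (\<lambda>x y. c * tone m x y :: complex fps)"
proof (intro ext)
  fix x y :: "'n list"
  show "site m k (\<lambda>i j. if i = j then c else 0) x y = c * tone m x y"
  proof (cases "length x = m \<and> length y = m")
    case True
    have "(\<forall>l\<in>{1..m}. x ! (l - 1) = y ! (l - 1)) \<longleftrightarrow> x = y"
    proof
      assume *: "\<forall>l\<in>{1..m}. x ! (l - 1) = y ! (l - 1)"
      show "x = y"
      proof (rule nth_equalityI)
        fix i assume "i < length x"
        then show "x ! i = y ! i" using *[rule_format, of "Suc i"] True by simp
      qed (use True in simp)
    qed simp
    moreover have "{1..m} = insert k ({1..m} - {k})" using assms by auto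
    ultimately have "(\<forall>l\<in>{1..m} - {k}. x ! (l - 1) = y ! (l - 1)) \<and> x ! (k - 1) = y ! (k - 1)
        \<longleftrightarrow> x = y"
      by (metis insert_iff)
    then show ?thesis using True by (auto simp: site_def tone_def)
  qed (auto simp: site_def tone_def)
qed

lemma tmap_aug_lcoeff:
  assumes "k \<in> {1..m}"
  shows "tmap aug (site m k (free_lcoeff r :: 'n \<Rightarrow> 'n \<Rightarrow> 'n hfree)) = (\<lambda>x y. (if r = 0 then 1 else 0) * tone m x y)"
proof -
  have "aug (free_lcoeff r i j) = (if i = j then if r = 0 then 1 else 0 else 0)" for i j :: 'n
    by (auto simp: free_lcoeff_def aug_diff aug_0 aug_1 aug_mult aug_gen)
  then have "tmap aug (site m k (free_lcoeff r :: 'n \<Rightarrow> 'n \<Rightarrow> 'n hfree))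
      = site m k (\<lambda>i j :: 'n. if i = j then if r = 0 then 1 else 0 else 0)"
    by (auto simp: fun_eq_iff tmap_def site_def aug_0)
  then show ?thesis using site_delta[OF assms] by (simp only:)
qed

lemma finite_lists_length: "finite {z :: 'n::finite list. length z = m}"
  using finite_lists_length_eq[of "UNIV :: 'n set" m] by simp

lemma tmult_scaled_tone:
  fixes A :: "('n::finite, complex fps) tmat"
  shows "tmult m A (\<lambda>x y. c * tone m x y) = (\<lambda>x y. if length x = m \<and> length y = m then c * A x y else 0)"
    and "tmult m (\<lambda>x y. c * tone m x y) A = (\<lambda>x y. if length x = m \<and> length y = m then c * A x y else 0)"
proof -
  have "(\<Sum>z | length z = m. A x z * (c * tone m z y)) = c * A x y" if "length y = m" for x y
  proof -
    have "(\<Sum>z | length z = m. A x z * (c * tone m z y)) = (\<Sum>z | length z = m. if z = y then c * A x z else 0)"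
      by (rule sum.cong) (auto simp: tone_def)
    then show ?thesis using that by (simp add: finite_lists_length)
  qed
  then show "tmult m A (\<lambda>x y. c * tone m x y) = (\<lambda>x y. if length x = m \<and> length y = m then c * A x y else 0)"
    by (auto simp: fun_eq_iff tmult_def)
  have "(\<Sum>z | length z = m. c * tone m x z * A z y) = c * A x y" if "length x = m" for x y
  proof -
    have "(\<Sum>z | length z = m. c * tone m x z * A z y) = (\<Sum>z | length z = m. if z = x then c * A z y else 0)"
      by (rule sum.cong) (auto simp: tone_def)
    then show ?thesis using that by (simp add: finite_lists_length)
  qed
  then show "tmult m (\<lambda>x y. c * tone m x y) A = (\<lambda>x y. if length x = m \<and> length y = m then c * A x y else 0)"
    by (auto simp: fun_eq_iff tmult_def)
qed

lemma tmult_scaled_tones: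
  "tmult m (\<lambda>x y. c * tone m x y) (\<lambda>x y. d * tone m x y)
   = (\<lambda>x y :: 'n::finite list. c * d * tone m x y :: complex fps)"
  unfolding tmult_scaled_tone(1) by (auto simp: tone_def fun_eq_iff)

lemma aug_rll_relator: "aug (rll_relator p t x y) = 0"
proof -
  have "tmap aug (tprod 2 [A, site 2 1 (free_lcoeff r), site 2 2 (free_lcoeff s)])
      = tmap aug (tprod 2 [site 2 2 (free_lcoeff s), site 2 1 (free_lcoeff r), A])"
    for r s and A :: "('a, 'a hfree) tmat"
  proof -
    define d :: "nat \<Rightarrow> complex fps" where "d u = (if u = 0 then 1 else 0)" for u
    have one: "tone 2 = (\<lambda>x y :: 'a list. 1 * tone 2 x y :: complex fps)" by simp
    have l: "tmap aug (site 2 1 (free_lcoeff u)) = (\<lambda>x y :: 'a list. d u * tone 2 x y)"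
            "tmap aug (site 2 2 (free_lcoeff u)) = (\<lambda>x y :: 'a list. d u * tone 2 x y)" for u
      unfolding d_def by (rule tmap_aug_lcoeff; simp)+
    have t: "tmult 2 B (tone 2) = (\<lambda>x y. if length x = 2 \<and> length y = 2 then B x y else 0)"
      for B :: "('a, complex fps) tmat"
      using tmult_scaled_tone(1)[of 2 B 1] unfolding mult_1 .
    have ts: "tmult 2 (\<lambda>x y. c * tone 2 x y) (tone 2) = (\<lambda>x y :: 'a list. c * tone 2 x y)"
      for c :: "complex fps"
      using tmult_scaled_tones[of 2 c 1] unfolding mult_1 mult_1_right .
    have "tmap aug (tprod 2 [A, site 2 1 (free_lcoeff r), site 2 2 (free_lcoeff s)])
        = tmult 2 (tmap aug A) (\<lambda>x y. d r * d s * tone 2 x y)"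
      by (simp only: tprod_def foldr.simps o_def id_def tmap_aug_tmult tmap_aug_tone l ts
            tmult_scaled_tones)
    moreover have "tmap aug (tprod 2 [site 2 2 (free_lcoeff s), site 2 1 (free_lcoeff r), A])
        = tmult 2 (\<lambda>x y. d s * tone 2 x y) (tmult 2 (\<lambda>x y. d r * tone 2 x y) (tmult 2 (tmap aug A) (tone 2)))"
      by (simp only: tprod_def foldr.simps o_def id_def tmap_aug_tmult tmap_aug_tone l)
    ultimately show ?thesis
      by (simp only: t tmult_scaled_tone) (simp add: fun_eq_iff mult_ac)
  qed
  then have "aug (tprod 2 [A, site 2 1 (free_lcoeff r), site 2 2 (free_lcoeff s)] x y)
      = aug (tprod 2 [site 2 2 (free_lcoeff s), site 2 1 (free_lcoeff r), A] x y)"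
    for r s and A :: "('a, 'a hfree) tmat"
    by (metis tmap_def)
  then show ?thesis by (simp add: rll_relator_def aug_sum aug_diff case_prod_beta)
qed

lemma one_notin_rll_ideal: "1 \<notin> (rll_ideal :: 'n::{finite,linorder} hfree set)"
proof -
  define I where "I = {a :: 'n hfree. aug a = 0}"
  have "aug a = 0" if approx: "\<forall>n. \<exists>b\<in>I. \<exists>c. a = b + fps_X ^ n * c" for a
  proof (rule fps_ext)
    fix n
    obtain b c where "b \<in> I" "a = b + fps_X ^ Suc n * c"
      using approx[THEN spec, of "Suc n"] by (elim bexE exE)
    moreover have "aug (fps_X ^ k :: 'n hfree) = fps_X ^ k" for k
      by (induction k) (simp_all add: aug_1 aug_mult aug_X)
    ultimately have "aug a = fps_X ^ Suc n * aug c"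
      unfolding I_def by (simp add: aug_add aug_mult del: power_Suc)
    then show "fps_nth (aug a) n = fps_nth 0 n" by (simp only: fps_X_power_mult_nth) simp
  qed
  then have "top_ideal I"
    by (auto simp: I_def top_ideal_def aug_0 aug_add aug_mult aug_X)
  then have "rll_ideal \<subseteq> I"
    unfolding rll_ideal_def using aug_rll_relator I_def by blast
  moreover have "1 \<notin> I" by (simp add: I_def aug_1)
  ultimately show ?thesis by blast
qed

instantiation h_yangian :: ("{finite,linorder}") ring_1
begin

lift_definition one_h_yangian :: "'a h_yangian" is 1 .

instance
proof
  show "(0 :: 'a h_yangian) \<noteq> 1"
    by transfer (use one_notin_rll_ideal rll_ideal_minus in \<open>force simp: rll_cong_def\<close>)
qed (transfer, simp add: rll_cong_def rll_ideal_zero)+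

end

lift_definition yscalar :: "complex fps \<Rightarrow> 'n::{finite,linorder} h_yangian" is free_scalar .

lift_definition ygen :: "'n::{finite,linorder} \<Rightarrow> 'n \<Rightarrow> nat \<Rightarrow> 'n h_yangian" is free_gen .

text \<open>
  The quotient is topologically free over \<^typ>\<open>complex fps\<close>: torsion-free, separated and complete.
\<close>

lemma yscalar_X_mult_eq_0: "yscalar fps_X * a = 0 \<Longrightarrow> a = 0"
proof transfer
  fix a :: "'n::{finite,linorder} hfree"
  have "free_scalar fps_X = (fps_X :: 'n hfree)"
    by (auto simp: fps_eq_iff free_scalar_def fps_X_def)
  then show "rll_cong (free_scalar fps_X * a) 0 \<Longrightarrow> rll_cong a 0"
    by (simp add: rll_cong_def rll_ideal_saturated)
qed

lemma free_scalar_X_power: "free_scalar (fps_X ^ n) = (fps_X ^ n :: 'n hfree)"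
  by (auto simp: fps_eq_iff free_scalar_def fps_X_power_nth)

lemma h_yangian_separated:
  assumes "\<And>n. \<exists>c. a = yscalar (fps_X ^ n) * c"
  shows "a = 0"
  using assms
proof transfer
  fix a :: "'n::{finite,linorder} hfree"
  assume *: "\<And>n. \<exists>c. rll_cong a (free_scalar (fps_X ^ n) * c)"
  have "\<exists>b\<in>rll_ideal. \<exists>c. a = b + fps_X ^ n * c" for n
  proof -
    obtain c where "a - fps_X ^ n * c \<in> rll_ideal"
      using *[of n] by (auto simp: rll_cong_def free_scalar_X_power)
    then show ?thesis by (metis diff_add_cancel)
  qed
  then show "rll_cong a 0" by (simp add: rll_cong_def rll_ideal_closed)
qed

lemma h_yangian_complete:
  fixes a :: "nat \<Rightarrow> 'n::{finite,linorder} h_yangian"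
  assumes "\<And>n. \<exists>c. a (Suc n) - a n = yscalar (fps_X ^ n) * c"
  shows "\<exists>l. \<forall>n. \<exists>c. l - a n = yscalar (fps_X ^ n) * c"
proof -
  obtain c where c: "\<And>n. a (Suc n) - a n = yscalar (fps_X ^ n) * c n" using assms by metis
  define u where "u n = rep_h_yangian (c n)" for n
  define tail where "tail n = Abs_fps (\<lambda>k. \<Sum>i\<le>k. fps_nth (u (n + i)) (k - i))" for n
  have u: "abs_h_yangian (u n) = c n" for n
    by (simp add: u_def Quotient3_abs_rep[OF Quotient3_h_yangian])
  have X: "yscalar (fps_X ^ n) * abs_h_yangian b = abs_h_yangian (fps_X ^ n * b)" for n and b :: "'n hfree"
    by (simp add: yscalar.abs_eq times_h_yangian.abs_eq free_scalar_X_power)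
  have tail_Suc: "tail n = u n + fps_X * tail (Suc n)" for n
  proof (rule fps_ext)
    fix k
    show "fps_nth (tail n) k = fps_nth (u n + fps_X * tail (Suc n)) k"
      by (cases k) (simp_all add: tail_def sum.atMost_Suc_shift del: sum.atMost_Suc)
  qed
  define l where "l = a 0 + abs_h_yangian (tail 0)"
  have "l = a n + abs_h_yangian (fps_X ^ n * tail n)" for n
  proof (induction n)
    case 0 then show ?case by (simp add: l_def)
  next
    case (Suc n)
    have "abs_h_yangian (fps_X ^ n * tail n)
        = abs_h_yangian (fps_X ^ n * u n) + abs_h_yangian (fps_X ^ Suc n * tail (Suc n))"
      by (subst tail_Suc) (simp only: plus_h_yangian.abs_eq distrib_left power_Suc2 mult.assoc)
    moreover have "abs_h_yangian (fps_X ^ n * u n) = a (Suc n) - a n"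
      using c[of n] X[of n "u n"] u[of n] by simp
    ultimately show ?case using Suc by simp
  qed
  then show ?thesis by (metis X add_diff_cancel_left')
qed

section \<open>The series\<close>

text \<open>
  Series in \<open>z\<^sup>-\<^sup>1\<close> over the h-Yangian. \<open>lseries a i j\<close> is \<open>\<ell>\<^bsub>ij\<^esub>(z e\<^sup>-\<^sup>a\<^sup>h)\<close>, whose coefficient of
  \<open>z\<^sup>-\<^sup>r\<close> carries the factor \<open>e\<^sup>r\<^sup>a\<^sup>h\<close>.
\<close>

definition lseries :: "int \<Rightarrow> 'n::{finite,linorder} \<Rightarrow> 'n \<Rightarrow> 'n h_yangian fps" where
  "lseries a i j =
     Abs_fps (\<lambda>r. (if r = 0 \<and> i = j then 1 else 0)
                  - yscalar (fps_X * fps_exp (of_nat r * of_int a)) * ygen i j r)"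

text \<open>The \<open>k\<close>-th diagonal entry of \<open>D\<close>, \<open>k = 1, \<dots>, N\<close>, is \<open>e\<close> to the power \<open>(N + 1 - 2k) h / 2\<close>.\<close>

definition dmat :: "'n::{finite,linorder} \<Rightarrow> 'n \<Rightarrow> complex fps" where
  "dmat i j =
     (if i = j then fps_exp ((of_nat CARD('n) + 1 - 2 * of_nat (card {..i})) / 2) else 0)"

definition ltab ::
    "nat list \<Rightarrow> (nat \<times> nat \<Rightarrow> nat) \<Rightarrow> 'n::{finite,linorder} h_yangian fps" where
  "ltab lam T =
     (let m = sum_list lam in
      ttrace m
        (tmult m
          (tprod m (map (\<lambda>k. site m k (lseries (tab_cont lam T k))) [1..<Suc m]))
          (tmap (\<lambda>c. fps_const (yscalar c))
            (tmult m (tprod m (map (\<lambda>k. site m k dmat) [1..<Suc m]))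
                     (fusion_idempotent lam T)))))"

text \<open>
  Series in \<open>z\<^sub>1\<^sup>-\<^sup>1\<close> and in \<open>z\<^sub>2\<^sup>-\<^sup>1\<close> as series in two variables; the inner variable is \<open>z\<^sub>1\<^sup>-\<^sup>1\<close>.
\<close>

definition in_z1 :: "'a::zero fps \<Rightarrow> 'a fps fps" where
  "in_z1 A = fps_const A"

definition in_z2 :: "'a::zero fps \<Rightarrow> 'a fps fps" where
  "in_z2 A = Abs_fps (\<lambda>s. fps_const (fps_nth A s))"

end

theory Submission
  imports Defs "HOL-Computational_Algebra.Polynomial"
begin

text \<open>
  Moving the block of spectral parameters of one tableau through that of the other by R-matrices
  gives an operator \<open>X\<close> with \<open>L\<^sub>A L\<^sub>B X = X L\<^sub>B L\<^sub>A\<close> for the two products of L-operators. Let \<open>F\<close>, \<open>G\<close> be the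
  fusion products of the two tableaux and \<open>\<tau>\<close> the inverse of the image of the longest permutation.
  By the Yang--Baxter equation, extended to the evaluation points by h-adic continuity, fusion products
  pass through \<open>L\<close> and \<open>X\<close> at the cost of reversing their parameters. The Jucys--Murphy elements act
  on \<open>F\<close> by the contents, which forces \<open>k F \<tau> F = k' F\<close> with nonzero constants \<open>k\<close>, \<open>k'\<close>. So \<open>F \<tau>\<close> is a
  multiple of an idempotent, \<open>X\<close> cancels under the trace, and the two traces commute up to a nonzero
  constant; the h-Yangian is torsion-free, so the value of the constant does not matter.

  Nor does the Schur element: if one of the consecutive evaluations is irregular or the result is not
  constant, the idempotent is 0 by convention. Otherwise the remaining factors are invertible at the
  evaluation point, and regularity at \<open>z\<^sub>k = 1\<close> means that a power of a linear polynomial divides the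
  fusion product.
\<close>

section \<open>Torsion-free and separated algebras over the power series ring\<close>

text \<open>The evaluation points of the fusion procedure are poles of single R-matrices, so
  Yang--Baxter arguments fail exactly where they are wanted. Hence every identity is stated with
  cleared denominators, for \<open>u T - v T^-1\<close>, and carries a factor
  \<open>(x - a)^k\<close> that is removed only at the end. Inverting \<open>X\<close> costs the
  scalars \<open>-(u - q^2 v)(u - q^-2 v)\<close> for parameters u, v from different blocks, and
  these have to be units. This is the reason for writing \<open>z1^-1 = t\<close> and
  \<open>z2^-1 = t w\<close>: the parameters of one block are constants, those of the other are
  multiples of \<open>w\<close>, and at \<open>w = 0\<close> the scalar is minus the square of an
  exponential. \<open>X\<close> does not commute with the fusion products, so cyclicity of the trace
  does not cancel it directly. The relation \<open>k F \<tau> F = k' F\<close> produces a second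
  copy of the product on one side of \<open>X\<close> and absorbs it again on the other side. The
  nonzero constants come from exact orders of vanishing: a box added to a diagram gives the
  numerator of the Jucys--Murphy function one zero more than twice the number of earlier boxes on
  its diagonal.\<close>

locale calg =
  fixes e :: "'p::comm_ring_1 \<Rightarrow> 'r::ring_1"
  assumes e_one: "e 1 = 1"
    and e_add: "e (x + y) = e x + e y"
    and e_mult: "e (x * y) = e x * e y"
    and e_central: "r * e x = e x * r"
begin

definition sm :: "'p \<Rightarrow> 'r \<Rightarrow> 'r" where "sm c r = e c * r"

lemma e_zero: "e 0 = 0"
  using e_add[of 0 0] by simp

lemma e_diff: "e (x - y) = e x - e y"
  using e_add[of "x - y" y] by (simp add: algebra_simps)

lemma sm_mult_right: "r * sm c s = sm c (r * s)"
  unfolding sm_def using e_central[of r c] by (simp flip: mult.assoc)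

lemma sm_mult_left: "sm c r * s = sm c (r * s)"
  by (simp add: sm_def mult.assoc)

lemma sm_sm: "sm c (sm d r) = sm (c * d) r"
  by (simp add: sm_def e_mult mult.assoc)

lemma sm_commute: "sm c (sm d r) = sm d (sm c r)"
  by (simp add: sm_sm mult.commute)

lemma sm_add: "sm c (r + s) = sm c r + sm c s" and sm_diff: "sm c (r - s) = sm c r - sm c s"
  and sm_minus: "sm c (- r) = - sm c r" and sm_zero: "sm c 0 = 0"
  by (simp_all add: sm_def algebra_simps)

lemma sm_add_left: "sm (c + d) r = sm c r + sm d r" and sm_diff_left: "sm (c - d) r = sm c r - sm d r"
  and sm_one: "sm 1 r = r" and sm_zero_left: "sm 0 r = 0"
  by (simp_all add: sm_def e_add e_diff e_one e_zero algebra_simps)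

lemma e_eq_sm: "e c = sm c 1"
  by (simp add: sm_def)

lemmas sm_simps = sm_mult_right sm_mult_left sm_sm sm_add sm_diff sm_minus sm_zero sm_one sm_zero_left

end

locale dalg = calg e for e :: "complex fps \<Rightarrow> 'r::ring_1" +
  assumes torsion_free: "e c * r = 0 \<Longrightarrow> c = 0 \<or> r = 0"
    and separated: "(\<And>n. \<exists>s. r = e (fps_X ^ n) * s) \<Longrightarrow> r = 0"
begin

lemma sm_cancel: "sm c r = sm c s \<Longrightarrow> c \<noteq> 0 \<Longrightarrow> r = s"
  using torsion_free[of c "r - s"] by (auto simp: sm_def algebra_simps)

text \<open>An h-adic Lipschitz condition: arguments congruent modulo \<open>h^n\<close> have values
  congruent modulo \<open>h^n\<close>. Polynomial functions satisfy it, and it survives products,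
  which is what limits of operator identities require.\<close>

definition lip :: "(complex fps \<Rightarrow> 'r) \<Rightarrow> bool" where
  "lip f \<longleftrightarrow> (\<forall>x y. \<exists>s. f x - f y = sm (x - y) s)"

lemma lipI: "(\<And>x y. \<exists>s. f x - f y = sm (x - y) s) \<Longrightarrow> lip f"
  by (simp add: lip_def)

lemma lip_const: "lip (\<lambda>x. c)"
  by (rule lipI) (auto intro: exI[of _ 0] simp: sm_simps)

lemma lip_add: "lip f \<Longrightarrow> lip g \<Longrightarrow> lip (\<lambda>x. f x + g x)"
proof (rule lipI)
  fix x y assume "lip f" "lip g"
  then obtain s t where "f x - f y = sm (x - y) s" "g x - g y = sm (x - y) t"
    unfolding lip_def by meson
  then have "f x + g x - (f y + g y) = sm (x - y) (s + t)" by (simp add: sm_simps algebra_simps)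
  then show "\<exists>s. f x + g x - (f y + g y) = sm (x - y) s" ..
qed

lemma lip_minus: "lip f \<Longrightarrow> lip (\<lambda>x. - f x)"
proof (rule lipI)
  fix x y assume "lip f"
  then obtain s where "f x - f y = sm (x - y) s" unfolding lip_def by meson
  then have "- f x - - f y = sm (x - y) (- s)" by (simp add: sm_simps algebra_simps)
  then show "\<exists>s. - f x - - f y = sm (x - y) s" ..
qed

lemma lip_diff: "lip f \<Longrightarrow> lip g \<Longrightarrow> lip (\<lambda>x. f x - g x)"
  using lip_add[OF _ lip_minus] by simp

lemma lip_mult: "lip f \<Longrightarrow> lip g \<Longrightarrow> lip (\<lambda>x. f x * g x)"
proof (rule lipI)
  fix x y assume "lip f" "lip g"
  then obtain s t where "f x - f y = sm (x - y) s" "g x - g y = sm (x - y) t"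
    unfolding lip_def by meson
  moreover have "f x * g x - f y * g y = f x * (g x - g y) + (f x - f y) * g y"
    by (simp add: algebra_simps)
  ultimately have "f x * g x - f y * g y = sm (x - y) (f x * t + s * g y)"
    by (simp add: sm_simps)
  then show "\<exists>s. f x * g x - f y * g y = sm (x - y) s" ..
qed

definition slip :: "(complex fps \<Rightarrow> complex fps) \<Rightarrow> bool" where
  "slip f \<longleftrightarrow> (\<forall>x y. x - y dvd f x - f y)"

lemma slip_const: "slip (\<lambda>x. c)" and slip_id: "slip (\<lambda>x. x)"
  by (simp_all add: slip_def)

lemma slip_diff: "slip f \<Longrightarrow> slip g \<Longrightarrow> slip (\<lambda>x. f x - g x)"
proof -
  assume "slip f" "slip g"
  moreover have "f x - g x - (f y - g y) = (f x - f y) - (g x - g y)" for x y by simp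
  ultimately show ?thesis by (auto simp only: slip_def dvd_diff)
qed

lemma slip_mult: "slip f \<Longrightarrow> slip g \<Longrightarrow> slip (\<lambda>x. f x * g x)"
proof -
  assume "slip f" "slip g"
  moreover have "f x * g x - f y * g y = f x * (g x - g y) + (f x - f y) * g y" for x y
    by (simp add: algebra_simps)
  ultimately show ?thesis by (simp add: slip_def dvd_add dvd_mult dvd_mult2)
qed

lemma lip_e: "slip f \<Longrightarrow> lip (\<lambda>x. e (f x))"
proof (rule lipI)
  fix x y assume "slip f"
  then obtain c where "f x - f y = (x - y) * c" unfolding slip_def by (meson dvdE)
  then have "e (f x) - e (f y) = sm (x - y) (e c)" by (simp add: sm_def flip: e_diff e_mult)
  then show "\<exists>s. e (f x) - e (f y) = sm (x - y) s" ..
qed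

lemma lip_sm: "slip f \<Longrightarrow> lip g \<Longrightarrow> lip (\<lambda>x. sm (f x) (g x))"
  unfolding sm_def by (intro lip_mult lip_e)

text \<open>Evaluate at the points \<open>a + h\<^sup>n\<close>, which converge to \<open>a\<close> h-adically.\<close>

lemma lip_extend:
  assumes "lip f" "lip g" "\<And>x. x \<noteq> a \<Longrightarrow> f x = g x"
  shows "f a = g a"
proof -
  have "f a - g a = 0"
  proof (rule separated)
    fix n
    define x :: "complex fps" where "x = a + fps_X ^ n"
    have "x \<noteq> a" by (simp add: x_def)
    then have "f x = g x" by (rule assms(3))
    moreover obtain s t where "f x - f a = sm (x - a) s" "g x - g a = sm (x - a) t"
      using assms(1,2) unfolding lip_def by meson
    ultimately have "f a - g a = sm (x - a) (t - s)" by (simp add: sm_simps algebra_simps)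
    then show "\<exists>s. f a - g a = e (fps_X ^ n) * s" by (auto simp: x_def sm_def)
  qed
  then show ?thesis by simp
qed

text \<open>For \<open>x \<noteq> a\<close> the factor is a nonzero scalar and cancels because the
  algebra is torsion-free; continuity then gives the value at \<open>a\<close>. This replaces
  division by a power of \<open>x - a\<close> throughout.\<close>

lemma lip_cancel:
  assumes "lip f" "lip g" "\<And>x. sm ((x - a) ^ k) (f x) = sm ((x - a) ^ k) (g x)"
  shows "f a = g a"
  using assms(1,2)
proof (rule lip_extend)
  fix x assume "x \<noteq> a"
  then show "f x = g x" using sm_cancel[OF assms(3)[of x]] by simp
qed

end

section \<open>Swap systems\<close>

text \<open>
  \<open>moveR R l b [a\<^sub>1, \<dots>, a\<^sub>n] = R\<^bsub>l+n-1\<^esub>(b, a\<^sub>n) \<dots> R\<^bsub>l\<^esub>(b, a\<^sub>1)\<close> carries a parameter \<open>b\<close> to the left through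
  \<open>a\<^sub>1, \<dots>, a\<^sub>n\<close>; the sites are numbered from 0 and \<open>R\<^sub>k\<close> acts on the sites \<open>k\<close> and \<open>k + 1\<close>.
\<close>

primrec moveR :: "(nat \<Rightarrow> 'p \<Rightarrow> 'p \<Rightarrow> 'r::ring_1) \<Rightarrow> nat \<Rightarrow> 'p \<Rightarrow> 'p list \<Rightarrow> 'r" where
  "moveR R l b [] = 1"
| "moveR R l b (a # as) = moveR R (Suc l) b as * R l b a"

lemma moveR_append: "moveR R l b (xs @ ys) = moveR R (l + length xs) b ys * moveR R l b xs"
  by (induction xs arbitrary: l) (simp_all add: mult.assoc)

text \<open>The common shape of the RLL relation, of the Yang--Baxter equation for a row of
  R-matrices, and of plain commutation. The R-matrices left and right of \<open>G\<close> are
  independent, because \<open>G\<close> may itself shift the sites on which the parameters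
  sit.\<close>

definition swap_system ::
    "(nat \<Rightarrow> 'p \<Rightarrow> 'p \<Rightarrow> 'r::ring_1) \<Rightarrow> (nat \<Rightarrow> 'p \<Rightarrow> 'p \<Rightarrow> 'r) \<Rightarrow> nat \<Rightarrow> ('p list \<Rightarrow> 'r) \<Rightarrow> bool" where
  "swap_system R1 R2 n G \<longleftrightarrow>
     (\<forall>xs a b ys. length xs + length ys + 2 = n \<longrightarrow>
        G (xs @ b # a # ys) * R2 (length xs) a b = R1 (length xs) a b * G (xs @ a # b # ys))"

lemma swap_systemD:
  "swap_system R1 R2 n G \<Longrightarrow> length xs + length ys + 2 = n \<Longrightarrow>
    G (xs @ b # a # ys) * R2 (length xs) a b = R1 (length xs) a b * G (xs @ a # b # ys)"
  by (simp add: swap_system_def)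

lemma swap_system_move:
  assumes "swap_system R1 R2 n G" "length xs + length as + length ys + 1 = n"
  shows "G (xs @ as @ b # ys) * moveR R2 (length xs) b as
       = moveR R1 (length xs) b as * G (xs @ b # as @ ys)"
  using assms(2)
proof (induction as arbitrary: xs)
  case (Cons a as)
  have "G (xs @ (a # as) @ b # ys) * moveR R2 (Suc (length xs)) b as
      = moveR R1 (Suc (length xs)) b as * G (xs @ a # b # as @ ys)"
    using Cons.IH[of "xs @ [a]"] Cons.prems by simp
  then have "G (xs @ (a # as) @ b # ys) * moveR R2 (length xs) b (a # as)
      = moveR R1 (Suc (length xs)) b as * (G (xs @ a # b # as @ ys) * R2 (length xs) b a)"
    by (simp only: moveR.simps(2) mult.assoc[symmetric])
  also have "G (xs @ a # b # as @ ys) * R2 (length xs) b a = R1 (length xs) b a * G (xs @ b # a # as @ ys)"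
    using Cons.prems by (intro swap_systemD[OF assms(1)]) simp
  finally show ?case by (simp add: mult.assoc)
qed simp

section \<open>The Hecke algebra and its polynomial R-matrices\<close>

locale hecke = calg e for e :: "'p::comm_ring_1 \<Rightarrow> 'r::ring_1" +
  fixes q qi :: 'p and T Ti :: "nat \<Rightarrow> 'r" and M :: nat
  assumes q_qi: "q * qi = 1"
    and T_Ti: "Suc k < M \<Longrightarrow> T k * Ti k = 1"
    and Ti_T: "Suc k < M \<Longrightarrow> Ti k * T k = 1"
    and Ti_eq: "Suc k < M \<Longrightarrow> Ti k = T k - e (q - qi)"
    and braid: "Suc (Suc k) < M \<Longrightarrow> T k * T (Suc k) * T k = T (Suc k) * T k * T (Suc k)"
    and T_far: "Suc k < l \<Longrightarrow> Suc l < M \<Longrightarrow> T k * T l = T l * T k"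
begin

text \<open>The Baxterised generator without denominator. It is homogeneous of degree 1 in the two
  parameters, so a common factor of both can be pulled out.\<close>

definition RR :: "nat \<Rightarrow> 'p \<Rightarrow> 'p \<Rightarrow> 'r" where
  "RR k u v = sm u (T k) - sm v (Ti k)"

lemma T_sq: "Suc k < M \<Longrightarrow> T k * T k = 1 + sm (q - qi) (T k)"
  using T_Ti[of k] Ti_eq[of k] by (simp add: algebra_simps e_central sm_def)

lemma RR_commute:
  assumes "Suc k < M" "x * T k = T k * x"
  shows "x * RR k u v = RR k u v * x"
proof -
  have "x * Ti k = Ti k * x" using assms by (simp add: Ti_eq algebra_simps e_central)
  then show ?thesis using assms by (simp add: RR_def algebra_simps sm_simps)
qed

lemma RR_T_far: "Suc k < l \<Longrightarrow> Suc l < M \<Longrightarrow> T k * RR l u v = RR l u v * T k"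
  by (rule RR_commute) (auto intro: T_far)

lemma RR_far: "Suc k < l \<Longrightarrow> Suc l < M \<Longrightarrow> RR k u v * RR l u' v' = RR l u' v' * RR k u v"
  using RR_commute[of k "RR l u' v'" u v] RR_T_far[of k l u' v'] by simp

lemma RR_unitarity:
  assumes "Suc k < M"
  shows "RR k u v * RR k v u = e (u * v * (q\<^sup>2 + qi\<^sup>2) - u\<^sup>2 - v\<^sup>2)"
proof -
  let ?h = "q - qi"
  have Ti: "Ti k = T k - sm ?h 1" using Ti_eq[OF assms] by (simp add: sm_def)
  have "RR k u v * RR k v u = sm (u * v) (T k * T k) - sm (u * u) (T k * Ti k) - sm (v * v) (Ti k * T k)
      + sm (u * v) (Ti k * Ti k)"
    by (simp add: RR_def algebra_simps sm_simps)
  also have "Ti k * Ti k = T k * T k - sm ?h (T k) - sm ?h (T k) + sm (?h * ?h) 1"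
    by (simp add: Ti algebra_simps sm_simps)
  also have "\<dots> = 1 + sm ?h (T k) - sm ?h (T k) - sm ?h (T k) + sm (?h * ?h) 1"
    by (simp only: T_sq[OF assms])
  finally have "RR k u v * RR k v u = sm (u * v) (1 + sm ?h (T k)) - sm (u * u) 1 - sm (v * v) 1
      + sm (u * v) (1 + sm ?h (T k) - sm ?h (T k) - sm ?h (T k) + sm (?h * ?h) 1)"
    by (simp only: T_sq[OF assms] T_Ti[OF assms] Ti_T[OF assms])
  also have "\<dots> = sm (u * v + u * v + u * v * (?h * ?h) - u * u - v * v) 1"
    by (simp only: sm_simps sm_add_left sm_diff_left) simp
  also have "u * v + u * v + u * v * (?h * ?h) - u * u - v * v
      = u * v * (q\<^sup>2 + qi\<^sup>2) - u\<^sup>2 - v\<^sup>2 + u * v * 2 * (1 - q * qi)"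
    by (simp add: power2_eq_square algebra_simps)
  finally show ?thesis by (simp add: q_qi sm_def)
qed

lemma yang_baxter:
  assumes "Suc (Suc k) < M"
  shows "RR (Suc k) x y * RR k x z * RR (Suc k) y z = RR k y z * RR (Suc k) x z * RR k x y"
proof -
  let ?a = "T k" and ?b = "T (Suc k)" and ?A = "Ti k" and ?B = "Ti (Suc k)" and ?h = "q - qi"
  have k: "Suc k < M" and l: "Suc (Suc k) < M" using assms by simp_all
  note i = T_Ti[OF k] Ti_T[OF k] T_Ti[OF l] Ti_T[OF l]
  have aba: "?a * (?b * ?a) = ?b * (?a * ?b)" using braid[OF assms] by (simp add: mult.assoc)
  have cl: "?A * ?a * r = r" "?a * ?A * r = r" "?B * ?b * r = r" "?b * ?B * r = r" for r
    by (simp_all add: i)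
  note cl' = cl[unfolded mult.assoc]
  have 1: "?b * (?a * ?B) = ?A * (?b * ?a)"
  proof -
    have "?A * (?b * ?a) = ?A * (?b * ?a * ?b) * ?B" by (simp add: i mult.assoc)
    also have "\<dots> = ?A * ?a * (?b * ?a) * ?B" using aba by (simp add: mult.assoc)
    finally show ?thesis by (simp add: i mult.assoc)
  qed
  have 2: "?a * (?b * ?A) = ?B * (?a * ?b)"
  proof -
    have "?B * (?a * ?b) = ?B * (?a * ?b * ?a) * ?A" by (simp add: i mult.assoc)
    also have "\<dots> = ?B * ?b * (?a * ?b) * ?A" using aba by (simp add: mult.assoc)
    finally show ?thesis by (simp add: i mult.assoc)
  qed
  have 3: "?b * (?A * ?B) = ?A * (?B * ?a)"
  proof -
    have "?A * (?B * ?a) = ?A * (?B * (?a * ?b)) * ?B" by (simp add: i mult.assoc)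
    also have "\<dots> = (?A * ?a) * (?b * ?A) * ?B" by (simp only: 2[symmetric] mult.assoc)
    finally show ?thesis by (simp add: i mult.assoc)
  qed
  have 4: "?a * (?B * ?A) = ?B * (?A * ?b)"
  proof -
    have "?B * (?A * ?b) = ?B * (?A * (?b * ?a)) * ?A" by (simp add: i mult.assoc)
    also have "\<dots> = (?B * ?b) * (?a * ?B) * ?A" by (simp only: 1[symmetric] mult.assoc)
    finally show ?thesis by (simp add: i mult.assoc)
  qed
  \<comment> \<open>One side is a left inverse and the other a right inverse of the same element
    \<open>aba\<close>, so they coincide.\<close>
  have 5: "?A * (?B * ?A) = ?B * (?A * ?B)"
  proof -
    have "?A * (?B * ?A) * (?a * (?b * ?a)) = 1"
      by (simp only: aba mult.assoc cl' i mult_1_right) (simp only: aba[symmetric] mult.assoc cl' i mult_1_right)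
    moreover have "(?a * (?b * ?a)) * (?B * (?A * ?B)) = 1"
      by (simp only: aba mult.assoc cl' i mult_1_right)
    ultimately have "x * (?B * (?A * ?B)) = ?B * (?A * ?B)" "y * ((?a * (?b * ?a)) * (?B * (?A * ?B))) = y"
      if "x = ?A * (?B * ?A) * (?a * (?b * ?a))" for x y
      using that by simp_all
    from this(1)[OF refl] this(2)[OF refl, of "?A * (?B * ?A)"] show ?thesis
      by (simp only: mult.assoc)
  qed
  have bb: "?b * ?b = 1 + sm ?h ?b" and aa: "?a * ?a = 1 + sm ?h ?a" by (rule T_sq, fact)+
  have A: "?A = ?a - sm ?h 1" and B: "?B = ?b - sm ?h 1" using Ti_eq k l by (simp_all add: sm_def)
  \<comment> \<open>The one place where the quadratic relation enters. Of the eight words on each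
    side of the Yang--Baxter equation, only \<open>BaB\<close>, \<open>bAb\<close> and
    \<open>AbA\<close>, \<open>aBa\<close> are not matched by the braid relation; within each pair
    the coefficients are \<open>x y z\<close> and \<open>- x y z\<close>, so the two differences
    suffice.\<close>
  have 6: "?B * (?a * ?B) - ?b * (?A * ?b) = ?A * (?b * ?A) - ?a * (?B * ?a)"
    unfolding A B by (simp add: algebra_simps sm_simps aa bb)
  then have 6: "?B * (?a * ?B) = ?A * (?b * ?A) - ?a * (?B * ?a) + ?b * (?A * ?b)"
    by (simp add: algebra_simps)
  note ac = mult.assoc[where 'a = 'p] mult.commute[where 'a = 'p] mult.left_commute[where 'a = 'p]
  show ?thesis
    unfolding RR_def
    apply (simp only: left_diff_distrib right_diff_distrib sm_simps mult.assoc)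
    apply (simp only: aba 1 2 3 4 5 6 sm_add sm_diff)
    apply (simp only: ac)
    apply (simp only: algebra_simps)
    done
qed

end

text \<open>\<open>moveB R l as bs\<close> carries the block of parameters \<open>bs\<close> to the left through the block \<open>as\<close>.\<close>

primrec moveB :: "(nat \<Rightarrow> 'p \<Rightarrow> 'p \<Rightarrow> 'r::ring_1) \<Rightarrow> nat \<Rightarrow> 'p list \<Rightarrow> 'p list \<Rightarrow> 'r" where
  "moveB R l as [] = 1"
| "moveB R l as (b # bs) = moveR R l b as * moveB R (Suc l) as bs"

lemma moveB_append: "moveB R l as (xs @ ys) = moveB R l as xs * moveB R (l + length xs) as ys"
  by (induction xs arbitrary: l) (simp_all add: mult.assoc)

lemma swap_system_moveB:
  assumes "swap_system R1 R2 n G" "length xs + length as + length bs + length ys = n"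
  shows "G (xs @ as @ bs @ ys) * moveB R2 (length xs) as bs
       = moveB R1 (length xs) as bs * G (xs @ bs @ as @ ys)"
  using assms(2)
proof (induction bs arbitrary: xs)
  case (Cons b bs)
  have "G (xs @ as @ b # bs @ ys) * moveR R2 (length xs) b as
      = moveR R1 (length xs) b as * G (xs @ b # as @ bs @ ys)"
    using Cons.prems by (intro swap_system_move[OF assms(1)]) simp
  then have "G (xs @ as @ (b # bs) @ ys) * moveB R2 (length xs) as (b # bs)
      = moveR R1 (length xs) b as * (G (xs @ b # as @ bs @ ys) * moveB R2 (Suc (length xs)) as bs)"
    by (simp flip: mult.assoc)
  also have "G (xs @ b # as @ bs @ ys) * moveB R2 (Suc (length xs)) as bs
      = moveB R1 (Suc (length xs)) as bs * G (xs @ b # bs @ as @ ys)"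
    using Cons.IH[of "xs @ [b]"] Cons.prems by simp
  finally show ?case by (simp add: mult.assoc)
qed simp

lemma commute_mult:
  fixes x y z :: "'a::semigroup_mult"
  shows "z * x = x * z \<Longrightarrow> z * y = y * z \<Longrightarrow> z * (x * y) = (x * y) * z"
proof -
  assume x: "z * x = x * z" and y: "z * y = y * z"
  have "z * (x * y) = x * (z * y)" using x by (simp flip: mult.assoc)
  then show ?thesis by (simp add: y mult.assoc)
qed

section \<open>Exchange of blocks of parameters\<close>

context hecke
begin

lemma commute_moveR:
  assumes "\<And>k u v. l \<le> k \<Longrightarrow> k < l + length as \<Longrightarrow> z * RR k u v = RR k u v * z"
  shows "z * moveR RR l b as = moveR RR l b as * z"
  using assms
proof (induction as arbitrary: l)
  case (Cons a as)
  have "z * moveR RR (Suc l) b as = moveR RR (Suc l) b as * z"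
    using Cons.prems by (intro Cons.IH) auto
  then have "z * moveR RR l b (a # as) = moveR RR (Suc l) b as * (z * RR l b a)"
    by (simp flip: mult.assoc)
  also have "z * RR l b a = RR l b a * z" using Cons.prems[of l] by simp
  finally show ?case by (simp add: mult.assoc)
qed simp

lemma RR_moveR_far:
  assumes "Suc k < l \<or> l + length as < k" "Suc k < M" "l + length as < M"
  shows "RR k u v * moveR RR l b as = moveR RR l b as * RR k u v"
  using assms by (intro commute_moveR) (auto intro: RR_far RR_far[symmetric])

lemma RR_moveB_far:
  assumes "Suc k < l \<or> l + length as + length bs \<le> k" "Suc k < M" "l + length as + length bs \<le> M"
  shows "RR k u v * moveB RR l as bs = moveB RR l as bs * RR k u v"
  using assms
proof (induction bs arbitrary: l)
  case (Cons b bs)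
  have "RR k u v * moveR RR l b as = moveR RR l b as * RR k u v"
    using Cons.prems by (intro RR_moveR_far) auto
  then have "RR k u v * moveB RR l as (b # bs) = moveR RR l b as * (RR k u v * moveB RR (Suc l) as bs)"
    by (simp flip: mult.assoc)
  also have "RR k u v * moveB RR (Suc l) as bs = moveB RR (Suc l) as bs * RR k u v"
    using Cons.prems by (intro Cons.IH) auto
  finally show ?case by (simp add: mult.assoc)
qed simp

text \<open>One Yang--Baxter move at the two factors that see the exchanged parameters; the other
  factors act on distant sites. The sites on the right are shifted by one because there
  \<open>c\<close> still stands in front of the row.\<close>

lemma moveR_swap_system:
  assumes "l + n < M"
  shows "swap_system (\<lambda>k. RR (l + k)) (\<lambda>k. RR (Suc l + k)) n (moveR RR l c)"
  unfolding swap_system_def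
proof (intro allI impI)
  fix xs ys :: "'p list" and a b
  assume len: "length xs + length ys + 2 = n"
  define k X Y where "k = l + length xs" and "X = moveR RR l c xs" and "Y = moveR RR (Suc (Suc k)) c ys"
  have *: "moveR RR l c (xs @ u # v # ys) = Y * (RR (Suc k) c v * RR k c u) * X" for u v
    by (simp add: moveR_append k_def X_def Y_def mult.assoc)
  have X: "X * RR (Suc k) a b = RR (Suc k) a b * X"
    unfolding X_def using assms len by (intro RR_moveR_far[symmetric]) (auto simp: k_def)
  have Y: "Y * RR k a b = RR k a b * Y"
    unfolding Y_def using assms len by (intro RR_moveR_far[symmetric]) (auto simp: k_def)
  have "moveR RR l c (xs @ b # a # ys) * RR (Suc k) a b = Y * (RR (Suc k) c a * RR k c b) * (X * RR (Suc k) a b)"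
    by (simp add: * mult.assoc)
  also have "\<dots> = Y * (RR (Suc k) c a * RR k c b * RR (Suc k) a b) * X"
    unfolding X by (simp add: mult.assoc)
  also have "RR (Suc k) c a * RR k c b * RR (Suc k) a b = RR k a b * RR (Suc k) c b * RR k c a"
    using assms len by (intro yang_baxter) (simp add: k_def)
  also have "Y * (RR k a b * RR (Suc k) c b * RR k c a) * X = (Y * RR k a b) * (RR (Suc k) c b * RR k c a) * X"
    by (simp add: mult.assoc)
  also have "\<dots> = RR k a b * moveR RR l c (xs @ a # b # ys)"
    unfolding Y by (simp add: * mult.assoc)
  finally show "moveR RR l c (xs @ b # a # ys) * RR (Suc l + length xs) a b
    = RR (l + length xs) a b * moveR RR l c (xs @ a # b # ys)" by (simp add: k_def)
qed

text \<open>Two parameters travelling through the same row may be exchanged before or after the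
  journey. The induction takes off the last entry of the row, each time by one Yang--Baxter
  move.\<close>

lemma moveR_moveR_swap:
  assumes "Suc (l + length as) < M"
  shows "moveR RR l b as * moveR RR (Suc l) b' as * RR l b' b
       = RR (l + length as) b' b * (moveR RR l b' as * moveR RR (Suc l) b as)"
  using assms
proof (induction as rule: rev_induct)
  case (snoc a as)
  define k where "k = l + length as"
  let ?m = "\<lambda>l b. moveR RR l b as"
  have k: "Suc (Suc k) < M" using snoc.prems by (simp add: k_def)
  have far: "?m l c * RR (Suc k) u v = RR (Suc k) u v * ?m l c" for c u v
    using k by (intro RR_moveR_far[symmetric]) (auto simp: k_def)
  have s: "moveR RR l c (as @ [a]) = RR k c a * ?m l c" "moveR RR (Suc l) c (as @ [a]) = RR (Suc k) c a * ?m (Suc l) c" for c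
    by (simp_all add: moveR_append k_def)
  have "moveR RR l b (as @ [a]) * moveR RR (Suc l) b' (as @ [a]) * RR l b' b
      = RR k b a * (?m l b * RR (Suc k) b' a) * ?m (Suc l) b' * RR l b' b"
    by (simp add: s mult.assoc)
  also have "\<dots> = RR k b a * RR (Suc k) b' a * (?m l b * ?m (Suc l) b' * RR l b' b)"
    unfolding far by (simp add: mult.assoc)
  also have "?m l b * ?m (Suc l) b' * RR l b' b = RR k b' b * (?m l b' * ?m (Suc l) b)"
    using snoc by (simp add: k_def)
  also have "RR k b a * RR (Suc k) b' a * (RR k b' b * (?m l b' * ?m (Suc l) b))
      = (RR k b a * RR (Suc k) b' a * RR k b' b) * ?m l b' * ?m (Suc l) b"
    by (simp add: mult.assoc)
  also have "RR k b a * RR (Suc k) b' a * RR k b' b = RR (Suc k) b' b * RR k b' a * RR (Suc k) b a"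
    using k by (intro yang_baxter[symmetric])
  also have "RR (Suc k) b' b * RR k b' a * RR (Suc k) b a * ?m l b' * ?m (Suc l) b
      = RR (Suc k) b' b * RR k b' a * (?m l b' * RR (Suc k) b a) * ?m (Suc l) b"
    unfolding far by (simp add: mult.assoc)
  finally show ?case by (simp add: s mult.assoc k_def)
qed simp

text \<open>Every parameter of \<open>bs\<close> that passes shifts the block \<open>as\<close> by
  one site, so the shifts of \<open>moveR_swap_system\<close> add up to the length of
  \<open>bs\<close>.\<close>

lemma moveB_swap_left:
  assumes "l + n + length bs \<le> M"
  shows "swap_system (\<lambda>k. RR (l + k)) (\<lambda>k. RR (l + length bs + k)) n (\<lambda>as. moveB RR l as bs)"
  using assms
proof (induction bs arbitrary: l)
  case Nil then show ?case by (simp add: swap_system_def)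
next
  case (Cons b bs)
  have 1: "swap_system (\<lambda>k. RR (l + k)) (\<lambda>k. RR (Suc l + k)) n (moveR RR l b)"
    using Cons.prems by (intro moveR_swap_system) simp
  have 2: "swap_system (\<lambda>k. RR (Suc l + k)) (\<lambda>k. RR (Suc l + length bs + k)) n (\<lambda>as. moveB RR (Suc l) as bs)"
    using Cons.prems by (intro Cons.IH) simp
  show ?case
    unfolding swap_system_def
  proof (intro allI impI)
    fix xs ys :: "'p list" and a a'
    assume len: "length xs + length ys + 2 = n"
    have "moveB RR l (xs @ a' # a # ys) (b # bs) * RR (l + length (b # bs) + length xs) a a'
        = moveR RR l b (xs @ a' # a # ys)
          * (moveB RR (Suc l) (xs @ a' # a # ys) bs * RR (Suc l + length bs + length xs) a a')"
      by (simp add: mult.assoc)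
    also have "\<dots> = (moveR RR l b (xs @ a' # a # ys) * RR (Suc l + length xs) a a')
          * moveB RR (Suc l) (xs @ a # a' # ys) bs"
      using swap_systemD[OF 2 len] by (simp add: mult.assoc)
    also have "\<dots> = RR (l + length xs) a a' * (moveR RR l b (xs @ a # a' # ys)
          * moveB RR (Suc l) (xs @ a # a' # ys) bs)"
      unfolding swap_systemD[OF 1 len] by (simp add: mult.assoc)
    finally show "moveB RR l (xs @ a' # a # ys) (b # bs) * RR (l + length (b # bs) + length xs) a a'
        = RR (l + length xs) a a' * moveB RR l (xs @ a # a' # ys) (b # bs)" by simp
  qed
qed

lemma moveB_swap_right:
  assumes "l + length as + n \<le> M"
  shows "swap_system (\<lambda>k. RR (l + length as + k)) (\<lambda>k. RR (l + k)) n (moveB RR l as)"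
  unfolding swap_system_def
proof (intro allI impI)
  fix xs ys :: "'p list" and b b'
  assume len: "length xs + length ys + 2 = n"
  define k P Q where "k = l + length xs" and "P = moveB RR l as xs" and "Q = moveB RR (Suc (Suc k)) as ys"
  have *: "moveB RR l as (xs @ u # v # ys) = P * (moveR RR k u as * moveR RR (Suc k) v as) * Q" for u v
    by (simp add: moveB_append k_def P_def Q_def mult.assoc)
  have Q: "Q * RR k b b' = RR k b b' * Q"
    unfolding Q_def using assms len by (intro RR_moveB_far[symmetric]) (auto simp: k_def)
  have P: "P * RR (k + length as) b b' = RR (k + length as) b b' * P"
    unfolding P_def using assms len by (intro RR_moveB_far[symmetric]) (auto simp: k_def)
  have "moveB RR l as (xs @ b' # b # ys) * RR k b b' = P * (moveR RR k b' as * moveR RR (Suc k) b as) * (Q * RR k b b')"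
    by (simp add: * mult.assoc)
  also have "\<dots> = P * (moveR RR k b' as * moveR RR (Suc k) b as * RR k b b') * Q"
    unfolding Q by (simp add: mult.assoc)
  also have "moveR RR k b' as * moveR RR (Suc k) b as * RR k b b'
      = RR (k + length as) b b' * (moveR RR k b as * moveR RR (Suc k) b' as)"
    using assms len by (intro moveR_moveR_swap) (simp add: k_def)
  also have "P * (RR (k + length as) b b' * (moveR RR k b as * moveR RR (Suc k) b' as)) * Q
      = (P * RR (k + length as) b b') * (moveR RR k b as * moveR RR (Suc k) b' as) * Q"
    by (simp add: mult.assoc)
  also have "\<dots> = RR (k + length as) b b' * moveB RR l as (xs @ b # b' # ys)"
    unfolding P by (simp add: * mult.assoc)
  finally show "moveB RR l as (xs @ b' # b # ys) * RR (l + length xs) b b'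
      = RR (l + length as + length xs) b b' * moveB RR l as (xs @ b # b' # ys)"
    by (simp add: k_def add_ac)
qed

text \<open>The scalar in \<open>RR_unitarity\<close>, equal to
  \<open>-(u - q^2 v)(u - q^-2 v)\<close>. An R-matrix is invertible as soon as this scalar is a
  unit.\<close>

definition delta :: "'p \<Rightarrow> 'p \<Rightarrow> 'p" where
  "delta u v = u * v * (q\<^sup>2 + qi\<^sup>2) - u\<^sup>2 - v\<^sup>2"

lemma RR_invertible:
  assumes "Suc k < M" "delta u v dvd 1"
  shows "\<exists>Y. RR k u v * Y = 1 \<and> Y * RR k u v = 1"
proof -
  obtain d where d: "delta u v * d = 1" using assms(2) by (metis dvdE)
  have "delta v u = delta u v" by (simp add: delta_def mult_ac)
  then have "RR k u v * sm d (RR k v u) = 1" "sm d (RR k v u) * RR k u v = 1"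
    using RR_unitarity[OF assms(1), of u v] RR_unitarity[OF assms(1), of v u] d
    by (simp_all add: delta_def[symmetric] sm_simps) (simp_all add: sm_def mult.commute e_one flip: e_mult)
  then show ?thesis by blast
qed

lemma invertible_mult:
  fixes x y :: "'a::ring_1"
  assumes "\<exists>z. x * z = 1 \<and> z * x = 1" "\<exists>z. y * z = 1 \<and> z * y = 1"
  shows "\<exists>z. (x * y) * z = 1 \<and> z * (x * y) = 1"
proof -
  obtain u v where *: "x * u = 1" "u * x = 1" "y * v = 1" "v * y = 1" using assms by blast
  have "(x * y) * (v * u) = x * (y * v) * u" "(v * u) * (x * y) = v * (u * x) * y"
    by (simp_all only: mult.assoc)
  then show ?thesis using * by (intro exI[of _ "v * u"]) simp
qed

lemma moveR_invertible:
  assumes "l + length as < M" "\<And>a. a \<in> set as \<Longrightarrow> delta b a dvd 1"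
  shows "\<exists>Y. moveR RR l b as * Y = 1 \<and> Y * moveR RR l b as = 1"
  using assms
proof (induction as arbitrary: l)
  case (Cons a as)
  show ?case unfolding moveR.simps
    by (intro invertible_mult Cons.IH RR_invertible) (use Cons.prems in auto)
qed auto

lemma moveB_invertible:
  assumes "l + length as + length bs \<le> M" "\<And>a b. a \<in> set as \<Longrightarrow> b \<in> set bs \<Longrightarrow> delta b a dvd 1"
  shows "\<exists>Y. moveB RR l as bs * Y = 1 \<and> Y * moveB RR l as bs = 1"
  using assms
proof (induction bs arbitrary: l)
  case (Cons b bs)
  show ?case unfolding moveB.simps
    by (intro invertible_mult Cons.IH moveR_invertible) (use Cons.prems in auto)
qed auto

section \<open>Jucys--Murphy elements\<close>

text \<open>The multiplicative Jucys--Murphy elements. Since sites are numbered from 0,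
  \<open>jm n\<close> belongs to the entry \<open>n + 1\<close> of a tableau; its eigenvalue there
  will be \<open>q\<close> to twice the content.\<close>

primrec jm :: "nat \<Rightarrow> 'r" where
  "jm 0 = 1"
| "jm (Suc n) = T n * jm n * T n"

primrec Uinv :: "nat \<Rightarrow> 'r" where
  "Uinv 0 = 1"
| "Uinv (Suc n) = Uinv n * Ti n"

text \<open>The R-matrices of the next fusion column, followed by the inverse of the cycle that they
  induce. This removes the net permutation, so that the operator can act from the left on a fusion
  product without moving its parameters; see \<open>Kop_fus\<close>.\<close>

definition Kop :: "'p \<Rightarrow> 'p list \<Rightarrow> 'r" where
  "Kop x as = moveR RR 0 x as * Uinv (length as)"

lemma Kop_snoc: "Kop x (as @ [a]) = RR (length as) x a * Kop x as * Ti (length as)"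
  by (simp add: Kop_def moveR_append mult.assoc)

lemma Ti_commute:
  assumes "Suc k < M" "z * T k = T k * z"
  shows "z * Ti k = Ti k * z"
  using assms by (simp add: Ti_eq algebra_simps e_central)

lemma jm_T_far: "n < k \<Longrightarrow> Suc k < M \<Longrightarrow> jm n * T k = T k * jm n"
proof (induction n)
  case (Suc n)
  have "T k * T n = T n * T k" using Suc.prems by (intro T_far[symmetric]) auto
  moreover have "T k * jm n = jm n * T k" using Suc by simp
  ultimately have "T k * (T n * jm n * T n) = T n * jm n * T n * T k" by (intro commute_mult)
  then show ?case by simp
qed simp

text \<open>The case that is not mere distance is \<open>n = k + 2\<close>: the braid relation turns
  \<open>T k\<close> into \<open>T (Suc k)\<close> inside the element, this passes
  \<open>jm k\<close>, and a second braid relation turns it back.\<close>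

lemma jm_T_commute: "Suc k < n \<Longrightarrow> n < M \<Longrightarrow> jm n * T k = T k * jm n"
proof (induction n)
  case (Suc n)
  show ?case
  proof (cases "Suc k < n")
    case True
    have "T k * T n = T n * T k" using True Suc.prems by (intro T_far) auto
    moreover have "T k * jm n = jm n * T k" using Suc True by simp
    ultimately have "T k * (T n * jm n * T n) = T n * jm n * T n * T k" by (intro commute_mult)
    then show ?thesis by simp
  next
    case False
    then have n: "n = Suc k" using Suc.prems by simp
    have br: "T k * T n * T k = T n * T k * T n" using braid[of k] Suc.prems n by simp
    have far: "jm k * T n = T n * jm k" using jm_T_far[of k n] Suc.prems n by simp
    have "jm (Suc n) * T k = T n * T k * jm k * (T k * T n * T k)" by (simp add: n mult.assoc)
    also have "\<dots> = T n * T k * (jm k * T n) * (T k * T n)" unfolding br by (simp add: mult.assoc)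
    also have "\<dots> = (T n * T k * T n) * jm k * (T k * T n)" unfolding far by (simp add: mult.assoc)
    also have "\<dots> = T k * jm (Suc n)" unfolding br[symmetric] by (simp add: n mult.assoc)
    finally show ?thesis .
  qed
qed simp

lemma commute_Uinv: "(\<And>k. k < n \<Longrightarrow> z * Ti k = Ti k * z) \<Longrightarrow> z * Uinv n = Uinv n * z"
proof (induction n)
  case (Suc n)
  then have "z * Uinv n = Uinv n * z" "z * Ti n = Ti n * z" by simp_all
  then show ?case unfolding Uinv.simps by (rule commute_mult)
qed simp

lemma jm_Kop_commute:
  assumes "Suc (length as) < M"
  shows "jm (Suc (length as)) * Kop x as = Kop x as * jm (Suc (length as))"
proof -
  have "jm (Suc (length as)) * T k = T k * jm (Suc (length as))" if "k < length as" for k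
    using that assms by (intro jm_T_commute) auto
  then have "jm (Suc (length as)) * moveR RR 0 x as = moveR RR 0 x as * jm (Suc (length as))"
      "jm (Suc (length as)) * Uinv (length as) = Uinv (length as) * jm (Suc (length as))"
    using assms by (auto intro!: commute_moveR RR_commute commute_Uinv Ti_commute)
  then show ?thesis unfolding Kop_def by (rule commute_mult)
qed

definition den :: "'p \<Rightarrow> 'p list \<Rightarrow> 'p" where
  "den x as = (\<Prod>a\<leftarrow>as. x - a)"

text \<open>Numerator of the rational function computed by \<open>Kop_jm\<close>. The root 1 is the
  eigenvalue of \<open>jm 0\<close>; each earlier parameter \<open>a\<close> contributes the two
  zeros \<open>q^2 a\<close> and \<open>q^-2 a\<close>, that is, the contents one above and one
  below its own.\<close>

definition num :: "'p \<Rightarrow> 'p list \<Rightarrow> 'p" where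
  "num x as = (x - 1) * (\<Prod>a\<leftarrow>as. (x - q\<^sup>2 * a) * (x - qi\<^sup>2 * a))"

lemma q_quadratic: "(x - a) * (x - a) - x * a * ((q - qi) * (q - qi)) = (x - q\<^sup>2 * a) * (x - qi\<^sup>2 * a)"
proof -
  have "(x - q\<^sup>2 * a) * (x - qi\<^sup>2 * a) - ((x - a) * (x - a) - x * a * ((q - qi) * (q - qi)))
      = a * a * ((q * qi) * (q * qi) - 1) + x * a * 2 * (1 - q * qi)"
    by (simp add: power2_eq_square algebra_simps)
  then show ?thesis by (simp add: q_qi)
qed

text \<open>
  On a joint eigenvector of the previous Jucys--Murphy elements, \<open>Kop x\<close> is a rational function of
  the next one, \<open>y\<close>, with the single pole \<open>x = y\<close>.
\<close>

lemma Kop_jm: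
  assumes "length as < M" "\<And>i. i < length as \<Longrightarrow> jm i * V = sm (as ! i) V"
  shows "sm (den x as) ((e x - jm (length as)) * (Kop x as * V)) = sm (num x as) V
       \<and> sm (den x as) (Kop x as * ((e x - jm (length as)) * V)) = sm (num x as) V"
  using assms
proof (induction as arbitrary: V rule: rev_induct)
  case Nil
  then show ?case by (simp add: Kop_def den_def num_def sm_def e_one e_diff algebra_simps)
next
  case (snoc a as V)
  let ?h = "q - qi"
  define n k y t ti P Q where "n = length as" and "k = Kop x as" and "y = jm n" and "t = T n"
    and "ti = Ti n" and "P = den x as" and "Q = num x as"
  have n: "Suc n < M" using snoc.prems(1) by (simp add: n_def)
  have yV: "y * V = sm a V" using snoc.prems(2)[of n] by (simp add: n_def y_def)
  have V: "jm i * V = sm (as ! i) V" if "i < n" for i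
    using snoc.prems(2)[of i] that by (simp add: n_def nth_append)
  have ee: "e x - y = sm x 1 - y" by (simp add: sm_def)
  have R1: "sm P (k * ((e x - y) * V)) = sm Q V"
    using snoc.IH[of V] V n by (simp add: n_def y_def k_def P_def Q_def)
  then have R1: "sm (P * (x - a)) (k * V) = sm Q V"
    by (simp add: ee algebra_simps yV sm_simps sm_diff_left)
  \<comment> \<open>The induction hypothesis is used for three vectors: \<open>V\<close>,
    \<open>ti * V\<close> and later \<open>t * V\<close>. The last two need not be eigenvectors of
    \<open>y\<close>, but they remain eigenvectors of the earlier elements, which commute with
    \<open>t\<close>.\<close>
  have "jm i * (ti * V) = sm (as ! i) (ti * V)" if "i < n" for i
  proof -
    have "jm i * ti = ti * jm i" unfolding ti_def using n that by (intro Ti_commute jm_T_far) auto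
    then have "jm i * (ti * V) = ti * (jm i * V)" by (simp flip: mult.assoc)
    then show ?thesis using V[OF that] by (simp add: sm_simps)
  qed
  then have L: "sm P ((e x - y) * (k * (ti * V))) = sm Q (ti * V)"
    using snoc.IH[of "ti * V"] n by (simp add: n_def y_def k_def P_def Q_def)
  define w where "w = k * (ti * V)"
  have tti: "t * ti = 1" "t * (ti * r) = r" for r
    using T_Ti[OF n] unfolding t_def ti_def by (simp_all flip: mult.assoc)
  have tt: "t * t = 1 + sm ?h t" unfolding t_def by (rule T_sq[OF n])
  then have tt': "t * (t * r) = r + sm ?h (t * r)" for r
    by (simp add: sm_def algebra_simps flip: mult.assoc)
  have ti: "ti = t - sm ?h 1" unfolding t_def ti_def by (simp add: Ti_eq[OF n] sm_def)
  have yw: "sm P (y * w) = sm (P * x) w - sm Q (ti * V)"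
    using L by (simp add: ee w_def[symmetric] algebra_simps sm_simps)
  have tyw: "sm P (t * (y * w)) = sm (P * x) (t * w) - sm Q V"
    using arg_cong[OF yw, of "\<lambda>r. t * r"] by (simp add: sm_simps algebra_simps tti)
  \<comment> \<open>The new Jucys--Murphy element centralises the Hecke algebra on the earlier
    sites, in which \<open>k\<close> lies. It can therefore be carried to \<open>V\<close>, where
    \<open>y\<close> acts by the scalar \<open>a\<close>.\<close>
  have com: "t * y * t * k = k * (t * y * t)"
    using jm_Kop_commute[of as x] n by (simp add: n_def k_def y_def t_def)
  have "t * (y * (t * w)) = (t * y * t * k) * (ti * V)" by (simp add: w_def mult.assoc)
  also have "\<dots> = k * (t * (y * V))" unfolding com by (simp add: mult.assoc tti)
  also have "\<dots> = sm a (k * (t * V))" by (simp add: yV sm_simps)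
  also have "k * (t * V) = w + sm ?h (k * V)" by (simp add: w_def ti algebra_simps sm_simps)
  finally have "t * (y * (t * w)) = sm a w + sm (a * ?h) (k * V)" by (simp add: sm_simps)
  then have tytw: "sm (P * (x - a)) (t * (y * (t * w))) = sm (P * (x - a) * a) w + sm (a * ?h * Q) V"
    using arg_cong[OF R1, of "sm (a * ?h)"] by (simp add: sm_simps mult_ac)
  have tiw: "ti * w = t * w - sm ?h w" by (simp add: ti algebra_simps sm_simps)
  let ?r = "(x - q\<^sup>2 * a) * (x - qi\<^sup>2 * a)"
  have P': "den x (as @ [a]) = P * (x - a)" by (simp add: den_def P_def)
  have Q': "num x (as @ [a]) = Q * ?r" by (simp add: num_def Q_def mult_ac)
  have J': "jm (length (as @ [a])) = t * y * t" by (simp add: n_def y_def t_def)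
  have K': "Kop x (as @ [a]) * r = (sm x t - sm a ti) * (k * (ti * r))" for r
    by (simp add: Kop_snoc n_def k_def t_def ti_def RR_def mult.assoc)
  have "(e x - t * y * t) * ((sm x t - sm a ti) * w)
      = sm (x * x) (t * w) - sm (x * a) (ti * w)
        - (sm x (t * (y * (t * (t * w)))) - sm a (t * (y * (t * (ti * w)))))"
    by (simp add: e_eq_sm algebra_simps sm_simps)
  also have "\<dots> = sm (x * a * ?h) w + sm (x * x) (t * w) - sm (x * a) (t * w)
        - sm x (t * (y * w)) - sm (x * ?h) (t * (y * (t * w))) + sm a (t * (y * w))"
    by (simp add: tt' tti tiw algebra_simps sm_simps)
  finally have main: "(e x - t * y * t) * ((sm x t - sm a ti) * w) = \<dots>" .
  define d where "d = x - a"
  have main: "(e x - t * y * t) * ((sm x t - sm a ti) * w) = sm (x * a * ?h) w + sm (x * d) (t * w)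
        - sm d (t * (y * w)) - sm (x * ?h) (t * (y * (t * w)))"
    unfolding main d_def by (simp add: sm_diff_left right_diff_distrib)
  have "sm (P * d) ((e x - t * y * t) * ((sm x t - sm a ti) * w))
      = sm (P * d * (x * a * ?h)) w + sm (P * d * (x * d)) (t * w)
        - sm (d * d) (sm P (t * (y * w))) - sm (x * ?h) (sm (P * d) (t * (y * (t * w))))"
    unfolding main by (simp add: sm_simps mult_ac)
  also have "\<dots> = sm (Q * (d * d - x * a * (?h * ?h))) V"
    unfolding tyw tytw[folded d_def] by (simp only: sm_simps sm_diff_left right_diff_distrib mult_ac) simp
  finally have left: "sm (P * (x - a)) ((e x - t * y * t) * ((sm x t - sm a ti) * w)) = sm (Q * ?r) V"
    by (simp add: q_quadratic d_def)
  have "ti * ((e x - t * y * t) * V) = sm x (ti * V) - ti * t * (y * (t * V))"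
    by (simp add: e_eq_sm algebra_simps sm_simps)
  also have "ti * t = 1" using Ti_T[OF n] by (simp add: t_def ti_def)
  finally have tV: "ti * ((e x - t * y * t) * V) = sm x (ti * V) - y * (t * V)" by simp
  have "sm P (k * ((e x - y) * (t * V))) = sm Q (t * V)"
  proof -
    have "jm i * (t * V) = sm (as ! i) (t * V)" if "i < n" for i
    proof -
      have "jm i * t = t * jm i" unfolding t_def using n that by (intro jm_T_far) auto
      then have "jm i * (t * V) = t * (jm i * V)" by (simp flip: mult.assoc)
      then show ?thesis using V[OF that] by (simp add: sm_simps)
    qed
    then show ?thesis using snoc.IH[of "t * V"] n by (simp add: n_def y_def k_def P_def Q_def)
  qed
  then have kyt: "sm P (k * (y * (t * V))) = sm (P * x) (k * (t * V)) - sm Q (t * V)"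
    by (simp add: ee algebra_simps sm_simps)
  have "sm (P * (x - a)) (k * (ti * ((e x - t * y * t) * V)))
      = sm (P * (x - a) * x) (k * (ti * V)) - sm (x - a) (sm P (k * (y * (t * V))))"
    unfolding tV by (simp add: algebra_simps sm_simps)
  also have "\<dots> = sm ((x - a) * Q) (t * V) - sm (x * ?h) (sm (P * (x - a)) (k * V))"
    unfolding kyt ti by (simp add: algebra_simps sm_simps sm_diff_left)
  finally have kk: "sm (P * (x - a)) (k * (ti * ((e x - t * y * t) * V)))
      = sm ((x - a) * Q) (t * V) - sm (x * ?h * Q) V"
    unfolding R1 by (simp add: sm_simps)
  have expand: "(sm x t - sm a ti) * (sm ((x - a) * Q) (t * V) - sm (x * ?h * Q) V) = sm (x * d * Q - a * d * Q - a * x * h * h * Q) V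
      + sm (x * d * Q * h - x * x * h * Q + a * x * h * Q) (t * V)" if "h = ?h" for h
  proof -
    have "(sm x t - sm a ti) * (sm ((x - a) * Q) (t * V) - sm (x * ?h * Q) V)
      = sm (x * d * Q) (t * (t * V)) - sm (x * x * h * Q) (t * V) - sm (a * d * Q) (ti * (t * V)) + sm (a * x * h * Q) (ti * V)"
      by (simp add: left_diff_distrib right_diff_distrib sm_simps that flip: d_def) (simp add: mult_ac)
    also have "ti * (t * V) = V" using Ti_T[OF n] by (simp add: t_def ti_def flip: mult.assoc)
    also have "t * (t * V) = V + sm h (t * V)" by (simp add: tt' that)
    also have "ti * V = t * V - sm h V" by (simp add: ti that left_diff_distrib sm_simps)
    finally show ?thesis by (simp add: sm_simps sm_add_left sm_diff_left) (simp add: mult_ac)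
  qed
  have "sm (P * (x - a)) ((sm x t - sm a ti) * (k * (ti * ((e x - t * y * t) * V))))
      = (sm x t - sm a ti) * (sm ((x - a) * Q) (t * V) - sm (x * ?h * Q) V)"
    by (simp only: kk[symmetric] sm_mult_right)
  also note expand[OF refl]
  \<comment> \<open>The terms with \<open>t * V\<close> drop out; what multiplies \<open>V\<close>
    is the quadratic polynomial of \<open>q_quadratic\<close>.\<close>
  also have "x * d * Q * ?h - x * x * ?h * Q + a * x * ?h * Q = 0"
    unfolding d_def by (simp add: algebra_simps)
  also have "x * d * Q - a * d * Q - a * x * ?h * ?h * Q = Q * ((x - a) * (x - a) - x * a * (?h * ?h))"
    unfolding d_def by (simp add: algebra_simps)
  also have "sm (Q * ((x - a) * (x - a) - x * a * (?h * ?h))) V + sm 0 (t * V) = sm (Q * ((x - a) * (x - a) - x * a * (?h * ?h))) V"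
    by (simp add: sm_simps)
  finally have right: "sm (P * (x - a)) ((sm x t - sm a ti) * (k * (ti * ((e x - t * y * t) * V)))) = sm (Q * ?r) V"
    by (simp add: q_quadratic)
  show ?case unfolding P' Q' J' K' using left right by (simp add: w_def)
qed

end

section \<open>Fusion\<close>

locale dhecke = dalg e + hecke e q qi T Ti M
  for e :: "complex fps \<Rightarrow> 'r::ring_1" and q qi T Ti M
begin

text \<open>
  The last evaluation of the fusion procedure extends \<open>F C(x) / (x - a)\<^sup>k\<close> to \<open>x = a\<close>; the condition
  on the contents says that the Jucys--Murphy pole at \<open>a\<close> is simple.
\<close>

inductive fus :: "complex fps list \<Rightarrow> 'r \<Rightarrow> bool" where
  fus_Nil: "fus [] 1"
| fus_snoc: "fus (as @ [a]) (H a)"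
  if "fus as F" "length as < M" "lip H"
    "\<And>x. sm ((x - a) ^ count_list as a) (H x) = F * moveR RR 0 x (rev as)"
    "count_list (1 # map ((*) (q\<^sup>2)) as @ map ((*) (qi\<^sup>2)) as) a = Suc (2 * count_list as a)"

lemma lip_RR: "slip f \<Longrightarrow> slip g \<Longrightarrow> lip (\<lambda>x. RR k (f x) (g x))"
  unfolding RR_def by (intro lip_diff lip_sm lip_const)

lemma lip_moveR: "lip (\<lambda>x. moveR RR l x as)"
  by (induction as arbitrary: l) (auto intro!: lip_const lip_mult lip_RR slip_id slip_const)

lemma lip_moveR_arg: "lip (\<lambda>y. moveR RR l x (as @ y # bs))"
proof (induction as arbitrary: l)
  case Nil
  then show ?case by (auto intro!: lip_const lip_mult lip_RR slip_id slip_const)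
next
  case (Cons a as)
  then show ?case by (auto intro!: lip_const lip_mult)
qed

lemma slip_den: "slip (\<lambda>x. \<Prod>r\<leftarrow>rs. x - r)"
  by (induction rs) (auto intro!: slip_const slip_mult slip_diff slip_id)

lemma root_factor:
  obtains p where "slip p" "p a \<noteq> 0" "\<And>x. (\<Prod>r\<leftarrow>rs. x - r) = (x - a) ^ count_list rs a * p x"
proof
  define p :: "complex fps \<Rightarrow> complex fps" where "p x = (\<Prod>r\<leftarrow>filter (\<lambda>r. r \<noteq> a) rs. x - r)" for x
  show "slip p" unfolding p_def by (rule slip_den)
  show "p a \<noteq> 0" by (auto simp: p_def prod_list_zero_iff)
  show "(\<Prod>r\<leftarrow>rs. x - r) = (x - a) ^ count_list rs a * p x" for x
    unfolding p_def by (induction rs) (auto simp: mult_ac)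
qed

lemma num_roots: "num x as = (\<Prod>r\<leftarrow>1 # map ((*) (q\<^sup>2)) as @ map ((*) (qi\<^sup>2)) as. x - r)"
  unfolding num_def by (induction as) (auto simp: mult_ac)

text \<open>The inverse of the image of the longest permutation on \<open>n\<close> sites, built
  from the inverse cycles \<open>Uinv\<close>.\<close>

primrec Tinv0 :: "nat \<Rightarrow> 'r" where
  "Tinv0 0 = 1"
| "Tinv0 (Suc n) = Uinv n * Tinv0 n"

primrec Uop :: "nat \<Rightarrow> 'r" where
  "Uop 0 = 1"
| "Uop (Suc n) = T n * Uop n"

lemma Uop_Uinv: "n < M \<Longrightarrow> Uop n * Uinv n = 1 \<and> Uinv n * Uop n = 1"
proof (induction n)
  case (Suc n)
  have "Uop (Suc n) * Uinv (Suc n) = T n * (Uop n * Uinv n) * Ti n"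
    "Uinv (Suc n) * Uop (Suc n) = Uinv n * (Ti n * T n) * Uop n" by (simp_all add: mult.assoc)
  then show ?case using Suc T_Ti[of n] Ti_T[of n] by simp
qed simp

text \<open>Conjugation by a cycle shifts the generators by one site. The recursion ends at
  \<open>n = k + 2\<close>, where the statement is the braid relation rewritten with two
  inverses.\<close>

lemma T_Uinv: "Suc k < n \<Longrightarrow> n < M \<Longrightarrow> T (Suc k) * Uinv n = Uinv n * T k"
proof (induction n)
  case (Suc n)
  show ?case
  proof (cases "Suc k < n")
    case True
    have "T k * Ti n = Ti n * T k" using True Suc.prems by (intro Ti_commute T_far) auto
    then show ?thesis using Suc True by (simp flip: mult.assoc) (simp add: mult.assoc)
  next
    case False
    then have n: "n = Suc k" using Suc.prems by simp
    have M: "Suc (Suc k) < M" using Suc.prems n by simp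
    note i = T_Ti[of k] Ti_T[of k] T_Ti[OF M] Ti_T[OF M]
    have "T (Suc k) * Uinv k = Uinv k * T (Suc k)"
      using M by (intro commute_Uinv Ti_commute T_far[symmetric]) auto
    then have "T (Suc k) * Uinv (Suc n) = Uinv k * (T (Suc k) * Ti k * Ti (Suc k))"
      by (simp add: n flip: mult.assoc)
    also have "T (Suc k) * Ti k * Ti (Suc k) = Ti k * Ti (Suc k) * T k"
    proof -
      have "Ti k * Ti (Suc k) * T k = Ti k * Ti (Suc k) * (T k * T (Suc k) * T k) * Ti k * Ti (Suc k)"
        using i M by (simp add: mult.assoc)
      also have "\<dots> = Ti k * (Ti (Suc k) * T (Suc k)) * T k * T (Suc k) * Ti k * Ti (Suc k)"
        unfolding braid[OF M] by (simp add: mult.assoc)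
      finally show ?thesis using i M by simp
    qed
    finally show ?thesis by (simp add: n mult.assoc)
  qed
qed simp

lemma RR_Uinv:
  assumes "Suc k < n" "n < M"
  shows "RR (Suc k) u v * Uinv n = Uinv n * RR k u v"
proof -
  have "Ti (Suc k) * Uinv n = Uinv n * Ti k"
    using assms T_Uinv[OF assms] by (simp add: Ti_eq algebra_simps e_central)
  then show ?thesis using T_Uinv[OF assms] by (simp add: RR_def algebra_simps sm_simps)
qed

end

section \<open>Passing fusion products through exchange operators\<close>

locale dhom = A: dalg e + B: dalg e' for e :: "complex fps \<Rightarrow> 'r::ring_1" and e' :: "complex fps \<Rightarrow> 's::ring_1" +
  fixes \<phi> :: "'r \<Rightarrow> 's"
  assumes hom_add: "\<phi> (x + y) = \<phi> x + \<phi> y" and hom_mult: "\<phi> (x * y) = \<phi> x * \<phi> y"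
    and hom_one: "\<phi> 1 = 1" and hom_e: "\<phi> (e c) = e' c"
begin

lemma hom_diff: "\<phi> (x - y) = \<phi> x - \<phi> y"
  using hom_add[of "x - y" y] by (simp add: algebra_simps)

lemma hom_sm: "\<phi> (A.sm c x) = B.sm c (\<phi> x)"
  by (simp add: A.sm_def B.sm_def hom_mult hom_e)

lemma hom_lip: "A.lip f \<Longrightarrow> B.lip (\<lambda>x. \<phi> (f x))"
  unfolding A.lip_def B.lip_def by (metis hom_diff hom_sm)

lemma hom_moveR: "\<phi> (moveR R l b as) = moveR (\<lambda>k u v. \<phi> (R k u v)) l b as"
  by (induction as arbitrary: l) (simp_all add: hom_one hom_mult)

end

lemma (in dalg) dhom_id: "dhom e e (\<lambda>x. x)"
  by unfold_locales simp_all

context dhecke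
begin

text \<open>Before evaluation, \<open>(x - a)^k H(x)\<close> is \<open>F\<close> times a row of
  R-matrices. By induction \<open>F\<close> passes through \<open>G\<close> and reverses the earlier
  parameters; the row then carries \<open>x\<close> to the front of the reversed list. Both sides
  are Lipschitz in \<open>x\<close>, so the power cancels at \<open>x = a\<close>.\<close>

theorem fus_exchange:
  assumes h1: "dhom e e' \<phi>1" and h2: "dhom e e' \<phi>2"
    and G: "swap_system (\<lambda>k u v. \<phi>1 (RR k u v)) (\<lambda>k u v. \<phi>2 (RR k u v)) N G"
    and lip: "\<And>xs ys. length xs + length ys + 1 = N \<Longrightarrow> dalg.lip e' (\<lambda>x. G (xs @ x # ys))"
    and "fus as F" "length as + length zs = N"
  shows "G (as @ zs) * \<phi>2 F = \<phi>1 F * G (rev as @ zs)"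
proof -
  interpret h1: dhom e e' \<phi>1 by fact
  interpret h2: dhom e e' \<phi>2 by fact
  show ?thesis using assms(5,6)
  proof (induction arbitrary: zs rule: fus.induct)
    case fus_Nil
    then show ?case by (simp add: h1.hom_one h2.hom_one)
  next
    case (fus_snoc as F H a)
    let ?k = "count_list as a" and ?C = "\<lambda>x. moveR RR 0 x (rev as)"
    have "G (as @ a # zs) * \<phi>2 (H a) = \<phi>1 (H a) * G (a # rev as @ zs)"
    proof (rule h1.B.lip_cancel)
      show "h1.B.lip (\<lambda>x. G (as @ x # zs) * \<phi>2 (H x))"
        using fus_snoc by (intro h1.B.lip_mult lip h2.hom_lip) auto
      show "h1.B.lip (\<lambda>x. \<phi>1 (H x) * G (x # rev as @ zs))"
        using fus_snoc lip[of "[]" "rev as @ zs"] by (intro h1.B.lip_mult h1.hom_lip) auto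
      fix x
      have "h1.B.sm ((x - a) ^ ?k) (G (as @ x # zs) * \<phi>2 (H x)) = G (as @ x # zs) * \<phi>2 (sm ((x - a) ^ ?k) (H x))"
        by (simp add: h2.hom_sm h1.B.sm_simps)
      also have "\<dots> = G (as @ x # zs) * \<phi>2 F * \<phi>2 (?C x)"
        by (simp add: fus_snoc.hyps h2.hom_mult mult.assoc)
      also have "G (as @ x # zs) * \<phi>2 F = \<phi>1 F * G (rev as @ x # zs)"
        using fus_snoc.prems by (intro fus_snoc.IH) simp
      also have "\<phi>1 F * G (rev as @ x # zs) * \<phi>2 (?C x) = \<phi>1 F * (G (rev as @ x # zs) * \<phi>2 (?C x))"
        by (simp add: mult.assoc)
      also have "G (rev as @ x # zs) * \<phi>2 (?C x) = \<phi>1 (?C x) * G (x # rev as @ zs)"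
        using swap_system_move[OF G, of "[]" "rev as" zs x] fus_snoc.prems
        by (simp add: h1.hom_moveR h2.hom_moveR)
      also have "\<phi>1 F * (\<phi>1 (?C x) * G (x # rev as @ zs)) = \<phi>1 (sm ((x - a) ^ ?k) (H x)) * G (x # rev as @ zs)"
        by (simp add: fus_snoc.hyps h1.hom_mult mult.assoc)
      finally show "h1.B.sm ((x - a) ^ ?k) (G (as @ x # zs) * \<phi>2 (H x))
          = h1.B.sm ((x - a) ^ ?k) (\<phi>1 (H x) * G (x # rev as @ zs))"
        by (simp add: h1.hom_sm h1.B.sm_simps)
    qed
    then show ?case by simp
  qed
qed

text \<open>\<open>fus_exchange\<close> for the row of R-matrices followed by \<open>Uinv\<close>.
  The row alone shifts sites by one and \<open>Uinv\<close> shifts them back, so the same copy of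
  \<open>F\<close> appears on both sides.\<close>

lemma Kop_fus:
  assumes "fus as F" "length as < M"
  shows "Kop x as * F = F * moveR RR 0 x (rev as) * Uinv (length as)"
proof -
  let ?n = "length as"
  have "moveR RR 0 x (as @ []) * Uinv ?n * F = F * (moveR RR 0 x (rev as @ []) * Uinv ?n)"
  proof (rule fus_exchange[OF dhom_id dhom_id _ _ assms(1), where N = ?n and G = "\<lambda>bs. moveR RR 0 x bs * Uinv ?n"])
    have *: "swap_system RR (\<lambda>k. RR (Suc k)) ?n (moveR RR 0 x)"
      using moveR_swap_system[of 0 ?n x] assms(2) by simp
    show "swap_system RR RR ?n (\<lambda>bs. moveR RR 0 x bs * Uinv ?n)"
      unfolding swap_system_def
    proof (intro allI impI)
      fix xs ys :: "complex fps list" and a b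
      assume len: "length xs + length ys + 2 = ?n"
      have "Uinv ?n * RR (length xs) a b = RR (Suc (length xs)) a b * Uinv ?n"
        using assms len by (intro RR_Uinv[symmetric]) auto
      then show "moveR RR 0 x (xs @ b # a # ys) * Uinv ?n * RR (length xs) a b
          = RR (length xs) a b * (moveR RR 0 x (xs @ a # b # ys) * Uinv ?n)"
        using swap_systemD[OF * len, of b a] by (simp add: mult.assoc) (simp flip: mult.assoc)
    qed
    show "lip (\<lambda>y. moveR RR 0 x (xs @ y # ys) * Uinv ?n)" for xs ys
      by (intro lip_mult lip_moveR_arg lip_const)
  qed simp
  then show ?thesis by (simp add: Kop_def mult.assoc)
qed

text \<open>The earlier elements act through the left factor \<open>F\<close>. For the last one,
  \<open>Kop_jm\<close> says that \<open>a - jm\<close> times the new factor is proportional to a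
  value of the numerator after cancellation, and one zero is left over there.\<close>

lemma fus_jm: "fus as F \<Longrightarrow> i < length as \<Longrightarrow> jm i * F = sm (as ! i) F"
proof (induction arbitrary: i rule: fus.induct)
  case (fus_snoc as F H a)
  let ?k = "count_list as a" and ?n = "length as" and ?C = "\<lambda>x. moveR RR 0 x (rev as)"
  show ?case
  proof (cases "i = ?n")
    case False
    then have i: "i < ?n" using fus_snoc.prems by simp
    have "jm i * H a = sm (as ! i) (H a)"
    proof (rule lip_cancel[where f = "\<lambda>x. jm i * H x" and g = "\<lambda>x. sm (as ! i) (H x)" and k = ?k])
      show "lip (\<lambda>x. jm i * H x)" "lip (\<lambda>x. sm (as ! i) (H x))"
        using fus_snoc.hyps by (auto intro!: lip_mult lip_sm lip_const slip_const)
      fix x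
      have "sm ((x - a) ^ ?k) (jm i * H x) = jm i * F * ?C x"
        by (simp add: fus_snoc.hyps mult.assoc flip: sm_mult_right)
      also have "\<dots> = sm (as ! i) (F * ?C x)" by (simp add: fus_snoc.IH[OF i] sm_simps)
      finally show "sm ((x - a) ^ ?k) (jm i * H x) = sm ((x - a) ^ ?k) (sm (as ! i) (H x))"
        by (simp add: sm_commute[of "_ ^ _"] fus_snoc.hyps)
    qed
    then show ?thesis using i by (simp add: nth_append)
  next
    case True
    obtain p where p: "slip p" "p a \<noteq> 0" "\<And>x. den x as = (x - a) ^ ?k * p x"
      unfolding den_def using root_factor by blast
    obtain p' where p': "slip p'" "p' a \<noteq> 0" "\<And>x. num x as = (x - a) ^ Suc (2 * ?k) * p' x"
      unfolding num_roots using root_factor[of a "1 # map ((*) (q\<^sup>2)) as @ map ((*) (qi\<^sup>2)) as"]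
      unfolding fus_snoc.hyps by blast
    have pw: "y ^ (2 * ?k) = y ^ ?k * y ^ ?k" for y :: "complex fps" by (simp add: mult_2 power_add)
    have K: "Kop x as * F = sm ((x - a) ^ ?k) (H x * Uinv ?n)" for x
      unfolding Kop_fus[OF fus_snoc.hyps(1,2)] fus_snoc.hyps(4)[symmetric] by (simp add: sm_simps)
    \<comment> \<open>Of the power \<open>2 k\<close>, one half comes from the denominator and the
      other from the definition of \<open>H\<close>. The numerator vanishes to order
      \<open>2 k + 1\<close>, so a factor \<open>x - a\<close> remains and kills the right-hand side
      at \<open>x = a\<close>.\<close>
    have "sm (p a) ((e a - jm ?n) * (H a * Uinv ?n)) = sm ((a - a) * p' a) F"
    proof (rule lip_cancel[where k = "2 * ?k" and f = "\<lambda>x. sm (p x) ((e x - jm ?n) * (H x * Uinv ?n))"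
          and g = "\<lambda>x. sm ((x - a) * p' x) F"])
      show "lip (\<lambda>x. sm (p x) ((e x - jm ?n) * (H x * Uinv ?n)))" "lip (\<lambda>x. sm ((x - a) * p' x) F)"
        using p p' fus_snoc.hyps
        by (auto intro!: lip_sm lip_mult lip_diff lip_const lip_e slip_id slip_mult slip_diff slip_const)
      fix x
      have "sm (den x as) ((e x - jm ?n) * (Kop x as * F)) = sm (num x as) F"
        using Kop_jm[OF fus_snoc.hyps(2)] fus_snoc.IH by blast
      then show "sm ((x - a) ^ (2 * ?k)) (sm (p x) ((e x - jm ?n) * (H x * Uinv ?n)))
          = sm ((x - a) ^ (2 * ?k)) (sm ((x - a) * p' x) F)"
        unfolding K p p' power_Suc pw by (simp add: sm_simps mult_ac)
    qed
    then have "sm (p a) ((e a - jm ?n) * (H a * Uinv ?n)) = sm (p a) 0" by (simp add: sm_simps)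
    then have "(e a - jm ?n) * (H a * Uinv ?n) = 0" using p(2) by (rule sm_cancel)
    then have "(e a - jm ?n) * H a * (Uinv ?n * Uop ?n) = 0" by (simp flip: mult.assoc)
    then have "(e a - jm ?n) * H a = 0" using Uop_Uinv[OF fus_snoc.hyps(2)] by simp
    then show ?thesis using True by (simp add: sm_def left_diff_distrib)
  qed
qed simp

text \<open>With \<open>E = H a\<close>, the product \<open>H(x) \<tau> E\<close> is, up to the
  power of \<open>x - a\<close>, \<open>Kop\<close> applied to \<open>F \<tau> E\<close>, which is a
  multiple of \<open>E\<close>. On \<open>E\<close> the pole of \<open>Kop\<close> is the scalar
  pole at \<open>a\<close>. The total order \<open>2 k + 1\<close> of the poles is the exact order
  of the zero of the numerator, so the limits at \<open>a\<close> are nonzero.\<close>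

theorem fus_quasi_idempotent:
  assumes "fus as F"
  shows "\<exists>k1 k2. k1 \<noteq> 0 \<and> k2 \<noteq> 0 \<and> sm k1 (F * Tinv0 (length as) * F) = sm k2 F"
  using assms
proof (induction rule: fus.induct)
  case fus_Nil
  show ?case by (intro exI[of _ 1]) simp
next
  case (fus_snoc as F H a)
  let ?k = "count_list as a" and ?n = "length as" and ?C = "\<lambda>x. moveR RR 0 x (rev as)"
  obtain k1 k2 where k: "k1 \<noteq> 0" "k2 \<noteq> 0" "sm k1 (F * Tinv0 ?n * F) = sm k2 F"
    using fus_snoc.IH by blast
  obtain p where p: "slip p" "p a \<noteq> 0" "\<And>x. den x as = (x - a) ^ ?k * p x"
    unfolding den_def using root_factor by blast
  obtain p' where p': "slip p'" "p' a \<noteq> 0" "\<And>x. num x as = (x - a) ^ Suc (2 * ?k) * p' x"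
    unfolding num_roots using root_factor[of a "1 # map ((*) (q\<^sup>2)) as @ map ((*) (qi\<^sup>2)) as"]
    unfolding fus_snoc.hyps by blast
  have pw: "y ^ (2 * ?k) = y ^ ?k * y ^ ?k" for y :: "complex fps" by (simp add: mult_2 power_add)
  define E where "E = H a"
  have fus: "fus (as @ [a]) E" unfolding E_def using fus_snoc.hyps by (intro fus.fus_snoc)
  \<comment> \<open>\<open>E\<close> is a limit of elements with left factor \<open>F\<close>, so it
    inherits the relation for \<open>F \<tau> F\<close>.\<close>
  have FE: "sm k1 (F * Tinv0 ?n * E) = sm k2 E"
    unfolding E_def
  proof (rule lip_cancel[where f = "\<lambda>x. sm k1 (F * Tinv0 ?n * H x)" and g = "\<lambda>x. sm k2 (H x)" and k = ?k])
    show "lip (\<lambda>x. sm k1 (F * Tinv0 ?n * H x))" "lip (\<lambda>x. sm k2 (H x))"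
      using fus_snoc.hyps by (auto intro!: lip_sm lip_mult lip_const slip_const)
    fix x
    have "sm ((x - a) ^ ?k) (sm k1 (F * Tinv0 ?n * H x)) = sm k1 (F * Tinv0 ?n * F) * ?C x"
      by (simp add: sm_commute[of "_ ^ _"] sm_mult_left mult.assoc fus_snoc.hyps flip: sm_mult_right)
    also have "\<dots> = sm ((x - a) ^ ?k) (sm k2 (H x))"
      unfolding k by (simp add: sm_commute[of "_ ^ _"] sm_mult_left fus_snoc.hyps)
    finally show "sm ((x - a) ^ ?k) (sm k1 (F * Tinv0 ?n * H x)) = sm ((x - a) ^ ?k) (sm k2 (H x))" .
  qed
  have jmE: "jm i * E = sm (as ! i) E" if "i < ?n" for i
    using fus_jm[OF fus, of i] that by (simp add: nth_append)
  have jmE': "jm ?n * E = sm a E" using fus_jm[OF fus, of ?n] by simp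
  have KE: "sm (den x as * (x - a)) (Kop x as * E) = sm (num x as) E" for x
  proof -
    have "sm (den x as) (Kop x as * ((e x - jm ?n) * E)) = sm (num x as) E"
      using Kop_jm[OF fus_snoc.hyps(2)] jmE by blast
    moreover have "(e x - jm ?n) * E = sm (x - a) E"
      by (simp add: left_diff_distrib jmE' sm_diff_left) (simp add: sm_def)
    ultimately show ?thesis by (simp add: sm_simps)
  qed
  have "sm (k1 * p a) (H a * Tinv0 (Suc ?n) * E) = sm (k2 * p' a) E"
  proof (rule lip_cancel[where k = "Suc (2 * ?k)" and f = "\<lambda>x. sm (k1 * p x) (H x * Tinv0 (Suc ?n) * E)"
        and g = "\<lambda>x. sm (k2 * p' x) E"])
    show "lip (\<lambda>x. sm (k1 * p x) (H x * Tinv0 (Suc ?n) * E))" "lip (\<lambda>x. sm (k2 * p' x) E)"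
      using p p' fus_snoc.hyps by (auto intro!: lip_sm lip_mult lip_const slip_mult slip_const)
    fix x
    have "sm k1 (sm ((x - a) ^ ?k) (H x) * Tinv0 (Suc ?n) * E) = sm k1 (Kop x as * F * Tinv0 ?n * E)"
      unfolding fus_snoc.hyps(4) Kop_fus[OF fus_snoc.hyps(1,2)] by (simp add: mult.assoc)
    also have "\<dots> = Kop x as * sm k1 (F * Tinv0 ?n * E)" by (simp add: sm_mult_right mult.assoc)
    also have "\<dots> = sm k2 (Kop x as * E)" unfolding FE by (simp add: sm_mult_right)
    finally have "sm (den x as * (x - a)) (sm k1 (sm ((x - a) ^ ?k) (H x) * Tinv0 (Suc ?n) * E))
        = sm k2 (sm (num x as) E)" unfolding KE[symmetric] by (simp add: sm_commute)
    then show "sm ((x - a) ^ Suc (2 * ?k)) (sm (k1 * p x) (H x * Tinv0 (Suc ?n) * E))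
        = sm ((x - a) ^ Suc (2 * ?k)) (sm (k2 * p' x) E)"
      unfolding p p' power_Suc pw by (simp add: sm_simps mult_ac)
  qed
  then show ?case using k p(2) p'(2)
    by (intro exI[of _ "k1 * p a"] exI[of _ "k2 * p' a"]) (simp add: E_def)
qed

end

section \<open>The ring of operators on tensor powers\<close>

text \<open>
  Operators on all tensor powers at once, as block matrices, so that they form a ring with unit.
  An operator meant for the \<open>M\<close>-th power is a scalar on the other powers.
\<close>

typedef (overloaded) ('n, 'a::zero) op =
  "{A :: 'n list \<Rightarrow> 'n list \<Rightarrow> 'a. \<forall>x y. length x \<noteq> length y \<longrightarrow> A x y = 0}"
  morphisms ent Abs_op by (intro exI[of _ "\<lambda>x y. 0"]) simp

lemma ent_length: "length x \<noteq> length y \<Longrightarrow> ent A x y = 0"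
  using ent[of A] by blast

definition Op :: "('n list \<Rightarrow> 'n list \<Rightarrow> 'a::zero) \<Rightarrow> ('n, 'a) op" where
  "Op A = Abs_op (\<lambda>x y. if length x = length y then A x y else 0)"

lemma ent_Op: "ent (Op A) x y = (if length x = length y then A x y else 0)"
  by (simp add: Op_def Abs_op_inverse)

lemma op_eqI: "(\<And>x y. length x = length y \<Longrightarrow> ent A x y = ent B x y) \<Longrightarrow> A = B"
  by (metis ent_inject ent_length ext)

lemma finite_lists: "finite {z :: 'n::finite list. length z = m}"
  using finite_lists_length_eq[of "UNIV :: 'n set" m] by simp

instantiation op :: (finite, ring_1) ring_1
begin

definition "0 = Op (\<lambda>x y. 0)"
definition "1 = Op (\<lambda>x y. if x = y then 1 else 0)"
definition "A + B = Op (\<lambda>x y. ent A x y + ent B x y)"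
definition "A - B = Op (\<lambda>x y. ent A x y - ent B x y)"
definition "- A = Op (\<lambda>x y. - ent A x y)"
definition "A * B = Op (\<lambda>x y. \<Sum>z | length z = length x. ent A x z * ent B z y)"

lemma ent_zero: "ent 0 x y = 0"
  and ent_one: "ent (1 :: ('a, 'b) op) x y = (if x = y then 1 else 0)"
  and ent_add: "ent (A + B) x y = ent A x y + ent B x y"
  and ent_diff: "ent (A - B) x y = ent A x y - ent B x y"
  and ent_minus: "ent (- A) x y = - ent A x y"
  for A B :: "('a, 'b) op"
  by (auto simp: zero_op_def one_op_def plus_op_def minus_op_def uminus_op_def ent_Op ent_length)

lemma ent_mult: "ent (A * B) x y = (\<Sum>z | length z = length x. ent A x z * ent B z y)" for A B :: "('a, 'b) op"
  by (auto simp: times_op_def ent_Op ent_length intro!: sum.neutral[symmetric])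

instance
proof
  fix A B C :: "('a, 'b) op"
  show "A * B * C = A * (B * C)"
  proof (rule op_eqI)
    fix x y :: "'a list"
    have "ent (A * B * C) x y
        = (\<Sum>z | length z = length x. \<Sum>w | length w = length x. ent A x w * ent B w z * ent C z y)"
      by (simp add: ent_mult sum_distrib_right)
    also have "\<dots> = (\<Sum>w | length w = length x. \<Sum>z | length z = length x. ent A x w * ent B w z * ent C z y)"
      by (rule sum.swap)
    also have "\<dots> = ent (A * (B * C)) x y"
      by (simp add: ent_mult sum_distrib_left mult.assoc)
    finally show "ent (A * B * C) x y = ent (A * (B * C)) x y" .
  qed
  have [simp]: "(\<Sum>z | length z = m. (if x = z then 1 else 0) * f z) = f x"
    if "length x = m" for f :: "'a list \<Rightarrow> 'b" and x m
    using that by (subst sum.cong[OF refl, where h = "\<lambda>z. if x = z then f z else 0"]) (auto simp: finite_lists)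
  have [simp]: "(\<Sum>z | length z = m. f z * (if z = y then 1 else 0)) = f y"
    if "length y = m" for f :: "'a list \<Rightarrow> 'b" and m y
    using that
    by (subst sum.cong[OF refl, where h = "\<lambda>z. if z = y then f z else 0"]) (auto simp: finite_lists)
  show "1 * A = A" "A * 1 = A" by (rule op_eqI; simp add: ent_mult ent_one)+
  show "(0 :: ('a, 'b) op) \<noteq> 1"
  proof
    assume "(0 :: ('a, 'b) op) = 1"
    then have "ent (0 :: ('a, 'b) op) [] [] = ent 1 [] []" by simp
    then show False by (simp add: ent_zero ent_one)
  qed
qed (rule op_eqI; simp add: ent_add ent_diff ent_minus ent_zero ent_mult algebra_simps sum.distrib)+

end

lemma sum_lists_delta:
  "(\<Sum>z :: 'n::finite list | length z = m. if z = y then f z else 0) = (if length y = m then f y else 0)"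
  by (simp add: finite_lists)

definition scal :: "'a \<Rightarrow> ('n::finite, 'a::ring_1) op" where
  "scal c = Op (\<lambda>x y. if x = y then c else 0)"

lemma ent_scal: "ent (scal c) x y = (if x = y then c else 0)"
  by (auto simp: scal_def ent_Op)

lemma ent_scal_mult: "ent (scal c * A) x y = c * ent A x y"
  by (subst ent_mult, subst sum.cong[OF refl, where h = "\<lambda>z. if z = x then c * ent A z y else 0"])
    (auto simp: ent_scal sum_lists_delta)

lemma ent_mult_scal: "ent (A * scal c) x y = ent A x y * c"
  by (subst ent_mult, subst sum.cong[OF refl, where h = "\<lambda>z. if z = y then ent A x z * c else 0"])
    (auto simp: ent_scal sum_lists_delta ent_length)

lemma calg_scal: "calg e \<Longrightarrow> calg (\<lambda>c. scal (e c) :: ('n::finite, 'r::ring_1) op)"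
proof -
  assume "calg e"
  then interpret calg e .
  show ?thesis
    by standard (rule op_eqI; simp add: ent_scal ent_scal_mult ent_mult_scal ent_one ent_add e_one e_add e_mult e_central[of "ent _ _ _"])+
qed

lemma dalg_scal: "dalg e \<Longrightarrow> dalg (\<lambda>c. scal (e c) :: ('n::finite, 'r::ring_1) op)"
proof -
  assume "dalg e"
  then interpret dalg e .
  interpret o: calg "\<lambda>c. scal (e c) :: ('n, 'r) op" by (rule calg_scal) (rule calg_axioms)
  show ?thesis
  proof
    fix c and r :: "('n, 'r) op"
    assume *: "scal (e c) * r = 0"
    have "e c * ent r x y = 0" for x y
      using arg_cong[OF *, of "\<lambda>r. ent r x y"] by (simp add: ent_scal_mult ent_zero)
    then have "c = 0 \<or> ent r x y = 0" for x y by (intro torsion_free)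
    then show "c = 0 \<or> r = 0" by (cases "c = 0") (auto intro!: op_eqI simp: ent_zero)
  next
    fix r :: "('n, 'r) op"
    assume *: "\<And>n. \<exists>s. r = scal (e (fps_X ^ n)) * s"
    have "ent r x y = 0" for x y
    proof (rule separated)
      fix n
      obtain s where "r = scal (e (fps_X ^ n)) * s" using * by blast
      then have "ent r x y = e (fps_X ^ n) * ent s x y" by (simp add: ent_scal_mult)
      then show "\<exists>s. ent r x y = e (fps_X ^ n) * s" ..
    qed
    then show "r = 0" by (intro op_eqI) (simp add: ent_zero)
  qed
qed

definition map_op :: "('a \<Rightarrow> 'b) \<Rightarrow> ('n::finite, 'a::ring_1) op \<Rightarrow> ('n, 'b::ring_1) op" where
  "map_op f A = Op (\<lambda>x y. f (ent A x y))"

locale rhom =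
  fixes f :: "'a::ring_1 \<Rightarrow> 'b::ring_1"
  assumes add: "f (x + y) = f x + f y" and mult: "f (x * y) = f x * f y" and one: "f 1 = 1"
begin

lemma zero: "f 0 = 0" using add[of 0 0] by simp

lemma diff: "f (x - y) = f x - f y"
  using add[of "x - y" y] by (simp add: algebra_simps)

lemma sum: "f (\<Sum>i\<in>A. g i) = (\<Sum>i\<in>A. f (g i))"
  by (induction A rule: infinite_finite_induct) (simp_all add: zero add)

lemma ent_map: "ent (map_op f A) x y = f (ent A x y)"
  by (simp add: map_op_def ent_Op ent_length zero)

lemma map_add: "map_op f (A + B) = map_op f A + map_op f B"
  and map_mult: "map_op f (A * B) = map_op f A * map_op f B"
  and map_one: "map_op f 1 = 1" and map_diff: "map_op f (A - B) = map_op f A - map_op f B"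
  and map_scal: "map_op f (scal c) = scal (f c)"
  by (rule op_eqI; simp add: ent_map ent_add ent_diff ent_mult ent_one ent_scal add diff mult sum one zero)+

end

lemma (in calg) rhom: "rhom e"
  by standard (simp_all add: e_add e_mult e_one)

section \<open>The Hecke action on tensor powers\<close>

definition swp :: "nat \<Rightarrow> 'n list \<Rightarrow> 'n list" where
  "swp k x = x[k := x ! Suc k, Suc k := x ! k]"

lemma length_swp: "length (swp k x) = length x"
  by (simp add: swp_def)

lemma swp_swp: "Suc k < length x \<Longrightarrow> swp k (swp k x) = x"
  by (rule nth_equalityI) (auto simp: swp_def nth_list_update)

lemma nth_swp: "Suc k < length x \<Longrightarrow> i < length x \<Longrightarrow>
    swp k x ! i = (if i = k then x ! Suc k else if i = Suc k then x ! k else x ! i)"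
  by (auto simp: swp_def nth_list_update)

lemma swp_append: "swp (length us) (us @ a # b # vs) = us @ b # a # vs"
  and swp_append_Suc: "swp (Suc (length us)) (us @ a # b # c # vs) = us @ a # c # b # vs"
  by (rule nth_equalityI; auto simp: swp_def nth_append nth_list_update nth_Cons split: nat.splits)+

lemma swp_far: "Suc k < l \<Longrightarrow> Suc l < length x \<Longrightarrow> swp k (swp l x) = swp l (swp k x)"
  by (rule nth_equalityI) (auto simp: swp_def nth_list_update)

lemma swp_neq: "Suc k < length x \<Longrightarrow> x ! k \<noteq> x ! Suc k \<Longrightarrow> swp k x \<noteq> x"
  by (metis Suc_lessD nth_swp)

text \<open>The flip composed with the R-matrix at parameter 0, rescaled by \<open>q\<close>. On
  lists of other lengths it is the scalar \<open>q\<close>, a root of the quadratic relation, so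
  that the Hecke relations hold in the whole ring of block matrices.\<close>

definition hecke_op :: "nat \<Rightarrow> 'p \<Rightarrow> 'p \<Rightarrow> nat \<Rightarrow> ('n::{finite,linorder}, 'p::comm_ring_1) op" where
  "hecke_op M q qi k = Op (\<lambda>x y.
     if length x = M then
       if x ! k = x ! Suc k then (if y = x then q else 0)
       else if y = swp k x then 1 else if y = x \<and> x ! Suc k < x ! k then q - qi else 0
     else if x = y then q else 0)"

text \<open>Lets multiplication by a generator from the right be computed like multiplication from
  the left.\<close>

lemma ent_hecke_op_sym:
  assumes "Suc k < M"
  shows "ent (hecke_op M q qi k) x y = ent (hecke_op M q qi k) y x"
proof -
  consider "length x \<noteq> length y" | "length x = length y" "length x \<noteq> M" | "length x = M" "x = y"
    | "length x = M" "length y = M" "x \<noteq> y" "y = swp k x" | "length x = M" "length y = M" "x \<noteq> y" "y \<noteq> swp k x"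
    by metis
  then show ?thesis
  proof cases
    case 4
    show ?thesis unfolding 4(4) hecke_op_def ent_Op
      using 4(1,3)[unfolded 4(4)] assms by (auto simp: swp_swp nth_swp length_swp)
  next
    case 5
    then have "x \<noteq> swp k y" using assms swp_swp[of k y] by auto
    with 5 show ?thesis unfolding hecke_op_def ent_Op by auto
  qed (auto simp: hecke_op_def ent_Op)
qed

lemma ent_hecke_mult:
  fixes X :: "('n::{finite,linorder}, 'r::ring_1) op" and q qi :: "'p::comm_ring_1"
  assumes "calg e" "Suc k < M"
  shows "ent (map_op e (hecke_op M q qi k) * X) x y =
    (if length x = M then
       if x ! k = x ! Suc k then e q * ent X x y
       else ent X (swp k x) y + (if x ! Suc k < x ! k then e (q - qi) * ent X x y else 0)
     else e q * ent X x y)"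
proof -
  interpret calg e by fact
  interpret r: rhom e by (rule rhom)
  have *: "e (ent (hecke_op M q qi k) x z) * ent X z y =
    (if length x = M then
       if x ! k = x ! Suc k then (if z = x then e q * ent X z y else 0)
       else (if z = swp k x then ent X z y else 0) + (if z = x then (if x ! Suc k < x ! k then e (q - qi) else 0) * ent X z y else 0)
     else (if z = x then e q * ent X z y else 0))" if "length z = length x" for z
    using that assms swp_neq[of k x] by (auto simp: hecke_op_def ent_Op e_zero e_one)
  have "ent (map_op e (hecke_op M q qi k) * X) x y =
    (\<Sum>z | length z = length x. if length x = M then
       if x ! k = x ! Suc k then (if z = x then e q * ent X z y else 0)
       else (if z = swp k x then ent X z y else 0) + (if z = x then (if x ! Suc k < x ! k then e (q - qi) else 0) * ent X z y else 0)
     else (if z = x then e q * ent X z y else 0))"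
    unfolding ent_mult r.ent_map by (rule sum.cong) (use * in auto)
  then show ?thesis
    by (auto simp: sum.distrib sum_lists_delta length_swp)
qed

lemma ent_mult_hecke:
  fixes X :: "('n::{finite,linorder}, 'r::ring_1) op" and q qi :: "'p::comm_ring_1"
  assumes "calg e" "Suc k < M"
  shows "ent (X * map_op e (hecke_op M q qi k)) x y =
    (if length y = M then
       if y ! k = y ! Suc k then e q * ent X x y
       else ent X x (swp k y) + (if y ! Suc k < y ! k then e (q - qi) * ent X x y else 0)
     else e q * ent X x y)"
proof (cases "length x = length y")
  case False
  then show ?thesis by (simp add: ent_length length_swp)
next
  case True
  interpret calg e by fact
  interpret r: rhom e by (rule rhom)
  have *: "ent X x z * e (ent (hecke_op M q qi k) z y) =
    (if length y = M then
       if y ! k = y ! Suc k then (if z = y then e q * ent X x z else 0)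
       else (if z = swp k y then ent X x z else 0) + (if z = y then (if y ! Suc k < y ! k then e (q - qi) else 0) * ent X x z else 0)
     else (if z = y then e q * ent X x z else 0))" if "length z = length y" for z
    using that assms swp_neq[of k y] unfolding ent_hecke_op_sym[OF assms(2), of _ _ z]
    by (auto simp: hecke_op_def ent_Op e_zero e_one e_central[of "ent _ _ _"])
  have "ent (X * map_op e (hecke_op M q qi k)) x y =
    (\<Sum>z | length z = length y. if length y = M then
       if y ! k = y ! Suc k then (if z = y then e q * ent X x z else 0)
       else (if z = swp k y then ent X x z else 0) + (if z = y then (if y ! Suc k < y ! k then e (q - qi) else 0) * ent X x z else 0)
     else (if z = y then e q * ent X x z else 0))"
    unfolding ent_mult r.ent_map True by (rule sum.cong) (use * in auto)
  then show ?thesis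
    by (auto simp: sum.distrib sum_lists_delta length_swp)
qed

lemma calg_self: "calg (\<lambda>x :: 'p::comm_ring_1. x)"
  by standard (simp_all add: mult.commute)

lemma map_op_self: "map_op (\<lambda>x. x) A = A"
  by (rule op_eqI) (simp add: map_op_def ent_Op)

lemmas ent_hecke_mult_self = ent_hecke_mult[OF calg_self, unfolded map_op_self]

definition hecke_inv :: "nat \<Rightarrow> 'p \<Rightarrow> 'p \<Rightarrow> nat \<Rightarrow> ('n::{finite,linorder}, 'p::comm_ring_1) op" where
  "hecke_inv M q qi k = hecke_op M q qi k - scal (q - qi)"

lemma hecke_op_square:
  fixes q qi :: "'p::comm_ring_1"
  assumes "Suc k < M" "q * qi = 1"
  shows "hecke_op M q qi k * hecke_op M q qi k = 1 + scal (q - qi) * (hecke_op M q qi k :: ('n::{finite,linorder}, 'p) op)"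
proof -
  let ?T = "hecke_op M q qi k :: ('n, 'p) op"
  have [simp]: "q * (qi * r) = r" for r using assms(2) by (simp flip: mult.assoc)
  have "?T * (?T * X) = X + scal (q - qi) * (?T * X)" for X :: "('n, 'p) op"
    using assms(1) by (intro op_eqI)
      (auto simp: ent_hecke_mult_self ent_add ent_scal_mult length_swp nth_swp swp_swp algebra_simps)
  from this[of 1] show ?thesis by simp
qed

lemma hecke_op_hecke:
  fixes q qi :: "'p::comm_ring_1"
  assumes "q * qi = 1"
  shows "hecke scal q qi (hecke_op M q qi :: nat \<Rightarrow> ('n::{finite,linorder}, 'p) op) (hecke_inv M q qi) M"
proof -
  interpret calg "\<lambda>c :: 'p. scal c :: ('n, 'p) op" by (rule calg_scal[OF calg_self])
  show ?thesis
  proof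
    fix k assume k: "Suc k < M"
    let ?T = "hecke_op M q qi k :: ('n, 'p) op"
    have "?T * ?T = 1 + scal (q - qi) * ?T" by (rule hecke_op_square[OF k assms])
    then show "?T * hecke_inv M q qi k = 1" "hecke_inv M q qi k * ?T = 1"
      using e_central[of ?T "q - qi"]
      by (simp_all add: hecke_inv_def left_diff_distrib right_diff_distrib)
  next
    fix k assume k: "Suc (Suc k) < M"
    let ?A = "hecke_op M q qi k :: ('n, 'p) op" and ?B = "hecke_op M q qi (Suc k) :: ('n, 'p) op"
    have "?A * (?B * (?A * X)) = ?B * (?A * (?B * X))" for X
    proof (rule op_eqI)
      fix x y :: "'n list"
      show "ent (?A * (?B * (?A * X))) x y = ent (?B * (?A * (?B * X))) x y"
      proof (cases "length x = M")
        case True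
        define us vs where "us = take k x" and "vs = drop (Suc (Suc (Suc k))) x"
        have x: "x = us @ x ! k # x ! Suc k # x ! Suc (Suc k) # vs"
          using k True by (simp add: us_def vs_def Cons_nth_drop_Suc)
        have len: "length us = k" "Suc (Suc (Suc (length us + length vs))) = M"
          using k True by (simp_all add: us_def vs_def)
        obtain a b c where x: "x = us @ a # b # c # vs" using x by metis
        have A: "ent (?A * Y) (us @ a # b # c # vs) y = (if a = b then q * ent Y (us @ a # b # c # vs) y
            else ent Y (us @ b # a # c # vs) y + (if b < a then (q - qi) * ent Y (us @ a # b # c # vs) y else 0))"
          for Y :: "('n, 'p) op" and a b c
          using k len(2) unfolding len(1)[symmetric] by (simp add: ent_hecke_mult_self nth_append swp_append)
        have B: "ent (?B * Y) (us @ a # b # c # vs) y = (if b = c then q * ent Y (us @ a # b # c # vs) y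
            else ent Y (us @ a # c # b # vs) y + (if c < b then (q - qi) * ent Y (us @ a # b # c # vs) y else 0))"
          for Y :: "('n, 'p) op" and a b c
          using k len(2) unfolding len(1)[symmetric] by (simp add: ent_hecke_mult_self nth_append swp_append_Suc)
        define h where "h = q - qi"
        have hq: "q * (q * r) = r + h * (q * r)" for r
          using assms by (simp add: h_def left_diff_distrib flip: mult.assoc) (simp add: mult.commute)
        note o = less_imp_neq less_imp_neq[symmetric] less_imp_not_less
        \<comment> \<open>Only the three letters at the sites \<open>k\<close>,
          \<open>k + 1\<close>, \<open>k + 2\<close> matter, so the braid relation is checked for
          every relative order of \<open>a\<close>, \<open>b\<close>, \<open>c\<close>.\<close>
        show ?thesis unfolding x
          by (cases a b rule: linorder_cases; cases b c rule: linorder_cases; cases a c rule: linorder_cases;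
              (order | auto simp: A B hq o algebra_simps dest: less_asym simp flip: h_def))
      qed (use k in \<open>simp add: ent_hecke_mult_self length_swp\<close>)
    qed
    from this[of 1] show "?A * ?B * ?A = ?B * ?A * ?B" by (simp add: mult.assoc)
  next
    fix k l assume kl: "Suc k < l" "Suc l < M"
    have "hecke_op M q qi k * (hecke_op M q qi l * X) = hecke_op M q qi l * (hecke_op M q qi k * X)"
      for X :: "('n, 'p) op"
    proof (rule op_eqI)
      fix x y :: "'n list"
      have "length x = M \<Longrightarrow> swp l (swp k x) = swp k (swp l x)" using kl by (intro swp_far[symmetric]) auto
      then show "ent (hecke_op M q qi k * (hecke_op M q qi l * X)) x y = ent (hecke_op M q qi l * (hecke_op M q qi k * X)) x y"
        using kl by (cases "length x = M") (auto simp: ent_hecke_mult_self length_swp nth_swp algebra_simps)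
    qed
    from this[of 1] show "hecke_op M q qi k * hecke_op M q qi l = (hecke_op M q qi l * hecke_op M q qi k :: ('n, 'p) op)"
      by simp
  qed (simp_all add: assms hecke_inv_def)
qed

lemma hecke_map:
  assumes "hecke e q qi T Ti M" "rhom f" "calg e'" "\<And>c. f (e c) = e' c"
  shows "hecke e' q qi (\<lambda>k. f (T k)) (\<lambda>k. f (Ti k)) M"
proof -
  interpret hecke e q qi T Ti M by fact
  interpret f: rhom f by fact
  interpret e': calg e' by fact
  show ?thesis
  proof
    show "f (T k) * f (Ti k) = 1" "f (Ti k) * f (T k) = 1" if "Suc k < M" for k
      using T_Ti[OF that] Ti_T[OF that] by (simp_all add: f.one flip: f.mult)
    show "f (Ti k) = f (T k) - e' (q - qi)" if "Suc k < M" for k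
      using Ti_eq[OF that] assms(4) by (simp add: f.diff)
    show "f (T k) * f (T (Suc k)) * f (T k) = f (T (Suc k)) * f (T k) * f (T (Suc k))" if "Suc (Suc k) < M" for k
      using braid[OF that] by (simp flip: f.mult)
    show "f (T k) * f (T l) = f (T l) * f (T k)" if "Suc k < l" "Suc l < M" for k l
      using T_far[OF that] by (simp flip: f.mult)
  qed (rule q_qi)
qed

section \<open>Operators acting in one tensor factor\<close>

definition agree :: "nat \<Rightarrow> 'n list \<Rightarrow> 'n list \<Rightarrow> bool" where
  "agree k x y \<longleftrightarrow> (\<forall>j<length x. j \<noteq> k \<longrightarrow> x ! j = y ! j)"

definition lop :: "nat \<Rightarrow> nat \<Rightarrow> ('n \<Rightarrow> 'n \<Rightarrow> 'a::ring_1) \<Rightarrow> ('n::finite, 'a) op" where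
  "lop M k l = Op (\<lambda>x y. if length x = M then if agree k x y then l (x ! k) (y ! k) else 0
     else if x = y then 1 else 0)"

lemma ent_lop: "ent (lop M k l) x y = (if length x = length y then if length x = M then
    if agree k x y then l (x ! k) (y ! k) else 0 else if x = y then 1 else 0 else 0)"
  by (simp add: lop_def ent_Op)

lemma agree_update:
  assumes k: "k < length x"
  shows "{z. length z = length x \<and> agree k x z} = (\<lambda>c. x[k := c]) ` UNIV"
proof (intro set_eqI iffI)
  fix z assume "z \<in> {z. length z = length x \<and> agree k x z}"
  then have "z = x[k := z ! k]"
    using k by (intro nth_equalityI) (auto simp: agree_def nth_list_update)
  then show "z \<in> (\<lambda>c. x[k := c]) ` UNIV" by blast
qed (auto simp: agree_def)

lemma ent_lop_mult:
  assumes "k < M"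
  shows "ent (lop M k l * X) x y = (if length x = M then \<Sum>c\<in>UNIV. l (x ! k) c * ent X (x[k := c]) y else ent X x y)"
proof (cases "length x = M")
  case True
  have "ent (lop M k l * X) x y
      = (\<Sum>z | length z = length x. if agree k x z then l (x ! k) (z ! k) * ent X z y else 0)"
    unfolding ent_mult by (rule sum.cong) (auto simp: ent_lop True)
  also have "\<dots> = (\<Sum>z | length z = length x \<and> agree k x z. l (x ! k) (z ! k) * ent X z y)"
    by (simp add: sum.If_cases finite_lists Int_def)
  also have "\<dots> = (\<Sum>c\<in>UNIV. l (x ! k) c * ent X (x[k := c]) y)"
  proof -
    have "inj (\<lambda>c. x[k := c])"
      using assms True by (intro injI) (metis nth_list_update_eq)
    then show ?thesis using agree_update[of k x] assms True by (simp add: sum.reindex)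
  qed
  finally show ?thesis using True by simp
next
  case False
  then have "ent (lop M k l * X) x y = (\<Sum>z | length z = length x. if z = x then ent X z y else 0)"
    unfolding ent_mult by (intro sum.cong) (auto simp: ent_lop)
  then show ?thesis using False by (simp add: sum_lists_delta)
qed

lemma agree_commute: "length x = length y \<Longrightarrow> agree k x y = agree k y x"
  by (auto simp: agree_def)

lemma agree_swp:
  assumes "Suc k < length x" "length y = length x" "j \<noteq> k" "j \<noteq> Suc k"
  shows "agree j (swp k x) y \<longleftrightarrow> agree j x (swp k y)"
proof -
  have "agree j (swp k x) y" if "agree j x (swp k y)" "length y = length x" "Suc k < length x" for x y :: "'a list"
    unfolding agree_def
  proof (intro allI impI)
    fix i assume "i < length (swp k x)" "i \<noteq> j"
    moreover have "x ! k = swp k y ! k \<and> x ! Suc k = swp k y ! Suc k"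
      using that assms(3,4) by (auto simp: agree_def)
    moreover have "x ! i = swp k y ! i" if "i < length x" "i \<noteq> j"
      using that \<open>agree j x (swp k y)\<close> by (simp add: agree_def)
    ultimately show "swp k x ! i = y ! i"
      using that by (simp add: nth_swp length_swp split: if_splits)
  qed
  note * = this
  show ?thesis
  proof
    assume "agree j (swp k x) y"
    then have "agree j y (swp k x)" by (rule agree_commute[THEN iffD1, rotated]) (simp add: length_swp assms)
    then have "agree j (swp k y) x" by (rule *) (use assms in auto)
    then show "agree j x (swp k y)" by (rule agree_commute[THEN iffD1, rotated]) (simp add: length_swp assms)
  qed (use * assms in blast)
qed

lemma hecke_lop_commute:
  fixes l :: "'n::{finite,linorder} \<Rightarrow> 'n \<Rightarrow> 'r::ring_1"
  assumes "calg e" "Suc k < M" "j < M" "j \<noteq> k" "j \<noteq> Suc k"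
  shows "map_op e (hecke_op M q qi k) * lop M j l = lop M j l * map_op e (hecke_op M q qi k)"
proof (rule op_eqI)
  fix x y :: "'n list" assume len: "length x = length y"
  show "ent (map_op e (hecke_op M q qi k) * lop M j l) x y = ent (lop M j l * map_op e (hecke_op M q qi k)) x y"
  proof (cases "length x = M")
    case True
    have j: "swp k z ! j = z ! j" if "length z = M" for z :: "'n list" using assms that by (simp add: nth_swp)
    have ag: "agree j (swp k x) y \<longleftrightarrow> agree j x (swp k y)" using assms len True by (intro agree_swp) auto
    have 1: "x ! k = y ! k \<and> x ! Suc k = y ! Suc k" if "agree j x y"
      using that assms True by (auto simp: agree_def)
    have 2: "x ! k = y ! Suc k \<and> x ! Suc k = y ! k" if "agree j x (swp k y)"
      using that assms True len by (auto simp: agree_def nth_swp)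
    show ?thesis
      unfolding ent_hecke_mult[OF assms(1,2)] ent_mult_hecke[OF assms(1,2)] ent_lop
      using True len 1 2 by (auto simp: length_swp ag j)
  qed (use assms len in \<open>auto simp: ent_hecke_mult ent_mult_hecke ent_lop\<close>)
qed

text \<open>The entries of \<open>R(u, v) L\<^sub>1(u) L\<^sub>2(v) = L\<^sub>1(v) L\<^sub>2(u) R(u, v)\<close>.\<close>

definition rll_family :: "('p::comm_ring_1 \<Rightarrow> 'r::ring_1) \<Rightarrow> 'p \<Rightarrow> 'p \<Rightarrow> ('p \<Rightarrow> 'n::linorder \<Rightarrow> 'n \<Rightarrow> 'r) \<Rightarrow> bool" where
  "rll_family e q qi l \<longleftrightarrow> (\<forall>u v i j c d.
     (if i = j then e (u * q - v * qi) * (l u i c * l v i d)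
      else e (u - v) * (l u j c * l v i d) + e ((q - qi) * (if j < i then u else v)) * (l u i c * l v j d))
   = (if c = d then e (u * q - v * qi) * (l v i c * l u j c)
      else e (u - v) * (l v i d * l u j c) + e ((q - qi) * (if d < c then u else v)) * (l v i c * l u j d)))"

lemma ent_lop_lop:
  assumes "Suc k < M" "length x = M" "length y = M"
  shows "ent (lop M k A * lop M (Suc k) B) x y =
    (if \<forall>j<M. j \<noteq> k \<and> j \<noteq> Suc k \<longrightarrow> x ! j = y ! j then A (x ! k) (y ! k) * B (x ! Suc k) (y ! Suc k) else 0)"
proof -
  have "agree (Suc k) (x[k := c]) y \<longleftrightarrow> c = y ! k \<and> (\<forall>j<M. j \<noteq> k \<and> j \<noteq> Suc k \<longrightarrow> x ! j = y ! j)" for c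
    using assms by (auto simp: agree_def nth_list_update dest: spec[of _ k])
  note ag = this
  have "ent (lop M k A * lop M (Suc k) B) x y = (\<Sum>c\<in>UNIV. A (x ! k) c * ent (lop M (Suc k) B) (x[k := c]) y)"
    using assms by (simp add: ent_lop_mult)
  also have "\<dots> = (\<Sum>c\<in>UNIV. if c = y ! k then
      (if \<forall>j<M. j \<noteq> k \<and> j \<noteq> Suc k \<longrightarrow> x ! j = y ! j then A (x ! k) c * B (x ! Suc k) (y ! Suc k) else 0) else 0)"
    by (rule sum.cong) (use assms in \<open>auto simp: ent_lop ag\<close>)
  finally show ?thesis by simp
qed

locale op_hecke = calg e for e :: "'p::comm_ring_1 \<Rightarrow> 'r::ring_1" +
  fixes q qi :: 'p and M :: nat and N_type :: "'n::{finite,linorder} itself"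
  assumes q_qi: "q * qi = 1"
begin

abbreviation T :: "nat \<Rightarrow> ('n, 'r) op" where "T k \<equiv> map_op e (hecke_op M q qi k)"
abbreviation Ti :: "nat \<Rightarrow> ('n, 'r) op" where "Ti k \<equiv> map_op e (hecke_inv M q qi k)"

interpretation r: rhom e by (rule rhom)

lemma map_op_rhom: "rhom (map_op e)"
  by standard (simp_all add: r.map_add r.map_mult r.map_one)

sublocale H: hecke "\<lambda>c. scal (e c) :: ('n, 'r) op" q qi T Ti M
  using hecke_map[OF hecke_op_hecke[OF q_qi] map_op_rhom calg_scal[OF calg_axioms]] r.map_scal by blast

lemma ee: "e c * (e d * r) = e (c * d) * r"
  by (simp add: e_mult mult.assoc)

lemma RR_expand:
  assumes "Suc k < M"
  shows "H.RR k u v = scal (e u) * T k - scal (e v) * T k + scal (e (v * (q - qi))) * 1"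
  unfolding H.RR_def H.Ti_eq[OF assms(1)] H.sm_def H.e_mult[of v "q - qi"]
  by (simp add: right_diff_distrib)

lemma RR_mult:
  assumes "Suc k < M" "length x = M"
  shows "ent (H.RR k u v * X) x y = (if x ! k = x ! Suc k then e (u * q - v * qi) * ent X x y
     else e (u - v) * ent X (swp k x) y + e ((q - qi) * (if x ! Suc k < x ! k then u else v)) * ent X x y)"
proof -
  have *: "H.RR k u v * X = scal (e u) * (T k * X) - scal (e v) * (T k * X) + scal (e (v * (q - qi))) * X"
    unfolding RR_expand[OF assms(1)] by (simp add: distrib_right left_diff_distrib mult.assoc)
  show ?thesis
    unfolding *
    using assms by (auto simp: ent_add ent_diff ent_scal_mult ent_hecke_mult[OF calg_axioms] e_add e_diff ee algebra_simps)
qed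

lemma mult_RR:
  assumes "Suc k < M" "length y = M"
  shows "ent (X * H.RR k u v) x y = (if y ! k = y ! Suc k then e (u * q - v * qi) * ent X x y
     else e (u - v) * ent X x (swp k y) + e ((q - qi) * (if y ! Suc k < y ! k then u else v)) * ent X x y)"
proof -
  have *: "X * H.RR k u v = scal (e u) * (X * T k) - scal (e v) * (X * T k) + scal (e (v * (q - qi))) * X"
    unfolding RR_expand[OF assms(1)]
    by (simp only: distrib_left right_diff_distrib[of X] H.sm_mult_right[unfolded H.sm_def]) simp
  show ?thesis
    unfolding *
    using assms by (auto simp: ent_add ent_diff ent_scal_mult ent_mult_hecke[OF calg_axioms] e_add e_diff ee algebra_simps)
qed

lemma RR_other_length:
  assumes "Suc k < M" "length x \<noteq> M"
  shows "ent (H.RR k u v * X) x y = ent (X * H.RR k u v) x y"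
proof -
  have 1: "H.RR k u v * X = scal (e u) * (T k * X) - scal (e v) * (T k * X) + scal (e (v * (q - qi))) * X"
    unfolding RR_expand[OF assms(1)] by (simp add: distrib_right left_diff_distrib mult.assoc)
  have 2: "X * H.RR k u v = scal (e u) * (X * T k) - scal (e v) * (X * T k) + scal (e (v * (q - qi))) * X"
    unfolding RR_expand[OF assms(1)]
    by (simp only: distrib_left right_diff_distrib[of X] H.sm_mult_right[unfolded H.sm_def]) simp
  show ?thesis unfolding 1 2 using assms
    by (cases "length x = length y")
      (simp_all add: ent_add ent_diff ent_scal_mult ent_mult_hecke[OF calg_axioms] ent_hecke_mult[OF calg_axioms] ent_length)
qed

text \<open>Read off entrywise: the letters at all other sites must agree on both sides, and the
  letters at \<open>k\<close> and \<open>k + 1\<close> reproduce the entries listed in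
  \<open>rll_family\<close>.\<close>

lemma lop_RR_swap:
  assumes "rll_family e q qi l" "Suc k < M"
  shows "lop M k (l v) * lop M (Suc k) (l u) * H.RR k u v = H.RR k u v * (lop M k (l u) * lop M (Suc k) (l v))"
proof (rule op_eqI)
  fix x y :: "'n list" assume len: "length x = length y"
  let ?L = "\<lambda>u v. lop M k (l u) * lop M (Suc k) (l v)"
  show "ent (?L v u * H.RR k u v) x y = ent (H.RR k u v * ?L u v) x y"
  proof (cases "length x = M")
    case True
    then have True': "length y = M" using len by simp
    let ?P = "\<forall>j<M. j \<noteq> k \<and> j \<noteq> Suc k \<longrightarrow> x ! j = y ! j"
    have P: "(\<forall>j<M. j \<noteq> k \<and> j \<noteq> Suc k \<longrightarrow> x ! j = swp k y ! j) \<longleftrightarrow> ?P"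
      "(\<forall>j<M. j \<noteq> k \<and> j \<noteq> Suc k \<longrightarrow> swp k x ! j = y ! j) \<longleftrightarrow> ?P"
      using assms(2) True True' by (auto simp: nth_swp)
    have rll: "(if i = j then e (u * q - v * qi) * (l u i c * l v i d)
        else e (u - v) * (l u j c * l v i d) + e ((q - qi) * (if j < i then u else v)) * (l u i c * l v j d))
     = (if c = d then e (u * q - v * qi) * (l v i c * l u j c)
        else e (u - v) * (l v i d * l u j c) + e ((q - qi) * (if d < c then u else v)) * (l v i c * l u j d))"
      for i j c d using assms(1) unfolding rll_family_def by blast
    have s: "k < M" "Suc k < M" using assms(2) by simp_all
    define P where "P = ?P"
    have L1: "ent (?L u v) x y = (if P then l u (x ! k) (y ! k) * l v (x ! Suc k) (y ! Suc k) else 0)" for u v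
      using s True True' by (simp only: ent_lop_lop P_def)
    have L2: "ent (?L u v) x (swp k y) = (if P then l u (x ! k) (y ! Suc k) * l v (x ! Suc k) (y ! k) else 0)" for u v
      using s True True' by (simp only: ent_lop_lop length_swp P P_def) (auto simp: nth_swp)
    have L3: "ent (?L u v) (swp k x) y = (if P then l u (x ! Suc k) (y ! k) * l v (x ! k) (y ! Suc k) else 0)" for u v
      using s True True' by (simp only: ent_lop_lop length_swp P P_def) (auto simp: nth_swp)
    show ?thesis
      unfolding RR_mult[OF assms(2) True] mult_RR[OF assms(2) True']
      using rll[of "x ! k" "x ! Suc k" "y ! k" "y ! Suc k"] s True True'
      unfolding L1 L2 L3
      by (cases P; cases "x ! k = x ! Suc k"; cases "y ! k = y ! Suc k") simp_all
  next
    case False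
    have L: "ent (?L u' v' * Y) x y = ent Y x y" for u' v' Y
      using False by (simp add: mult.assoc ent_lop_mult assms(2) Suc_lessD[OF assms(2)])
    have "ent (H.RR k u v * ?L u v) x y = ent (H.RR k u v) x y"
      using RR_other_length[OF assms(2) False] L by simp
    then show ?thesis using L by simp
  qed
qed

primrec lprod :: "('p \<Rightarrow> 'n \<Rightarrow> 'n \<Rightarrow> 'r) \<Rightarrow> nat \<Rightarrow> 'p list \<Rightarrow> ('n, 'r) op" where
  "lprod l j [] = 1"
| "lprod l j (b # bs) = lop M j (l b) * lprod l (Suc j) bs"

lemma lprod_append: "lprod l j (xs @ ys) = lprod l j xs * lprod l (j + length xs) ys"
  by (induction xs arbitrary: j) (simp_all add: mult.assoc)

lemma RR_lprod_commute:
  assumes "Suc k < M" "Suc k < j \<or> j + length bs \<le> k" "j + length bs \<le> M"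
  shows "H.RR k u v * lprod l j bs = lprod l j bs * H.RR k u v"
  using assms(2,3)
proof (induction bs arbitrary: j)
  case (Cons b bs)
  have "lop M j (l b) * H.RR k u v = H.RR k u v * lop M j (l b)"
    using assms(1) Cons.prems by (intro H.RR_commute hecke_lop_commute[OF calg_axioms, symmetric]) auto
  moreover have "H.RR k u v * lprod l (Suc j) bs = lprod l (Suc j) bs * H.RR k u v"
    using Cons.prems by (intro Cons.IH) auto
  ultimately show ?case unfolding lprod.simps by (intro commute_mult) simp_all
qed simp

theorem lprod_swap_system:
  assumes "rll_family e q qi l"
  shows "swap_system H.RR H.RR M (lprod l 0)"
  unfolding swap_system_def
proof (intro allI impI)
  fix xs ys :: "'p list" and a b
  assume len: "length xs + length ys + 2 = M"
  let ?k = "length xs"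
  let ?P = "lprod l 0 xs" and ?Q = "lprod l (Suc (Suc ?k)) ys"
  have P: "?P * H.RR ?k a b = H.RR ?k a b * ?P" "?Q * H.RR ?k a b = H.RR ?k a b * ?Q"
    using len by (intro RR_lprod_commute[symmetric]; simp)+
  have "lprod l 0 (xs @ b # a # ys) * H.RR ?k a b
      = ?P * (lop M ?k (l b) * lop M (Suc ?k) (l a)) * (?Q * H.RR ?k a b)"
    by (simp add: lprod_append mult.assoc)
  also have "\<dots> = ?P * (lop M ?k (l b) * lop M (Suc ?k) (l a) * H.RR ?k a b) * ?Q"
    unfolding P by (simp add: mult.assoc)
  also have "\<dots> = (?P * H.RR ?k a b) * (lop M ?k (l a) * lop M (Suc ?k) (l b)) * ?Q"
    using len by (subst lop_RR_swap[OF assms]) (simp_all add: mult.assoc)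
  also have "\<dots> = H.RR ?k a b * lprod l 0 (xs @ a # b # ys)"
    unfolding P by (simp add: lprod_append mult.assoc)
  finally show "lprod l 0 (xs @ b # a # ys) * H.RR ?k a b = H.RR ?k a b * lprod l 0 (xs @ a # b # ys)" .
qed

end

section \<open>Products of tensor powers and the trace\<close>

text \<open>Action on the first \<open>m\<close> of \<open>m + n\<close> factors. On other lengths
  the scalar is the entry of \<open>X\<close> at the empty list: this keeps the map a unital ring
  homomorphism, and it sends \<open>q\<close>, the value of a generator off its own length, to the
  same value on the larger tensor power.\<close>

definition amp1 :: "nat \<Rightarrow> nat \<Rightarrow> ('n::finite, 'a::ring_1) op \<Rightarrow> ('n, 'a) op" where
  "amp1 m n X = Op (\<lambda>x y. if length x = m + n
     then if drop m x = drop m y then ent X (take m x) (take m y) else 0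
     else if x = y then ent X [] [] else 0)"

definition amp2 :: "nat \<Rightarrow> nat \<Rightarrow> ('n::finite, 'a::ring_1) op \<Rightarrow> ('n, 'a) op" where
  "amp2 m n X = Op (\<lambda>x y. if length x = m + n
     then if take m x = take m y then ent X (drop m x) (drop m y) else 0
     else if x = y then ent X [] [] else 0)"

lemma sum_lists_append:
  "(\<Sum>z :: 'n::finite list | length z = m + n. f z) = (\<Sum>x | length x = m. \<Sum>y | length y = n. f (x @ y))"
proof -
  have "(\<Sum>z :: 'n list | length z = m + n. f z)
      = sum f ((\<lambda>(x, y). x @ y) ` ({x. length x = m} \<times> {y. length y = n}))"
  proof (rule sum.cong)
    have "z \<in> (\<lambda>(x, y). x @ y) ` ({x. length x = m} \<times> {y. length y = n})" if "length z = m + n" for z :: "'n list"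
      using that by (intro image_eqI[of _ _ "(take m z, drop m z)"]) auto
    then show "{z :: 'n list. length z = m + n} = (\<lambda>(x, y). x @ y) ` ({x. length x = m} \<times> {y. length y = n})"
      by auto
  qed simp
  also have "\<dots> = (\<Sum>(x, y)\<in>{x. length x = m} \<times> {y. length y = n}. f (x @ y))"
    by (subst sum.reindex) (auto simp: inj_on_def intro!: sum.cong)
  finally show ?thesis by (simp add: sum.cartesian_product)
qed

lemma ent_amp1_append:
  "length x = m \<Longrightarrow> length y = n \<Longrightarrow> length x' = m \<Longrightarrow> length y' = n \<Longrightarrow>
    ent (amp1 m n X) (x @ y) (x' @ y') = (if y = y' then ent X x x' else 0)"
  by (simp add: amp1_def ent_Op)

lemma ent_amp2_append:
  "length x = m \<Longrightarrow> length y = n \<Longrightarrow> length x' = m \<Longrightarrow> length y' = n \<Longrightarrow>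
    ent (amp2 m n X) (x @ y) (x' @ y') = (if x = x' then ent X y y' else 0)"
  by (simp add: amp2_def ent_Op)

lemma ent_amp_other:
  "length x \<noteq> m + n \<Longrightarrow> ent (amp1 m n X) x y = (if x = y then ent X [] [] else 0)"
  "length x \<noteq> m + n \<Longrightarrow> ent (amp2 m n X) x y = (if x = y then ent X [] [] else 0)"
  by (auto simp: amp1_def amp2_def ent_Op)

lemma op_eq_appendI:
  assumes "\<And>x y x' y'. length x = m \<Longrightarrow> length y = n \<Longrightarrow> length x' = m \<Longrightarrow> length y' = n \<Longrightarrow>
      ent A (x @ y) (x' @ y') = ent B (x @ y) (x' @ y')"
    and "\<And>x y. length x \<noteq> m + n \<Longrightarrow> length x = length y \<Longrightarrow> ent A x y = ent B x y"
  shows "A = B"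
proof (rule op_eqI)
  fix x y :: "'a list" assume len: "length x = length y"
  show "ent A x y = ent B x y"
  proof (cases "length x = m + n")
    case True
    then show ?thesis
      using assms(1)[of "take m x" "drop m x" "take m y" "drop m y"] len by simp
  qed (use assms(2) len in blast)
qed

lemma ent_mult_append:
  "length x = m \<Longrightarrow> length y = n \<Longrightarrow>
    ent (A * B) (x @ y) w = (\<Sum>z | length z = m. \<Sum>z' | length z' = n. ent A (x @ y) (z @ z') * ent B (z @ z') w)"
  by (simp add: ent_mult sum_lists_append)

lemma ent_amp1_mult:
  assumes "length x = m" "length y = n"
  shows "ent (amp1 m n X * B) (x @ y) w = (\<Sum>z | length z = m. ent X x z * ent B (z @ y) w)"
proof -
  have "ent (amp1 m n X * B) (x @ y) w
      = (\<Sum>z | length z = m. \<Sum>z' | length z' = n. if z' = y then ent X x z * ent B (z @ z') w else 0)"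
    unfolding ent_mult_append[OF assms] using assms by (intro sum.cong) (auto simp: ent_amp1_append)
  then show ?thesis using assms by (simp add: sum_lists_delta)
qed

lemma ent_amp2_mult:
  assumes "length x = m" "length y = n"
  shows "ent (amp2 m n X * B) (x @ y) w = (\<Sum>z | length z = n. ent X y z * ent B (x @ z) w)"
proof -
  have "ent (amp2 m n X * B) (x @ y) w
      = (\<Sum>z | length z = m. if z = x then \<Sum>z' | length z' = n. ent X y z' * ent B (z @ z') w else 0)"
    unfolding ent_mult_append[OF assms] using assms by (intro sum.cong) (auto simp: ent_amp2_append)
  then show ?thesis using assms by (simp add: sum_lists_delta)
qed

lemma ent_diag_mult:
  assumes "\<And>z. ent A x z = (if x = z then c else 0)"
  shows "ent (A * B) x y = c * ent B x y"
proof -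
  have "ent (A * B) x y = (\<Sum>z | length z = length x. if z = x then c * ent B z y else 0)"
    unfolding ent_mult by (rule sum.cong) (auto simp: assms)
  then show ?thesis by (simp add: sum_lists_delta)
qed

lemma ent_Nil_mult: "ent (A * B) [] [] = ent A [] [] * ent B [] []"
  by (simp add: ent_mult)

lemma amp1_rhom: "rhom (amp1 m n :: ('n::finite, 'a::ring_1) op \<Rightarrow> _)"
proof
  fix X Y :: "('n, 'a) op"
  show "amp1 m n (X + Y) = amp1 m n X + amp1 m n Y"
    by (rule op_eqI) (simp add: amp1_def ent_Op ent_add)
  show "amp1 m n 1 = (1 :: ('n, 'a) op)"
    by (rule op_eq_appendI[of m n]) (auto simp: ent_amp1_append ent_amp_other ent_one)
  show "amp1 m n (X * Y) = amp1 m n X * amp1 m n Y"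
  proof (rule op_eq_appendI[of m n])
    fix x y x' y' :: "'n list"
    assume len: "length x = m" "length y = n" "length x' = m" "length y' = n"
    have "(\<Sum>z | length z = m. ent X x z * ent (amp1 m n Y) (z @ y) (x' @ y')) =
       (\<Sum>z | length z = m. ent X x z * (if y = y' then ent Y z x' else 0))"
      by (rule sum.cong) (auto simp: ent_amp1_append len)
    then show "ent (amp1 m n (X * Y)) (x @ y) (x' @ y') = ent (amp1 m n X * amp1 m n Y) (x @ y) (x' @ y')"
      by (simp only: ent_amp1_mult[OF len(1,2)] ent_amp1_append[OF len]) (auto simp: ent_mult len)
  next
    fix x y :: "'n list" assume "length x \<noteq> m + n"
    then show "ent (amp1 m n (X * Y)) x y = ent (amp1 m n X * amp1 m n Y) x y"
      by (subst ent_diag_mult[where c = "ent X [] []"]) (auto simp: ent_amp_other ent_Nil_mult)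
  qed
qed

lemma amp2_rhom: "rhom (amp2 m n :: ('n::finite, 'a::ring_1) op \<Rightarrow> _)"
proof
  fix X Y :: "('n, 'a) op"
  show "amp2 m n (X + Y) = amp2 m n X + amp2 m n Y"
    by (rule op_eqI) (simp add: amp2_def ent_Op ent_add)
  show "amp2 m n 1 = (1 :: ('n, 'a) op)"
    by (rule op_eq_appendI[of m n]) (auto simp: ent_amp2_append ent_amp_other ent_one)
  show "amp2 m n (X * Y) = amp2 m n X * amp2 m n Y"
  proof (rule op_eq_appendI[of m n])
    fix x y x' y' :: "'n list"
    assume len: "length x = m" "length y = n" "length x' = m" "length y' = n"
    have "(\<Sum>z | length z = n. ent X y z * ent (amp2 m n Y) (x @ z) (x' @ y')) =
       (\<Sum>z | length z = n. ent X y z * (if x = x' then ent Y z y' else 0))"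
      by (rule sum.cong) (auto simp: ent_amp2_append len)
    then show "ent (amp2 m n (X * Y)) (x @ y) (x' @ y') = ent (amp2 m n X * amp2 m n Y) (x @ y) (x' @ y')"
      by (simp only: ent_amp2_mult[OF len(1,2)] ent_amp2_append[OF len]) (auto simp: ent_mult len)
  next
    fix x y :: "'n list" assume "length x \<noteq> m + n"
    then show "ent (amp2 m n (X * Y)) x y = ent (amp2 m n X * amp2 m n Y) x y"
      by (subst ent_diag_mult[where c = "ent X [] []"]) (auto simp: ent_amp_other ent_Nil_mult)
  qed
qed

lemma amp_scal: "amp1 m n (scal c) = scal c" "amp2 m n (scal c) = scal c"
  by (rule op_eq_appendI[of m n]; auto simp: ent_amp1_append ent_amp2_append ent_amp_other ent_scal)+

text \<open>Entries over the h-Yangian do not commute. Cyclicity of the trace and commutation of the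
  two tensor legs are therefore available only when one factor has central entries; the L-operators
  are the factors for which this fails.\<close>

definition central_op :: "('n, 'a::ring_1) op \<Rightarrow> bool" where
  "central_op X \<longleftrightarrow> (\<forall>x y r. ent X x y * r = r * ent X x y)"

lemma ent_amp12:
  assumes "length x = m" "length y = n" "length x' = m" "length y' = n"
  shows "ent (amp1 m n X * amp2 m n Y) (x @ y) (x' @ y') = ent X x x' * ent Y y y'"
proof -
  have "ent (amp1 m n X * amp2 m n Y) (x @ y) (x' @ y')
      = (\<Sum>z | length z = m. if z = x' then ent X x z * ent Y y y' else 0)"
    unfolding ent_amp1_mult[OF assms(1,2)] by (rule sum.cong) (auto simp: ent_amp2_append assms)
  then show ?thesis using assms by (simp add: sum_lists_delta)
qed

lemma amp1_amp2_commute: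
  assumes "central_op X"
  shows "amp1 m n X * amp2 m n Y = amp2 m n Y * amp1 m n X"
proof (rule op_eq_appendI[of m n])
  fix x y x' y' :: "'a list"
  assume len: "length x = m" "length y = n" "length x' = m" "length y' = n"
  have "ent (amp2 m n Y * amp1 m n X) (x @ y) (x' @ y')
      = (\<Sum>z | length z = n. if z = y' then ent Y y z * ent X x x' else 0)"
    unfolding ent_amp2_mult[OF len(1,2)] by (rule sum.cong) (auto simp: ent_amp1_append len)
  also have "\<dots> = ent X x x' * ent Y y y'" using len assms by (simp add: sum_lists_delta central_op_def)
  finally show "ent (amp1 m n X * amp2 m n Y) (x @ y) (x' @ y') = ent (amp2 m n Y * amp1 m n X) (x @ y) (x' @ y')"
    by (simp add: ent_amp12[OF len])
next
  fix x y :: "'a list" assume *: "length x \<noteq> m + n"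
  have "ent (amp1 m n X * amp2 m n Y) x y = ent X [] [] * ent (amp2 m n Y) x y"
    using * by (intro ent_diag_mult) (simp add: ent_amp_other)
  moreover have "ent (amp2 m n Y * amp1 m n X) x y = ent Y [] [] * ent (amp1 m n X) x y"
    using * by (intro ent_diag_mult) (simp add: ent_amp_other)
  ultimately show "ent (amp1 m n X * amp2 m n Y) x y = ent (amp2 m n Y * amp1 m n X) x y"
    using * assms by (simp add: ent_amp_other central_op_def)
qed

definition trm :: "nat \<Rightarrow> ('n::finite, 'a::ring_1) op \<Rightarrow> 'a" where
  "trm m X = (\<Sum>x | length x = m. ent X x x)"

lemma trm_amp: "trm (m + n) (amp1 m n X * amp2 m n Y) = trm m X * trm n Y"
proof -
  have "trm (m + n) (amp1 m n X * amp2 m n Y)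
      = (\<Sum>x | length x = m. \<Sum>y | length y = n. ent X x x * ent Y y y)"
    unfolding trm_def sum_lists_append by (intro sum.cong refl) (auto simp: ent_amp12)
  then show ?thesis by (simp add: trm_def sum_product)
qed

lemma trm_commute:
  assumes "central_op X"
  shows "trm m (X * Y) = trm m (Y * X)"
proof -
  have "trm m (X * Y) = (\<Sum>x | length x = m. \<Sum>z | length z = m. ent X x z * ent Y z x)"
    unfolding trm_def ent_mult by (intro sum.cong) auto
  also have "\<dots> = (\<Sum>z | length z = m. \<Sum>x | length x = m. ent Y z x * ent X x z)"
    using assms by (subst sum.swap) (simp add: central_op_def)
  also have "\<dots> = trm m (Y * X)"
    unfolding trm_def ent_mult by (intro sum.cong) auto
  finally show ?thesis .
qed

lemma trm_scal: "trm m (scal c * X) = c * trm m X"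
  by (simp add: trm_def ent_scal_mult sum_distrib_left)

lemma central_op_mult: "central_op X \<Longrightarrow> central_op Y \<Longrightarrow> central_op (X * Y)" for X Y :: "('n::finite, 'a::ring_1) op"
proof -
  assume X: "central_op X" and Y: "central_op Y"
  have "ent X x z * ent Y z y * r = r * (ent X x z * ent Y z y)" for x y z r
    using X Y unfolding central_op_def by (metis mult.assoc)
  then show ?thesis
    unfolding central_op_def by (simp add: ent_mult sum_distrib_left sum_distrib_right)
qed

lemma central_op_map: "calg e \<Longrightarrow> central_op (map_op e X)"
  unfolding central_op_def by (simp add: rhom.ent_map[OF calg.rhom] calg.e_central)

lemma swp_append1: "Suc k < length x \<Longrightarrow> swp k (x @ y) = swp k x @ y"
  and swp_append2: "swp (length x + k) (x @ y) = x @ swp k y"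
  by (simp_all add: swp_def nth_append list_update_append)

lemma amp1_hecke:
  assumes "calg e" "Suc k < m"
  shows "amp1 m n (map_op e (hecke_op m q qi k)) = map_op e (hecke_op (m + n) q qi k :: ('n::{finite,linorder}, 'p::comm_ring_1) op)"
proof (rule op_eq_appendI[of m n])
  interpret calg e by fact
  note em = rhom.ent_map[OF rhom]
  fix x y x' y' :: "'n list"
  assume len: "length x = m" "length y = n" "length x' = m" "length y' = n"
  show "ent (amp1 m n (map_op e (hecke_op m q qi k))) (x @ y) (x' @ y') =
        ent (map_op e (hecke_op (m + n) q qi k)) (x @ y) (x' @ y')"
    using len assms(2) unfolding ent_amp1_append[OF len] em
    by (auto simp: hecke_op_def ent_Op swp_append1 swp_append2 nth_append length_swp e_zero)
next
  interpret calg e by fact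
  note em = rhom.ent_map[OF rhom]
  fix x y :: "'n list" assume "length x \<noteq> m + n" "length x = length y"
  then show "ent (amp1 m n (map_op e (hecke_op m q qi k))) x y = ent (map_op e (hecke_op (m + n) q qi k)) x y"
    using assms(2) by (auto simp: ent_amp_other em hecke_op_def ent_Op e_zero)
qed

lemma amp2_hecke:
  assumes "calg e" "Suc k < n"
  shows "amp2 m n (map_op e (hecke_op n q qi k)) = map_op e (hecke_op (m + n) q qi (m + k) :: ('n::{finite,linorder}, 'p::comm_ring_1) op)"
proof (rule op_eq_appendI[of m n])
  interpret calg e by fact
  note em = rhom.ent_map[OF rhom]
  fix x y x' y' :: "'n list"
  assume len: "length x = m" "length y = n" "length x' = m" "length y' = n"
  show "ent (amp2 m n (map_op e (hecke_op n q qi k))) (x @ y) (x' @ y') =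
        ent (map_op e (hecke_op (m + n) q qi (m + k))) (x @ y) (x' @ y')"
    using len assms(2) unfolding ent_amp2_append[OF len] em
    by (auto simp: hecke_op_def ent_Op swp_append1 swp_append2 nth_append length_swp e_zero)
next
  interpret calg e by fact
  note em = rhom.ent_map[OF rhom]
  fix x y :: "'n list" assume "length x \<noteq> m + n" "length x = length y"
  then show "ent (amp2 m n (map_op e (hecke_op n q qi k))) x y = ent (map_op e (hecke_op (m + n) q qi (m + k))) x y"
    using assms(2) by (auto simp: ent_amp_other em hecke_op_def ent_Op e_zero)
qed

lemma agree_append1:
  assumes len: "length x = length x'" "length y = length y'" and k: "k < length x"
  shows "agree k (x @ y) (x' @ y') \<longleftrightarrow> agree k x x' \<and> y = y'"
proof
  assume *: "agree k (x @ y) (x' @ y')"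
  have "y ! i = y' ! i" if "i < length y" for i
  proof -
    have "(x @ y) ! (length x + i) = (x' @ y') ! (length x + i)"
      by (rule *[unfolded agree_def, rule_format]) (use that k in auto)
    then show ?thesis by (metis len(1) nth_append_length_plus)
  qed
  moreover have "x ! i = x' ! i" if "i < length x" "i \<noteq> k" for i
    using * that len by (auto simp: agree_def nth_append dest: spec[of _ i])
  ultimately show "agree k x x' \<and> y = y'"
    using len by (auto simp: agree_def intro: nth_equalityI)
qed (use len in \<open>auto simp: agree_def nth_append\<close>)

lemma agree_append2:
  assumes len: "length x = length x'" "length y = length y'"
  shows "agree (length x + k) (x @ y) (x' @ y') \<longleftrightarrow> x = x' \<and> agree k y y'"
proof
  assume *: "agree (length x + k) (x @ y) (x' @ y')"
  have "y ! i = y' ! i" if "i < length y" "i \<noteq> k" for i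
  proof -
    have "(x @ y) ! (length x + i) = (x' @ y') ! (length x + i)"
      by (rule *[unfolded agree_def, rule_format]) (use that in auto)
    then show ?thesis by (metis len(1) nth_append_length_plus)
  qed
  moreover have "x ! i = x' ! i" if "i < length x" for i
    using * that len by (auto simp: agree_def nth_append dest: spec[of _ i])
  ultimately show "x = x' \<and> agree k y y'"
    using len by (auto simp: agree_def intro: nth_equalityI)
qed (use len in \<open>auto simp: agree_def nth_append\<close>)

lemma amp1_lop: "k < m \<Longrightarrow> amp1 m n (lop m k l) = lop (m + n) k l"
  by (rule op_eq_appendI[of m n])
    (auto simp: ent_amp1_append ent_amp_other ent_lop agree_append1 nth_append)

lemma amp2_lop: "k < n \<Longrightarrow> amp2 m n (lop n k l) = lop (m + n) (m + k) l"
proof (rule op_eq_appendI[of m n])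
  fix x y x' y' :: "'a list"
  assume len: "k < n" "length x = m" "length y = n" "length x' = m" "length y' = n"
  show "ent (amp2 m n (lop n k l)) (x @ y) (x' @ y') = ent (lop (m + n) (m + k) l) (x @ y) (x' @ y')"
    using len agree_append2[of x x' y y' k] by (auto simp: ent_amp2_append ent_lop nth_append)
qed (auto simp: ent_amp_other ent_lop)

section \<open>Commutation of the traces\<close>

lemma dhecke_op:
  assumes "q * qi = 1"
  shows "dhecke scal q qi (hecke_op p q qi :: nat \<Rightarrow> ('n::{finite,linorder}, complex fps) op) (hecke_inv p q qi) p"
proof -
  have "dalg (\<lambda>x :: complex fps. x)"
  proof
    fix r :: "complex fps" assume *: "\<And>n. \<exists>s. r = fps_X ^ n * s"
    have "fps_nth r k = 0" for k
    proof -
      obtain s where "r = fps_X ^ Suc k * s" using * by blast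
      then show ?thesis by (simp add: fps_X_power_mult_nth del: power_Suc)
    qed
    then show "r = 0" by (simp add: fps_eq_iff)
  qed (simp_all add: mult.commute)
  then have "dalg (scal :: complex fps \<Rightarrow> ('n, complex fps) op)" by (rule dalg_scal)
  then show ?thesis
    using hecke_op_hecke[OF assms] by (intro dhecke.intro)
qed

definition diag_op :: "nat \<Rightarrow> ('n \<Rightarrow> 'a) \<Rightarrow> ('n::finite, 'a::comm_ring_1) op" where
  "diag_op M d = Op (\<lambda>x y. if x = y then if length x = M then prod_list (map d x) else 1 else 0)"

lemma ent_diag_op: "ent (diag_op M d) x y = (if x = y then if length x = M then prod_list (map d x) else 1 else 0)"
  by (simp add: diag_op_def ent_Op)

lemma prod_list_swp: "Suc k < length x \<Longrightarrow> prod_list (map d (swp k x)) = prod_list (map (d :: _ \<Rightarrow> 'a::comm_monoid_mult) x)"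
proof -
  assume "Suc k < length x"
  then have "mset (swp k x) = mset x" unfolding swp_def by (intro mset_swap) auto
  then have "image_mset d (mset (swp k x)) = image_mset d (mset x)" by simp
  then show ?thesis by (metis mset_map prod_mset_prod_list)
qed

text \<open>A tensor power of one diagonal matrix takes the same value on a list and on its swap,
  and a generator links only these two.\<close>

lemma diag_hecke_commute:
  assumes "Suc k < M"
  shows "diag_op M d * hecke_op M q qi k = hecke_op M q qi k * (diag_op M d :: ('n::{finite,linorder}, 'a::comm_ring_1) op)"
proof (rule op_eqI)
  fix x y :: "'n list" assume len: "length x = length y"
  show "ent (diag_op M d * hecke_op M q qi k) x y = ent (hecke_op M q qi k * diag_op M d) x y"
  proof (cases "length x = M")
    case True
    note e = ent_mult_hecke[OF calg_self, unfolded map_op_self, OF assms] ent_hecke_mult_self[OF assms]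
    consider "x = y" | "x \<noteq> y" "x = swp k y" | "x \<noteq> y" "x \<noteq> swp k y" "swp k x \<noteq> y"
      using assms len True swp_swp[of k x] by metis
    then show ?thesis
    proof cases
      case 2
      have "ent (diag_op M d * hecke_op M q qi k) (swp k y) y = ent (hecke_op M q qi k * diag_op M d) (swp k y) y"
        unfolding e using assms len True 2(1)[unfolded 2(2)]
        by (simp add: ent_diag_op length_swp swp_swp nth_swp prod_list_swp)
      then show ?thesis by (simp only: 2(2))
    next
      case 1
      have "x \<noteq> swp k x" if "x ! k \<noteq> x ! Suc k" using swp_neq[of k x] assms True that by metis
      with 1 show ?thesis unfolding e using True by (auto simp: ent_diag_op)
    next
      case 3
      then show ?thesis unfolding e using True len by (auto simp: ent_diag_op)
    qed
  qed (use assms len in \<open>auto simp: ent_mult_hecke[OF calg_self, unfolded map_op_self] ent_hecke_mult_self ent_diag_op\<close>)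
qed

lemma amp_diag: "amp1 m n (diag_op m d) * amp2 m n (diag_op n d) = diag_op (m + n) d"
proof (rule op_eq_appendI[of m n])
  fix x y :: "'a list" assume *: "length x \<noteq> m + n"
  have "ent (amp1 m n (diag_op m d) * amp2 m n (diag_op n d)) x y
      = ent (diag_op m d) [] [] * ent (amp2 m n (diag_op n d)) x y"
    using * by (intro ent_diag_mult) (simp add: ent_amp_other)
  then show "ent (amp1 m n (diag_op m d) * amp2 m n (diag_op n d)) x y = ent (diag_op (m + n) d) x y"
    using * by (auto simp: ent_amp_other ent_diag_op)
qed (simp add: ent_amp12, simp add: ent_diag_op)

text \<open>Parameters are series in an auxiliary variable \<open>w\<close> over the power series in
  \<open>h\<close>. Constants play the part of evaluation points, and \<open>w\<close> keeps the two
  blocks apart. \<open>l_lip\<close> is the h-adic continuity of the L-operators in a constant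
  factor of their parameter.\<close>

locale rll_setting = calg eZ for eZ :: "complex fps fps \<Rightarrow> 's::ring_1" +
  fixes q qi :: "complex fps" and l :: "complex fps fps \<Rightarrow> 'n::{finite,linorder} \<Rightarrow> 'n \<Rightarrow> 's" and d :: "'n \<Rightarrow> complex fps"
    and m n :: nat
  assumes qqi: "q * qi = 1"
    and dalg_const: "dalg (\<lambda>c. eZ (fps_const c))"
    and rll: "rll_family eZ (fps_const q) (fps_const qi) l"
    and l_lip: "\<exists>s. l (fps_const x * c) i j - l (fps_const y * c) i j = eZ (fps_const (x - y)) * s"
begin

abbreviation "eS c \<equiv> eZ (fps_const c)"
abbreviation "eO c \<equiv> scal (eS c) :: ('n, 's) op"
abbreviation "M \<equiv> m + n"

sublocale O: op_hecke eZ "fps_const q" "fps_const qi" M "TYPE('n)"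
  by unfold_locales (simp add: fps_const_mult qqi flip: fps_const_1_eq_1)

sublocale S: dalg "\<lambda>c. eS c" by (rule dalg_const)

sublocale OS: dalg "\<lambda>c. eO c" by (rule dalg_scal[OF dalg_const])

abbreviation "RR \<equiv> O.H.RR"

definition RRD :: "nat \<Rightarrow> nat \<Rightarrow> complex fps \<Rightarrow> complex fps \<Rightarrow> ('n, complex fps) op" where
  "RRD p = hecke.RR scal (hecke_op p q qi) (hecke_inv p q qi)"

definition fusD :: "nat \<Rightarrow> complex fps list \<Rightarrow> ('n, complex fps) op \<Rightarrow> bool" where
  "fusD p = dhecke.fus scal q qi (hecke_op p q qi) (hecke_inv p q qi) p"

text \<open>A homomorphism that lets operators on \<open>p\<close> factors over the ground ring act
  on the factors \<open>j\<close>, ..., \<open>j + p - 1\<close> of the large tensor power. Knowing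
  it on scalars and generators suffices, since fusion products are moved by their R-matrices
  only.\<close>

definition place :: "nat \<Rightarrow> nat \<Rightarrow> (('n, complex fps) op \<Rightarrow> ('n, 's) op) \<Rightarrow> bool" where
  "place p j \<phi> \<longleftrightarrow> j + p \<le> M \<and> dhom scal eO \<phi> \<and> (\<forall>k. Suc k < p \<longrightarrow> \<phi> (hecke_op p q qi k) = O.T (j + k))"

lemma place_RR:
  assumes "place p j \<phi>" "Suc k < p"
  shows "\<phi> (RRD p k a b) = RR (j + k) (fps_const a) (fps_const b)"
proof -
  interpret h: dhom scal eO \<phi> using assms(1) by (simp add: place_def)
  interpret D: dhecke scal q qi "hecke_op p q qi :: nat \<Rightarrow> ('n, complex fps) op" "hecke_inv p q qi" p
    by (rule dhecke_op[OF qqi])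
  have "Suc (j + k) < M" using assms by (simp add: place_def)
  then have "O.Ti (j + k) = O.T (j + k) - eO (q - qi)" by (simp only: O.H.Ti_eq fps_const_sub)
  then have "\<phi> (hecke_inv p q qi k) = O.Ti (j + k)"
    using assms by (simp add: place_def hecke_inv_def h.hom_diff h.hom_e)
  then show ?thesis
    using assms by (simp add: place_def RRD_def D.RR_def O.H.RR_def h.hom_diff h.hom_sm OS.sm_def O.H.sm_def)
qed

definition cancels :: "complex fps fps \<Rightarrow> bool" where
  "cancels c \<longleftrightarrow> (\<forall>r. eZ c * r = 0 \<longrightarrow> r = 0)"

definition param :: "complex fps fps \<Rightarrow> complex fps list \<Rightarrow> complex fps fps list" where
  "param c xs = map (\<lambda>x. fps_const x * c) xs"

lemma RR_scale: "RR k (u * c) (v * c) = scal (eZ c) * RR k u v"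
proof -
  have "O.H.sm (u * c) X = scal (eZ c) * O.H.sm u X" for u X
    unfolding O.H.sm_def mult.commute[of u] O.H.e_mult by (rule mult.assoc)
  then show ?thesis by (simp add: O.H.RR_def right_diff_distrib)
qed

lemma scal_cancel:
  assumes "cancels c" "scal (eZ c) * X = scal (eZ c) * Y"
  shows "X = Y"
proof (rule op_eqI)
  fix x y
  have "eZ c * (ent X x y - ent Y x y) = 0"
    using arg_cong[OF assms(2), of "\<lambda>X. ent X x y"] by (simp add: ent_scal_mult right_diff_distrib)
  then have "ent X x y - ent Y x y = 0" using assms(1) unfolding cancels_def by blast
  then show "ent X x y = ent Y x y" by simp
qed

text \<open>Fusion uses constant parameters, while the blocks carry the common factor
  \<open>c\<close>. By homogeneity \<open>c\<close> leaves the R-matrices as a scalar, and it need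
  only be cancellable, not invertible; \<open>w\<close> is such a factor.\<close>

lemma swap_system_param:
  assumes "swap_system (\<lambda>k. RR (j1 + k)) (\<lambda>k. RR (j2 + k)) p G" "cancels c" "place p j1 \<phi>1" "place p j2 \<phi>2"
  shows "swap_system (\<lambda>k u v. \<phi>1 (RRD p k u v)) (\<lambda>k u v. \<phi>2 (RRD p k u v)) p (\<lambda>xs. G (param c xs))"
  unfolding swap_system_def
proof (intro allI impI)
  fix xs ys :: "complex fps list" and a b
  assume len: "length xs + length ys + 2 = p"
  let ?C = "\<lambda>x. fps_const x :: complex fps fps"
  have "G (param c xs @ ?C b * c # ?C a * c # param c ys) * RR (j2 + length (param c xs)) (?C a * c) (?C b * c)
     = RR (j1 + length (param c xs)) (?C a * c) (?C b * c) * G (param c xs @ ?C a * c # ?C b * c # param c ys)"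
    using len by (intro swap_systemD[OF assms(1)]) (simp add: param_def)
  then have "scal (eZ c) * (G (param c (xs @ b # a # ys)) * RR (j2 + length xs) (?C a) (?C b))
      = scal (eZ c) * (RR (j1 + length xs) (?C a) (?C b) * G (param c (xs @ a # b # ys)))"
    by (simp add: RR_scale param_def mult.assoc O.H.sm_mult_right[unfolded O.H.sm_def])
  then show "G (param c (xs @ b # a # ys)) * \<phi>2 (RRD p (length xs) a b)
      = \<phi>1 (RRD p (length xs) a b) * G (param c (xs @ a # b # ys))"
    using len assms by (simp add: place_RR scal_cancel)
qed

theorem exchange:
  assumes "swap_system (\<lambda>k. RR (j1 + k)) (\<lambda>k. RR (j2 + k)) p G" "cancels c" "place p j1 \<phi>1" "place p j2 \<phi>2"
    and lip: "\<And>xs ys. OS.lip (\<lambda>x. G (param c xs @ (fps_const x * c) # param c ys))"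
    and "fusD p as F" "length as = p"
  shows "G (param c as) * \<phi>2 F = \<phi>1 F * G (param c (rev as))"
proof -
  interpret D: dhecke scal q qi "hecke_op p q qi :: nat \<Rightarrow> ('n, complex fps) op" "hecke_inv p q qi" p
    by (rule dhecke_op[OF qqi])
  have "G (param c (as @ [])) * \<phi>2 F = \<phi>1 F * G (param c (rev as @ []))"
  proof (rule D.fus_exchange)
    show "dhom scal eO \<phi>1" "dhom scal eO \<phi>2" using assms by (simp_all add: place_def)
    show "swap_system (\<lambda>k u v. \<phi>1 (D.RR k u v)) (\<lambda>k u v. \<phi>2 (D.RR k u v)) p (\<lambda>xs. G (param c xs))"
      using swap_system_param[OF assms(1-4)] by (simp add: RRD_def)
    show "OS.lip (\<lambda>x. G (param c (xs @ x # ys)))" for xs ys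
      using lip by (simp add: param_def)
    show "D.fus as F" using assms by (simp add: fusD_def)
    show "length as + length [] = p" using assms by simp
  qed
  then show ?thesis by simp
qed

lemma lip_op:
  assumes "\<And>x y. S.lip (\<lambda>t. ent (f t) x y)"
  shows "OS.lip f"
proof (rule OS.lipI)
  fix s t
  have "\<exists>r. ent (f s) x y - ent (f t) x y = eS (s - t) * r" for x y
    using assms unfolding S.lip_def S.sm_def by blast
  then obtain r where r: "\<And>x y. ent (f s) x y - ent (f t) x y = eS (s - t) * r x y" by metis
  have "f s - f t = OS.sm (s - t) (Op r)"
    by (rule op_eqI) (simp add: OS.sm_def ent_diff ent_scal_mult ent_Op r)
  then show "\<exists>X. f s - f t = OS.sm (s - t) X" ..
qed

text \<open>The two ways in which a parameter can depend on the point moved in a continuity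
  argument: it is the moving parameter of the block, or it is fixed.\<close>

definition pfun :: "(complex fps \<Rightarrow> complex fps fps) \<Rightarrow> bool" where
  "pfun f \<longleftrightarrow> (\<exists>c. f = (\<lambda>x. fps_const x * c) \<or> f = (\<lambda>x. c))"

lemma lip_lop: "pfun f \<Longrightarrow> OS.lip (\<lambda>x. lop M k (l (f x)))"
proof (rule lip_op)
  fix x y assume f: "pfun f"
  have "S.lip (\<lambda>t. l (f t) i j)" for i j
  proof -
    obtain c where "f = (\<lambda>x. fps_const x * c) \<or> f = (\<lambda>x. c)" using f unfolding pfun_def by blast
    then show ?thesis
    proof
      assume "f = (\<lambda>x. fps_const x * c)"
      then show ?thesis using l_lip by (auto intro!: S.lipI simp: S.sm_def)
    qed (simp add: S.lip_const)
  qed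
  then show "S.lip (\<lambda>t. ent (lop M k (l (f t))) x y)"
    unfolding ent_lop
    by (cases "length x = length y"; cases "length x = M"; cases "agree k x y") (simp_all add: S.lip_const)
qed

lemma lip_scalar: "pfun f \<Longrightarrow> OS.lip (\<lambda>x. O.H.sm (f x) X)"
proof -
  have "OS.lip (\<lambda>x. scal (eS x) * scal (eZ c))" for c
    by (intro OS.lip_mult OS.lip_const OS.lip_e OS.slip_id)
  then have "OS.lip (\<lambda>x. scal (eZ (fps_const x * c)))" for c
    by (simp add: O.H.e_mult)
  then show "pfun f \<Longrightarrow> OS.lip (\<lambda>x. O.H.sm (f x) X)"
    unfolding O.H.sm_def pfun_def by (auto intro!: OS.lip_mult OS.lip_const)
qed

lemma lip_RR: "pfun f \<Longrightarrow> pfun g \<Longrightarrow> OS.lip (\<lambda>x. RR k (f x) (g x))"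
  unfolding O.H.RR_def by (intro OS.lip_diff lip_scalar)

lemma lip_lprod: "list_all pfun fs \<Longrightarrow> OS.lip (\<lambda>x. O.lprod l k (map (\<lambda>f. f x) fs))"
  by (induction fs arbitrary: k) (auto intro!: OS.lip_const OS.lip_mult lip_lop)

lemma lip_moveR: "list_all pfun fs \<Longrightarrow> pfun g \<Longrightarrow> OS.lip (\<lambda>x. moveR RR k (g x) (map (\<lambda>f. f x) fs))"
  by (induction fs arbitrary: k) (auto intro!: OS.lip_const OS.lip_mult lip_RR)

lemma lip_moveB:
  "list_all pfun fs \<Longrightarrow> list_all pfun gs \<Longrightarrow> OS.lip (\<lambda>x. moveB RR k (map (\<lambda>f. f x) fs) (map (\<lambda>f. f x) gs))"
  by (induction gs arbitrary: k) (auto intro!: OS.lip_const OS.lip_mult lip_moveR)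

definition pfuns :: "complex fps fps \<Rightarrow> complex fps list \<Rightarrow> complex fps list \<Rightarrow> (complex fps \<Rightarrow> complex fps fps) list" where
  "pfuns c xs ys = map (\<lambda>y x. y) (param c xs) @ (\<lambda>x. fps_const x * c) # map (\<lambda>y x. y) (param c ys)"

lemma pfuns: "list_all pfun (pfuns c xs ys)" "list_all pfun (map (\<lambda>y x. y) zs)"
  "map (\<lambda>f. f x) (pfuns c xs ys) = param c xs @ (fps_const x * c) # param c ys"
  "map (\<lambda>f. f x) (map (\<lambda>y x. y) zs) = zs"
  by (auto simp: pfuns_def pfun_def list_all_iff o_def)

abbreviation "LL \<equiv> O.lprod l 0"
abbreviation "XX \<equiv> moveB RR 0"

lemma LL_exchange:
  assumes "cancels c" "place p (length us) \<phi>" "length us + p + length vs = M" "fusD p as F" "length as = p"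
  shows "LL (us @ param c as @ vs) * \<phi> F = \<phi> F * LL (us @ param c (rev as) @ vs)"
proof (rule exchange[where G = "\<lambda>ps. LL (us @ ps @ vs)"])
  show "swap_system (\<lambda>k. RR (length us + k)) (\<lambda>k. RR (length us + k)) p (\<lambda>ps. LL (us @ ps @ vs))"
    unfolding swap_system_def
  proof (intro allI impI)
    fix xs ys :: "complex fps fps list" and a b
    assume "length xs + length ys + 2 = p"
    then show "LL (us @ (xs @ b # a # ys) @ vs) * RR (length us + length xs) a b
        = RR (length us + length xs) a b * LL (us @ (xs @ a # b # ys) @ vs)"
      using swap_systemD[OF O.lprod_swap_system[OF rll], of "us @ xs" "ys @ vs" b a] assms(3) by simp
  qed
  fix xs ys
  have "OS.lip (\<lambda>x. LL (map (\<lambda>f. f x) (map (\<lambda>y x. y) us @ pfuns c xs ys @ map (\<lambda>y x. y) vs)))"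
    by (rule lip_lprod) (use pfuns in \<open>simp add: list_all_append\<close>)
  then show "OS.lip (\<lambda>x. LL (us @ (param c xs @ (fps_const x * c) # param c ys) @ vs))"
    using pfuns by (simp only: map_append)
qed (use assms in auto)

lemma XX_exchange_left:
  assumes "cancels c" "place m 0 \<phi>1" "place m n \<phi>2" "length bs = n" "fusD m as F" "length as = m"
  shows "XX (param c as) bs * \<phi>2 F = \<phi>1 F * XX (param c (rev as)) bs"
proof (rule exchange[where G = "\<lambda>ps. XX ps bs"])
  show "swap_system (\<lambda>k. RR (0 + k)) (\<lambda>k. RR (n + k)) m (\<lambda>ps. XX ps bs)"
    using O.H.moveB_swap_left[of 0 m bs] assms(4) by simp
  fix xs ys
  have "OS.lip (\<lambda>x. XX (map (\<lambda>f. f x) (pfuns c xs ys)) (map (\<lambda>f. f x) (map (\<lambda>y x. y) bs)))"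
    by (rule lip_moveB) (use pfuns in simp_all)
  then show "OS.lip (\<lambda>x. XX (param c xs @ (fps_const x * c) # param c ys) bs)"
    using pfuns by (simp only:)
qed (use assms in auto)

lemma XX_exchange_right:
  assumes "cancels c" "place n m \<phi>1" "place n 0 \<phi>2" "length as = m" "fusD n bs F" "length bs = n"
  shows "XX as (param c bs) * \<phi>2 F = \<phi>1 F * XX as (param c (rev bs))"
proof (rule exchange[where G = "\<lambda>ps. XX as ps"])
  show "swap_system (\<lambda>k. RR (m + k)) (\<lambda>k. RR (0 + k)) n (\<lambda>ps. XX as ps)"
    using O.H.moveB_swap_right[of 0 as n] assms(4) by simp
  fix xs ys
  have "OS.lip (\<lambda>x. XX (map (\<lambda>f. f x) (map (\<lambda>y x. y) as)) (map (\<lambda>f. f x) (pfuns c xs ys)))"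
    by (rule lip_moveB) (use pfuns in simp_all)
  then show "OS.lip (\<lambda>x. XX as (param c xs @ (fps_const x * c) # param c ys))"
    using pfuns by (simp only:)
qed (use assms in auto)

text \<open>\<open>exchange\<close> with \<open>G\<close> constant in its list of parameters, so
  that the reversal is invisible.\<close>

lemma commute_exchange:
  assumes "\<And>k. Suc k < M \<Longrightarrow> Z * O.T k = O.T k * Z" "place p j \<phi>" "fusD p as F" "length as = p"
  shows "Z * \<phi> F = \<phi> F * Z"
proof -
  have "swap_system (\<lambda>k. RR (j + k)) (\<lambda>k. RR (j + k)) p (\<lambda>ps. Z)"
    using assms(1,2) by (auto simp: swap_system_def place_def intro!: O.H.RR_commute)
  moreover have "cancels 1" by (simp add: cancels_def e_one)
  ultimately show ?thesis
    using exchange[where G = "\<lambda>ps. Z"] OS.lip_const assms(2-4) by blast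
qed

lemma place_amp1: "place m 0 (\<lambda>X. amp1 m n (map_op (\<lambda>c. eS c) X))"
  and place_amp2: "place n m (\<lambda>X. amp2 m n (map_op (\<lambda>c. eS c) X))"
  and place_amp1': "place n 0 (\<lambda>X. amp1 n m (map_op (\<lambda>c. eS c) X))"
  and place_amp2': "place m n (\<lambda>X. amp2 n m (map_op (\<lambda>c. eS c) X))"
proof -
  interpret D: dhecke scal q qi "hecke_op 0 q qi :: nat \<Rightarrow> ('n, complex fps) op" "hecke_inv 0 q qi" 0
    by (rule dhecke_op[OF qqi])
  have calgS: "calg (\<lambda>c. eS c)" ..
  interpret r: rhom "\<lambda>c. eS c" by (rule S.rhom)
  have hom: "dhom scal eO (\<lambda>X. f (map_op (\<lambda>c. eS c) X))" if "rhom f" "\<And>c. f (scal c) = scal c"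
    for f :: "('n, 's) op \<Rightarrow> ('n, 's) op"
  proof -
    interpret f: rhom f by fact
    show ?thesis
      by unfold_locales (simp_all add: r.map_add r.map_mult r.map_one r.map_scal f.add f.mult f.one that)
  qed
  have T: "map_op (\<lambda>c. eS c) (hecke_op p q qi k) = (map_op eZ (hecke_op p (fps_const q) (fps_const qi) k) :: ('n, 's) op)" for p k
  proof -
    interpret Z: rhom eZ by (rule rhom)
    have "ent (hecke_op p (fps_const q) (fps_const qi) k) x y = fps_const (ent (hecke_op p q qi k) x y)" for x y :: "'n list"
      unfolding hecke_op_def ent_Op by simp
    then show ?thesis
      by (intro op_eqI) (simp add: Z.ent_map r.ent_map)
  qed
  show "place m 0 (\<lambda>X. amp1 m n (map_op (\<lambda>c. eS c) X))" "place n m (\<lambda>X. amp2 m n (map_op (\<lambda>c. eS c) X))"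
    "place n 0 (\<lambda>X. amp1 n m (map_op (\<lambda>c. eS c) X))" "place m n (\<lambda>X. amp2 n m (map_op (\<lambda>c. eS c) X))"
    unfolding place_def
    by (simp_all add: hom amp1_rhom amp2_rhom amp_scal T amp1_hecke[OF calg_axioms] amp2_hecke[OF calg_axioms] add.commute[of n m])
qed

end

lemma (in rhom) amp_map: "amp1 m n (map_op f X) = map_op f (amp1 m n X)" "amp2 m n (map_op f X) = map_op f (amp2 m n X)"
  by (rule op_eqI; simp add: ent_map amp1_def amp2_def ent_Op zero)+

lemma central_op_amp: "central_op X \<Longrightarrow> central_op (amp1 m n X)" "central_op X \<Longrightarrow> central_op (amp2 m n X)"
  by (simp_all add: central_op_def amp1_def amp2_def ent_Op)

section \<open>Conjugation under the trace\<close>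

context rll_setting
begin

lemma amp1_lprod: "j + length ps \<le> m \<Longrightarrow> amp1 m n (op_hecke.lprod m l j ps) = O.lprod l j ps"
proof (induction ps arbitrary: j)
  interpret A: op_hecke eZ "fps_const q" "fps_const qi" m "TYPE('n)" by unfold_locales (rule O.q_qi)
  case Nil
  show ?case by (simp add: A.lprod.simps rhom.one[OF amp1_rhom])
next
  interpret A: op_hecke eZ "fps_const q" "fps_const qi" m "TYPE('n)" by unfold_locales (rule O.q_qi)
  case (Cons b ps)
  then show ?case by (simp add: A.lprod.simps rhom.mult[OF amp1_rhom] amp1_lop)
qed

lemma amp2_lprod: "j + length ps \<le> n \<Longrightarrow> amp2 m n (op_hecke.lprod n l j ps) = O.lprod l (m + j) ps"
proof (induction ps arbitrary: j)
  interpret A: op_hecke eZ "fps_const q" "fps_const qi" n "TYPE('n)" by unfold_locales (rule O.q_qi)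
  case Nil
  show ?case by (simp add: A.lprod.simps rhom.one[OF amp2_rhom])
next
  interpret A: op_hecke eZ "fps_const q" "fps_const qi" n "TYPE('n)" by unfold_locales (rule O.q_qi)
  case (Cons b ps)
  then show ?case by (simp add: A.lprod.simps rhom.mult[OF amp2_rhom] amp2_lop)
qed

abbreviation "mS X \<equiv> map_op (\<lambda>c. eS c) X :: ('n, 's) op"

lemma rS: "rhom (\<lambda>c. eS c)" by (rule S.rhom)

lemma central_mS: "central_op (mS X)"
  by (rule central_op_map) (rule S.calg_axioms)

text \<open>The scalar part of the first leg has central entries, so it passes the L-operators of
  the second leg; then all L-operators stand on the left in their original order.\<close>

lemma trace_product:
  assumes "length ps = m" "length ps' = n"
  shows "trm m (op_hecke.lprod m l 0 ps * mS (diag_op m d * F * t)) * trm n (op_hecke.lprod n l 0 ps' * mS (diag_op n d * G * t'))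
    = trm M (LL (ps @ ps') * (mS (diag_op M d) * (amp1 m n (mS F) * amp2 m n (mS G)) * (amp1 m n (mS t) * amp2 m n (mS t'))))"
proof -
  let ?a = "amp1 m n" and ?b = "amp2 m n"
  let ?A = "op_hecke.lprod m l 0 ps :: ('n, 's) op" and ?B = "op_hecke.lprod n l 0 ps' :: ('n, 's) op"
  let ?P = "mS (diag_op m d * F * t)" and ?Q = "mS (diag_op n d * G * t')"
  note am = rhom.mult[OF amp1_rhom[of m n]] rhom.mult[OF amp2_rhom[of m n]] rhom.map_mult[OF rS]
  have c: "?b (mS Y) * ?a (mS X) = ?a (mS X) * ?b (mS Y)" for X Y
    by (rule amp1_amp2_commute[OF central_mS, symmetric])
  then have c': "?b (mS Y) * (?a (mS X) * r) = ?a (mS X) * (?b (mS Y) * r)" for X Y r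
    by (simp flip: mult.assoc)
  have "trm m (?A * ?P) * trm n (?B * ?Q) = trm M (?a ?A * (?a ?P * ?b ?B) * ?b ?Q)"
    by (simp add: trm_amp[symmetric] am(1,2) mult.assoc)
  also have "?a ?P * ?b ?B = ?b ?B * ?a ?P" by (rule amp1_amp2_commute[OF central_mS])
  also have "?a ?A * (?b ?B * ?a ?P) * ?b ?Q = (?a ?A * ?b ?B) * (?a ?P * ?b ?Q)" by (simp add: mult.assoc)
  also have "?a ?A * ?b ?B = LL (ps @ ps')"
    using assms by (simp add: amp1_lprod amp2_lprod O.lprod_append)
  also have "?a ?P * ?b ?Q = (?a (mS (diag_op m d)) * ?b (mS (diag_op n d))) * (?a (mS F) * ?b (mS G)) * (?a (mS t) * ?b (mS t'))"
    by (simp add: am mult.assoc c c')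
  also have "?a (mS (diag_op m d)) * ?b (mS (diag_op n d)) = mS (diag_op M d)"
    by (simp add: rhom.amp_map[OF rS] amp_diag flip: rhom.map_mult[OF rS])
  finally show ?thesis .
qed

text \<open>Conjugating \<open>K\<close> by \<open>X\<close> leaves \<open>V t\<close> next to the
  inverse of \<open>X\<close>, and these do not commute. The relation for \<open>W\<close> doubles
  \<open>W\<close>; one copy becomes \<open>V\<close> across the inverse of \<open>X\<close>,
  travels around the trace together with \<open>t\<close>, meets the \<open>V\<close> obtained from
  the other copy, and is absorbed. Then only \<open>X\<close> and its inverse remain at the two
  ends.\<close>

lemma trace_conjugate:
  fixes V W t t' X Xi X' Xi' D K K' L' :: "('n, 's) op"
  assumes X: "X * Xi = 1" "Xi * X = 1" and X': "X' * Xi' = 1" and XW: "X * W = V * X'"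
    and K: "K * X = X * K'" and DX: "D * X = X * D" and KW: "K' * D * W = W * L'"
    and V: "OS.sm c1 (V * t * V) = OS.sm c2 V" and W: "OS.sm c1 (W * t' * W) = OS.sm c2 W"
    and c2: "c2 \<noteq> 0" and central: "central_op (V * t)" "central_op Xi"
  shows "trm p (K * (D * V * t)) = trm p (K' * (D * W * t'))"
proof -
  have tr: "trm p (OS.sm c Y) = eS c * trm p Y" for c Y by (simp add: OS.sm_def trm_scal)
  have XV: "Xi * V = W * Xi'"
  proof -
    have "Xi * V = Xi * (V * X') * Xi'" using X' by (simp add: mult.assoc)
    also have "\<dots> = (Xi * X) * W * Xi'" by (simp add: mult.assoc flip: XW)
    finally show ?thesis using X by simp
  qed
  have DXi: "Xi * D = D * Xi"
  proof -
    have "Xi * D = Xi * (D * X) * Xi" using X by (simp add: mult.assoc)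
    also have "\<dots> = (Xi * X) * D * Xi" unfolding DX by (simp add: mult.assoc)
    finally show ?thesis using X by simp
  qed
  have "K * (D * V * t) = K * X * (Xi * D) * V * t"
    using X(1) by (simp add: mult.assoc) (simp flip: mult.assoc)
  also have "\<dots> = X * K' * D * (Xi * V) * t" unfolding K DXi by (simp add: mult.assoc)
  finally have 1: "K * (D * V * t) = X * K' * D * W * Xi' * t" unfolding XV by (simp add: mult.assoc)
  have "OS.sm c2 (K * (D * V * t)) = X * K' * D * OS.sm c2 W * Xi' * t"
    unfolding 1 by (simp add: OS.sm_mult_right OS.sm_mult_left)
  \<comment> \<open>Doubles \<open>W\<close>; the new copy is carried across the inverse of
    \<open>X\<close> in the next line.\<close>
  also have "\<dots> = OS.sm c1 (X * K' * D * W * t' * (W * Xi') * t)"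
    unfolding W[symmetric] by (simp add: OS.sm_mult_right OS.sm_mult_left mult.assoc)
  also have "\<dots> = OS.sm c1 ((X * K' * D * W * t' * Xi) * (V * t))"
    unfolding XV[symmetric] by (simp add: mult.assoc)
  finally have "eS c2 * trm p (K * (D * V * t)) = eS c1 * trm p ((X * K' * D * W * t' * Xi) * (V * t))"
    by (metis tr)
  \<comment> \<open>Cyclicity is legitimate here because the part that moves, \<open>V * t\<close>,
    contains no L-operators.\<close>
  also have "trm p ((X * K' * D * W * t' * Xi) * (V * t)) = trm p ((V * t) * (X * K' * D * W * t' * Xi))"
    by (rule trm_commute[OF central(1), symmetric])
  also have "(V * t) * (X * K' * D * W * t' * Xi) = V * t * X * (K' * D * W) * t' * Xi" by (simp add: mult.assoc)
  also have "\<dots> = V * t * (X * W) * L' * t' * Xi" unfolding KW by (simp add: mult.assoc)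
  also have "\<dots> = V * t * V * X' * L' * t' * Xi" unfolding XW by (simp add: mult.assoc)
  also have "eS c1 * trm p \<dots> = trm p (OS.sm c1 (V * t * V) * X' * L' * t' * Xi)"
    by (simp add: OS.sm_mult_left flip: tr)
  \<comment> \<open>The two copies of \<open>V\<close> have met and merge; from here the moves are
    undone.\<close>
  also have "\<dots> = eS c2 * trm p ((V * X') * L' * t' * Xi)"
    unfolding V by (simp add: OS.sm_mult_left tr)
  also have "(V * X') * L' * t' * Xi = (X * (K' * D * W) * t') * Xi" unfolding KW XW[symmetric] by (simp add: mult.assoc)
  also have "trm p \<dots> = trm p (Xi * (X * (K' * D * W) * t'))"
    by (rule trm_commute[OF central(2), symmetric])
  also have "Xi * (X * (K' * D * W) * t') = (Xi * X) * (K' * (D * W * t'))" by (simp add: mult.assoc)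
  finally have "eS c2 * (trm p (K * (D * V * t)) - trm p (K' * (D * W * t'))) = 0"
    using X by (simp add: right_diff_distrib)
  then have "trm p (K * (D * V * t)) - trm p (K' * (D * W * t')) = 0"
    using S.torsion_free c2 by blast
  then show ?thesis by simp
qed

lemma central_RR: "central_op (RR k u v)"
proof -
  have "ent (scal (eZ c) * map_op eZ A) x y * r = r * ent (scal (eZ c) * map_op eZ A) x y" for c r x y and A :: "('n, complex fps fps) op"
    by (simp add: ent_scal_mult rhom.ent_map[OF rhom] e_central[of r] flip: e_mult)
  then show ?thesis
    by (simp add: central_op_def O.H.RR_def O.H.sm_def ent_diff left_diff_distrib right_diff_distrib)
qed

lemma central_XX: "central_op (moveB RR k us vs)"
proof -
  have 1: "central_op (1 :: ('n, 's) op)" by (simp add: central_op_def ent_one)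
  have "central_op (moveR RR k b us)" for k b
    by (induction us arbitrary: k) (auto intro!: 1 central_op_mult central_RR)
  then show ?thesis
    by (induction vs arbitrary: k) (auto intro!: 1 central_op_mult)
qed

lemma central_inverse:
  fixes X Y :: "('n, 's) op"
  assumes "central_op X" "X * Y = 1" "Y * X = 1"
  shows "central_op Y"
proof -
  have comm: "scal r * X = X * scal r" for r
    using assms(1) by (intro op_eqI) (simp add: ent_scal_mult ent_mult_scal central_op_def)
  have "scal r * Y = Y * scal r" for r
  proof -
    have "scal r * Y = Y * (X * scal r) * Y" using assms by (simp flip: mult.assoc)
    also have "\<dots> = Y * scal r * (X * Y)" unfolding comm[symmetric] by (simp add: mult.assoc)
    finally show ?thesis using assms by simp
  qed
  then have "ent (scal r * Y) x y = ent (Y * scal r) x y" for r x y by simp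
  then show ?thesis by (simp add: central_op_def ent_scal_mult ent_mult_scal)
qed

text \<open>\<open>trace_conjugate\<close> with \<open>X\<close> exchanging the two blocks,
  \<open>V\<close> the two fusion products in the order of the first trace, and \<open>W\<close> the
  same products with the tensor legs exchanged. Passing the fusion products reverses the parameters
  of each block, whence \<open>A'\<close> and \<open>B'\<close>.\<close>

theorem traces_commute:
  assumes ca: "cancels ca" and cb: "cancels cb"
    and F: "fusD m as F" "length as = m" and G: "fusD n bs G" "length bs = n"
    and delta: "\<And>a b. a \<in> set (param ca as) \<Longrightarrow> b \<in> set (param cb bs) \<Longrightarrow> O.H.delta b a dvd 1"
    and qF: "scal k1 * (F * tF * F) = scal k2 * F" and k2: "k2 \<noteq> 0"
    and qG: "scal k3 * (G * tG * G) = scal k4 * G" and k4: "k4 \<noteq> 0"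
  shows "trm m (op_hecke.lprod m l 0 (param ca as) * mS (diag_op m d * F * tF))
        * trm n (op_hecke.lprod n l 0 (param cb bs) * mS (diag_op n d * G * tG))
      = trm n (op_hecke.lprod n l 0 (param cb bs) * mS (diag_op n d * G * tG))
        * trm m (op_hecke.lprod m l 0 (param ca as) * mS (diag_op m d * F * tF))"
proof -
  \<comment> \<open>The block sizes are exchanged in order to merge the two traces in the opposite
    order.\<close>
  interpret R: rll_setting eZ q qi l d n m by unfold_locales
  define A B where "A = param ca as" and "B = param cb bs"
  define A' B' where "A' = param ca (rev as)" and "B' = param cb (rev bs)"
  have len: "length A = m" "length B = n" "length A' = m" "length B' = n" 
    using F G by (simp_all add: A_def B_def A'_def B'_def param_def)
  define f1 g2 g1 f2 where "f1 = amp1 m n (mS F)" and "g2 = amp2 m n (mS G)"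
    and "g1 = amp1 n m (mS G)" and "f2 = amp2 n m (mS F)"
  define t t' where "t = amp1 m n (mS tF) * amp2 m n (mS tG)" and "t' = amp1 n m (mS tG) * amp2 n m (mS tF)"
  define D where "D = mS (diag_op M d)"
  have LB: "LL (B @ A) * g1 = g1 * LL (B' @ A)"
    unfolding B_def B'_def g1_def
    using LL_exchange[OF cb _ _ G, of "[]" _ A] place_amp1' len by simp
  have LA: "LL (B' @ A) * f2 = f2 * LL (B' @ A')"
    unfolding A_def A'_def f2_def
    using LL_exchange[OF ca _ _ F, of B' _ "[]"] place_amp2' len by simp
  have X1: "XX A B * f2 = f1 * XX A' B"
    unfolding A_def A'_def f1_def f2_def
    by (rule XX_exchange_left[OF ca place_amp1 place_amp2' len(2) F])
  have X2: "XX A' B * g1 = g2 * XX A' B'"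
    unfolding B_def B'_def g1_def g2_def
    by (rule XX_exchange_right[OF cb place_amp2 place_amp1' len(3) G])
  have gf: "g1 * f2 = f2 * g1" unfolding g1_def f2_def by (rule amp1_amp2_commute[OF central_mS])
  have XW: "XX A B * (g1 * f2) = f1 * g2 * XX A' B'"
    using X1 X2 unfolding gf by (simp add: mult.assoc) (simp flip: mult.assoc, simp add: mult.assoc)
  have K: "LL (A @ B) * XX A B = XX A B * LL (B @ A)"
    using swap_system_moveB[OF O.lprod_swap_system[OF rll], of "[]" A B "[]"] len by simp
  have DT: "D * O.T k = O.T k * D" if "Suc k < M" for k
  proof -
    have "mS (diag_op M d) * mS (hecke_op M q qi k) = mS (hecke_op M q qi k) * mS (diag_op M d)"
      by (simp only: diag_hecke_commute[OF that] flip: rhom.map_mult[OF rS])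
    moreover have "mS (hecke_op M q qi k) = O.T k"
    proof -
      have "ent (hecke_op p (fps_const q) (fps_const qi) k) x y = fps_const (ent (hecke_op p q qi k) x y)" for p and x y :: "'n list"
        unfolding hecke_op_def ent_Op by simp
      then show ?thesis by (intro op_eqI) (simp add: rhom.ent_map[OF rhom] rhom.ent_map[OF rS])
    qed
    ultimately show ?thesis by (simp add: D_def)
  qed
  have DX: "D * XX A B = XX A B * D"
  proof -
    have "D * RR k u v = RR k u v * D" if "Suc k < M" for k u v
      using that DT by (intro O.H.RR_commute) auto
    then have "D * moveR RR j b A = moveR RR j b A * D" if "j < n" for j b
      using that len by (intro O.H.commute_moveR) auto
    then have "D * moveB RR j A vs = moveB RR j A vs * D" if "j + length vs \<le> n" for j vs
      using that
    proof (induction vs arbitrary: j)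
      case (Cons v vs)
      then show ?case unfolding moveB.simps by (intro commute_mult) auto
    qed simp
    then show ?thesis using len by simp
  qed
  have Df: "D * f2 = f2 * D" unfolding f2_def
    by (rule commute_exchange[OF DT place_amp2' F])
  have Dg: "D * g1 = g1 * D" unfolding g1_def
    by (rule commute_exchange[OF DT place_amp1' G])
  have "LL (B @ A) * D * (g1 * f2) = LL (B @ A) * (g1 * f2) * D"
    using commute_mult[OF Dg Df] by (simp add: mult.assoc)
  also have "LL (B @ A) * (g1 * f2) = g1 * f2 * LL (B' @ A')"
    using LB LA by (simp flip: mult.assoc) (simp add: mult.assoc)
  finally have KW: "LL (B @ A) * D * (g1 * f2) = g1 * f2 * (LL (B' @ A') * D)" by (simp add: mult.assoc)
  have idem: "OS.sm c1 (mS (X * Y * X)) = OS.sm c2 (mS X)" if "scal c1 * (X * Y * X) = scal c2 * X" for c1 c2 X Y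
    using arg_cong[OF that, of "\<lambda>X. mS X"] by (simp add: rhom.map_mult[OF rS] rhom.map_scal[OF rS] OS.sm_def)
  have amp_sm: "amp1 p p' (OS.sm c X) = OS.sm c (amp1 p p' X)" "amp2 p p' (OS.sm c X) = OS.sm c (amp2 p p' X)" for p p' c X
    by (simp_all add: OS.sm_def rhom.mult[OF amp1_rhom] rhom.mult[OF amp2_rhom] amp_scal)
  have quasi: "OS.sm (c1 * c3) ((amp1 p p' (mS X) * amp2 p p' (mS Y)) * (amp1 p p' (mS s) * amp2 p p' (mS s')) * (amp1 p p' (mS X) * amp2 p p' (mS Y)))
      = OS.sm (c2 * c4) (amp1 p p' (mS X) * amp2 p p' (mS Y))"
    if "scal c1 * (X * s * X) = scal c2 * X" "scal c3 * (Y * s' * Y) = scal c4 * Y" for c1 c2 c3 c4 X Y s s' p p'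
  proof -
    have c: "amp2 p p' (mS Y) * amp1 p p' (mS X) = amp1 p p' (mS X) * amp2 p p' (mS Y)" for X Y
      by (rule amp1_amp2_commute[OF central_mS, symmetric])
    then have c': "amp2 p p' (mS Y) * (amp1 p p' (mS X) * r) = amp1 p p' (mS X) * (amp2 p p' (mS Y) * r)" for X Y r
      by (simp flip: mult.assoc)
    have "(amp1 p p' (mS X) * amp2 p p' (mS Y)) * (amp1 p p' (mS s) * amp2 p p' (mS s')) * (amp1 p p' (mS X) * amp2 p p' (mS Y))
       = amp1 p p' (mS (X * s * X)) * amp2 p p' (mS (Y * s' * Y))"
      by (simp add: rhom.mult[OF amp1_rhom] rhom.mult[OF amp2_rhom] rhom.map_mult[OF rS] mult.assoc c c')
    then have "OS.sm (c1 * c3) ((amp1 p p' (mS X) * amp2 p p' (mS Y)) * (amp1 p p' (mS s) * amp2 p p' (mS s')) * (amp1 p p' (mS X) * amp2 p p' (mS Y)))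
       = amp1 p p' (OS.sm c1 (mS (X * s * X))) * amp2 p p' (OS.sm c3 (mS (Y * s' * Y)))"
      by (simp add: amp_sm OS.sm_simps mult.commute)
    then show ?thesis
      unfolding idem[OF that(1)] idem[OF that(2)] by (simp add: amp_sm OS.sm_simps mult.commute)
  qed
  obtain Xi where Xi: "XX A B * Xi = 1" "Xi * XX A B = 1"
    using O.H.moveB_invertible[of 0 A B] len delta by (auto simp: A_def B_def)
  \<comment> \<open>Reversal does not change the set of parameters, so the same scalars are
    units.\<close>
  obtain Xi' where Xi': "XX A' B' * Xi' = 1"
    using O.H.moveB_invertible[of 0 A' B'] len delta by (auto simp: A'_def B'_def param_def)
  have "trm M (LL (A @ B) * (D * (f1 * g2) * t)) = trm M (LL (B @ A) * (D * (g1 * f2) * t'))"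
  proof (rule trace_conjugate[OF Xi Xi' XW K DX KW])
    show "OS.sm (k1 * k3) (f1 * g2 * t * (f1 * g2)) = OS.sm (k2 * k4) (f1 * g2)"
      unfolding f1_def g2_def t_def by (rule quasi[OF qF qG])
    have "OS.sm (k3 * k1) (g1 * f2 * t' * (g1 * f2)) = OS.sm (k4 * k2) (g1 * f2)"
      unfolding g1_def f2_def t'_def by (rule quasi[OF qG qF])
    then show "OS.sm (k1 * k3) (g1 * f2 * t' * (g1 * f2)) = OS.sm (k2 * k4) (g1 * f2)"
      by (simp add: mult.commute)
    show "k2 * k4 \<noteq> 0" using k2 k4 by simp
    show "central_op (f1 * g2 * t)" unfolding f1_def g2_def t_def
      by (intro central_op_mult central_op_amp central_mS)
    show "central_op Xi" by (rule central_inverse[OF central_XX Xi])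
  qed
  then show ?thesis
    unfolding A_def[symmetric] B_def[symmetric] trace_product[OF len(1,2)] R.trace_product[OF len(2,1)]
    unfolding D_def f1_def g1_def g2_def f2_def t_def t'_def add.commute[of n m] .
qed

end

section \<open>The series of the h-Yangian\<close>

lemma sum_lists_2: "(\<Sum>z :: 'n::finite list | length z = 2. f z) = (\<Sum>a\<in>UNIV. \<Sum>b\<in>UNIV. f [a, b])"
proof -
  define g :: "'n \<times> 'n \<Rightarrow> 'n list" where "g = (\<lambda>p. [fst p, snd p])"
  have 1: "{z :: 'n list. length z = 2} = range g"
    by (auto simp: numeral_2_eq_2 length_Suc_conv g_def image_iff)
  have "inj g" by (auto simp: inj_def g_def prod_eq_iff)
  then have "(\<Sum>z :: 'n list | length z = 2. f z) = (\<Sum>p\<in>UNIV. f (g p))"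
    unfolding 1 by (simp add: sum.reindex)
  also have "\<dots> = (\<Sum>(a, b)\<in>UNIV \<times> UNIV. f [a, b])"
    by (rule sum.cong) (auto simp: g_def)
  finally show ?thesis by (simp add: sum.cartesian_product)
qed

lemma atLeastAtMost_12: "{1..2 :: nat} - {1} = {2}" "{1..2 :: nat} - {2} = {1}"
  by auto

lemma site_2:
  "site 2 1 A [a, b] [c, d] = (if b = d then A a c else 0)"
  "site 2 2 A [a, b] [c, d] = (if a = c then A b d else 0)"
  unfolding site_def atLeastAtMost_12 by simp_all

lemma tmult_tone_2: "tmult 2 A (tone 2) [a, b] [c, d] = A [a, b] [c, d]"
  for A :: "('n::finite, 'a::ring_1) tmat"
proof -
  have "(\<Sum>z :: 'n list | length z = 2. A [a, b] z * (if z = [c, d] then 1 else 0))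
     = (\<Sum>z :: 'n list | length z = 2. if z = [c, d] then A [a, b] z else 0)"
    by (rule sum.cong) auto
  then show ?thesis by (simp add: tmult_def tone_def sum_lists_delta)
qed

lemma tmult_2: "tmult 2 A B [a, b] [c, d] = (\<Sum>i\<in>UNIV. \<Sum>j\<in>UNIV. A [a, b] [i, j] * B [i, j] [c, d])"
  for A :: "('n::finite, 'a::ring_1) tmat"
  by (simp add: tmult_def sum_lists_2)

lemma tprod_RLL:
  fixes A B :: "'n::finite \<Rightarrow> 'n \<Rightarrow> 'a::ring_1"
  shows "tprod 2 [R, site 2 1 A, site 2 2 B] [a, b] [c, d]
    = (\<Sum>i\<in>UNIV. \<Sum>j\<in>UNIV. R [a, b] [i, j] * (A i c * B j d))"
proof -
  have "tmult 2 (site 2 1 A) (tmult 2 (site 2 2 B) (tone 2)) [i, j] [c, d] = A i c * B j d" for i j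
  proof -
    have "(\<Sum>b\<in>UNIV. (if j = b then A i a else 0) * (if a = c then B b d else 0)) =
      (if a = c then A i a * B j d else 0)" for a
      by (subst sum.cong[OF refl, where h = "\<lambda>b. if b = j then (if a = c then A i a * B j d else 0) else 0"]) auto
    moreover have "tmult 2 (site 2 2 B) (tone 2) [i, j] [c, d] = (if i = c then B j d else 0)" for i j
      by (simp only: tmult_tone_2 site_2)
    ultimately show ?thesis unfolding tmult_2[of "site 2 1 A"] site_2 by simp
  qed
  then show ?thesis by (simp only: tprod_def foldr.simps o_def id_def tmult_2[of R])
qed

lemma tprod_LLR:
  fixes A B :: "'n::finite \<Rightarrow> 'n \<Rightarrow> 'a::ring_1"
  shows "tprod 2 [site 2 2 B, site 2 1 A, R] [a, b] [c, d]
    = (\<Sum>i\<in>UNIV. \<Sum>j\<in>UNIV. B b j * A a i * R [i, j] [c, d])"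
proof -
  have 1: "tmult 2 (site 2 1 A) X [i, j] [c, d] = (\<Sum>k\<in>UNIV. A i k * X [k, j] [c, d])" for i j X
  proof -
    have "(\<Sum>b\<in>UNIV. (if j = b then A i a else 0) * X [a, b] [c, d]) = A i a * X [a, j] [c, d]" for a
      by (subst sum.cong[OF refl, where h = "\<lambda>b. if b = j then A i a * X [a, j] [c, d] else 0"]) auto
    then show ?thesis unfolding tmult_2 site_2 by simp
  qed
  have 2: "tmult 2 (site 2 2 B) X [i, j] [c, d] = (\<Sum>k\<in>UNIV. B j k * X [i, k] [c, d])" for i j X
  proof -
    have "(\<Sum>b\<in>UNIV. (if i = a then B j b else 0) * X [a, b] [c, d]) =
        (if a = i then \<Sum>b\<in>UNIV. B j b * X [i, b] [c, d] else 0)" for a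
      by auto
    then show ?thesis unfolding tmult_2 site_2 by simp
  qed
  have "tprod 2 [site 2 2 B, site 2 1 A, R] [a, b] [c, d]
      = (\<Sum>j\<in>UNIV. \<Sum>i\<in>UNIV. B b j * A a i * R [i, j] [c, d])"
    by (simp only: tprod_def foldr.simps o_def id_def 1 2 tmult_tone_2 sum_distrib_left mult.assoc)
  also have "\<dots> = (\<Sum>i\<in>UNIV. \<Sum>j\<in>UNIV. B b j * A a i * R [i, j] [c, d])"
    by (rule sum.swap)
  finally show ?thesis .
qed

lemma rbar_entry:
  fixes s z :: "'a::{comm_ring_1,inverse}" and a b c d :: "'n::{finite,linorder}"
  shows "rbar s z [a, b] [c, d] =
    (if a = b then if c = a \<and> d = a then 1 else 0
     else if c = a \<and> d = b then s * ((1 - z) / (1 - z * s\<^sup>2))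
     else if c = b \<and> d = a then (if b < a then ((1 - s\<^sup>2) * z) / (1 - z * s\<^sup>2) else (1 - s\<^sup>2) / (1 - z * s\<^sup>2))
     else 0)"
proof -
  have 1: "(\<Sum>i\<in>UNIV. unit2 i i i i [a, b] [c, d]) = (if a = b \<and> c = a \<and> d = a then 1 else 0 :: 'a)"
    by (subst sum.cong[OF refl, where h = "\<lambda>i. if i = a then if a = b \<and> c = a \<and> d = a then 1 else 0 else 0"])
      (auto simp: unit2_def)
  have D: "(\<Sum>(i, j) | P i j. unit2 i i j j [a, b] [c, d]) = (if P a b \<and> c = a \<and> d = b then 1 else 0 :: 'a)" for P
  proof -
    have "(\<Sum>(i, j) | P i j. unit2 i i j j [a, b] [c, d])
        = (\<Sum>p\<in>{(i, j). P i j}. if p = (a, b) then if c = a \<and> d = b then 1 else 0 else 0 :: 'a)"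
      by (rule sum.cong) (auto simp: unit2_def split: if_splits)
    then show ?thesis by (simp add: sum.delta)
  qed
  have S: "(\<Sum>(i, j) | P i j. unit2 i j j i [a, b] [c, d]) = (if P a b \<and> c = b \<and> d = a then 1 else 0 :: 'a)" for P
  proof -
    have "(\<Sum>(i, j) | P i j. unit2 i j j i [a, b] [c, d])
        = (\<Sum>p\<in>{(i, j). P i j}. if p = (a, b) then if c = b \<and> d = a then 1 else 0 else 0 :: 'a)"
      by (rule sum.cong) (auto simp: unit2_def split: if_splits)
    then show ?thesis by (simp add: sum.delta)
  qed
  have less: "\<not> b < a \<Longrightarrow> a \<noteq> b \<Longrightarrow> a < b" by simp
  show ?thesis unfolding rbar_def 1 D S
    by (cases "a = b"; cases "b < a"; cases "c = a \<and> d = b"; cases "c = b \<and> d = a")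
      (simp_all add: less less_imp_not_less, blast+)
qed

section \<open>The RLL relation for the coefficients of the L-series\<close>

definition "sD = fps_exp (- 1/2 :: complex)"
abbreviation "qD \<equiv> fps_exp (1/2 :: complex)"

lemma qD_sD: "qD * sD = 1"
  unfolding sD_def by (simp flip: fps_exp_add_mult)

text \<open>\<open>(1 - s\<^sup>2 z) R(z) = RA + z RB\<close>\<close>

definition RA :: "('n::{finite,linorder}, complex fps) tmat" where
  "RA x y = (let a = x ! 0; b = x ! 1; c = y ! 0; d = y ! 1 in
    if a = b then if c = a \<and> d = a then 1 else 0 else if c = a \<and> d = b then sD
    else if c = b \<and> d = a then (if b < a then 0 else 1 - sD\<^sup>2) else 0)"

definition RB :: "('n::{finite,linorder}, complex fps) tmat" where
  "RB x y = (let a = x ! 0; b = x ! 1; c = y ! 0; d = y ! 1 in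
    if a = b then if c = a \<and> d = a then - sD\<^sup>2 else 0 else if c = a \<and> d = b then - sD
    else if c = b \<and> d = a then (if b < a then 1 - sD\<^sup>2 else 0) else 0)"

lemma fps_divide_mult_cancel:
  fixes p g :: "complex fps fps"
  assumes "fps_nth g 0 = 1"
  shows "g * (p / g) = p"
proof -
  have "subdegree g = 0" "g \<noteq> 0" using assms by (auto simp: subdegree_eq_0_iff)
  then have "p / g = p * inverse g" by (simp add: fps_divide_def)
  moreover have "g * inverse g = 1"
    unfolding fps_inverse_def[of g] by (rule fps_right_inverse) (simp add: assms)
  ultimately show ?thesis by (simp add: mult_ac)
qed

lemma rbar_RA_RB:
  "(1 - fps_X * (fps_const sD)\<^sup>2) * rbar (fps_const sD) fps_X [a, b] [c, d]
   = fps_const (RA [a, b] [c, d]) + fps_X * fps_const (RB [a, b] [c, d])"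
proof -
  define S where "S = fps_const sD"
  let ?g = "1 - fps_X * S\<^sup>2"
  have g: "?g * (p / ?g) = p" for p by (rule fps_divide_mult_cancel) (simp add: power2_eq_square)
  have g': "?g * (r * (p / ?g)) = r * p" for p r using g[of p] by (simp add: mult.left_commute)
  have c: "fps_const (1 - sD\<^sup>2) = 1 - S\<^sup>2" "fps_const (- (sD\<^sup>2)) = - (S\<^sup>2)" "fps_const (- sD) = - S"
    by (simp_all add: S_def power2_eq_square flip: fps_const_sub fps_const_neg)
  consider "a = b" "c = a \<and> d = a" | "a = b" "\<not> (c = a \<and> d = a)" | "a \<noteq> b" "c = a \<and> d = b"
    | "a \<noteq> b" "c = b \<and> d = a" "b < a" | "a \<noteq> b" "c = b \<and> d = a" "\<not> b < a"
    | "a \<noteq> b" "\<not> (c = a \<and> d = b)" "\<not> (c = b \<and> d = a)" by blast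
  then have "?g * rbar S fps_X [a, b] [c, d]
   = fps_const (RA [a, b] [c, d]) + fps_X * fps_const (RB [a, b] [c, d])"
  proof cases
    case 1
    then have "RA [a, b] [c, d] = 1" "RB [a, b] [c, d] = - (sD\<^sup>2)" "rbar S fps_X [a, b] [c, d] = 1"
      by (simp_all add: RA_def RB_def rbar_entry)
    then show ?thesis by (simp only: c) simp
  next
    case 3
    then have "?g * rbar S fps_X [a, b] [c, d] = S * (1 - fps_X)"
      unfolding rbar_entry by (simp only: g' simp_thms if_True if_False)
    moreover have "RA [a, b] [c, d] = sD" "RB [a, b] [c, d] = - sD" using 3 by (simp_all add: RA_def RB_def)
    ultimately show ?thesis by (simp only: c S_def[symmetric]) (simp add: algebra_simps)
  next
    case 4
    then have "?g * rbar S fps_X [a, b] [c, d] = (1 - S\<^sup>2) * fps_X"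
      unfolding rbar_entry by (auto simp only: g simp_thms if_True if_False)
    moreover have "RA [a, b] [c, d] = 0" "RB [a, b] [c, d] = 1 - sD\<^sup>2" using 4 by (auto simp: RA_def RB_def)
    ultimately show ?thesis by (simp only: c) (simp add: mult.commute)
  next
    case 5
    then have "?g * rbar S fps_X [a, b] [c, d] = 1 - S\<^sup>2"
      unfolding rbar_entry by (auto simp only: g simp_thms if_True if_False)
    moreover have "RA [a, b] [c, d] = 1 - sD\<^sup>2" "RB [a, b] [c, d] = 0" using 5 by (auto simp: RA_def RB_def)
    ultimately show ?thesis by (simp only: c) simp
  qed (unfold rbar_entry RA_def RB_def Let_def, auto)
  then show ?thesis by (simp only: S_def)
qed

text \<open>Comparison of coefficients in \<open>rbar_RA_RB\<close>: the geometric expansion of the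
  denominator becomes a recursion of length one, disturbed only at the first power of
  \<open>z\<close>.\<close>

lemma rbar_coeff_rec:
  "rbar_coeff 0 [a, b] [c, d] = RA [a, b] [c, d]"
  "rbar_coeff (Suc k) [a, b] [c, d] = sD\<^sup>2 * rbar_coeff k [a, b] [c, d] + (if k = 0 then RB [a, b] [c, d] else 0)"
proof -
  let ?r = "rbar (fps_const sD) (fps_X :: complex fps fps) [a, b] [c, d]"
  have *: "?r = fps_const (RA [a, b] [c, d]) + fps_X * fps_const (RB [a, b] [c, d]) + fps_X * (fps_const (sD\<^sup>2) * ?r)"
    using rbar_RA_RB[of a b c d] by (simp add: algebra_simps fps_const_power)
  show "rbar_coeff 0 [a, b] [c, d] = RA [a, b] [c, d]"
    unfolding rbar_coeff_def sD_def[symmetric] by (subst *) simp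
  show "rbar_coeff (Suc k) [a, b] [c, d] = sD\<^sup>2 * rbar_coeff k [a, b] [c, d] + (if k = 0 then RB [a, b] [c, d] else 0)"
    unfolding rbar_coeff_def sD_def[symmetric] by (subst *) simp
qed

definition ycoeff :: "nat \<Rightarrow> 'n::{finite,linorder} \<Rightarrow> 'n \<Rightarrow> 'n h_yangian" where
  "ycoeff r i j = (if r = 0 \<and> i = j then 1 else 0) - yscalar fps_X * ygen i j r"

lemma free_scalar_X: "free_scalar fps_X = (fps_X :: 'n hfree)"
  by (auto simp: fps_eq_iff free_scalar_def fps_X_def)

lemma abs_yangian_hom:
  "abs_h_yangian (a + b) = abs_h_yangian a + abs_h_yangian b"
  "abs_h_yangian (a - b) = abs_h_yangian a - abs_h_yangian b"
  "abs_h_yangian (a * b) = abs_h_yangian a * abs_h_yangian b"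
  "abs_h_yangian 0 = 0" "abs_h_yangian 1 = 1"
  by (simp_all add: plus_h_yangian.abs_eq minus_h_yangian.abs_eq times_h_yangian.abs_eq
      zero_h_yangian.abs_eq one_h_yangian.abs_eq)

lemma abs_yangian_sum: "abs_h_yangian (\<Sum>i\<in>A. f i) = (\<Sum>i\<in>A. abs_h_yangian (f i))"
  by (induction A rule: infinite_finite_induct) (simp_all add: abs_yangian_hom)

lemma abs_yangian_lcoeff: "abs_h_yangian (free_lcoeff r i j) = ycoeff r i j"
  by (simp add: free_lcoeff_def ycoeff_def abs_yangian_hom yscalar.abs_eq ygen.abs_eq free_scalar_X)

lemma abs_yangian_relator: "abs_h_yangian (rll_relator p t x y) = 0"
  using rll_relator_in_ideal[of p t x y]
  by (simp add: zero_h_yangian.abs_eq Quotient3_rel_abs[OF Quotient3_h_yangian] rll_cong_def)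

lemma free_scalar_ring:
  "free_scalar 1 = (1 :: 'n hfree)" "free_scalar (c + d) = (free_scalar c + free_scalar d :: 'n hfree)"
  "free_scalar (c * d) = (free_scalar c * free_scalar d :: 'n hfree)"
  and free_scalar_central: "r * free_scalar c = (free_scalar c * r :: 'n hfree)"
proof -
  have z: "Poly_Mapping.single 0 x * (Poly_Mapping.single 0 y :: ('n \<times> 'n \<times> nat) word \<Rightarrow>\<^sub>0 complex) = Poly_Mapping.single 0 (x * y)" for x y
    by (simp add: mult_single)
  have s: "Poly_Mapping.single 0 (\<Sum>i\<in>A. f i) = (\<Sum>i\<in>A. Poly_Mapping.single 0 (f i) :: ('n \<times> 'n \<times> nat) word \<Rightarrow>\<^sub>0 complex)" for A and f :: "nat \<Rightarrow> complex"
    by (induction A rule: infinite_finite_induct) (simp_all add: single_add)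
  have c: "(p :: ('n \<times> 'n \<times> nat) word \<Rightarrow>\<^sub>0 complex) * Poly_Mapping.single 0 x = Poly_Mapping.single 0 x * p" for p x
  proof (induction p rule: update_induct)
    case (update p a b)
    then have "Poly_Mapping.update a b p = p + Poly_Mapping.single a b"
      by (intro poly_mapping_eqI) (auto simp: lookup_update lookup_add lookup_single in_keys_iff)
    then show ?case using update by (simp add: distrib_left distrib_right mult_single mult.commute)
  qed simp
  show "free_scalar 1 = (1 :: 'n hfree)" by (auto simp: fps_eq_iff free_scalar_def)
  show "free_scalar (c + d) = (free_scalar c + free_scalar d :: 'n hfree)"
    by (simp add: fps_eq_iff free_scalar_def single_add)
  show "free_scalar (c * d) = (free_scalar c * free_scalar d :: 'n hfree)"
    by (simp add: fps_eq_iff free_scalar_def fps_mult_nth s z)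
  show "r * free_scalar c = (free_scalar c * r :: 'n hfree)"
  proof (rule fps_ext)
    fix k
    have "fps_nth (r * free_scalar c) k = (\<Sum>i=0..k. Poly_Mapping.single 0 (fps_nth c (k - i)) * fps_nth r i)"
      by (simp add: fps_mult_nth free_scalar_def c)
    also have "\<dots> = (\<Sum>i=0..k. Poly_Mapping.single 0 (fps_nth c i) * fps_nth r (k - i))"
      by (rule sum.reindex_bij_witness[where i = "\<lambda>i. k - i" and j = "\<lambda>i. k - i"]) auto
    finally show "fps_nth (r * free_scalar c) k = fps_nth (free_scalar c * r) k"
      by (simp add: fps_mult_nth free_scalar_def)
  qed
qed

lemma calg_yscalar: "calg (yscalar :: complex fps \<Rightarrow> 'n::{finite,linorder} h_yangian)"
proof
  show "yscalar 1 = (1 :: 'n h_yangian)" by transfer (simp add: free_scalar_ring rll_cong_def rll_ideal_zero)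
  show "yscalar (x + y) = (yscalar x + yscalar y :: 'n h_yangian)" for x y
    by transfer (simp add: free_scalar_ring rll_cong_def rll_ideal_zero)
  show "yscalar (x * y) = (yscalar x * yscalar y :: 'n h_yangian)" for x y
    by transfer (simp add: free_scalar_ring rll_cong_def rll_ideal_zero)
  show "r * yscalar x = (yscalar x * r :: 'n h_yangian)" for x r
    by transfer (simp add: free_scalar_central rll_cong_def rll_ideal_zero)
qed

lemma dalg_yscalar: "dalg (yscalar :: complex fps \<Rightarrow> 'n::{finite,linorder} h_yangian)"
proof -
  interpret calg "yscalar :: complex fps \<Rightarrow> 'n h_yangian" by (rule calg_yscalar)
  have X: "yscalar (fps_X ^ k) * r = 0 \<Longrightarrow> r = 0" for k and r :: "'n h_yangian"
  proof (induction k)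
    case (Suc k)
    then have "yscalar fps_X * (yscalar (fps_X ^ k) * r) = 0" by (simp add: e_mult mult.assoc)
    then show ?case using Suc.IH yscalar_X_mult_eq_0 by blast
  qed (simp add: e_one)
  show ?thesis
  proof
    fix c and r :: "'n h_yangian"
    assume *: "yscalar c * r = 0"
    show "c = 0 \<or> r = 0"
    proof (cases "c = 0")
      case False
      have c: "c = unit_factor c * fps_X ^ subdegree c" by (rule fps_unit_factor_decompose)
      have "is_unit (unit_factor c)" using False by simp
      then obtain u where u: "u * unit_factor c = 1" by (metis dvdE mult.commute)
      have "yscalar u * (yscalar c * r) = yscalar (u * unit_factor c) * (yscalar (fps_X ^ subdegree c) * r)"
        by (subst c) (simp add: e_mult mult.assoc)
      then have "yscalar (fps_X ^ subdegree c) * r = 0" using * u by (simp add: e_one)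
      then show ?thesis using X by blast
    qed simp
  next
    fix r :: "'n h_yangian" assume "\<And>n. \<exists>s. r = yscalar (fps_X ^ n) * s"
    then show "r = 0" by (rule h_yangian_separated)
  qed
qed

text \<open>The image in the h-Yangian of one summand of the relator, for the coefficients
  \<open>r\<close> and \<open>s\<close> of the two L-operators and an arbitrary matrix
  \<open>R\<close>.\<close>

definition brack :: "('n, complex fps) tmat \<Rightarrow> nat \<Rightarrow> nat \<Rightarrow> 'n \<Rightarrow> 'n \<Rightarrow> 'n \<Rightarrow> 'n \<Rightarrow> 'n::{finite,linorder} h_yangian" where
  "brack R r s a b c d =
     (\<Sum>i\<in>UNIV. \<Sum>j\<in>UNIV. yscalar (R [a, b] [i, j]) * (ycoeff r i c * ycoeff s j d))
     - (\<Sum>i\<in>UNIV. \<Sum>j\<in>UNIV. yscalar (R [i, j] [c, d]) * (ycoeff s b j * ycoeff r a i))"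

lemma relator_brack:
  "(\<Sum>(k, r, s) | int r = p + int k \<and> s + k = t. brack (rbar_coeff k) r s a b c d) = 0"
proof -
  interpret calg "yscalar :: complex fps \<Rightarrow> 'a h_yangian" by (rule calg_yscalar)
  have "abs_h_yangian (tprod 2 [tmap free_scalar R, site 2 1 (free_lcoeff r), site 2 2 (free_lcoeff s)] [a, b] [c, d]
        - tprod 2 [site 2 2 (free_lcoeff s), site 2 1 (free_lcoeff r), tmap free_scalar R] [a, b] [c, d])
      = brack R r s a b c d" for R r s
    unfolding tprod_RLL tprod_LLR
    by (simp add: abs_yangian_hom abs_yangian_sum abs_yangian_lcoeff tmap_def brack_def
        yscalar.abs_eq[symmetric] e_central[of "ycoeff _ _ _ * ycoeff _ _ _"])
  then have "abs_h_yangian (rll_relator p t [a, b] [c, d])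
      = (\<Sum>(k, r, s) | int r = p + int k \<and> s + k = t. brack (rbar_coeff k) r s a b c d)"
    unfolding rll_relator_def abs_yangian_sum by (simp add: case_prod_beta)
  then show ?thesis by (simp add: abs_yangian_relator)
qed

lemma brack_sum: "(\<Sum>k\<le>t. brack (rbar_coeff k) (r + k) (t - k) a b c d) = 0"
proof -
  have "(\<Sum>(k, r, s) | int r = int r' + int k \<and> s + k = t. brack (rbar_coeff k) r s a b c d)
      = (\<Sum>k\<le>t. brack (rbar_coeff k) (r' + k) (t - k) a b c d)" for r'
  proof -
    have [simp]: "int x = int r' + int k \<longleftrightarrow> x = r' + k" for x k by auto
    show ?thesis by (rule sum.reindex_bij_witness[where i = "\<lambda>k. (k, r' + k, t - k)" and j = fst]) auto
  qed
  then show ?thesis using relator_brack[where p = "int r" and t = t and a = a and b = b and c = c and d = d] by simp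
qed

text \<open>The relator at \<open>p = - 1\<close>. There \<open>r = k - 1\<close>, so the constant
  term of the R-matrix is absent and the sum starts with its coefficient of index 1.\<close>

lemma brack_sum_Suc: "(\<Sum>k\<le>t. brack (rbar_coeff (Suc k)) k (t - k) a b c d) = 0"
proof -
  have "(\<Sum>(k, r, s) | int r = - 1 + int k \<and> s + k = Suc t. brack (rbar_coeff k) r s a b c d)
      = (\<Sum>k\<le>t. brack (rbar_coeff (Suc k)) k (t - k) a b c d)"
  proof -
    have [simp]: "int x = int k - 1 \<longleftrightarrow> k = Suc x" for x k by auto
    show ?thesis by (rule sum.reindex_bij_witness[where i = "\<lambda>k. (Suc k, k, t - k)" and j = "\<lambda>p. fst p - 1"]) auto
  qed
  then show ?thesis using relator_brack[where p = "- 1" and t = "Suc t" and a = a and b = b and c = c and d = d] by simp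
qed

lemma brack_rbar_0: "brack (rbar_coeff 0) r s a b c d = brack RA r s a b c d"
  by (simp add: brack_def rbar_coeff_rec)

lemma brack_rbar_Suc:
  "brack (rbar_coeff (Suc k)) r s a b c d
   = yscalar (sD\<^sup>2) * brack (rbar_coeff k) r s a b c d + (if k = 0 then brack RB r s a b c d else 0)"
proof -
  interpret calg "yscalar :: complex fps \<Rightarrow> 'a h_yangian" by (rule calg_yscalar)
  show ?thesis
    by (simp add: brack_def rbar_coeff_rec e_add e_mult e_zero distrib_left distrib_right right_diff_distrib
        sum.distrib sum_distrib_left mult.assoc)
qed

text \<open>The denominator \<open>1 - s^2 z1/z2\<close> of the R-matrix is cleared: by the
  recursion, all but the last correction term of a relator add up to a multiple of a relator that
  vanishes already. What is left is the polynomial relation \<open>RA + (z1/z2) RB\<close>, with two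
  boundary cases.\<close>

lemma brack_relations:
  "brack RA r 0 a b c d = 0" "brack RB 0 s a b c d = 0"
  "brack RA r (Suc s) a b c d + brack RB (Suc r) s a b c d = 0"
proof -
  have sum: "(\<Sum>k\<le>s. brack (rbar_coeff (Suc k)) (r + k) (s - k) a b c d) = brack RB r s a b c d" for r
    by (simp add: brack_rbar_Suc sum.distrib sum.delta brack_sum flip: sum_distrib_left)
  show "brack RA r 0 a b c d = 0" using brack_sum[of r 0 a b c d] by (simp add: brack_rbar_0)
  show "brack RB 0 s a b c d = 0" using sum[of 0] brack_sum_Suc[of s a b c d] by simp
  have "(\<Sum>k\<le>Suc s. brack (rbar_coeff k) (r + k) (Suc s - k) a b c d)
      = brack (rbar_coeff 0) r (Suc s) a b c d + (\<Sum>k\<le>s. brack (rbar_coeff (Suc k)) (Suc r + k) (s - k) a b c d)"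
    by (subst sum.atMost_Suc_shift) simp
  then show "brack RA r (Suc s) a b c d + brack RB (Suc r) s a b c d = 0"
    unfolding brack_sum sum brack_rbar_0 by simp
qed

lemma sum_pair_delta:
  fixes g :: "'n::finite \<Rightarrow> 'n \<Rightarrow> 'a::ring_1"
  shows "(\<Sum>i\<in>UNIV. \<Sum>j\<in>UNIV. (if i = a \<and> j = b then u else 0) * g i j) = u * g a b"
proof -
  have "(\<Sum>j\<in>UNIV. (if i = a \<and> j = b then u else 0) * g i j) = (if i = a then u * g a b else 0)" for i
    by (subst sum.cong[OF refl, where h = "\<lambda>j. if j = b then (if i = a then u * g a b else 0) else 0"]) auto
  then show ?thesis by simp
qed

text \<open>The row indices occur as \<open>j i\<close> because \<open>rll_family\<close> describes
  the R-matrix preceded by the flip. The factor \<open>q\<close> normalises the entries: the first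
  equation gives the coefficient of \<open>u\<close> in \<open>rll_family\<close>, the second that
  of \<open>v\<close>.\<close>

lemma brack_RA_RB:
  fixes y :: "nat \<Rightarrow> 'n::{finite,linorder} \<Rightarrow> 'n \<Rightarrow> 'n h_yangian"
  defines "y \<equiv> ycoeff"
  shows "yscalar qD * brack RA r s j i c d =
     (if i = j then yscalar qD * (y r i c * y s i d) else y r j c * y s i d + (if j < i then yscalar (qD - sD) * (y r i c * y s j d) else 0))
     - (if c = d then yscalar qD * (y s i c * y r j c) else y s i d * y r j c + (if d < c then yscalar (qD - sD) * (y s i c * y r j d) else 0))"
    and "yscalar qD * brack RB r s j i c d =
     (if i = j then yscalar (- sD) * (y r i c * y s i d) else - (y r j c * y s i d) + (if i < j then yscalar (qD - sD) * (y r i c * y s j d) else 0))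
     - (if c = d then yscalar (- sD) * (y s i c * y r j c) else - (y s i d * y r j c) + (if c < d then yscalar (qD - sD) * (y s i c * y r j d) else 0))"
proof -
  interpret calg "yscalar :: complex fps \<Rightarrow> 'n h_yangian" by (rule calg_yscalar)
  let ?Y = "yscalar :: complex fps \<Rightarrow> 'n h_yangian"
  define s' where "s' = sD"
  have qs: "qD * s' = 1" "s' * qD = 1" using qD_sD by (simp_all add: s'_def mult.commute)
  then have q: "qD * (1 - s'\<^sup>2) = qD - s'" "qD * (- (s'\<^sup>2)) = - s'" "qD * - s' = - 1"
    by (simp_all add: power2_eq_square right_diff_distrib flip: mult.assoc)
  have "qD * s'\<^sup>2 = s'" using qs by (simp add: power2_eq_square flip: mult.assoc)
  note qs = qs this
  have e_minus: "?Y (- x) = - ?Y x" for x using e_diff[of 0 x] by (simp add: e_zero)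
  have neq: "x < z \<Longrightarrow> x \<noteq> z" for x z :: 'n by simp
  have "?Y (RA [j, i] [i', j']) = (if i = j then if i' = i \<and> j' = i then 1 else 0 else
      (if i' = j \<and> j' = i then ?Y sD else 0) + (if i' = i \<and> j' = j then ?Y (if i < j then 0 else 1 - sD\<^sup>2) else 0))"
    "?Y (RB [j, i] [i', j']) = (if i = j then if i' = i \<and> j' = i then ?Y (- (sD\<^sup>2)) else 0 else
      (if i' = j \<and> j' = i then ?Y (- sD) else 0) + (if i' = i \<and> j' = j then ?Y (if i < j then 1 - sD\<^sup>2 else 0) else 0))"
    "?Y (RA [i', j'] [c, d]) = (if c = d then if i' = c \<and> j' = c then 1 else 0 else
      (if i' = c \<and> j' = d then ?Y sD else 0) + (if i' = d \<and> j' = c then ?Y (if c < d then 0 else 1 - sD\<^sup>2) else 0))"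
    "?Y (RB [i', j'] [c, d]) = (if c = d then if i' = c \<and> j' = c then ?Y (- (sD\<^sup>2)) else 0 else
      (if i' = c \<and> j' = d then ?Y (- sD) else 0) + (if i' = d \<and> j' = c then ?Y (if c < d then 1 - sD\<^sup>2 else 0) else 0))"
    for i' j'
    by (auto simp: RA_def RB_def Let_def e_zero e_one)
  note entries = this
  have S: "(\<Sum>i'\<in>UNIV. \<Sum>j'\<in>UNIV. (if P then if i' = a \<and> j' = b then u else 0 else
      (if i' = a' \<and> j' = b' then u' else 0) + (if i' = a'' \<and> j' = b'' then u'' else 0)) * g i' j')
      = (if P then u * g a b else u' * g a' b' + u'' * g a'' b'')" for P a b a' b' a'' b'' u u' u'' and g :: "'n \<Rightarrow> 'n \<Rightarrow> 'n h_yangian"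
    by (simp add: distrib_right sum.distrib sum_pair_delta)
  have yy: "?Y u * (?Y v * r) = ?Y (u * v) * r" for u v r by (simp add: e_mult mult.assoc)
  show "yscalar qD * brack RA r s j i c d =
     (if i = j then yscalar qD * (y r i c * y s i d) else y r j c * y s i d + (if j < i then yscalar (qD - sD) * (y r i c * y s j d) else 0))
     - (if c = d then yscalar qD * (y s i c * y r j c) else y s i d * y r j c + (if d < c then yscalar (qD - sD) * (y s i c * y r j d) else 0))"
    unfolding brack_def entries S y_def[symmetric] s'_def[symmetric]
    by (cases i j rule: linorder_cases; cases c d rule: linorder_cases)
      (auto simp: right_diff_distrib distrib_left yy q qs e_one e_zero e_minus neq neq[symmetric] dest: less_asym)
  show "yscalar qD * brack RB r s j i c d =
     (if i = j then yscalar (- sD) * (y r i c * y s i d) else - (y r j c * y s i d) + (if i < j then yscalar (qD - sD) * (y r i c * y s j d) else 0))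
     - (if c = d then yscalar (- sD) * (y s i c * y r j c) else - (y s i d * y r j c) + (if c < d then yscalar (qD - sD) * (y s i c * y r j d) else 0))"
    unfolding brack_def entries S y_def[symmetric] s'_def[symmetric]
    by (cases i j rule: linorder_cases; cases c d rule: linorder_cases)
      (auto simp: right_diff_distrib distrib_left yy q qs e_one e_zero e_minus neq neq[symmetric] dest: less_asym)
qed

section \<open>Extension of scalars to power series\<close>

lemma calg_fps_const: "calg e \<Longrightarrow> calg (\<lambda>c. fps_const (e c) :: 'r::ring_1 fps)"
proof -
  assume "calg e"
  then interpret calg e .
  have "fps_nth (r * fps_const (e c)) n = fps_nth (fps_const (e c) * r) n" for r c n
    by (simp add: e_central[of "fps_nth r n"])
  then show ?thesis by unfold_locales (auto simp: e_one e_add e_mult fps_eq_iff)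
qed

lemma dalg_fps_const: "dalg e \<Longrightarrow> dalg (\<lambda>c. fps_const (e c) :: 'r::ring_1 fps)"
proof -
  assume "dalg e"
  then interpret dalg e .
  interpret f: calg "\<lambda>c. fps_const (e c) :: 'r fps" by (rule calg_fps_const) (rule calg_axioms)
  show ?thesis
  proof
    fix c and r :: "'r fps" assume *: "fps_const (e c) * r = 0"
    have "e c * fps_nth r n = 0" for n
      using arg_cong[OF *, of "\<lambda>r. fps_nth r n"] by simp
    then have "c = 0 \<or> fps_nth r n = 0" for n by (rule torsion_free)
    then show "c = 0 \<or> r = 0" by (auto simp: fps_eq_iff)
  next
    fix r :: "'r fps" assume *: "\<And>n. \<exists>s. r = fps_const (e (fps_X ^ n)) * s"
    have "fps_nth r k = 0" for k
    proof (rule separated)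
      fix n
      obtain s where "r = fps_const (e (fps_X ^ n)) * s" using * by blast
      then have "fps_nth r k = e (fps_X ^ n) * fps_nth s k" by simp
      then show "\<exists>s. fps_nth r k = e (fps_X ^ n) * s" ..
    qed
    then show "r = 0" by (simp add: fps_eq_iff)
  qed
qed

definition map_fps :: "('a \<Rightarrow> 'b) \<Rightarrow> 'a fps \<Rightarrow> 'b fps" where
  "map_fps f p = Abs_fps (\<lambda>n. f (fps_nth p n))"

lemma calg_map_fps:
  assumes "calg e"
  shows "calg (map_fps e :: 'p::comm_ring_1 fps \<Rightarrow> 'r::ring_1 fps)"
proof -
  interpret calg e by fact
  interpret r: rhom e by (rule rhom)
  show ?thesis
  proof
    show "map_fps e 1 = 1" by (simp add: map_fps_def fps_eq_iff e_one e_zero)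
    show "map_fps e (x + y) = map_fps e x + map_fps e y" for x y by (simp add: map_fps_def fps_eq_iff e_add)
    show "map_fps e (x * y) = map_fps e x * map_fps e y" for x y
      by (simp add: map_fps_def fps_eq_iff fps_mult_nth r.sum e_mult)
    show "r * map_fps e x = map_fps e x * r" for r x
    proof (rule fps_ext)
      fix k
      have "fps_nth (r * map_fps e x) k = (\<Sum>i=0..k. e (fps_nth x (k - i)) * fps_nth r i)"
        by (simp add: fps_mult_nth map_fps_def e_central[of "fps_nth r _"])
      also have "\<dots> = (\<Sum>i=0..k. e (fps_nth x i) * fps_nth r (k - i))"
        by (rule sum.reindex_bij_witness[where i = "\<lambda>i. k - i" and j = "\<lambda>i. k - i"]) auto
      finally show "fps_nth (r * map_fps e x) k = fps_nth (map_fps e x * r) k"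
        by (simp add: fps_mult_nth map_fps_def)
    qed
  qed
qed


definition ymap :: "complex fps fps \<Rightarrow> 'n::{finite,linorder} h_yangian fps" where
  "ymap = map_fps yscalar"

definition yZ :: "complex fps fps \<Rightarrow> 'n::{finite,linorder} h_yangian fps fps" where
  "yZ p = fps_const (ymap p)"

text \<open>The L-series with \<open>z^-1 = p t\<close>, where \<open>t\<close> is the outer
  variable. Spectral parameters thus enter through their inverses, and \<open>z1/z2\<close>
  corresponds to \<open>v/u\<close>.\<close>

definition ygenser :: "complex fps fps \<Rightarrow> 'n \<Rightarrow> 'n \<Rightarrow> 'n::{finite,linorder} h_yangian fps fps" where
  "ygenser p i j = Abs_fps (\<lambda>r. ymap (p ^ r) * fps_const (ycoeff r i j))"

lemma calg_ymap: "calg (ymap :: complex fps fps \<Rightarrow> 'n::{finite,linorder} h_yangian fps)"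
  unfolding ymap_def by (rule calg_map_fps[OF calg_yscalar])

lemma calg_yZ: "calg (yZ :: complex fps fps \<Rightarrow> 'n::{finite,linorder} h_yangian fps fps)"
proof -
  have "calg (\<lambda>p. fps_const (ymap p) :: 'n h_yangian fps fps)" by (rule calg_fps_const[OF calg_ymap])
  then show ?thesis unfolding yZ_def[abs_def] .
qed

lemma ymap_const: "ymap (fps_const c) = fps_const (yscalar c)"
proof -
  interpret calg "yscalar :: complex fps \<Rightarrow> 'a h_yangian" by (rule calg_yscalar)
  show ?thesis by (simp add: ymap_def map_fps_def fps_eq_iff e_zero)
qed

lemma ymap_X: "ymap fps_X = fps_X"
proof -
  interpret calg "yscalar :: complex fps \<Rightarrow> 'a h_yangian" by (rule calg_yscalar)
  show ?thesis by (simp add: ymap_def map_fps_def fps_eq_iff fps_X_def e_zero e_one)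
qed

lemma rll_ygenser: "rll_family yZ (fps_const qD) (fps_const sD) (ygenser :: complex fps fps \<Rightarrow> 'n::{finite,linorder} \<Rightarrow> _)"
  unfolding rll_family_def
proof (intro allI)
  fix u v :: "complex fps fps" and i j c d :: 'n
  interpret m: calg "ymap :: complex fps fps \<Rightarrow> 'n h_yangian fps" by (rule calg_ymap)
  interpret y: calg "yscalar :: complex fps \<Rightarrow> 'n h_yangian" by (rule calg_yscalar)
  let ?Q = "fps_const qD" and ?S = "fps_const sD"
  let ?C = "fps_const :: 'n h_yangian \<Rightarrow> 'n h_yangian fps"
  let ?y = "ycoeff :: nat \<Rightarrow> 'n \<Rightarrow> 'n \<Rightarrow> 'n h_yangian"
  let ?L = "if i = j then yZ (u * ?Q - v * ?S) * (ygenser u i c * ygenser v i d)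
      else yZ (u - v) * (ygenser u j c * ygenser v i d) + yZ ((?Q - ?S) * (if j < i then u else v)) * (ygenser u i c * ygenser v j d)"
  let ?R = "if c = d then yZ (u * ?Q - v * ?S) * (ygenser v i c * ygenser u j c)
      else yZ (u - v) * (ygenser v i d * ygenser u j c) + yZ ((?Q - ?S) * (if d < c then u else v)) * (ygenser v i c * ygenser u j d)"
  define X1 X2 where "X1 r s = yscalar qD * brack RA r s j i c d" and "X2 r s = yscalar qD * brack RB r s j i c d" for r s
  show "?L = ?R"
  proof (rule fps_ext)
    fix N
    define t where "t P f = (\<Sum>r\<le>N. ymap (P * (u ^ r * v ^ (N - r))) * ?C (f r (N - r)))" for P and f :: "nat \<Rightarrow> nat \<Rightarrow> 'n h_yangian"
    have t_add: "t P (\<lambda>r s. f r s + g r s) = t P f + t P g" "t P (\<lambda>r s. f r s - g r s) = t P f - t P g"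
      "t P (\<lambda>r s. - f r s) = - t P f" "t (P + P') f = t P f + t P' f" "t (P - P') f = t P f - t P' f" for P P' f g
      by (simp_all add: t_def distrib_left distrib_right left_diff_distrib right_diff_distrib m.e_add m.e_diff
          sum.distrib sum_subtractf sum_negf flip: fps_const_add fps_const_sub fps_const_neg)
    have t_const: "t (P * fps_const q) f = t P (\<lambda>r s. yscalar q * f r s)" for P q f
    proof -
      have "ymap (P * fps_const q * w) * ?C z = ymap (P * w) * ?C (yscalar q * z)" for w z
      proof -
        have "ymap (P * fps_const q * w) = ymap (P * w) * ?C (yscalar q)"
          by (simp only: ymap_const[symmetric] m.e_mult[symmetric] mult.assoc mult.commute[of w])
        then show ?thesis by (simp add: mult.assoc)
      qed
      then show ?thesis by (simp add: t_def)
    qed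
    have t1: "fps_nth (yZ P * (ygenser u a b * ygenser v a' b')) N = t P (\<lambda>r s. ?y r a b * ?y s a' b')" for P a b a' b'
    proof -
      have "ymap P * (ymap p * ?C z * (ymap p' * ?C z')) = ymap (P * (p * p')) * ?C (z * z')" for p p' z z'
      proof -
        have "ymap p * ?C z * (ymap p' * ?C z') = ymap p * (?C z * ymap p') * ?C z'" by (simp only: mult.assoc)
        also have "\<dots> = ymap p * ymap p' * (?C z * ?C z')" unfolding m.e_central[of "?C z"] by (simp only: mult.assoc)
        finally show ?thesis by (simp add: m.e_mult mult.assoc)
      qed
      then show ?thesis
        unfolding yZ_def fps_mult_left_const_nth
        by (simp add: ygenser_def t_def fps_mult_nth sum_distrib_left atMost_atLeast0)
    qed
    have t2: "fps_nth (yZ P * (ygenser v a b * ygenser u a' b')) N = t P (\<lambda>r s. ?y s a b * ?y r a' b')" for P a b a' b'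
    proof -
      have "ymap P * (ymap p * ?C z * (ymap p' * ?C z')) = ymap (P * (p' * p)) * ?C (z * z')" for p p' z z'
      proof -
        have "ymap p * ?C z * (ymap p' * ?C z') = ymap p * (?C z * ymap p') * ?C z'" by (simp only: mult.assoc)
        also have "\<dots> = ymap p * ymap p' * (?C z * ?C z')" unfolding m.e_central[of "?C z"] by (simp only: mult.assoc)
        also have "ymap p * ymap p' = (ymap (p' * p) :: 'n h_yangian fps)" unfolding mult.commute[of p'] m.e_mult ..
        finally show ?thesis by (simp add: m.e_mult mult.assoc)
      qed
      then have "fps_nth (yZ P * (ygenser v a b * ygenser u a' b')) N
          = (\<Sum>r=0..N. ymap (P * (u ^ (N - r) * v ^ r)) * ?C (?y r a b * ?y (N - r) a' b'))"
        unfolding yZ_def fps_mult_left_const_nth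
        by (simp add: ygenser_def fps_mult_nth sum_distrib_left)
      also have "\<dots> = t P (\<lambda>r s. ?y s a b * ?y r a' b')"
        unfolding t_def atMost_atLeast0
        by (rule sum.reindex_bij_witness[where i = "\<lambda>r. N - r" and j = "\<lambda>r. N - r"]) auto
      finally show ?thesis .
    qed
    have y_minus: "yscalar (- p) * z = - (yscalar p * z)" for p and z :: "'n h_yangian"
      using y.e_diff[of 0 p] by (simp add: y.e_zero)
    have if_L: "(\<lambda>r s. if P then f r s else g r s) = (if P then f else g)" for P and f g :: "nat \<Rightarrow> nat \<Rightarrow> 'n h_yangian"
      by auto
    \<comment> \<open>Since \<open>z1/z2 = v/u\<close>, the polynomial relation
      \<open>RA + (z1/z2) RB\<close>, multiplied by \<open>q u\<close>, is the combination of
      \<open>X1\<close> and \<open>X2\<close> on the right.\<close>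
    have L: "fps_nth ?L N - fps_nth ?R N = t u X1 + t v X2"
      unfolding X1_def X2_def brack_RA_RB t_add if_L if_distrib[of "t _"]
      by (cases "i = j"; cases "c = d"; cases "i < j"; cases "j < i"; cases "c < d"; cases "d < c")
        (simp_all add: t1 t2 t_add t_const y_minus left_diff_distrib right_diff_distrib mult.commute[of _ u] mult.commute[of _ v])
    \<comment> \<open>The boundary relations remove the last term of the first sum and the term 0 of
      the second; after a shift both run over \<open>r < N\<close>.\<close>
    have "t u X1 = (\<Sum>r<N. ymap (u * (u ^ r * v ^ (N - r))) * ?C (X1 r (N - r)))"
      by (simp add: t_def lessThan_Suc_atMost[symmetric] X1_def brack_relations)
    moreover have "t v X2 = (\<Sum>r<N. ymap (v * (u ^ Suc r * v ^ (N - Suc r))) * ?C (X2 (Suc r) (N - Suc r)))"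
      unfolding t_def lessThan_Suc_atMost[symmetric] by (subst sum.lessThan_Suc_shift) (simp add: X2_def brack_relations)
    \<comment> \<open>Both terms carry the monomial of degree \<open>r + 1\<close> in
      \<open>u\<close> and \<open>N - r\<close> in \<open>v\<close>, so the two-term relation
      applies.\<close>
    moreover have "ymap (u * (u ^ r * v ^ (N - r))) * ?C (X1 r (N - r))
        + ymap (v * (u ^ Suc r * v ^ (N - Suc r))) * ?C (X2 (Suc r) (N - Suc r)) = 0" if "r < N" for r
    proof -
      define s where "s = N - Suc r"
      have s: "N - r = Suc s" "N - Suc r = s" using that by (auto simp: s_def)
      have "X1 r (Suc s) + X2 (Suc r) s = 0"
        unfolding X1_def X2_def by (simp add: brack_relations flip: distrib_left)
      then have "ymap (u * (u ^ r * v ^ Suc s)) * (?C (X1 r (Suc s)) + ?C (X2 (Suc r) s)) = 0" by simp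
      moreover have "v * (u ^ Suc r * v ^ s) = u * (u ^ r * v ^ Suc s)" by (simp add: mult_ac)
      ultimately show ?thesis unfolding s by (simp only: distrib_left)
    qed
    ultimately have "t u X1 + t v X2 = 0" by (simp flip: sum.distrib)
    then show "fps_nth ?L N = fps_nth ?R N" using L by simp
  qed
qed

section \<open>Evaluation of rational functions\<close>

lemma subst_one_superset:
  assumes "finite A" "Poly_Mapping.keys p \<subseteq> A"
  shows "subst_one k p = (\<Sum>t\<in>A. Poly_Mapping.single (Poly_Mapping.update k 0 t) (Poly_Mapping.lookup p t))"
  unfolding subst_one_def using assms by (intro sum.mono_neutral_left) (auto simp: in_keys_iff)

lemma subst_one_add: "subst_one k (p + r) = subst_one k p + subst_one k r"
proof -
  let ?A = "Poly_Mapping.keys p \<union> Poly_Mapping.keys r"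
  have "Poly_Mapping.keys (p + r) \<subseteq> ?A" by (rule Poly_Mapping.keys_add)
  then show ?thesis
    by (simp add: subst_one_superset[of ?A] lookup_add single_add sum.distrib)
qed

lemma subst_one_single: "subst_one k (Poly_Mapping.single t c) = Poly_Mapping.single (Poly_Mapping.update k 0 t) c"
proof -
  have "Poly_Mapping.keys (Poly_Mapping.single t c) \<subseteq> {t}" by simp
  then show ?thesis by (simp add: subst_one_superset[of "{t}"])
qed

lemma poly_mapping_add_induct [case_names zero add]:
  assumes "P 0" "\<And>p t c. P p \<Longrightarrow> P (p + Poly_Mapping.single t c)"
  shows "P (p :: 'a \<Rightarrow>\<^sub>0 'b::comm_monoid_add)"
proof (induction p rule: update_induct)
  case (update p a b)
  then have "Poly_Mapping.update a b p = p + Poly_Mapping.single a b"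
    by (intro poly_mapping_eqI) (auto simp: lookup_update lookup_add lookup_single in_keys_iff)
  then show ?case using update assms(2) by simp
qed (rule assms(1))

lemma subst_one_0: "subst_one k 0 = 0"
  by (simp add: subst_one_def)

lemma subst_one_mult: "subst_one k (p * r) = subst_one k p * subst_one k r"
proof -
  have u: "Poly_Mapping.update k 0 (s + t) = Poly_Mapping.update k 0 s + Poly_Mapping.update k 0 t" for s t :: "nat \<Rightarrow>\<^sub>0 nat"
    by (intro poly_mapping_eqI) (auto simp: lookup_update lookup_add)
  have "subst_one k (Poly_Mapping.single t c * r) = Poly_Mapping.single (Poly_Mapping.update k 0 t) c * subst_one k r" for t c
    by (induction r rule: poly_mapping_add_induct)
      (simp_all add: subst_one_0 subst_one_add subst_one_single distrib_left mult_single u)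
  then show ?thesis
    by (induction p rule: poly_mapping_add_induct)
      (simp_all add: subst_one_0 subst_one_add subst_one_single distrib_right)
qed

definition pconst :: "complex fps \<Rightarrow> zpoly" where "pconst c = Poly_Mapping.single 0 c"
definition pvar :: "nat \<Rightarrow> zpoly" where "pvar k = Poly_Mapping.single (Poly_Mapping.single k 1) 1"

lemma subst_one_const: "subst_one k (pconst c) = pconst c"
proof -
  have "Poly_Mapping.update k 0 0 = (0 :: nat \<Rightarrow>\<^sub>0 nat)"
    by (intro poly_mapping_eqI) (auto simp: lookup_update)
  then show ?thesis by (simp add: pconst_def subst_one_single)
qed

lemma pconst_ring: "pconst 0 = 0" "pconst 1 = 1" "pconst (c + d) = pconst c + pconst d" "pconst (c * d) = pconst c * pconst d"
  by (simp_all add: pconst_def single_add mult_single)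

lemma pconst_inj: "pconst c = pconst d \<longleftrightarrow> c = d"
  by (metis pconst_def lookup_single_eq)

lemma subst_one_1: "subst_one k 1 = 1"
  using subst_one_const[of k 1] by (simp add: pconst_ring)

lemma subst_one_var: "subst_one k (pvar i) = (if i = k then 1 else pvar i)"
proof -
  have "Poly_Mapping.update k 0 (Poly_Mapping.single k 1) = (0 :: nat \<Rightarrow>\<^sub>0 nat)"
    "i \<noteq> k \<Longrightarrow> Poly_Mapping.update k 0 (Poly_Mapping.single i 1) = (Poly_Mapping.single i 1 :: nat \<Rightarrow>\<^sub>0 nat)"
    by (auto intro!: poly_mapping_eqI simp: lookup_update lookup_single when_def)
  then show ?thesis by (auto simp: pvar_def subst_one_single)
qed

text \<open>Relational form of \<open>eval_one\<close>: regularity and value are carried together,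
  and both pass through sums and products.\<close>

definition evals :: "nat \<Rightarrow> zfun \<Rightarrow> zfun \<Rightarrow> bool" where
  "evals k f v \<longleftrightarrow> (\<exists>a b. f = Fract a b \<and> subst_one k b \<noteq> 0 \<and> v = Fract (subst_one k a) (subst_one k b))"

lemma evalsI: "subst_one k b \<noteq> 0 \<Longrightarrow> evals k (Fract a b) (Fract (subst_one k a) (subst_one k b))"
  unfolding evals_def by blast

lemma evals_unique: "evals k f v \<Longrightarrow> evals k f w \<Longrightarrow> v = w"
proof -
  assume "evals k f v" "evals k f w"
  then obtain a b c d where *: "f = Fract a b" "subst_one k b \<noteq> 0" "v = Fract (subst_one k a) (subst_one k b)"
    "f = Fract c d" "subst_one k d \<noteq> 0" "w = Fract (subst_one k c) (subst_one k d)"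
    unfolding evals_def by blast
  have "b \<noteq> 0" "d \<noteq> 0" using * by (auto simp: subst_one_0)
  then have "a * d = c * b" using * by (simp add: eq_fract)
  then have "subst_one k a * subst_one k d = subst_one k c * subst_one k b" by (metis subst_one_mult)
  then show ?thesis using * by (simp add: eq_fract)
qed

lemma regular_one_iff: "regular_one k f \<longleftrightarrow> (\<exists>v. evals k f v)"
  unfolding regular_one_def evals_def by blast

lemma eval_one_eq: "evals k f v \<Longrightarrow> eval_one k f = v"
  unfolding eval_one_def evals_def[symmetric] using evals_unique by blast

lemma evals_add: "evals k f v \<Longrightarrow> evals k g w \<Longrightarrow> evals k (f + g) (v + w)"
  and evals_mult: "evals k f v \<Longrightarrow> evals k g w \<Longrightarrow> evals k (f * g) (v * w)"
proof -
  assume "evals k f v" "evals k g w"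
  then obtain a b c d where *: "f = Fract a b" "subst_one k b \<noteq> 0" "v = Fract (subst_one k a) (subst_one k b)"
    "g = Fract c d" "subst_one k d \<noteq> 0" "w = Fract (subst_one k c) (subst_one k d)"
    unfolding evals_def by blast
  have nz: "b \<noteq> 0" "d \<noteq> 0" "subst_one k (b * d) \<noteq> 0" using * by (auto simp: subst_one_0 subst_one_mult)
  show "evals k (f + g) (v + w)"
    using evalsI[OF nz(3), of "a * d + c * b"] * nz by (simp add: subst_one_add subst_one_mult)
  show "evals k (f * g) (v * w)"
    using evalsI[OF nz(3), of "a * c"] * nz by (simp add: subst_one_mult)
qed

lemma evals_poly: "evals k (Fract p 1) (Fract (subst_one k p) 1)"
  using evalsI[of k 1 p] by (simp add: subst_one_1)

lemma zconst_pconst: "zconst c = Fract (pconst c) 1" and zvar_pvar: "zvar k = Fract (pvar k) 1"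
  by (simp_all add: zconst_def pconst_def zvar_def pvar_def)

lemma evals_const: "evals k (zconst c) (zconst c)"
  using evals_poly[of k "pconst c"] by (simp add: zconst_pconst subst_one_const)

lemma evals_var: "evals k (zvar i) (if i = k then 1 else zvar i)"
  using evals_poly[of k "pvar i"] by (auto simp: zvar_pvar subst_one_var One_fract_def)

lemma calg_zconst: "calg zconst"
  by standard (simp_all add: zconst_pconst pconst_ring One_fract_def mult.commute)

lemma zconst_ring: "zconst 0 = 0" "zconst 1 = 1" "zconst (c + d) = zconst c + zconst d"
  "zconst (c * d) = zconst c * zconst d" "zconst (c - d) = zconst c - zconst d"
proof -
  interpret calg zconst by (rule calg_zconst)
  show "zconst 0 = 0" "zconst 1 = 1" "zconst (c + d) = zconst c + zconst d"
    "zconst (c * d) = zconst c * zconst d" "zconst (c - d) = zconst c - zconst d"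
    by (simp_all add: e_zero e_one e_add e_mult e_diff)
qed

lemma zconst_inj: "zconst c = zconst d \<longleftrightarrow> c = d"
  by (simp add: zconst_pconst eq_fract pconst_inj)

lemma evals_0: "evals k 0 0" and evals_1: "evals k 1 1"
  using evals_const[of k 0] evals_const[of k 1] by (simp_all add: zconst_ring)

lemma evals_minus: "evals k f v \<Longrightarrow> evals k (- f) (- v)"
  using evals_mult[OF evals_const[of k "- 1"], of f v] zconst_ring(5)[of 0 1] by (simp add: zconst_ring)

lemma evals_diff: "evals k f v \<Longrightarrow> evals k g w \<Longrightarrow> evals k (f - g) (v - w)"
  using evals_add[OF _ evals_minus, of k f v g w] by simp

lemma evals_inverse:
  assumes "evals k f v" "v \<noteq> 0"
  shows "evals k (1 / f) (1 / v)"
proof -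
  obtain a b where *: "f = Fract a b" "subst_one k b \<noteq> 0" "v = Fract (subst_one k a) (subst_one k b)"
    using assms unfolding evals_def by blast
  have a: "subst_one k a \<noteq> 0" using * assms(2) by (auto simp: fract_collapse)
  then have "1 / f = Fract b a" "1 / v = Fract (subst_one k b) (subst_one k a)"
    using * by (simp_all add: One_fract_def)
  then show ?thesis using evalsI[OF a, of b] by simp
qed

lemma evals_sum: "(\<And>i. i \<in> A \<Longrightarrow> evals k (f i) (g i)) \<Longrightarrow> evals k (\<Sum>i\<in>A. f i) (\<Sum>i\<in>A. g i)"
  by (induction A rule: infinite_finite_induct) (auto intro: evals_0 evals_add)

lemma evals_prod_list: "list_all2 (evals k) xs ys \<Longrightarrow> evals k (prod_list xs) (prod_list ys)"
  by (induction xs ys rule: list_all2_induct) (auto intro: evals_1 evals_mult)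

lemma single_1_neq_0: "Poly_Mapping.single k (Suc 0) \<noteq> 0"
  by (metis lookup_single_eq lookup_zero nat.distinct(1))

text \<open>The substitution \<open>x = a z_k\<close> in a one-variable polynomial. Setting
  \<open>z_k = 1\<close> afterwards is evaluation at \<open>x = a\<close>, which links the rational
  fusion procedure with the polynomial one.\<close>

definition iota :: "nat \<Rightarrow> complex fps \<Rightarrow> complex fps poly \<Rightarrow> zpoly" where
  "iota k a p = poly (map_poly pconst p) (pconst a * pvar k)"

lemma map_poly_pconst: "map_poly pconst (p + r) = map_poly pconst p + map_poly pconst r"
  "map_poly pconst (p * r) = map_poly pconst p * map_poly pconst r"
proof -
  interpret Ring_Hom_Poly?: calg pconst by standard (simp_all add: pconst_ring mult.commute)
  show add: "map_poly pconst (p + r) = map_poly pconst p + map_poly pconst r" for p r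
    by (rule poly_eqI) (simp add: coeff_map_poly pconst_ring)
  have sum: "pconst (\<Sum>i\<in>A. f i) = (\<Sum>i\<in>A. pconst (f i))" for A and f :: "nat \<Rightarrow> complex fps"
    by (induction A rule: infinite_finite_induct) (simp_all add: pconst_ring)
  show "map_poly pconst (p * r) = map_poly pconst p * map_poly pconst r"
    by (rule poly_eqI) (simp add: coeff_map_poly pconst_ring coeff_mult sum)
qed

lemma iota_ring: "iota k a (p + r) = iota k a p + iota k a r" "iota k a (p * r) = iota k a p * iota k a r"
  "iota k a [:c:] = pconst c" "iota k a [:0, 1:] = pconst a * pvar k" "iota k a 0 = 0" "iota k a 1 = 1"
  by (simp_all add: iota_def map_poly_pconst map_poly_pCons pconst_ring)

lemma iota_pCons: "iota k a (pCons c p) = pconst c + pconst a * pvar k * iota k a p"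
  by (simp add: iota_def map_poly_pCons pconst_ring)

lemma subst_one_iota: "subst_one k (iota k a p) = pconst (poly p a)"
  by (induction p) (simp_all add: iota_ring iota_pCons subst_one_0 subst_one_add subst_one_mult subst_one_const subst_one_var pconst_ring)

text \<open>This is how regularity yields divisibility: setting \<open>z_k = 1\<close> makes the
  right-hand side vanish while \<open>b\<close> survives, so \<open>p\<close> has the root
  \<open>a\<close>; cancel one linear factor and repeat. For \<open>a \<noteq> 0\<close> the image
  of \<open>x - a\<close> has a nonzero constant coefficient and may be cancelled.\<close>

lemma iota_divides:
  assumes "iota k a p * b = iota k a ([:- a, 1:] ^ j * r) * c" "subst_one k b \<noteq> 0" "a \<noteq> 0"
  shows "[:- a, 1:] ^ j dvd p"
  using assms(1)
proof (induction j arbitrary: p)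
  case (Suc j)
  have "subst_one k (iota k a p * b) = 0"
    by (simp only: Suc.prems subst_one_mult subst_one_iota) (simp add: pconst_ring)
  then have "pconst (poly p a) = pconst 0" using assms(2) by (simp add: subst_one_mult subst_one_iota pconst_ring)
  then have "poly p a = 0" by (simp only: pconst_inj)
  then obtain p' where p: "p = [:- a, 1:] * p'" by (auto simp: poly_eq_0_iff_dvd)
  have nz: "iota k a [:- a, 1:] \<noteq> 0"
  proof
    assume *: "iota k a [:- a, 1:] = 0"
    have "poly [:- a, 1:] 0 = 0"
    proof -
      have "iota k a [:- a, 1:] = Poly_Mapping.single 0 (- a) + Poly_Mapping.single (Poly_Mapping.single k 1) a"
        by (simp add: iota_pCons iota_ring pconst_def pvar_def mult_single)
      then have "Poly_Mapping.lookup (iota k a [:- a, 1:]) 0 = - a"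
        by (simp add: lookup_add lookup_single single_1_neq_0)
      then show ?thesis using * by simp
    qed
    then show False using assms(3) by simp
  qed
  have "iota k a [:- a, 1:] * (iota k a p' * b) = iota k a [:- a, 1:] * (iota k a ([:- a, 1:] ^ j * r) * c)"
    using Suc.prems unfolding p power_Suc iota_ring(2) by (simp only: mult.assoc)
  then have "iota k a p' * b = iota k a ([:- a, 1:] ^ j * r) * c" using nz by simp
  then have "[:- a, 1:] ^ j dvd p'" by (rule Suc.IH)
  then show ?case unfolding p power_Suc by (rule mult_dvd_mono[OF dvd_refl])
qed simp

text \<open>If \<open>f\<close> is its own value at \<open>z_j = 1\<close>, then equality with
  \<open>c z_j\<close> forces \<open>f = c\<close> upon evaluation, hence \<open>c z_j = c\<close>,
  which is false.\<close>

lemma zvar_neq: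
  assumes "c \<noteq> 0" "evals j f f"
  shows "zconst c * zvar j - f \<noteq> 0"
proof
  assume "zconst c * zvar j - f = 0"
  then have f: "f = zconst c * zvar j" by simp
  then have "evals j f (zconst c)"
    using evals_mult[OF evals_const[of j c] evals_var[of j j]] by simp
  then have "f = zconst c" by (rule evals_unique[OF assms(2)])
  then have "zconst c * zvar j = zconst c" using f by (simp only:)
  then have "pconst c * pvar j = pconst c" by (simp add: zconst_pconst zvar_pvar eq_fract)
  then have "Poly_Mapping.lookup (Poly_Mapping.single (Poly_Mapping.single j (Suc 0)) c) 0
      = Poly_Mapping.lookup (Poly_Mapping.single 0 c) 0"
    by (simp add: pconst_def pvar_def mult_single)
  then show False using assms(1) by (simp add: lookup_single single_1_neq_0)
qed

section \<open>The fusion procedure\<close>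

text \<open>The polynomial R-matrix over an arbitrary commutative ring, so that it can be
  transported between power series, polynomials and rational functions by ring
  homomorphisms.\<close>

definition RRg :: "nat \<Rightarrow> 'p \<Rightarrow> 'p \<Rightarrow> nat \<Rightarrow> 'p \<Rightarrow> 'p \<Rightarrow> ('n::{finite,linorder}, 'p::comm_ring_1) op" where
  "RRg m q qi k u v = scal u * hecke_op m q qi k - scal v * hecke_inv m q qi k"

lemma ent_RRg:
  fixes q qi u v :: "'p::comm_ring_1" and x y :: "'n::{finite,linorder} list"
  assumes "q * qi = 1" "Suc k < m" "length x = m"
  shows "ent (RRg m q qi k u v) x y = (if x ! k = x ! Suc k then (u * q - v * qi) * (if x = y then 1 else 0)
     else (u - v) * (if swp k x = y then 1 else 0) + (q - qi) * (if x ! Suc k < x ! k then u else v) * (if x = y then 1 else 0))"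
proof -
  interpret O: op_hecke "\<lambda>x. x" q qi m "TYPE('n)"
    using assms(1) by (intro op_hecke.intro calg_self op_hecke_axioms.intro)
  have "RRg m q qi k u v = O.H.RR k u v"
    unfolding RRg_def by (simp only: O.H.RR_def O.H.sm_def) (simp only: map_op_self)
  then show ?thesis using O.RR_mult[OF assms(2,3), of u v 1 y] by (simp add: ent_one)
qed

lemma map_hecke:
  assumes "rhom f"
  shows "map_op f (hecke_op m q qi k :: ('n::{finite,linorder}, 'p::comm_ring_1) op) = hecke_op m (f q) (f qi) k"
    and "map_op f (hecke_inv m q qi k :: ('n, 'p) op) = hecke_inv m (f q) (f qi) k"
proof -
  interpret rhom f by fact
  have "ent (hecke_op m (f q) (f qi) k) x y = f (ent (hecke_op m q qi k) x y)" for x y :: "'n list"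
    unfolding hecke_op_def ent_Op by (simp add: zero one diff)
  then show "map_op f (hecke_op m q qi k :: ('n, 'p) op) = hecke_op m (f q) (f qi) k"
    by (intro op_eqI) (simp add: ent_map)
  then show "map_op f (hecke_inv m q qi k :: ('n, 'p) op) = hecke_inv m (f q) (f qi) k"
    by (simp add: hecke_inv_def map_diff map_scal diff)
qed

lemma map_RRg:
  assumes "rhom f"
  shows "map_op f (RRg m q qi k u v :: ('n::{finite,linorder}, 'p::comm_ring_1) op) = RRg m (f q) (f qi) k (f u) (f v)"
proof -
  interpret rhom f by fact
  show ?thesis by (simp add: RRg_def map_diff map_mult map_scal map_hecke[OF assms])
qed

lemma map_moveR_RRg:
  assumes "rhom f"
  shows "map_op f (moveR (RRg m q qi) l b as :: ('n::{finite,linorder}, 'p::comm_ring_1) op)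
    = moveR (RRg m (f q) (f qi)) l (f b) (map f as)"
proof -
  interpret rhom f by fact
  show ?thesis by (induction as arbitrary: l) (simp_all add: map_one map_mult map_RRg[OF assms])
qed

definition tmat_of :: "nat \<Rightarrow> ('n::finite, 'a::ring_1) op \<Rightarrow> ('n, 'a) tmat" where
  "tmat_of m X x y = (if length x = m \<and> length y = m then ent X x y else 0)"

lemma tmat_of_mult: "tmult m (tmat_of m X) (tmat_of m Y) = tmat_of m (X * Y)"
  by (intro ext) (auto simp: tmult_def tmat_of_def ent_mult)

lemma tmat_of_one: "tone m = tmat_of m 1"
  by (intro ext) (auto simp: tone_def tmat_of_def ent_one)

lemma tprod_tmat_of: "(\<And>x. x \<in> set xs \<Longrightarrow> f x = tmat_of m (g x)) \<Longrightarrow> tprod m (map f xs) = tmat_of m (prod_list (map g xs))"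
  unfolding tprod_def by (induction xs) (simp_all add: tmat_of_one tmat_of_mult)

lemma tmat_of_scal: "(\<lambda>x y. c * tmat_of m X x y) = tmat_of m (scal c * X)"
  by (intro ext) (simp add: tmat_of_def ent_scal_mult)

lemma tinv_tmat_of:
  assumes "X * Y = 1" "Y * X = 1"
  shows "tmult m (tmat_of m Z) (tinv m (tmat_of m X)) = tmat_of m (Z * Y)"
proof -
  have "tmult m (tmat_of m X) (tmat_of m Y) = tone m \<and> tmult m (tmat_of m Y) (tmat_of m X) = tone m"
    by (simp add: tmat_of_mult assms tmat_of_one)
  then have B: "tmult m (tmat_of m X) (tinv m (tmat_of m X)) = tone m"
    unfolding tinv_def by (rule someI2[where Q = "\<lambda>B. tmult m (tmat_of m X) B = tone m"]) blast
  \<comment> \<open>The chosen inverse is determined only on lists of length \<open>m\<close>.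
    Completed by \<open>Y\<close> elsewhere it becomes a right inverse in the ring, and uniqueness
    of inverses identifies it with \<open>Y\<close>.\<close>
  define B where "B = Op (\<lambda>x y. if length x = m then tinv m (tmat_of m X) x y else ent Y x y)"
  have "X * B = 1"
  proof (rule op_eqI)
    fix x y :: "'a list" assume len: "length x = length y"
    show "ent (X * B) x y = ent 1 x y"
    proof (cases "length x = m")
      case True
      have "ent (X * B) x y = tmult m (tmat_of m X) (tinv m (tmat_of m X)) x y"
        using len True by (auto simp: ent_mult tmult_def tmat_of_def B_def ent_Op intro!: sum.cong)
      then show ?thesis using len True by (simp add: B tone_def ent_one)
    next
      case False
      have "ent (X * B) x y = ent (X * Y) x y"
        unfolding ent_mult by (rule sum.cong) (use len False in \<open>auto simp: B_def ent_Op\<close>)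
      then show ?thesis by (simp add: assms)
    qed
  qed
  then have "Y * (X * B) = Y" by simp
  then have "B = Y" using assms by (simp flip: mult.assoc)
  then have "tmult m (tmat_of m Z) (tinv m (tmat_of m X)) x y = tmat_of m (Z * Y) x y" for x y
    by (auto simp: tmult_def tmat_of_def ent_mult B_def[symmetric] ent_Op
        dest: arg_cong[where f = "\<lambda>B. ent B _ y"] intro!: sum.cong)
      (simp add: B_def ent_Op flip: \<open>B = Y\<close>)
  then show ?thesis by (intro ext)
qed

abbreviation "qz \<equiv> zconst qD"
abbreviation "sz \<equiv> zconst sD"
abbreviation "RRz m \<equiv> RRg m qz sz"

lemma qz_sz: "qz * sz = 1" "sz * qz = 1"
  using qD_sD by (simp_all flip: zconst_ring add: mult.commute)

lemma zexp_half: "zexp (1/2) = qz" "zexp (- 1/2) = sz"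
  by (simp_all only: zexp_def sD_def)

text \<open>The Baxterised form: flip times \<open>rcheck z\<close> is
  \<open>(T - z T^-1) / (1 - z)\<close>. The second condition on \<open>z\<close> keeps the
  denominator of the R-matrix away from 0; it cancels against the normalising factor of
  \<open>rcheck\<close>.\<close>

lemma fusion_factor_RR:
  assumes ij: "1 \<le> i" "i < j" "j \<le> m" and z: "1 - z \<noteq> 0" "1 - z * sz\<^sup>2 \<noteq> 0"
  shows "(fusion_factor m i j z :: ('n::{finite,linorder}, zfun) tmat) = tmat_of m (scal (1 / (1 - z)) * RRz m (j - i - 1) 1 z)"
proof (intro ext)
  fix x y :: "'n list"
  define k where "k = j - i - 1"
  have k: "j - i = Suc k" "Suc k < m" using ij by (simp_all add: k_def)
  show "fusion_factor m i j z x y = tmat_of m (scal (1 / (1 - z)) * RRz m (j - i - 1) 1 z) x y"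
  proof (cases "length x = m \<and> length y = m")
    case True
    then have len: "length x = m" "length y = m" by simp_all
    have idx: "(\<forall>r\<in>{1..m} - {Suc k, Suc (Suc k)}. u ! (r - 1) = v ! (r - 1)) \<longleftrightarrow> (\<forall>r<m. r \<noteq> k \<and> r \<noteq> Suc k \<longrightarrow> u ! r = v ! r)"
      for u v :: "'n list"
    proof
      assume *: "\<forall>r\<in>{1..m} - {Suc k, Suc (Suc k)}. u ! (r - 1) = v ! (r - 1)"
      show "\<forall>r<m. r \<noteq> k \<and> r \<noteq> Suc k \<longrightarrow> u ! r = v ! r"
        using *[rule_format, of "Suc _"] by auto
    next
      assume *: "\<forall>r<m. r \<noteq> k \<and> r \<noteq> Suc k \<longrightarrow> u ! r = v ! r"
      show "\<forall>r\<in>{1..m} - {Suc k, Suc (Suc k)}. u ! (r - 1) = v ! (r - 1)"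
      proof
        fix r assume "r \<in> {1..m} - {Suc k, Suc (Suc k)}"
        then show "u ! (r - 1) = v ! (r - 1)" using *[rule_format, of "r - 1"] by (cases r) auto
      qed
    qed
    have perm: "perm_op [a, b] [c, d] = (if c = b \<and> d = a then 1 else 0 :: zfun)" for a b c d :: 'n
    proof -
      have "perm_op [a, b] [c, d] = (\<Sum>p\<in>UNIV. if p = (a, b) then if c = b \<and> d = a then 1 else 0 else 0 :: zfun)"
        unfolding perm_op_def by (rule sum.cong) (auto simp: unit2_def split: if_splits)
      then show ?thesis by simp
    qed
    have P: "site2 m (Suc k) (Suc (Suc k)) perm_op x w = (if w = swp k x then 1 else 0 :: zfun)" if "length w = m" for w
    proof -
      have "w = swp k x \<longleftrightarrow> (\<forall>r<m. r \<noteq> k \<and> r \<noteq> Suc k \<longrightarrow> x ! r = w ! r) \<and> w ! k = x ! Suc k \<and> w ! Suc k = x ! k"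
        (is "_ \<longleftrightarrow> ?rhs")
      proof
        assume ?rhs
        then show "w = swp k x" using that len k by (intro nth_equalityI) (auto simp: length_swp nth_swp)
      qed (use len k in \<open>auto simp: nth_swp\<close>)
      then show ?thesis using that len unfolding site2_def idx by (auto simp: perm)
    qed
    have "fusion_factor m i j z x y = (\<Sum>w | length w = m. if w = swp k x then site2 m (Suc k) (Suc (Suc k)) (rcheck z) w y else 0)"
      unfolding fusion_factor_def tmult_def k using True by (auto simp: P intro!: sum.cong)
    also have "\<dots> = site2 m (Suc k) (Suc (Suc k)) (rcheck z) (swp k x) y"
      using len by (simp add: sum_lists_delta length_swp)
    also have "\<dots> = (if \<forall>r<m. r \<noteq> k \<and> r \<noteq> Suc k \<longrightarrow> x ! r = y ! r
        then rcheck z [x ! Suc k, x ! k] [y ! k, y ! Suc k] else 0)"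
    proof -
      have "(\<forall>r<m. r \<noteq> k \<and> r \<noteq> Suc k \<longrightarrow> swp k x ! r = y ! r) \<longleftrightarrow> (\<forall>r<m. r \<noteq> k \<and> r \<noteq> Suc k \<longrightarrow> x ! r = y ! r)"
        using len k by (auto simp: nth_swp)
      then show ?thesis unfolding site2_def idx using len k by (auto simp: length_swp nth_swp)
    qed
    finally have lhs: "fusion_factor m i j z x y = \<dots>" .
    let ?P = "\<forall>r<m. r \<noteq> k \<and> r \<noteq> Suc k \<longrightarrow> x ! r = y ! r"
    have eq: "x = y \<longleftrightarrow> ?P \<and> y ! k = x ! k \<and> y ! Suc k = x ! Suc k"
      using len k by (auto intro!: nth_equalityI)
    have eqs: "swp k x = y \<longleftrightarrow> ?P \<and> y ! k = x ! Suc k \<and> y ! Suc k = x ! k"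
    proof
      assume "?P \<and> y ! k = x ! Suc k \<and> y ! Suc k = x ! k"
      then show "swp k x = y" using len k by (intro nth_equalityI) (auto simp: length_swp nth_swp)
    qed (use len k in \<open>auto simp: nth_swp\<close>)
    have qs: "qz - sz * z = qz * (1 - z * sz\<^sup>2)"
      using qz_sz by (simp add: right_diff_distrib power2_eq_square)
    have q2: "qz * (1 - sz\<^sup>2) = qz - sz"
      using qz_sz by (simp add: right_diff_distrib power2_eq_square flip: mult.assoc)
    have "rcheck z [b, a] [c, d] = 1 / (1 - z) *
       (if a = b then (qz - z * sz) * (if c = a \<and> d = b then 1 else 0)
        else (1 - z) * (if c = b \<and> d = a then 1 else 0) + (qz - sz) * (if b < a then 1 else z) * (if c = a \<and> d = b then 1 else 0))"
      for a b c d :: 'n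
    proof (cases "a = b")
      case True
      then show ?thesis unfolding rcheck_def zexp_half rbar_entry by (simp add: mult.commute[of z])
    next
      case False
      have "rcheck z [b, a] [c, d] = (1 / (1 - z)) * ((qz - sz * z) * rbar sz z [b, a] [c, d])"
        unfolding rcheck_def zexp_half by simp
      also have "(qz - sz * z) * rbar sz z [b, a] [c, d] =
        (if c = b \<and> d = a then (1 - z) else if c = a \<and> d = b then (qz - sz) * (if b < a then 1 else z) else 0)"
      proof -
        have g: "qz * (1 - z * sz\<^sup>2) * (w / (1 - z * sz\<^sup>2)) = qz * w" for w using z(2) by simp
        have w: "sz * ((1 - z) / (1 - z * sz\<^sup>2)) = (sz * (1 - z)) / (1 - z * sz\<^sup>2)" by simp
        have q3: "qz * (sz * (1 - z)) = 1 - z" "qz * ((1 - sz\<^sup>2) * z) = (qz - sz) * z"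
          using qz_sz q2 by (simp_all flip: mult.assoc)
        consider "c = b \<and> d = a" | "c = a \<and> d = b" "a < b" | "c = a \<and> d = b" "b < a" | "\<not> (c = b \<and> d = a)" "\<not> (c = a \<and> d = b)"
          using False by (meson linorder_neqE)
        then show ?thesis
        proof cases
          case 1
          then have "rbar sz z [b, a] [c, d] = (sz * (1 - z)) / (1 - z * sz\<^sup>2)"
            unfolding rbar_entry w using False by auto
          then show ?thesis using 1 unfolding qs by (simp only: g q3 simp_thms if_True)
        next
          case 2
          then have nb: "\<not> b < a" "c \<noteq> b" using False by auto
          then have "rbar sz z [b, a] [c, d] = ((1 - sz\<^sup>2) * z) / (1 - z * sz\<^sup>2)"
            unfolding rbar_entry using 2 False by auto
          then show ?thesis using 2 nb unfolding qs by (simp only: g q3 simp_thms if_True if_False)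
        next
          case 3
          then have na: "\<not> a < b" "c \<noteq> b" using False by auto
          then have "rbar sz z [b, a] [c, d] = (1 - sz\<^sup>2) / (1 - z * sz\<^sup>2)"
            unfolding rbar_entry using 3 False by auto
          then show ?thesis using 3 na unfolding qs by (simp only: g q2 simp_thms if_True if_False mult_1_right)
        next
          case 4
          then show ?thesis using False unfolding rbar_entry by auto
        qed
      qed
      finally show ?thesis using False by auto
    qed
    note rc = this
    have "ent (scal (1 / (1 - z)) * RRz m k 1 z) x y = 1 / (1 - z) *
       (if x ! k = x ! Suc k then (qz - z * sz) * (if x = y then 1 else 0)
        else (1 - z) * (if swp k x = y then 1 else 0) + (qz - sz) * (if x ! Suc k < x ! k then 1 else z) * (if x = y then 1 else 0))"
      unfolding ent_scal_mult ent_RRg[OF qz_sz(1) k(2) len(1)] by simp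
    define P where "P = ?P"
    note eqP = eq[folded P_def] eqs[folded P_def] lhs[folded P_def]
    have rhs: "tmat_of m (scal (1 / (1 - z)) * RRz m k 1 z) x y = ent (scal (1 / (1 - z)) * RRz m k 1 z) x y"
      using len by (simp add: tmat_of_def)
    show ?thesis
      unfolding eqP(3) k_def[symmetric] rhs \<open>ent _ x y = _\<close> rc eqP(1,2)
      by (cases P) simp_all
  next
    case False
    then show ?thesis by (auto simp: fusion_factor_def tmult_def tmat_of_def)
  qed
qed

definition ev_op :: "nat \<Rightarrow> nat \<Rightarrow> ('n, zfun) op \<Rightarrow> ('n, zfun) op \<Rightarrow> bool" where
  "ev_op k m X X' \<longleftrightarrow> (\<forall>x y. length x = m \<longrightarrow> length y = m \<longrightarrow> evals k (ent X x y) (ent X' x y))"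

lemma ev_op_mult: "ev_op k m X X' \<Longrightarrow> ev_op k m Y Y' \<Longrightarrow> ev_op k m (X * Y) (X' * Y')"
  unfolding ev_op_def by (auto simp: ent_mult intro!: evals_sum evals_mult)

lemma ev_op_diff: "ev_op k m X X' \<Longrightarrow> ev_op k m Y Y' \<Longrightarrow> ev_op k m (X - Y) (X' - Y')"
  unfolding ev_op_def by (auto simp: ent_diff intro!: evals_diff)

lemma ev_op_scal: "evals k f v \<Longrightarrow> ev_op k m (scal f) (scal v)"
  unfolding ev_op_def by (auto simp: ent_scal intro: evals_0)

lemma ev_op_const: "ev_op k m (map_op zconst X) (map_op zconst X)"
  unfolding ev_op_def by (simp add: rhom.ent_map[OF calg.rhom[OF calg_zconst]] evals_const)

lemma ev_op_1: "ev_op k m 1 1"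
  unfolding ev_op_def by (simp add: ent_one evals_0 evals_1)

lemma rhom_zconst: "rhom zconst"
  by (rule calg.rhom[OF calg_zconst])

lemma ev_op_RRz: "evals k u u' \<Longrightarrow> evals k v v' \<Longrightarrow> ev_op k m (RRz m j u v) (RRz m j u' v')"
  unfolding RRg_def map_hecke[OF rhom_zconst, symmetric]
  by (intro ev_op_diff ev_op_mult ev_op_scal ev_op_const)

text \<open>The dichotomy behind the convention for irregular values. Entries at other lengths are 0
  in \<open>tmat_of\<close> and cause no irregularity.\<close>

lemma teval_tmat_of:
  "(\<exists>X'. ev_op k m X X' \<and> teval_one k (tmat_of m X) = tmat_of m X') \<or> teval_one k (tmat_of m X) = (\<lambda>x y. 0)"
proof (cases "\<forall>x y. regular_one k (tmat_of m X x y)")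
  case True
  define X' where "X' = Op (\<lambda>x y. eval_one k (ent X x y))"
  have "evals k (ent X x y) (eval_one k (ent X x y))" if "length x = m" "length y = m" for x y
  proof -
    have "regular_one k (ent X x y)" using True[rule_format, of x y] that by (simp add: tmat_of_def)
    then show ?thesis using eval_one_eq unfolding regular_one_iff by blast
  qed
  then have "ev_op k m X X'" by (simp add: ev_op_def X'_def ent_Op)
  moreover have "teval_one k (tmat_of m X) = tmat_of m X'"
    using True by (intro ext) (simp add: teval_one_def tmap_def tmat_of_def X'_def ent_Op eval_one_eq[OF evals_0])
  ultimately show ?thesis by blast
next
  case False
  then have "teval_one k (tmat_of m X) = (\<lambda>x y. 0)" unfolding teval_one_def by (rule if_not_P)
  then show ?thesis ..
qed

lemma teval_ev_op: "ev_op k m X X' \<Longrightarrow> teval_one k (tmat_of m X) = tmat_of m X'"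
proof (intro ext)
  fix x y assume ev: "ev_op k m X X'"
  have "\<forall>x y. regular_one k (tmat_of m X x y)"
    using ev unfolding regular_one_iff tmat_of_def ev_op_def by (auto intro: evals_0)
  then show "teval_one k (tmat_of m X) x y = tmat_of m X' x y"
    using ev by (simp add: teval_one_def tmap_def tmat_of_def ev_op_def eval_one_eq eval_one_eq[OF evals_0])
qed

lemma prod_list_map_concat: "prod_list (map g (concat xss)) = prod_list (map (\<lambda>xs. prod_list (map g xs)) xss)"
  for g :: "_ \<Rightarrow> 'a::monoid_mult"
  by (induction xss) simp_all

lemma RRg_scale: "RRg m q qi k (w * u) (w * v) = scal w * RRg m q qi k u v"
proof -
  have "scal (w * u) * X = scal w * (scal u * X)" for u and X :: "('a, 'b) op"
    by (rule op_eqI) (simp add: ent_scal_mult mult.assoc)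
  then show ?thesis by (simp add: RRg_def right_diff_distrib)
qed

lemma scal_hom: "scal (u * v) = (scal u * scal v :: ('n::{finite,linorder}, zfun) op)" "scal 1 = (1 :: ('n, zfun) op)"
  by (rule op_eqI; simp add: ent_scal_mult ent_scal ent_one)+

section \<open>The columns of the fusion product and their evaluation\<close>

locale fusion_setting =
  fixes m :: nat and c :: "nat \<Rightarrow> int" and N_type :: "'n::{finite,linorder} itself"
begin

sublocale D: dhecke scal qD sD "hecke_op m qD sD :: nat \<Rightarrow> ('n, complex fps) op" "hecke_inv m qD sD" m
  by (rule dhecke_op[OF qD_sD])

abbreviation "mz X \<equiv> map_op zconst X :: ('n, zfun) op"

definition av :: "nat \<Rightarrow> complex fps" where "av i = fps_exp (of_int (c i))"

text \<open>The spectral parameters after the evaluations at \<open>z\<^sub>1 = 1, \<dots>, z\<^sub>n = 1\<close>\<close>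

definition zv :: "nat \<Rightarrow> nat \<Rightarrow> zfun" where
  "zv n i = (if i \<le> n then zconst (av i) else zconst (av i) * zvar i)"

lemma av_neq_0: "av i \<noteq> 0"
proof
  assume "av i = 0"
  then have "fps_nth (av i) 0 = 0" by simp
  then show False by (simp add: av_def)
qed

lemma evals_zv_other: "i \<noteq> k \<Longrightarrow> evals k (zv n i) (zv n i)"
  using evals_var[of k i] by (auto simp: zv_def intro: evals_const evals_mult)

lemma evals_zv: "evals (Suc n) (zv n i) (zv (Suc n) i)"
proof (cases "i = Suc n")
  case True
  then show ?thesis
    using evals_mult[OF evals_const evals_var, of "Suc n" "av i" i] by (simp add: zv_def)
next
  case False
  then have "zv (Suc n) i = zv n i" by (auto simp: zv_def)
  then show ?thesis using evals_zv_other[of i "Suc n" n] False by simp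
qed

lemma zv_diff_nz: "n < j \<Longrightarrow> i \<noteq> j \<Longrightarrow> zv n j - zconst t * zv n i \<noteq> 0"
  using zvar_neq[OF av_neq_0, of j "zconst t * zv n i" j] evals_mult[OF evals_const evals_zv_other, of i j t n]
  by (simp add: zv_def[of n j])

lemma zv_diff_nz': "n < j \<Longrightarrow> i \<noteq> j \<Longrightarrow> zv n j - zv n i \<noteq> 0"
  using zv_diff_nz[of n j i 1] by (simp add: zconst_ring)

text \<open>The factors \<open>(1, j)\<close>, ..., \<open>(j - 1, j)\<close> of the fusion product
  after \<open>n\<close> evaluations. Multiplying numerator and denominator of each factor by the
  parameter of \<open>j\<close> makes it homogeneous, and the sites \<open>j - i\<close> make the
  product a \<open>moveR\<close> through the reversed list.\<close>

definition col :: "nat \<Rightarrow> nat \<Rightarrow> ('n, zfun) op" where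
  "col n j = scal (1 / (\<Prod>i\<leftarrow>[1..<j]. zv n j - zv n i)) * moveR (RRz m) 0 (zv n j) (rev (map (zv n) [1..<j]))"

lemma scal_central: "X * scal u = (scal u * X :: ('n, zfun) op)"
  by (rule op_eqI) (simp add: ent_scal_mult ent_mult_scal mult.commute)

lemma col_prod:
  assumes "i0 \<le> j"
  shows "prod_list (map (\<lambda>i. scal (1 / (zv n j - zv n i)) * RRz m (j - i - 1) (zv n j) (zv n i)) [i0..<j])
    = (scal (1 / (\<Prod>i\<leftarrow>[i0..<j]. zv n j - zv n i)) * moveR (RRz m) 0 (zv n j) (rev (map (zv n) [i0..<j])) :: ('n, zfun) op)"
  using assms
proof (induction i0 rule: inc_induct)
  case base
  have "scal 1 = (1 :: ('n, zfun) op)" by (rule op_eqI) (simp add: ent_scal ent_one)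
  then show ?case by simp
next
  case (step i)
  let ?R = "RRz m (j - i - 1) (zv n j) (zv n i) :: ('n, zfun) op"
  let ?s = "1 / (zv n j - zv n i)" and ?S = "1 / (\<Prod>i\<leftarrow>[Suc i..<j]. zv n j - zv n i)"
  let ?M = "moveR (RRz m) 0 (zv n j) (rev (map (zv n) [Suc i..<j])) :: ('n, zfun) op"
  have up: "[i..<j] = i # [Suc i..<j]" using step.hyps by (simp add: upt_conv_Cons)
  have "prod_list (map (\<lambda>i. scal (1 / (zv n j - zv n i)) * RRz m (j - i - 1) (zv n j) (zv n i)) [i..<j])
     = scal ?s * (?R * scal ?S) * ?M"
    unfolding up using step.IH by (simp add: mult.assoc)
  also have "\<dots> = scal (?s * ?S) * (?R * ?M)"
    unfolding scal_central[of ?R] scal_hom(1) by (simp add: mult.assoc)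
  also have "?R * ?M = moveR (RRz m) 0 (zv n j) (rev (map (zv n) [i..<j]))"
    unfolding up by (simp add: moveR_append)
  also have "?s * ?S = 1 / (\<Prod>i\<leftarrow>[i..<j]. zv n j - zv n i)" unfolding up by simp
  finally show ?case .
qed

lemma fusion_op_col: "fusion_op m c = tmat_of m (prod_list (map (col 0) [1..<Suc m]))"
proof -
  define g where "g = (\<lambda>(i, j). scal (1 / (zv 0 j - zv 0 i)) * RRz m (j - i - 1) (zv 0 j) (zv 0 i) :: ('n, zfun) op)"
  have "(\<lambda>(i, j). fusion_factor m i j (zvar i * zexp (of_int (c i - c j)) / zvar j)) p = tmat_of m (g p)"
    if "p \<in> set (pair_list m)" for p
  proof -
    define i j where "i = fst p" and "j = snd p"
    have p: "p = (i, j)" by (simp add: i_def j_def)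
    have ij: "1 \<le> i" "i < j" "j \<le> m"
      using that by (auto simp: pair_list_def i_def j_def)
    define z where "z = zvar i * zexp (of_int (c i - c j)) / zvar j"
    have zv: "zv 0 i = zconst (av i) * zvar i" "zv 0 j = zconst (av j) * zvar j" using ij by (simp_all add: zv_def)
    have nz: "zv 0 j \<noteq> 0" using zv_diff_nz[of 0 j i 0] ij by (simp add: zconst_ring)
    then have nz': "zconst (av j) \<noteq> 0" "zvar j \<noteq> 0" by (auto simp: zv)
    have "fps_exp (of_int (c i - c j)) * av j = av i"
      unfolding av_def by (simp flip: fps_exp_add_mult)
    then have "zexp (of_int (c i - c j)) * zconst (av j) = zconst (av i)"
      unfolding zexp_def by (simp flip: zconst_ring)
    then have z: "z = zv 0 i / zv 0 j" using nz' by (simp add: z_def zv field_simps)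
    have 1: "1 - z = (zv 0 j - zv 0 i) / zv 0 j" "1 - z * sz\<^sup>2 = (zv 0 j - zconst (sD\<^sup>2) * zv 0 i) / zv 0 j"
      using nz by (simp_all add: z field_simps power2_eq_square zconst_ring)
    have d: "zv 0 j - zv 0 i \<noteq> 0" "zv 0 j - zconst (sD\<^sup>2) * zv 0 i \<noteq> 0"
      using zv_diff_nz'[of 0 j i] zv_diff_nz[of 0 j i] ij by auto
    have "fusion_factor m i j z = tmat_of m (scal (1 / (1 - z)) * RRz m (j - i - 1) 1 z :: ('n, zfun) op)"
      using ij d nz unfolding z_def[symmetric] by (intro fusion_factor_RR) (auto simp: 1)
    also have "scal (1 / (1 - z)) * RRz m (j - i - 1) 1 z = (g (i, j) :: ('n, zfun) op)"
    proof -
      have "RRz m (j - i - 1) (zv 0 j) (zv 0 i) = (scal (zv 0 j) * RRz m (j - i - 1) 1 z :: ('n, zfun) op)"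
        using RRg_scale[of m qz sz "j - i - 1" "zv 0 j" 1 z] nz by (simp add: z)
      then have "g (i, j) = scal (1 / (zv 0 j - zv 0 i) * zv 0 j) * RRz m (j - i - 1) 1 z"
        unfolding g_def by (simp only: prod.case scal_hom(1) mult.assoc)
      then show ?thesis unfolding 1 by simp
    qed
    finally show ?thesis by (simp add: p z_def)
  qed
  then have "fusion_op m c = tmat_of m (prod_list (map g (pair_list m)))"
    unfolding fusion_op_def by (rule tprod_tmat_of)
  also have "prod_list (map g (pair_list m)) = prod_list (map (\<lambda>j. prod_list (map (\<lambda>i. g (i, j)) [1..<j])) [1..<Suc m])"
    unfolding pair_list_def prod_list_map_concat by (simp add: o_def)
  also have "map (\<lambda>j. prod_list (map (\<lambda>i. g (i, j)) [1..<j])) [1..<Suc m] = map (col 0) [1..<Suc m]"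
  proof (rule map_cong[OF refl])
    fix j assume "j \<in> set [1..<Suc m]"
    then have "1 \<le> j" by auto
    then show "prod_list (map (\<lambda>i. g (i, j)) [1..<j]) = col 0 j"
      unfolding g_def col_def prod.case by (rule col_prod)
  qed
  finally show ?thesis .
qed

text \<open>At argument 0 each factor is a bare generator, and column \<open>j\<close> is the cycle
  \<open>Uop (j - 1)\<close>; the inverse of their product is assembled from \<open>Uinv\<close> in
  \<open>Tinv0\<close>.\<close>

lemma fusion_op_zero_inverse:
  "tmult m (tmat_of m Z) (tinv m (fusion_op_zero m)) = tmat_of m (Z * mz (D.Tinv0 m))"
proof -
  define g where "g = (\<lambda>(i, j). mz (hecke_op m qD sD (j - i - 1)))"
  have one: "scal 1 = (1 :: ('n, zfun) op)" "scal 0 = (0 :: ('n, zfun) op)"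
    by (rule op_eqI; simp add: ent_scal ent_one ent_zero)+
  have "(\<lambda>(i, j). fusion_factor m i j 0) p = tmat_of m (g p)" if "p \<in> set (pair_list m)" for p
  proof -
    define i j where "i = fst p" and "j = snd p"
    have p: "p = (i, j)" by (simp add: i_def j_def)
    have ij: "1 \<le> i" "i < j" "j \<le> m"
      using that by (auto simp: pair_list_def i_def j_def)
    have "fusion_factor m i j 0 = tmat_of m (scal (1 / (1 - 0)) * RRz m (j - i - 1) 1 0 :: ('n, zfun) op)"
      by (rule fusion_factor_RR[OF ij]) simp_all
    then show ?thesis by (simp add: p g_def RRg_def one map_hecke[OF rhom_zconst])
  qed
  then have "fusion_op_zero m = tmat_of m (prod_list (map g (pair_list m)))"
    unfolding fusion_op_zero_def by (rule tprod_tmat_of)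
  also have "prod_list (map g (pair_list m)) = prod_list (map (\<lambda>j. prod_list (map (\<lambda>i. g (i, j)) [1..<j])) [1..<Suc m])"
    unfolding pair_list_def prod_list_map_concat by (simp add: o_def)
  also have "map (\<lambda>j. prod_list (map (\<lambda>i. g (i, j)) [1..<j])) [1..<Suc m] = map (\<lambda>j. mz (D.Uop (j - 1))) [1..<Suc m]"
  proof (rule map_cong[OF refl])
    fix j assume "j \<in> set [1..<Suc m]"
    have "prod_list (map (\<lambda>i. g (i, j)) [i0..<j]) = mz (D.Uop (j - i0))" if "i0 \<le> j" for i0
      using that
    proof (induction i0 rule: inc_induct)
      case base
      show ?case by (simp add: rhom.map_one[OF rhom_zconst])
    next
      case (step i)
      then have "[i..<j] = i # [Suc i..<j]" "j - i = Suc (j - Suc i)" by (simp_all add: upt_conv_Cons)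
      then show ?case using step.IH by (simp add: g_def rhom.map_mult[OF rhom_zconst])
    qed
    moreover have "1 \<le> j" using \<open>j \<in> set [1..<Suc m]\<close> by auto
    ultimately show "prod_list (map (\<lambda>i. g (i, j)) [1..<j]) = mz (D.Uop (j - 1))" by blast
  qed
  finally have T0: "fusion_op_zero m = tmat_of m (prod_list (map (\<lambda>j. mz (D.Uop (j - 1))) [1..<Suc m]))" .
  have "prod_list (map (\<lambda>j. mz (D.Uop (j - 1))) [1..<Suc k]) * mz (D.Tinv0 k) = 1
      \<and> mz (D.Tinv0 k) * prod_list (map (\<lambda>j. mz (D.Uop (j - 1))) [1..<Suc k]) = 1" if "k \<le> m" for k
    using that
  proof (induction k)
    case 0
    show ?case by (simp add: rhom.map_one[OF rhom_zconst])
  next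
    case (Suc k)
    let ?P = "prod_list (map (\<lambda>j. mz (D.Uop (j - 1))) [1..<Suc k])"
    have U: "mz (D.Uop k) * mz (D.Uinv k) = 1" "mz (D.Uinv k) * mz (D.Uop k) = 1"
      using D.Uop_Uinv[of k] Suc.prems by (simp_all add: rhom.map_one[OF rhom_zconst] flip: rhom.map_mult[OF rhom_zconst])
    have IH: "?P * mz (D.Tinv0 k) = 1" "mz (D.Tinv0 k) * ?P = 1" using Suc by simp_all
    have P: "prod_list (map (\<lambda>j. mz (D.Uop (j - 1))) [1..<Suc (Suc k)]) = ?P * mz (D.Uop k)"
      by simp
    have T: "mz (D.Tinv0 (Suc k)) = mz (D.Uinv k) * mz (D.Tinv0 k)" by (simp add: rhom.map_mult[OF rhom_zconst])
    have "?P * mz (D.Uop k) * (mz (D.Uinv k) * mz (D.Tinv0 k)) = ?P * (mz (D.Uop k) * mz (D.Uinv k)) * mz (D.Tinv0 k)"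
      "mz (D.Uinv k) * mz (D.Tinv0 k) * (?P * mz (D.Uop k)) = mz (D.Uinv k) * (mz (D.Tinv0 k) * ?P) * mz (D.Uop k)"
      by (simp_all only: mult.assoc)
    then show ?case unfolding P T using U IH by simp
  qed
  from this[OF order_refl] show ?thesis unfolding T0 by (intro tinv_tmat_of) blast+
qed

end

lemma poly_diff_dvd: "x - y dvd poly p x - poly p y" for x y :: "'a::comm_ring_1"
proof (induction p)
  case (pCons a p)
  have "poly (pCons a p) x - poly (pCons a p) y = (x - y) * poly p x + y * (poly p x - poly p y)"
    by (simp add: algebra_simps)
  then show ?case using pCons.IH by simp
qed simp

text \<open>A regular factor whose right inverse is regular too. Such a factor can be cancelled on
  the right without affecting regularity of the rest.\<close>

definition ev_unit :: "nat \<Rightarrow> nat \<Rightarrow> ('n::{finite,linorder}, zfun) op \<Rightarrow> ('n, zfun) op \<Rightarrow> bool" where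
  "ev_unit k m X X' \<longleftrightarrow> ev_op k m X X' \<and> (\<exists>W W'. X * W = 1 \<and> ev_op k m W W')"

lemma ev_unit_mult: "ev_unit k m X X' \<Longrightarrow> ev_unit k m Y Y' \<Longrightarrow> ev_unit k m (X * Y) (X' * Y')"
proof -
  assume "ev_unit k m X X'" "ev_unit k m Y Y'"
  then obtain V V' W W' where *: "ev_op k m X X'" "X * V = 1" "ev_op k m V V'" "ev_op k m Y Y'" "Y * W = 1" "ev_op k m W W'"
    unfolding ev_unit_def by blast
  have "X * Y * (W * V) = X * (Y * W) * V" by (simp only: mult.assoc)
  then have "X * Y * (W * V) = 1" using * by simp
  moreover have "ev_op k m (W * V) (W' * V')" "ev_op k m (X * Y) (X' * Y')" using * by (auto intro: ev_op_mult)
  ultimately show ?thesis unfolding ev_unit_def by blast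
qed

lemma ev_unit_1: "ev_unit k m 1 1"
  unfolding ev_unit_def using ev_op_1 by (metis mult_1)

lemma ev_unit_prod_list: "list_all2 (ev_unit k m) Xs Xs' \<Longrightarrow> ev_unit k m (prod_list Xs) (prod_list Xs')"
  by (induction Xs Xs' rule: list_all2_induct) (auto intro: ev_unit_1 ev_unit_mult)

lemma ev_unit_scal:
  assumes "evals k f v" "v \<noteq> 0"
  shows "ev_unit k m (scal f) (scal v)"
proof -
  have "f \<noteq> 0" using assms evals_unique[OF assms(1), of 0] evals_0 by auto
  then have "scal f * scal (1 / f) = (1 :: ('a, zfun) op)" by (simp flip: scal_hom)
  then show ?thesis
    unfolding ev_unit_def using ev_op_scal[OF assms(1)] ev_op_scal[OF evals_inverse[OF assms]] by blast
qed

lemma RRz_unitarity: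
  assumes "Suc j < m"
  shows "RRz m j u v * RRz m j v u = (scal ((u - zconst (qD\<^sup>2) * v) * (zconst (sD\<^sup>2) * v - u)) * 1 :: ('n::{finite,linorder}, zfun) op)"
proof -
  interpret H: hecke scal qz sz "hecke_op m qz sz :: nat \<Rightarrow> ('n, zfun) op" "hecke_inv m qz sz" m
    by (rule hecke_op_hecke[OF qz_sz(1)])
  have RR: "H.RR k u v = RRz m k u v" for k u v by (simp only: H.RR_def H.sm_def RRg_def)
  have qs: "qz\<^sup>2 * sz\<^sup>2 = 1" using qz_sz by (simp flip: power_mult_distrib)
  have "(u - qz\<^sup>2 * v) * (sz\<^sup>2 * v - u) = u * v * (qz\<^sup>2 + sz\<^sup>2) - u\<^sup>2 - (qz\<^sup>2 * sz\<^sup>2) * v\<^sup>2"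
    by (simp add: algebra_simps power2_eq_square)
  then have "u * v * (qz\<^sup>2 + sz\<^sup>2) - u\<^sup>2 - v\<^sup>2 = (u - qz\<^sup>2 * v) * (sz\<^sup>2 * v - u)" unfolding qs by simp
  then show ?thesis using H.RR_unitarity[OF assms, of u v] unfolding RR by (simp add: zconst_ring power2_eq_square)
qed

lemma ev_unit_RRz:
  assumes "Suc j < m" "evals k u u'" "evals k v v'" "u' - zconst (qD\<^sup>2) * v' \<noteq> 0" "u' - zconst (sD\<^sup>2) * v' \<noteq> 0"
  shows "ev_unit k m (RRz m j u v) (RRz m j u' v' :: ('n::{finite,linorder}, zfun) op)"
proof -
  let ?d = "\<lambda>u v. (u - zconst (qD\<^sup>2) * v) * (zconst (sD\<^sup>2) * v - u)"
  have ev: "evals k (?d u v) (?d u' v')" using assms by (intro evals_mult evals_diff evals_const)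
  have nz: "?d u' v' \<noteq> 0" using assms(4,5) by auto
  then obtain W W' where W: "scal (?d u v) * W = 1" "ev_op k m W (W' :: ('n, zfun) op)"
    using ev_unit_scal[OF ev nz, of m] unfolding ev_unit_def by blast
  have "RRz m j u v * (RRz m j v u * W) = 1"
    unfolding mult.assoc[symmetric] RRz_unitarity[OF assms(1)] using W(1) by simp
  then show ?thesis unfolding ev_unit_def
    using ev_op_RRz[OF assms(2,3)] ev_op_mult[OF ev_op_RRz[OF assms(3,2)] W(2)] by blast
qed

lemma ev_unit_moveR:
  assumes "evals k b b'" "list_all2 (evals k) as as'" "l + length as < m"
    "\<And>a. a \<in> set as' \<Longrightarrow> b' - zconst (qD\<^sup>2) * a \<noteq> 0 \<and> b' - zconst (sD\<^sup>2) * a \<noteq> 0"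
  shows "ev_unit k m (moveR (RRz m) l b as) (moveR (RRz m) l b' as' :: ('n::{finite,linorder}, zfun) op)"
  using assms(2-4)
proof (induction as arbitrary: l as')
  case (Cons a as)
  obtain a' as'' where as': "as' = a' # as''" "evals k a a'" "list_all2 (evals k) as as''"
    using Cons.prems(1) by (auto simp: list_all2_Cons1)
  show ?case unfolding as'(1) moveR.simps
    using Cons.prems as' by (intro ev_unit_mult ev_unit_RRz Cons.IH assms(1)) auto
qed (simp add: ev_unit_1)

lemma RRg_filler:
  assumes "length x \<noteq> m"
  shows "ent (RRg m q qi k u v) x y = (if x = y then u * q - v * qi else 0)"
proof -
  have T: "ent (hecke_op m q qi k) x y = (if x = y then q else 0)"
    unfolding hecke_op_def ent_Op using assms by (cases "x = y") auto
  then have "ent (hecke_inv m q qi k) x y = (if x = y then qi else 0)"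
    by (simp add: hecke_inv_def ent_diff ent_scal)
  then show ?thesis using T by (simp add: RRg_def ent_diff ent_scal_mult)
qed

context fusion_setting
begin

lemma D_RR: "D.RR = RRg m qD sD"
  by (intro ext) (simp only: D.RR_def D.sm_def RRg_def)

text \<open>A later column still contains its own free variable, so neither its denominators nor its
  unitarity scalars vanish identically after the evaluation.\<close>

lemma ev_unit_col:
  assumes "Suc n < j" "j \<le> m"
  shows "ev_unit (Suc n) m (col n j) (col (Suc n) j)"
  unfolding col_def
proof (intro ev_unit_mult)
  have "list_all2 (evals (Suc n)) (map (\<lambda>i. zv n j - zv n i) [1..<j]) (map (\<lambda>i. zv (Suc n) j - zv (Suc n) i) [1..<j])"
    by (auto simp: list_all2_conv_all_nth intro!: evals_diff evals_zv)
  from evals_prod_list[OF this] have ev: "evals (Suc n) (\<Prod>i\<leftarrow>[1..<j]. zv n j - zv n i) (\<Prod>i\<leftarrow>[1..<j]. zv (Suc n) j - zv (Suc n) i)" .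
  have nz: "(\<Prod>i\<leftarrow>[1..<j]. zv (Suc n) j - zv (Suc n) i) \<noteq> 0"
  proof
    assume "(\<Prod>i\<leftarrow>[1..<j]. zv (Suc n) j - zv (Suc n) i) = 0"
    then obtain i where "i < j" "zv (Suc n) j - zv (Suc n) i = 0" by (auto simp: prod_list_zero_iff)
    then show False using zv_diff_nz'[of "Suc n" j i] assms(1) by simp
  qed
  show "ev_unit (Suc n) m (scal (1 / (\<Prod>i\<leftarrow>[1..<j]. zv n j - zv n i))) (scal (1 / (\<Prod>i\<leftarrow>[1..<j]. zv (Suc n) j - zv (Suc n) i)))"
    by (rule ev_unit_scal[OF evals_inverse[OF ev nz]]) (use nz in simp)
  show "ev_unit (Suc n) m (moveR (RRz m) 0 (zv n j) (rev (map (zv n) [1..<j])))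
      (moveR (RRz m) 0 (zv (Suc n) j) (rev (map (zv (Suc n)) [1..<j])))"
  proof (rule ev_unit_moveR)
    show "list_all2 (evals (Suc n)) (rev (map (zv n) [1..<j])) (rev (map (zv (Suc n)) [1..<j]))"
      unfolding list_all2_rev by (auto simp: list_all2_conv_all_nth intro!: evals_zv)
    show "zv (Suc n) j - zconst (qD\<^sup>2) * a \<noteq> 0 \<and> zv (Suc n) j - zconst (sD\<^sup>2) * a \<noteq> 0"
      if "a \<in> set (rev (map (zv (Suc n)) [1..<j]))" for a
    proof -
      have "a \<in> zv (Suc n) ` {1..<j}" using that by simp
      then obtain i where "i < j" "a = zv (Suc n) i" by (metis imageE atLeastLessThan_iff)
      then show ?thesis using zv_diff_nz[of "Suc n" j i] assms(1) by simp
    qed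
  qed (use assms in \<open>auto intro: evals_zv\<close>)
qed

lemma ev_unit_Tinv0: "ev_unit k m (mz (D.Tinv0 m)) (mz (D.Tinv0 m))"
proof -
  have "\<exists>W. D.Tinv0 n * W = 1" if "n \<le> m" for n
    using that
  proof (induction n)
    case (Suc n)
    then obtain W where W: "D.Tinv0 n * W = 1" by auto
    have "D.Tinv0 (Suc n) * (W * D.Uop n) = D.Uinv n * (D.Tinv0 n * W) * D.Uop n"
      by (simp only: D.Tinv0.simps mult.assoc)
    then show ?case using W D.Uop_Uinv[of n] Suc.prems by (intro exI[of _ "W * D.Uop n"]) simp
  qed (use mult_1 in auto)
  then obtain W where "D.Tinv0 m * W = 1" by blast
  then have "mz (D.Tinv0 m) * mz W = 1"
    by (simp add: rhom.map_one[OF rhom_zconst] flip: rhom.map_mult[OF rhom_zconst])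
  then show ?thesis unfolding ev_unit_def using ev_op_const by blast
qed

definition rest :: "nat \<Rightarrow> nat \<Rightarrow> ('n, zfun) op" where
  "rest n j = prod_list (map (col n) [j..<Suc m]) * mz (D.Tinv0 m)"

lemma ev_unit_rest: "ev_unit (Suc n) m (rest n (Suc (Suc n))) (rest (Suc n) (Suc (Suc n)))"
  unfolding rest_def
  by (intro ev_unit_mult ev_unit_prod_list ev_unit_Tinv0)
    (auto simp: list_all2_conv_all_nth simp del: upt_Suc intro!: ev_unit_col)

text \<open>If the whole expression is regular, cancelling \<open>s\<close> and \<open>R\<close>
  shows that \<open>Y\<close> is regular, and the value is computed factor by factor. Otherwise the
  evaluation is 0 by convention.\<close>

lemma teval_step:
  fixes Y R :: "('n, zfun) op"
  assumes "evals k s s'" "s' \<noteq> 0" and R: "ev_unit k m R R'"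
    and Y: "\<And>Y'. ev_op k m Y Y' \<Longrightarrow> ev_op k m Y Y1"
  shows "teval_one k (tmat_of m (scal s * (Y * R))) = tmat_of m (scal s' * (Y1 * R'))
    \<or> teval_one k (tmat_of m (scal s * (Y * R))) = (\<lambda>x y. 0)"
proof -
  consider X' where "ev_op k m (scal s * (Y * R)) X'" | "teval_one k (tmat_of m (scal s * (Y * R))) = (\<lambda>x y. 0)"
    using teval_tmat_of by blast
  then show ?thesis
  proof cases
    case 1
    obtain W W' where W: "R * W = 1" "ev_op k m W W'" using R unfolding ev_unit_def by blast
    have "s \<noteq> 0" using assms(1,2) evals_unique[OF assms(1), of 0] evals_0 by auto
    then have "scal (1 / s) * scal s = (1 :: ('n, zfun) op)" by (simp flip: scal_hom)
    moreover have "scal (1 / s) * ((scal s * (Y * R)) * W) = (scal (1 / s) * scal s) * Y * (R * W)"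
      by (simp only: mult.assoc)
    ultimately have "ev_op k m Y (scal (1 / s') * (X' * W'))"
      using ev_op_mult[OF ev_op_scal[OF evals_inverse[OF assms(1,2)]] ev_op_mult[OF 1 W(2)]] W(1)
      by (simp only: mult_1 mult_1_right)
    then have "ev_op k m Y Y1" by (rule Y)
    then have "ev_op k m (scal s * (Y * R)) (scal s' * (Y1 * R'))"
      using R by (intro ev_op_mult ev_op_scal assms(1)) (simp_all add: ev_unit_def)
    then show ?thesis using teval_ev_op by blast
  qed blast
qed

end

lemma linear_root_factor:
  fixes a :: "'a::idom"
  obtains r where "poly r a \<noteq> 0" "(\<Prod>b\<leftarrow>as. [:- b, 1:]) = [:- a, 1:] ^ count_list as a * r"
proof
  let ?r = "\<Prod>b\<leftarrow>filter (\<lambda>b. b \<noteq> a) as. [:- b, 1:]"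
  show "poly ?r a \<noteq> 0" by (induction as) auto
  show "(\<Prod>b\<leftarrow>as. [:- b, 1:]) = [:- a, 1:] ^ count_list as a * ?r"
    by (induction as) (simp_all add: mult.left_commute mult.assoc del: mult_pCons_left mult_pCons_right)
qed

lemma count_list_distinct: "distinct xs \<Longrightarrow> count_list xs x = (if x \<in> set xs then 1 else 0)"
  by (induction xs) auto

lemma (in rhom) map_prod_list: "f (prod_list xs) = prod_list (map f xs)"
  by (induction xs) (simp_all add: one mult)

lemma rhom_pCons: "rhom (\<lambda>c :: complex fps. [:c:])"
  by standard (simp_all add: one_pCons)

lemma rhom_poly: "rhom (\<lambda>p :: complex fps poly. poly p x)"
  by standard simp_all

lemma rhom_iota: "rhom (\<lambda>p. Fract (iota k a p) 1)"
  by standard (simp_all add: iota_ring One_fract_def)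

context fusion_setting
begin

text \<open>The multiplicity condition of \<open>fus\<close> in terms of contents: multiplication of
  a parameter by \<open>q^2\<close> or \<open>q^-2\<close> changes its content by 1 or -1, and the
  leading 0 stands for the root 1.\<close>

definition content_step :: "nat \<Rightarrow> bool" where
  "content_step n \<longleftrightarrow> (let cs = map c [1..<Suc n] in
     count_list (0 # map (\<lambda>k. k + 1) cs @ map (\<lambda>k. k - 1) cs) (c (Suc n)) = Suc (2 * count_list cs (c (Suc n))))"

lemma content_step_av:
  fixes n
  defines "as \<equiv> map av [1..<Suc n]"
  assumes "content_step n"
  shows "count_list (1 # map ((*) (qD\<^sup>2)) as @ map ((*) (sD\<^sup>2)) as) (av (Suc n)) = Suc (2 * count_list as (av (Suc n)))"
proof -
  define E :: "int \<Rightarrow> complex fps" where "E k = fps_exp (of_int k)" for k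
  let ?cs = "map c [1..<Suc n]"
  have "inj E"
  proof
    fix k l assume "E k = E l"
    then have "fps_nth (E k) 1 = fps_nth (E l) 1" by simp
    then show "k = l" by (simp add: E_def)
  qed
  have as: "as = map E ?cs" by (simp add: as_def E_def av_def)
  have "qD\<^sup>2 * E k = E (k + 1)" "sD\<^sup>2 * E k = E (k - 1)" for k
    by (simp_all add: E_def sD_def power2_eq_square flip: fps_exp_add_mult)
  then have eq: "1 # map ((*) (qD\<^sup>2)) as @ map ((*) (sD\<^sup>2)) as = map E (0 # map (\<lambda>k. k + 1) ?cs @ map (\<lambda>k. k - 1) ?cs)"
    unfolding as by (simp add: E_def del: upt_Suc)
  have av: "av (Suc n) = E (c (Suc n))" by (simp add: av_def E_def)
  have cnt: "count_list (map E xs) (E k) = count_list xs k" for xs k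
    by (rule count_list_map_conv[OF \<open>inj E\<close>])
  show ?thesis unfolding eq av unfolding as cnt using assms(2) unfolding content_step_def Let_def .
qed

text \<open>
  Off the lists of length \<open>m\<close> the operators are scalars; there the fusion product vanishes as soon as
  the contents leave the first row.
\<close>

definition filler0 :: "('n, 'a::ring_1) op \<Rightarrow> bool" where
  "filler0 X \<longleftrightarrow> (\<forall>x y. length x \<noteq> m \<longrightarrow> ent X x y = 0)"

lemma filler0_mult: "filler0 X \<or> filler0 Y \<Longrightarrow> filler0 (X * Y)"
  by (auto simp: filler0_def ent_mult intro!: sum.neutral)

definition row :: "nat \<Rightarrow> bool" where "row n \<longleftrightarrow> (\<forall>i\<in>{1..n}. c i = int i - 1)"

text \<open>When the first contents are \<open>0\<close>, ..., \<open>n - 1\<close>, the condition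
  allows only the next content \<open>n\<close> or, for \<open>n \<ge> 1\<close>, the content -1.
  Neither has occurred before, so no power of \<open>x - a\<close> has to be divided out
  yet.\<close>

lemma row_step:
  assumes "row n" "content_step n"
  shows "count_list (map av [1..<Suc n]) (av (Suc n)) = 0" "row (Suc n) \<or> (1 \<le> n \<and> c (Suc n) = - 1)"
proof -
  let ?k = "c (Suc n)"
  have cs: "map c [1..<Suc n] = map (\<lambda>i. int i - 1) [1..<Suc n]"
    using assms(1) by (intro map_cong) (auto simp: row_def)
  have cnt: "count_list (map (\<lambda>i. int i + d) [1..<Suc n]) k = (if 1 + d \<le> k \<and> k \<le> int n + d then 1 else 0)" for d k
  proof -
    have "k \<in> set (map (\<lambda>i. int i + d) [1..<Suc n]) \<longleftrightarrow> 1 + d \<le> k \<and> k \<le> int n + d"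
    proof
      assume "1 + d \<le> k \<and> k \<le> int n + d"
      then have "k = int (nat (k - d)) + d" "nat (k - d) \<in> set [1..<Suc n]" by auto
      then show "k \<in> set (map (\<lambda>i. int i + d) [1..<Suc n])"
        unfolding set_map by (rule image_eqI[of _ "\<lambda>i. int i + d" "nat (k - d)"])
    qed auto
    then show ?thesis by (subst count_list_distinct) (simp_all add: distinct_map inj_on_def)
  qed
  have "count_list [0] ?k + count_list (map (\<lambda>i. int i + 0) [1..<Suc n]) ?k + count_list (map (\<lambda>i. int i + - 2) [1..<Suc n]) ?k
      = Suc (2 * count_list (map (\<lambda>i. int i + - 1) [1..<Suc n]) ?k)"
    using assms(2) unfolding content_step_def Let_def cs by (simp add: o_def del: upt_Suc split: if_splits)
  then have k: "?k = int n \<or> (1 \<le> n \<and> ?k = - 1)"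
    unfolding cnt by (auto split: if_splits)
  show "row (Suc n) \<or> (1 \<le> n \<and> ?k = - 1)"
    using k assms(1) unfolding row_def by (auto simp: le_Suc_eq)
  have "av (Suc n) \<noteq> av i" if "i \<in> set [1..<Suc n]" for i
  proof
    assume "av (Suc n) = av i"
    then have "fps_nth (av (Suc n)) 1 = fps_nth (av i) 1" by simp
    then have "?k = c i" by (simp add: av_def)
    then show False using k that assms(1) by (auto simp: row_def)
  qed
  then show "count_list (map av [1..<Suc n]) (av (Suc n)) = 0"
    by (auto simp: count_list_0_iff)
qed

text \<open>The factor that pairs the content -1 with the first box has parameters
  \<open>q^-2\<close> and 1; off length \<open>m\<close> it is the scalar
  \<open>q^-2 q - q^-1 = 0\<close>.\<close>

lemma moveR_filler0:
  assumes "row n" "1 \<le> n" "c (Suc n) = - 1"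
  shows "filler0 (moveR D.RR 0 (av (Suc n)) (rev (map av [1..<Suc n])))"
proof -
  have "[1..<Suc n] = 1 # [2..<Suc n]" using assms(2) by (simp add: upt_conv_Cons numeral_2_eq_2)
  then have r: "rev (map av [1..<Suc n]) = rev (map av [2..<Suc n]) @ [av 1]" by simp
  have "c 1 = 0" using assms(1,2) by (auto simp: row_def)
  then have "av 1 = 1" by (simp add: av_def)
  moreover have "av (Suc n) * qD = sD"
    unfolding av_def assms(3) sD_def by (simp flip: fps_exp_add_mult)
  ultimately have "filler0 (D.RR k (av (Suc n)) (av 1))" for k
    by (simp add: filler0_def D_RR RRg_filler)
  then show ?thesis unfolding r moveR_append by (simp add: filler0_mult)
qed

text \<open>\<open>fus\<close> asks for divisibility by \<open>(x - a)^k\<close> in the whole ring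
  of block matrices, whereas regularity speaks only of lists of length \<open>m\<close>. On the
  other lengths either the entries vanish or the first row has not been left and
  \<open>k = 0\<close>; this is what the alternative \<open>filler0 F \<or> row n\<close>
  secures.\<close>

lemma fusion_step:
  fixes n
  defines "as \<equiv> map av [1..<Suc n]" and "a \<equiv> av (Suc n)"
  assumes F: "D.fus as F" "n < m" and cs: "content_step n" and fl: "filler0 F \<or> row n"
    and reg: "ev_op (Suc n) m (mz F * col n (Suc n)) Y"
  obtains H t where "D.fus (as @ [a]) H" "filler0 H \<or> row (Suc n)" "t \<noteq> 0"
    "ev_op (Suc n) m (mz F * col n (Suc n)) (scal (1 / zconst t) * mz H)"
proof -
  let ?k = "count_list as a"
  let ?J = "\<lambda>p. Fract (iota (Suc n) a p) 1"
  interpret J: rhom ?J by (rule rhom_iota)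
  interpret C: rhom "\<lambda>c :: complex fps. [:c:]" by (rule rhom_pCons)
  \<comment> \<open>The next column with an indeterminate \<open>x\<close> as its parameter and
    without denominators; \<open>?J\<close> substitutes \<open>a z_(n+1)\<close> for
    \<open>x\<close>.\<close>
  define P :: "('n, complex fps poly) op" where
    "P = map_op (\<lambda>c. [:c:]) F * moveR (RRg m [:qD:] [:sD:]) 0 [:0, 1:] (map (\<lambda>c. [:c:]) (rev as))"
  define d where "d = (\<Prod>b\<leftarrow>as. [:- b, 1:])"
  have P_at: "map_op (\<lambda>p. poly p x) P = F * moveR D.RR 0 x (rev as)" for x
  proof -
    interpret E: rhom "\<lambda>p. poly p x" by (rule rhom_poly)
    have "map_op (\<lambda>p. poly p x) (map_op (\<lambda>c. [:c:]) F) = F"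
      by (rule op_eqI) (simp add: E.ent_map C.ent_map)
    then show ?thesis
      unfolding P_def E.map_mult map_moveR_RRg[OF rhom_poly] D_RR by (simp add: o_def)
  qed
  have Jc: "?J [:b:] = zconst b" for b by (simp add: iota_ring zconst_pconst)
  have JX: "?J [:0, 1:] = zv n (Suc n)"
    by (simp add: iota_ring zv_def a_def zconst_pconst zvar_pvar)
  have zvs: "map (zv n) [1..<Suc n] = map zconst as"
    by (simp add: as_def zv_def)
  have JP: "map_op ?J P = mz F * moveR (RRz m) 0 (zv n (Suc n)) (rev (map (zv n) [1..<Suc n]))"
  proof -
    have "map_op ?J (map_op (\<lambda>c. [:c:]) F) = mz F"
      by (rule op_eqI) (simp only: J.ent_map C.ent_map rhom.ent_map[OF rhom_zconst] Jc)
    then show ?thesis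
      unfolding P_def J.map_mult map_moveR_RRg[OF rhom_iota] zvs rev_map[symmetric] map_map o_def Jc JX by simp
  qed
  have Jd: "?J d = (\<Prod>i\<leftarrow>[1..<Suc n]. zv n (Suc n) - zv n i)"
  proof -
    have "?J [:- b, 1:] = zv n (Suc n) - zconst b" for b
      using J.diff[of "[:0, 1:]" "[:b:]"] unfolding Jc JX by simp
    then have "?J d = (\<Prod>b\<leftarrow>as. zv n (Suc n) - zconst b)"
      unfolding d_def J.map_prod_list map_map o_def by (simp only:)
    also have "\<dots> = (\<Prod>b\<leftarrow>map zconst as. zv n (Suc n) - b)" by (simp add: o_def)
    also have "\<dots> = (\<Prod>i\<leftarrow>[1..<Suc n]. zv n (Suc n) - zv n i)" unfolding zvs[symmetric] by (simp add: o_def)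
    finally show ?thesis .
  qed
  have Jd_nz: "?J d \<noteq> 0"
  proof
    assume "?J d = 0"
    then have "0 \<in> (\<lambda>i. zv n (Suc n) - zv n i) ` {1..<Suc n}" unfolding Jd prod_list_zero_iff by (simp del: upt_Suc)
    then show False
    proof (rule imageE)
      fix i assume "0 = zv n (Suc n) - zv n i" "i \<in> {1..<Suc n}"
      then show False using zv_diff_nz'[of n "Suc n" i] by simp
    qed
  qed
  have Y_eq: "mz F * col n (Suc n) = scal (1 / ?J d) * map_op ?J P"
  proof -
    have "mz F * (scal s * X) = scal s * (mz F * X)" for s X
      using scal_central[of "mz F" s] by (simp flip: mult.assoc)
    then show ?thesis unfolding col_def JP Jd by simp
  qed
  then have entY: "ent (mz F * col n (Suc n)) u v = 1 / ?J d * ?J (ent P u v)" for u v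
    by (simp only: ent_scal_mult J.ent_map)
  obtain d2 where d2: "poly d2 a \<noteq> 0" "d = [:- a, 1:] ^ ?k * d2"
    unfolding d_def by (rule linear_root_factor)
  \<comment> \<open>A fraction with denominator \<open>(x - a)^k d2\<close> can be regular at
    \<open>x = a\<close>, where \<open>d2\<close> does not vanish, only if the power divides its
    numerator.\<close>
  have dvd: "[:- a, 1:] ^ ?k dvd ent P u v" for u v
  proof (cases "length u = m \<and> length v = m")
    case True
    then have "evals (Suc n) (1 / ?J d * ?J (ent P u v)) (ent Y u v)"
      using reg unfolding ev_op_def entY by blast
    then obtain A B where AB: "1 / ?J d * ?J (ent P u v) = Fract A B" "subst_one (Suc n) B \<noteq> 0"
      unfolding evals_def by blast
    then have "B \<noteq> 0" by (auto simp: subst_one_0)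
    have "f = g * (1 / g * f)" if "g \<noteq> 0" for f g :: zfun using that by simp
    from this[OF Jd_nz] have "?J (ent P u v) = ?J d * (1 / ?J d * ?J (ent P u v))" .
    then have "?J (ent P u v) = Fract (iota (Suc n) a d * A) B" unfolding AB(1) by simp
    then have "iota (Suc n) a (ent P u v) * B = iota (Suc n) a d * A" using \<open>B \<noteq> 0\<close> by (simp add: eq_fract)
    then show ?thesis using AB(2) av_neq_0 unfolding d2(2) a_def by (rule iota_divides)
  next
    case False
    consider "length u \<noteq> length v" | "length u \<noteq> m" "filler0 F" | "row n" using False fl by (cases "length u = m") auto
    then show ?thesis
    proof cases
      case 2
      then have "filler0 (map_op (\<lambda>c. [:c:]) F)" by (simp add: filler0_def C.ent_map)
      then have "filler0 P" unfolding P_def by (simp add: filler0_mult)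
      then show ?thesis using 2 by (simp add: filler0_def)
    next
      case 3
      then show ?thesis using row_step(1)[OF _ cs] by (simp add: as_def a_def)
    qed (simp add: ent_length)
  qed
  then obtain p2 where p2: "\<And>u v. ent P u v = [:- a, 1:] ^ ?k * p2 u v"
    unfolding dvd_def by metis
  define H where "H x = Op (\<lambda>u v. poly (p2 u v) x)" for x
  have H: "D.sm ((x - a) ^ ?k) (H x) = F * moveR D.RR 0 x (rev as)" for x
    unfolding P_at[symmetric]
    by (rule op_eqI) (simp add: D.sm_def ent_scal_mult H_def ent_Op rhom.ent_map[OF rhom_poly] p2)
  have lip: "D.lip H"
  proof (rule D.lipI)
    fix x y :: "complex fps"
    have "\<exists>s. poly p x - poly p y = (x - y) * s" for p
      using poly_diff_dvd[of x y p] unfolding dvd_def .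
    then obtain g where g: "\<And>p. poly p x - poly p y = (x - y) * g p" by metis
    have "H x - H y = D.sm (x - y) (Op (\<lambda>u v. g (p2 u v)))"
      by (rule op_eqI) (simp add: D.sm_def ent_scal_mult H_def ent_Op ent_diff g)
    then show "\<exists>s. H x - H y = D.sm (x - y) s" ..
  qed
  have "length as < m" using F(2) by (simp add: as_def)
  then have fus: "D.fus (as @ [a]) (H a)"
    using D.fus_snoc[OF F(1) _ lip H] content_step_av[OF cs] by (simp add: as_def a_def)
  have filler: "filler0 (H a) \<or> row (Suc n)"
  proof (cases "filler0 F")
    case True
    then have "filler0 (map_op (\<lambda>c. [:c:]) F)" by (simp add: filler0_def C.ent_map)
    then have "filler0 P" unfolding P_def by (simp add: filler0_mult)
    then have "p2 u v = 0" if "length u \<noteq> m" for u v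
      using p2[of u v] that by (simp add: filler0_def)
    then show ?thesis by (simp add: filler0_def H_def ent_Op)
  next
    case False
    then have row: "row n" using fl by blast
    consider "row (Suc n)" | "1 \<le> n" "c (Suc n) = - 1" using row_step(2)[OF row cs] by blast
    then show ?thesis
    proof cases
      case 2
      have "?k = 0" using row_step(1)[OF row cs] by (simp add: as_def a_def)
      then have "H a = F * moveR D.RR 0 a (rev as)" using H[of a] by (simp add: D.sm_simps)
      then show ?thesis using moveR_filler0[OF row 2] by (simp add: as_def a_def filler0_mult)
    qed blast
  qed
  have "ev_op (Suc n) m (mz F * col n (Suc n)) (scal (1 / zconst (poly d2 a)) * mz (H a))"
    unfolding ev_op_def entY
  proof (intro allI impI)
    fix u v :: "'n list" assume len: "length u = m" "length v = m"
    have Jev: "evals (Suc n) (?J p) (zconst (poly p a))" for p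
      using evals_poly[of "Suc n" "iota (Suc n) a p"] by (simp add: subst_one_iota zconst_pconst)
    have nz: "zconst (poly d2 a) \<noteq> 0" using d2(1) zconst_inj[of _ 0] by (simp add: zconst_ring)
    have "1 / (f * g) * (f * h) = 1 / g * h" if "f * g \<noteq> 0" for f g h :: zfun using that by simp
    from this[OF Jd_nz[unfolded d2(2) J.mult], of "?J (p2 u v)"]
    have "1 / ?J d * ?J (ent P u v) = 1 / ?J d2 * ?J (p2 u v)"
      unfolding d2(2) p2 J.mult .
    moreover have "evals (Suc n) (1 / ?J d2 * ?J (p2 u v)) (1 / zconst (poly d2 a) * zconst (poly (p2 u v) a))"
      by (intro evals_mult evals_inverse Jev nz)
    ultimately show "evals (Suc n) (1 / ?J d * ?J (ent P u v)) (ent (scal (1 / zconst (poly d2 a)) * mz (H a)) u v)"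
      using len by (simp add: ent_scal_mult rhom.ent_map[OF rhom_zconst] H_def ent_Op)
  qed
  then show ?thesis by (rule that[OF fus filler d2(1)])
qed

end

lemma teval_zero: "teval_one k (\<lambda>x y. 0) = (\<lambda>x y. 0)"
proof -
  have "regular_one k 0" using evals_0 unfolding regular_one_iff by blast
  then show ?thesis by (intro ext) (simp add: teval_one_def tmap_def eval_one_eq[OF evals_0])
qed

lemma fold_teval_zero: "fold teval_one ks (\<lambda>x y. 0) = (\<lambda>x y. 0)"
  by (induction ks) (simp_all add: teval_zero)

context fusion_setting
begin

text \<open>The invariant of the evaluations: a constant fusion product of the first
  \<open>n\<close> contents, times the columns not yet evaluated, or 0. The quotient
  \<open>p / r\<close> collects the Schur element and the values of the cofactors met on the
  way.\<close>

lemma fold_teval_fusion: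
  assumes cs: "\<And>n. n < m \<Longrightarrow> content_step n" and pr: "p0 \<noteq> 0" "r0 \<noteq> 0" and "n \<le> m"
  defines "X \<equiv> (\<lambda>x y. zconst p0 / zconst r0 * tmult m (fusion_op m c) (tinv m (fusion_op_zero m)) x y) :: ('n, zfun) tmat"
  shows "fold teval_one [1..<Suc n] X = (\<lambda>x y. 0) \<or>
    (\<exists>F p r. D.fus (map av [1..<Suc n]) F \<and> (filler0 F \<or> row n) \<and> p \<noteq> 0 \<and> r \<noteq> 0 \<and>
      fold teval_one [1..<Suc n] X = tmat_of m (scal (zconst p / zconst r) * (mz F * rest n (Suc n))))"
  using assms(4)
proof (induction n)
  case 0
  have "X = tmat_of m (scal (zconst p0 / zconst r0) * (mz 1 * rest 0 (Suc 0)))"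
    unfolding X_def fusion_op_col fusion_op_zero_inverse tmat_of_scal rest_def
    by (simp add: rhom.map_one[OF rhom_zconst] mult.assoc del: upt_Suc)
  moreover have "row 0" by (simp add: row_def)
  ultimately show ?case using pr D.fus_Nil by auto
next
  case (Suc n)
  have up: "[1..<Suc (Suc n)] = [1..<Suc n] @ [Suc n]" by simp
  have fold: "fold teval_one [1..<Suc (Suc n)] X = teval_one (Suc n) (fold teval_one [1..<Suc n] X)"
    unfolding up by simp
  have "n < m" using Suc.prems by simp
  consider "fold teval_one [1..<Suc n] X = (\<lambda>x y. 0)" |
    F p r where "D.fus (map av [1..<Suc n]) F" "filler0 F \<or> row n" "p \<noteq> 0" "r \<noteq> 0"
      "fold teval_one [1..<Suc n] X = tmat_of m (scal (zconst p / zconst r) * (mz F * rest n (Suc n)))"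
    using Suc.IH Suc.prems by auto
  then show ?case
  proof cases
    case 1
    then show ?thesis unfolding fold by (simp add: teval_zero)
  next
    case 2
    let ?s = "zconst p / zconst r" and ?Y = "mz F * col n (Suc n)" and ?R = "rest n (Suc (Suc n))"
      and ?R' = "rest (Suc n) (Suc (Suc n))"
    have nz: "zconst u \<noteq> 0" if "u \<noteq> 0" for u using that zconst_inj[of u 0] by (simp add: zconst_ring)
    have "rest n (Suc n) = col n (Suc n) * ?R"
      unfolding rest_def using Suc.prems by (subst upt_conv_Cons) (simp_all add: mult.assoc)
    then have Z: "fold teval_one [1..<Suc n] X = tmat_of m (scal ?s * (?Y * ?R))"
      using 2(5) by (simp add: mult.assoc)
    have s: "evals (Suc n) ?s ?s" "?s \<noteq> 0"
      using evals_mult[OF evals_const evals_inverse[OF evals_const nz[OF 2(4)]], of "Suc n" p] nz 2 by auto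
    show ?thesis
    proof (cases "\<exists>Y. ev_op (Suc n) m ?Y Y")
      case True
      then obtain Y where "ev_op (Suc n) m ?Y Y" ..
      then obtain H t where H: "D.fus (map av [1..<Suc n] @ [av (Suc n)]) H" "filler0 H \<or> row (Suc n)" "t \<noteq> 0"
        "ev_op (Suc n) m ?Y (scal (1 / zconst t) * mz H)"
        using fusion_step[OF 2(1) \<open>n < m\<close> cs[OF \<open>n < m\<close>] 2(2)] by metis
      have step: "fold teval_one [1..<Suc (Suc n)] X = tmat_of m (scal ?s * ((scal (1 / zconst t) * mz H) * ?R'))
          \<or> fold teval_one [1..<Suc (Suc n)] X = (\<lambda>x y. 0)"
        unfolding fold Z by (rule teval_step[OF s ev_unit_rest H(4)])
      have "scal ?s * ((scal (1 / zconst t) * mz H) * ?R') = scal (zconst p / zconst (r * t)) * (mz H * ?R')"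
      proof -
        have "zconst p / zconst (r * t) = ?s * (1 / zconst t)" by (simp add: zconst_ring)
        then show ?thesis by (simp only: scal_hom(1) mult.assoc)
      qed
      moreover have "r * t \<noteq> 0" using 2 H by simp
      moreover have "D.fus (map av [1..<Suc (Suc n)]) H" using H(1) unfolding up by simp
      ultimately show ?thesis using step H(2) 2(3) by metis
    next
      case False
      \<comment> \<open>Since \<open>?Y\<close> has no regular value, the last premise of
        \<open>teval_step\<close> holds vacuously for every \<open>Y1\<close>; the choice 0 makes
        both outcomes zero.\<close>
      then have "fold teval_one [1..<Suc (Suc n)] X = tmat_of m (scal ?s * (0 * ?R'))
          \<or> fold teval_one [1..<Suc (Suc n)] X = (\<lambda>x y. 0)"
        unfolding fold Z by (intro teval_step[OF s ev_unit_rest]) blast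
      moreover have "tmat_of m (scal ?s * (0 * ?R')) = (\<lambda>x y. 0)"
        by (intro ext) (simp add: tmat_of_def ent_zero)
      ultimately show ?thesis by simp
    qed
  qed
qed

text \<open>The quotient stays in the form \<open>r E = p F \<tau>\<close> because \<open>r\<close>
  need not be invertible in the power series ring.\<close>

theorem fusion_constant:
  fixes p0 r0 :: "complex fps"
  assumes cs: "\<And>n. n < m \<Longrightarrow> content_step n" and pr: "r0 \<noteq> 0"
  defines "E \<equiv> tconstant (fold teval_one [1..<Suc m]
    (\<lambda>x y. zconst p0 / zconst r0 * tmult m (fusion_op m c) (tinv m (fusion_op_zero m)) x y)) :: ('n, complex fps) tmat"
  shows "E = (\<lambda>x y. 0) \<or> (\<exists>F p r. D.fus (map av [1..<Suc m]) F \<and> r \<noteq> 0 \<and>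
    (\<forall>x y. length x = m \<longrightarrow> length y = m \<longrightarrow> r * E x y = p * ent (F * D.Tinv0 m) x y))"
proof -
  define Z where "Z = fold teval_one [1..<Suc m]
    ((\<lambda>x y. zconst p0 / zconst r0 * tmult m (fusion_op m c) (tinv m (fusion_op_zero m)) x y) :: ('n, zfun) tmat)"
  have z0: "(tconstant (\<lambda>x y. 0) :: ('n, complex fps) tmat) = (\<lambda>x y. 0)"
  proof -
    have "inv zconst 0 = 0" using inv_f_f[of zconst 0] zconst_inj by (simp add: inj_def zconst_ring)
    then show ?thesis by (intro ext) (simp add: tconstant_def tmap_def)
  qed
  show ?thesis
  proof (cases "p0 = 0 \<or> Z = (\<lambda>x y. 0)")
    case True
    moreover have "Z = (\<lambda>x y. 0)" if "p0 = 0" unfolding Z_def that by (simp add: zconst_ring fold_teval_zero del: upt_Suc)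
    ultimately have "Z = (\<lambda>x y. 0)" by blast
    then show ?thesis using z0 unfolding E_def Z_def[symmetric] by simp
  next
    case False
    then obtain F p r where F: "D.fus (map av [1..<Suc m]) F" "r \<noteq> 0"
      "Z = tmat_of m (scal (zconst p / zconst r) * (mz F * rest m (Suc m)))"
      using fold_teval_fusion[OF cs _ pr order_refl, of p0] unfolding Z_def[symmetric] by auto
    have Z: "Z x y = zconst p / zconst r * zconst (ent (F * D.Tinv0 m) x y)" if "length x = m" "length y = m" for x y
      unfolding F(3) rest_def using that
      by (simp add: tmat_of_def ent_scal_mult flip: rhom.map_mult[OF rhom_zconst] rhom.ent_map[OF rhom_zconst])
    show ?thesis
    proof (cases "\<forall>x y. Z x y \<in> range zconst")
      case True
      then have "E x y = inv zconst (Z x y)" for x y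
        unfolding E_def Z_def[symmetric] by (simp add: tconstant_def tmap_def)
      then have E: "zconst (E x y) = Z x y" for x y using True by (simp add: f_inv_into_f)
      have "r * E x y = p * ent (F * D.Tinv0 m) x y" if "length x = m" "length y = m" for x y
      proof -
        have "zconst r \<noteq> 0" using F(2) zconst_inj[of r 0] by (simp add: zconst_ring)
        then have "zconst (r * E x y) = zconst (p * ent (F * D.Tinv0 m) x y)"
          using Z[OF that] by (simp add: zconst_ring E)
        then show ?thesis by (simp only: zconst_inj)
      qed
      then show ?thesis using F by blast
    next
      case False
      then have "E = (\<lambda>x y. 0)" unfolding E_def Z_def[symmetric] tconstant_def by (rule if_not_P)
      then show ?thesis ..
    qed
  qed
qed

end

section \<open>Contents of standard tableaux\<close>

lemma diagram_ideal:
  assumes "partition_of lam m" "standard_tableau lam T" "(i, j) \<in> diagram lam" "i' \<le> i" "j' \<le> j"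
  shows "(i', j') \<in> diagram lam \<and> T (i', j') \<le> T (i, j)"
proof -
  have T: "(i, Suc j) \<in> diagram lam \<Longrightarrow> T (i, j) < T (i, Suc j)" "(Suc i, j) \<in> diagram lam \<Longrightarrow> T (i, j) < T (Suc i, j)"
    for i j using assms(2) by (auto simp: standard_tableau_def)
  have up: "(Suc i, j) \<in> diagram lam \<Longrightarrow> (i, j) \<in> diagram lam" for i j
    using assms(1) sorted_wrt_nth_less[of "(\<ge>)" lam i "Suc i"] by (auto simp: partition_of_def diagram_def)
  have left: "(i, Suc j) \<in> diagram lam \<Longrightarrow> (i, j) \<in> diagram lam" for i j
    by (simp add: diagram_def)
  have 1: "(i, j') \<in> diagram lam \<and> T (i, j') \<le> T (i, j)"
    using assms(5)
  proof (induction j' rule: inc_induct)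
    case (step j')
    then show ?case using left[of i j'] T(1)[of i j'] by auto
  qed (use assms in simp)
  show ?thesis
    using assms(4)
  proof (induction i' rule: inc_induct)
    case (step i')
    then show ?case using up[of i' j'] T(2)[of i' j'] by auto
  qed (rule 1)
qed

text \<open>An order ideal meets a diagonal in an initial segment. The hypotheses say that
  \<open>(a, b)\<close> is the first missing box of its diagonal, and \<open>min a b\<close> boxes
  precede it.\<close>

lemma card_diagonal:
  assumes "\<And>i j i' j'. (i, j) \<in> B \<Longrightarrow> i' \<le> i \<Longrightarrow> j' \<le> j \<Longrightarrow> (i', j') \<in> B"
    and "(a, b) \<notin> B" "0 < a \<Longrightarrow> 0 < b \<Longrightarrow> (a - 1, b - 1) \<in> B"
  shows "card {\<alpha> \<in> B. cont \<alpha> = int b - int a} = min a b"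
proof -
  have "{\<alpha> \<in> B. cont \<alpha> = int b - int a} = (\<lambda>s. (a - 1 - s, b - 1 - s)) ` {..<min a b}"
  proof (intro set_eqI iffI)
    fix \<alpha> assume \<alpha>: "\<alpha> \<in> {\<alpha> \<in> B. cont \<alpha> = int b - int a}"
    obtain i j where ij: "\<alpha> = (i, j)" by (cases \<alpha>)
    have c: "int j - int i = int b - int a" using \<alpha> by (simp add: ij cont_def)
    have "i < a"
    proof (rule ccontr)
      assume "\<not> i < a"
      then show False using assms(1)[of i j a b] assms(2) \<alpha> c by (simp add: ij)
    qed
    then have "i = a - 1 - (a - 1 - i)" "j = b - 1 - (a - 1 - i)" "a - 1 - i \<in> {..<min a b}" using c by auto
    then show "\<alpha> \<in> (\<lambda>s. (a - 1 - s, b - 1 - s)) ` {..<min a b}" unfolding ij by blast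
  next
    fix \<alpha> assume "\<alpha> \<in> (\<lambda>s. (a - 1 - s, b - 1 - s)) ` {..<min a b}"
    then obtain s where s: "s < a" "s < b" "\<alpha> = (a - 1 - s, b - 1 - s)" by auto
    then show "\<alpha> \<in> {\<alpha> \<in> B. cont \<alpha> = int b - int a}"
      using assms(1)[of "a - 1" "b - 1" "a - 1 - s" "b - 1 - s"] assms(3) by (auto simp: cont_def)
  qed
  moreover have "inj_on (\<lambda>s. (a - 1 - s, b - 1 - s)) {..<min a b}" by (auto simp: inj_on_def)
  ultimately show ?thesis by (simp add: card_image)
qed

lemma count_list_map_card: "distinct xs \<Longrightarrow> count_list (map f xs) k = card {x \<in> set xs. f x = k}"
proof (induction xs)
  case (Cons x xs)
  have "{y \<in> set (x # xs). f y = k} = (if f x = k then insert x {y \<in> set xs. f y = k} else {y \<in> set xs. f y = k})"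
    by auto
  then show ?case using Cons by simp
qed simp

text \<open>For the new box \<open>(a, b)\<close> the earlier boxes on its own diagonal and on the
  two adjacent ones number \<open>min a b\<close>, \<open>min a (b + 1)\<close> and
  \<open>min (a + 1) b\<close>. The last two, plus 1 if \<open>a = b\<close>, add up to
  \<open>2 min a b + 1\<close>.\<close>

lemma tableau_content_step:
  assumes "partition_of lam m" "standard_tableau lam T" "n < m"
  shows "fusion_setting.content_step (tab_cont lam T) n"
proof -
  let ?D = "diagram lam" and ?c = "tab_cont lam T"
  define B where "B = {\<alpha> \<in> ?D. T \<alpha> \<le> n}"
  have m: "sum_list lam = m" using assms(1) by (simp add: partition_of_def)
  have bij: "bij_betw T ?D {1..m}" using assms(2) m by (simp add: standard_tableau_def)
  have T: "(i, Suc j) \<in> diagram lam \<Longrightarrow> T (i, j) < T (i, Suc j)" "(Suc i, j) \<in> diagram lam \<Longrightarrow> T (i, j) < T (Suc i, j)"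
    for i j using assms(2) by (auto simp: standard_tableau_def)
  have ideal: "(i', j') \<in> B" if "(i, j) \<in> B" "i' \<le> i" "j' \<le> j" for i j i' j'
    using diagram_ideal[OF assms(1,2) _ that(2,3)] that(1) unfolding B_def by fastforce
  have cnt: "card {i \<in> {1..n}. ?c i = k} = card {\<alpha> \<in> B. cont \<alpha> = k}" for k
  proof -
    have "T ` {\<alpha> \<in> B. cont \<alpha> = k} = {i \<in> {1..n}. ?c i = k}"
    proof (intro set_eqI iffI)
      fix i assume "i \<in> T ` {\<alpha> \<in> B. cont \<alpha> = k}"
      then show "i \<in> {i \<in> {1..n}. ?c i = k}"
        using bij_betw_inv_into_left[OF bij] bij_betw_imp_surj_on[OF bij] by (auto simp: B_def tab_cont_def)
    next
      fix i assume i: "i \<in> {i \<in> {1..n}. ?c i = k}"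
      then have "i \<in> T ` ?D" using bij_betw_imp_surj_on[OF bij] assms(3) by auto
      then have "T (inv_into ?D T i) = i" "inv_into ?D T i \<in> ?D" by (simp_all add: f_inv_into_f inv_into_into)
      then show "i \<in> T ` {\<alpha> \<in> B. cont \<alpha> = k}"
        using i by (intro image_eqI[of _ _ "inv_into ?D T i"]) (auto simp: B_def tab_cont_def)
    qed
    moreover have "inj_on T {\<alpha> \<in> B. cont \<alpha> = k}"
      using bij_betw_imp_inj_on[OF bij] by (rule inj_on_subset) (auto simp: B_def)
    ultimately show ?thesis using card_image[of T "{\<alpha> \<in> B. cont \<alpha> = k}"] by simp
  qed
  \<comment> \<open>The box of the entry \<open>n + 1\<close> is the first missing one on its
    diagonal of \<open>B\<close>; hence \<open>(a, b + 1)\<close> and \<open>(a + 1, b)\<close> are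
    the first missing ones on the adjacent diagonals.\<close>
  obtain a b where ab: "inv_into ?D T (Suc n) = (a, b)" by (cases "inv_into ?D T (Suc n)")
  have "Suc n \<in> T ` ?D" using bij_betw_imp_surj_on[OF bij] assms(3) by auto
  then have abD: "(a, b) \<in> ?D" "T (a, b) = Suc n"
    using inv_into_into[of "Suc n" T ?D] f_inv_into_f[of "Suc n" T ?D] by (simp_all add: ab)
  have k: "?c (Suc n) = int b - int a" by (simp add: tab_cont_def ab cont_def)
  have notin: "(a, b) \<notin> B" using abD by (simp add: B_def)
  have up: "(a - 1, b) \<in> B" if "0 < a"
  proof -
    from that obtain a' where "a = Suc a'" by (cases a) auto
    then show ?thesis using T(2)[of a' b] abD diagram_ideal[OF assms(1,2) abD(1), of a' b] by (simp add: B_def)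
  qed
  have left: "(a, b - 1) \<in> B" if "0 < b"
  proof -
    from that obtain b' where "b = Suc b'" by (cases b) auto
    then show ?thesis using T(1)[of a b'] abD diagram_ideal[OF assms(1,2) abD(1), of a b'] by (simp add: B_def)
  qed
  have "card {\<alpha> \<in> B. cont \<alpha> = int b - int a} = min a b"
    using up ideal[of "a - 1" b "a - 1" "b - 1"] using notin by (intro card_diagonal[OF ideal]) auto
  moreover have "card {\<alpha> \<in> B. cont \<alpha> = int (Suc b) - int a} = min a (Suc b)"
    using up ideal[of a "Suc b" a b] notin by (intro card_diagonal[OF ideal]) auto
  moreover have "card {\<alpha> \<in> B. cont \<alpha> = int b - int (Suc a)} = min (Suc a) b"
    using left ideal[of "Suc a" b a b] notin by (intro card_diagonal[OF ideal]) auto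
  moreover have "int (Suc b) - int a = ?c (Suc n) + 1" "int b - int (Suc a) = ?c (Suc n) - 1" "int b - int a = ?c (Suc n)"
    using k by simp_all
  ultimately have N: "card {i \<in> {1..n}. ?c i = ?c (Suc n)} = min a b" "card {i \<in> {1..n}. ?c i = ?c (Suc n) + 1} = min a (Suc b)"
    "card {i \<in> {1..n}. ?c i = ?c (Suc n) - 1} = min (Suc a) b"
    unfolding cnt by (simp_all only:)
  have set: "{x \<in> set [1..<Suc n]. P x} = {i \<in> {1..n}. P i}" for P by auto
  have "count_list (map ?c [1..<Suc n]) (?c (Suc n)) = min a b"
    unfolding count_list_map_card[OF distinct_upt] set by (rule N)
  moreover have "count_list (map (\<lambda>i. ?c i - 1) [1..<Suc n]) (?c (Suc n)) = min a (Suc b)"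
    unfolding count_list_map_card[OF distinct_upt] set N(2)[symmetric] by (rule arg_cong[where f = card]) auto
  moreover have "count_list (map (\<lambda>i. ?c i + 1) [1..<Suc n]) (?c (Suc n)) = min (Suc a) b"
    unfolding count_list_map_card[OF distinct_upt] set N(3)[symmetric] by (rule arg_cong[where f = card]) auto

  moreover have cons: "count_list (0 # xs) x = (if x = 0 then 1 else 0) + count_list xs x" for xs and x :: int by simp
  moreover have "?c (Suc n) = 0 \<longleftrightarrow> a = b" using k by auto
  ultimately have "count_list (0 # map (\<lambda>k. k + 1) (map ?c [1..<Suc n]) @ map (\<lambda>k. k - 1) (map ?c [1..<Suc n])) (?c (Suc n))
      = (if a = b then 1 else 0) + (min (Suc a) b + min a (Suc b))"
    by (simp only: count_list_append map_map o_def)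
  moreover have "(if a = b then 1 else 0) + (min (Suc a) b + min a (Suc b)) = Suc (2 * min a b)" by auto
  ultimately show ?thesis
    unfolding fusion_setting.content_step_def Let_def \<open>count_list (map ?c _) _ = min a b\<close> by (simp only:)
qed

section \<open>The series of a tableau\<close>

text \<open>All that is used of the Schur element. It need not be nonzero: with
  \<open>1 / 0 = 0\<close> its inverse is again of this form.\<close>

definition const_ratio :: "zfun \<Rightarrow> bool" where
  "const_ratio f \<longleftrightarrow> (\<exists>p r. r \<noteq> 0 \<and> f = zconst p / zconst r)"

lemma const_ratioI: "r \<noteq> 0 \<Longrightarrow> const_ratio (zconst p / zconst r)"
  unfolding const_ratio_def by blast

lemma const_ratio_const: "const_ratio (zconst p)"
  using const_ratioI[of 1 p] by (simp add: zconst_ring)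

lemma const_ratio_mult: "const_ratio f \<Longrightarrow> const_ratio g \<Longrightarrow> const_ratio (f * g)"
proof -
  assume "const_ratio f" "const_ratio g"
  then obtain p r p' r' where *: "r \<noteq> 0" "f = zconst p / zconst r" "r' \<noteq> 0" "g = zconst p' / zconst r'"
    unfolding const_ratio_def by blast
  then show ?thesis using const_ratioI[of "r * r'" "p * p'"] by (simp add: zconst_ring)
qed

lemma const_ratio_inverse: "const_ratio f \<Longrightarrow> const_ratio (1 / f)"
proof -
  assume "const_ratio f"
  then obtain p r where *: "r \<noteq> 0" "f = zconst p / zconst r" unfolding const_ratio_def by blast
  show ?thesis
  proof (cases "p = 0")
    case True
    then show ?thesis using * const_ratio_const[of 0] by (simp add: zconst_ring)
  next
    case False
    then show ?thesis using * const_ratioI[of p r] by simp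
  qed
qed

lemma const_ratio_schur: "const_ratio (schur_element_conj lam)"
proof -
  have prod: "(\<And>\<alpha>. const_ratio (f \<alpha>)) \<Longrightarrow> const_ratio (\<Prod>\<alpha>\<in>A. f \<alpha>)" for A and f :: "nat \<times> nat \<Rightarrow> zfun"
    using const_ratio_const[of 1] by (induction A rule: infinite_finite_induct) (auto simp: zconst_ring intro: const_ratio_mult)
  have diff: "const_ratio (zexp a - zexp b)" for a b
    unfolding zexp_def zconst_ring(5)[symmetric] by (rule const_ratio_const)
  have div: "const_ratio (f / g)" if "const_ratio f" "const_ratio g" for f g
    using const_ratio_mult[OF that(1) const_ratio_inverse[OF that(2)]] by simp
  show ?thesis
    unfolding schur_element_conj_def
    by (intro prod const_ratio_mult div diff) (simp add: zexp_def const_ratio_const)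
qed

lemma fusion_idempotent_fus:
  assumes "partition_of lam m" "standard_tableau lam T"
  shows "(fusion_idempotent lam T :: ('n::{finite,linorder}, complex fps) tmat) = (\<lambda>x y. 0) \<or>
    (\<exists>F tF p r k1 k2. dhecke.fus scal qD sD (hecke_op m qD sD) (hecke_inv m qD sD) m
        (map (\<lambda>k. fps_exp (of_int (tab_cont lam T k))) [1..<Suc m]) F \<and> r \<noteq> 0 \<and>
      (\<forall>x y :: 'n list. length x = m \<longrightarrow> length y = m \<longrightarrow> r * fusion_idempotent lam T x y = p * ent (F * tF) x y) \<and>
      k2 \<noteq> 0 \<and> scal k1 * (F * tF * F) = scal k2 * F)"
proof -
  interpret F: fusion_setting m "tab_cont lam T" "TYPE('n)" .
  obtain p0 r0 where *: "r0 \<noteq> 0" "1 / schur_element_conj lam = zconst p0 / zconst r0"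
    using const_ratio_inverse[OF const_ratio_schur] unfolding const_ratio_def by blast
  have m: "sum_list lam = m" using assms(1) by (simp add: partition_of_def)
  have "(fusion_idempotent lam T :: ('n, complex fps) tmat) = tconstant (fold teval_one [1..<Suc m]
      (\<lambda>x y. zconst p0 / zconst r0 * tmult m (fusion_op m (tab_cont lam T)) (tinv m (fusion_op_zero m)) x y))"
    unfolding fusion_idempotent_def Let_def m * ..
  then consider "(fusion_idempotent lam T :: ('n, complex fps) tmat) = (\<lambda>x y. 0)" | F p r
    where "F.D.fus (map F.av [1..<Suc m]) F" "r \<noteq> 0"
      "\<forall>x y :: 'n list. length x = m \<longrightarrow> length y = m \<longrightarrow> r * fusion_idempotent lam T x y = p * ent (F * F.D.Tinv0 m) x y"
    using F.fusion_constant[OF tableau_content_step[OF assms] *(1), of p0] by (simp only:) blast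
  then show ?thesis
  proof cases
    case 2
    obtain k1 k2 where "k1 \<noteq> 0" "k2 \<noteq> 0" "F.D.sm k1 (F * F.D.Tinv0 m * F) = F.D.sm k2 F"
      using F.D.fus_quasi_idempotent[OF 2(1)] by (auto simp del: upt_Suc)
    then show ?thesis using 2 unfolding F.D.sm_def F.av_def[abs_def] by blast
  qed blast
qed

lemma site_lop: "k \<in> {1..m} \<Longrightarrow> site m k A = tmat_of m (lop m (k - 1) A)"
proof (intro ext)
  fix x y :: "'a list" assume k: "k \<in> {1..m}"
  have "(\<forall>l\<in>{1..m} - {k}. x ! (l - 1) = y ! (l - 1)) \<longleftrightarrow> agree (k - 1) x y" if "length x = m"
  proof
    assume *: "\<forall>l\<in>{1..m} - {k}. x ! (l - 1) = y ! (l - 1)"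
    show "agree (k - 1) x y"
      unfolding agree_def
    proof (intro allI impI)
      fix j assume "j < length x" "j \<noteq> k - 1"
      then show "x ! j = y ! j" using *[rule_format, of "Suc j"] that by auto
    qed
  next
    assume *: "agree (k - 1) x y"
    show "\<forall>l\<in>{1..m} - {k}. x ! (l - 1) = y ! (l - 1)"
    proof
      fix l assume "l \<in> {1..m} - {k}"
      then show "x ! (l - 1) = y ! (l - 1)" using *[unfolded agree_def, rule_format, of "l - 1"] that k by auto
    qed
  qed
  then show "site m k A x y = tmat_of m (lop m (k - 1) A) x y"
    by (auto simp: site_def tmat_of_def ent_lop)
qed

lemma lprod_eq_prod_list:
  fixes e :: "'p::comm_ring_1 \<Rightarrow> 'r::ring_1" and l :: "'p \<Rightarrow> 'n::{finite,linorder} \<Rightarrow> 'n \<Rightarrow> 'r"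
  assumes "op_hecke e q qi"
  shows "op_hecke.lprod m l 0 (map g [1..<Suc n]) = prod_list (map (\<lambda>k. lop m (k - 1) (l (g k))) [1..<Suc n])"
proof -
  interpret op_hecke e q qi m "TYPE('n)" by (rule assms)
  show ?thesis
  proof (induction n)
    case (Suc n)
    have up: "[1..<Suc (Suc n)] = [1..<Suc n] @ [Suc n]" by simp
    show ?case unfolding up map_append lprod_append Suc.IH by (simp del: upt_Suc)
  qed simp
qed

lemma (in rhom) map_op_prod_list: "map_op f (prod_list Xs) = prod_list (map (map_op f) Xs)"
  by (induction Xs) (simp_all add: map_one map_mult)

lemma (in rhom) map_lop: "map_op f (lop m k l) = lop m k (\<lambda>i j. f (l i j))"
  by (rule op_eqI) (simp add: ent_map ent_lop zero one)

lemma (in rhom) map_tmat_of: "tmap f (tmat_of m X) = tmat_of m (map_op f X)"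
  by (intro ext) (simp add: tmap_def tmat_of_def ent_map zero)

lemma trm_tmat_of: "trm m X = ttrace m (tmat_of m X)"
  by (simp add: trm_def ttrace_def tmat_of_def)

lemma tmult_cong_right:
  "(\<And>x y. length x = m \<Longrightarrow> length y = m \<Longrightarrow> E x y = E' x y) \<Longrightarrow> tmult m A E = tmult m A E'"
  by (intro ext) (auto simp: tmult_def intro!: sum.cong)

definition dval :: "'n::{finite,linorder} \<Rightarrow> complex fps" where
  "dval i = fps_exp ((of_nat CARD('n) + 1 - 2 * of_nat (card {..i})) / 2)"

lemma prod_list_dmat: "prod_list (map (\<lambda>k. lop m (k - 1) dmat) [1..<Suc m]) = diag_op m dval"
proof -
  have lop: "ent (lop m k dmat * X) x y = (if length x = m then dval (x ! k) else 1) * ent X x y"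
    if "k < m" for k X and x y :: "'a list"
  proof -
    have "agree k x z \<and> x ! k = z ! k \<longleftrightarrow> x = z" if "length x = m" "length z = m" for z
      using that \<open>k < m\<close> unfolding agree_def by (auto simp: list_eq_iff_nth_eq)
    then have "ent (lop m k dmat) x z = (if x = z then (if length x = m then dval (x ! k) else 1) else 0)" for z
      by (auto simp: ent_lop dmat_def dval_def)
    then have "ent (lop m k dmat * X) x y = (\<Sum>z | length z = length x. if z = x then (if length x = m then dval (x ! k) else 1) * ent X z y else 0)"
      unfolding ent_mult by (intro sum.cong) auto
    then show ?thesis by (simp add: sum_lists_delta)
  qed
  have e: "ent (prod_list (map (\<lambda>k. lop m (k - 1) dmat) ks) :: ('a, complex fps) op) x y
      = (if x = y then if length x = m then (\<Prod>k\<leftarrow>ks. dval (x ! (k - 1))) else 1 else 0)"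
    if "set ks \<subseteq> {1..m}" for ks and x y :: "'a list"
    using that
  proof (induction ks)
    case (Cons k ks)
    then have "k - 1 < m" by auto
    then show ?case using Cons by (simp add: lop)
  qed (simp add: ent_one)
  have p: "(\<Prod>k\<leftarrow>[1..<Suc m]. dval (x ! (k - 1))) = prod_list (map dval x)" if "length x = m" for x :: "'a list"
  proof -
    have "map (\<lambda>k. dval (x ! (k - 1))) [1..<Suc m] = map dval x"
      using that by (intro nth_equalityI) (simp_all del: upt_Suc)
    then show ?thesis by simp
  qed
  have "set [1..<Suc m] \<subseteq> {1..m}" by auto
  then show ?thesis
    by (intro op_eqI) (simp only: e p ent_diag_op cong: if_cong)
qed

lemma ltab_trm:
  fixes T :: "nat \<times> nat \<Rightarrow> nat"
  assumes "partition_of lam m"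
  shows "(ltab lam T :: 'n::{finite,linorder} h_yangian fps)
    = trm m (prod_list (map (\<lambda>k. lop m (k - 1) (lseries (tab_cont lam T k))) [1..<Suc m])
        * map_op (\<lambda>c. fps_const (yscalar c)) (diag_op m dval * Op (fusion_idempotent lam T)))"
proof -
  have m: "sum_list lam = m" using assms(1) by (simp add: partition_of_def)
  have r: "rhom (\<lambda>c. fps_const (yscalar c) :: 'n h_yangian fps)"
    by (rule calg.rhom[OF calg_fps_const[OF calg_yscalar]])
  have site: "tprod m (map (\<lambda>k. site m k (A k)) [1..<Suc m]) = tmat_of m (prod_list (map (\<lambda>k. lop m (k - 1) (A k)) [1..<Suc m]))"
    for A :: "nat \<Rightarrow> 'n \<Rightarrow> 'n \<Rightarrow> 'a::ring_1"
    by (rule tprod_tmat_of, rule site_lop) (simp add: atLeastLessThanSuc_atLeastAtMost del: upt_Suc)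
  have E: "tmult m A (fusion_idempotent lam T) = tmult m A (tmat_of m (Op (fusion_idempotent lam T)))" for A :: "('n, complex fps) tmat"
    by (rule tmult_cong_right) (simp add: tmat_of_def ent_Op)
  show ?thesis
    unfolding ltab_def Let_def m site E prod_list_dmat tmat_of_mult rhom.map_tmat_of[OF r] trm_tmat_of ..
qed

section \<open>Separating the two spectral variables\<close>

definition jA :: "'a::ring_1 fps \<Rightarrow> 'a fps fps" where
  "jA f = Abs_fps (\<lambda>r. fps_const (fps_nth f r))"

text \<open>With \<open>t\<close> the outer and \<open>w\<close> the inner variable,
  \<open>jA f\<close> is \<open>f(t)\<close> and \<open>jB f\<close> is \<open>f(t w)\<close>. The
  coefficient of \<open>t^(r + s) w^s\<close> in a product of the two isolates one pair of
  coefficients.\<close>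

definition jB :: "'a::ring_1 fps \<Rightarrow> 'a fps fps" where
  "jB f = Abs_fps (\<lambda>r. fps_const (fps_nth f r) * fps_X ^ r)"

lemma fps_const_sum: "fps_const (\<Sum>i\<in>A. f i) = (\<Sum>i\<in>A. fps_const (f i))"
  by (induction A rule: infinite_finite_induct) (simp_all flip: fps_const_add)

lemma rhom_jA: "rhom jA"
  by standard (rule fps_ext, simp add: jA_def fps_mult_nth fps_const_sum)+

lemma fps_X_power_commute: "fps_X ^ n * f = f * fps_X ^ n" for f :: "'a::ring_1 fps"
  by (rule fps_ext) (simp add: fps_X_power_mult_nth fps_X_power_mult_right_nth)

lemma rhom_jB: "rhom jB"
proof
  fix f g :: "'a fps"
  show "jB (f * g) = jB f * jB g"
  proof (rule fps_ext)
    fix n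
    have "fps_nth (jB f * jB g) n = (\<Sum>i=0..n. fps_const (fps_nth f i) * fps_X ^ i * (fps_const (fps_nth g (n - i)) * fps_X ^ (n - i)))"
      by (simp add: jB_def fps_mult_nth)
    also have "\<dots> = (\<Sum>i=0..n. fps_const (fps_nth f i * fps_nth g (n - i)) * fps_X ^ n)"
    proof (rule sum.cong[OF refl])
      fix i assume "i \<in> {0..n}"
      have "fps_const (fps_nth f i) * fps_X ^ i * (fps_const (fps_nth g (n - i)) * fps_X ^ (n - i))
          = fps_const (fps_nth f i) * (fps_X ^ i * fps_const (fps_nth g (n - i))) * fps_X ^ (n - i)"
        by (simp only: mult.assoc)
      also have "\<dots> = fps_const (fps_nth f i) * fps_const (fps_nth g (n - i)) * (fps_X ^ i * fps_X ^ (n - i))"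
        unfolding fps_X_power_commute[of i "fps_const _"] by (simp only: mult.assoc)
      also have "fps_X ^ i * fps_X ^ (n - i) = (fps_X ^ n :: 'a fps)"
        using \<open>i \<in> {0..n}\<close> by (simp flip: power_add)
      finally show "fps_const (fps_nth f i) * fps_X ^ i * (fps_const (fps_nth g (n - i)) * fps_X ^ (n - i))
          = fps_const (fps_nth f i * fps_nth g (n - i)) * fps_X ^ n" by simp
    qed
    also have "\<dots> = fps_nth (jB (f * g)) n"
      by (simp add: jB_def fps_mult_nth fps_const_sum sum_distrib_right)
    finally show "fps_nth (jB (f * g)) n = fps_nth (jB f * jB g) n" ..
  qed
  show "jB (f + g) = jB f + jB g"
    by (rule fps_ext) (simp add: jB_def distrib_right flip: fps_const_add)
  show "jB 1 = (1 :: 'a fps fps)"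
    by (rule fps_ext) (simp add: jB_def)
qed

lemma j_const: "jA (fps_const c) = fps_const (fps_const c)" "jB (fps_const c) = fps_const (fps_const c)"
  by (rule fps_ext; simp add: jA_def jB_def)+

lemma coeff_jA_jB:
  "fps_nth (fps_nth (jA f * jB g) (r + s)) s = fps_nth f r * fps_nth g s"
  "fps_nth (fps_nth (jB g * jA f) (r + s)) s = fps_nth g s * fps_nth f r"
proof -
  have "fps_nth (fps_nth (jA f * jB g) (r + s)) s = (\<Sum>i=0..r+s. if i = r then fps_nth f r * fps_nth g s else 0)"
    unfolding fps_mult_nth[of "jA f"] fps_sum_nth
    by (rule sum.cong) (auto simp: jA_def jB_def fps_X_power_nth)
  then show "fps_nth (fps_nth (jA f * jB g) (r + s)) s = fps_nth f r * fps_nth g s" by simp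
  have "fps_nth (fps_nth (jB g * jA f) (r + s)) s = (\<Sum>i=0..r+s. if i = s then fps_nth g s * fps_nth f r else 0)"
    unfolding fps_mult_nth[of "jB g"] fps_sum_nth
    by (rule sum.cong) (auto simp: jA_def jB_def fps_X_power_nth fps_mult_right_const_nth)
  then show "fps_nth (fps_nth (jB g * jA f) (r + s)) s = fps_nth g s * fps_nth f r" by simp
qed

lemma lseries_nth: "fps_nth (lseries a i j) r = yscalar (fps_exp (of_int a) ^ r) * ycoeff r i j"
proof -
  interpret calg "yscalar :: complex fps \<Rightarrow> 'a h_yangian" by (rule calg_yscalar)
  have "fps_exp (of_nat r * of_int a) = (fps_exp (of_int a) ^ r :: complex fps)"
    by (simp add: fps_exp_power_mult)
  then have "fps_nth (lseries a i j) r = (if r = 0 \<and> i = j then 1 else 0)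
      - yscalar (fps_exp (of_int a) ^ r * fps_X) * ygen i j r"
    by (simp add: lseries_def mult.commute)
  then show ?thesis by (simp add: ycoeff_def right_diff_distrib e_mult e_one mult.assoc)
qed

lemma ygenser_jA: "ygenser (fps_const (fps_exp (of_int a)) * 1) i j = jA (lseries a i j)"
  by (rule fps_ext) (simp add: ygenser_def jA_def lseries_nth ymap_const)

lemma ygenser_jB: "ygenser (fps_const (fps_exp (of_int a)) * fps_X) i j = jB (lseries a i j :: 'n::{finite,linorder} h_yangian fps)"
proof (rule fps_ext)
  fix r
  interpret m: calg "ymap :: complex fps fps \<Rightarrow> 'n h_yangian fps" by (rule calg_ymap)
  have X: "ymap (fps_X ^ k) = (fps_X ^ k :: 'n h_yangian fps)" for k
    by (induction k) (simp_all add: m.e_one m.e_mult ymap_X)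
  have "fps_nth (ygenser (fps_const (fps_exp (of_int a)) * fps_X) i j) r
      = ymap (fps_const (fps_exp (of_int a) ^ r)) * fps_X ^ r * fps_const (ycoeff r i j :: 'n h_yangian)"
    by (simp add: ygenser_def power_mult_distrib m.e_mult X)
  also have "\<dots> = fps_const (yscalar (fps_exp (of_int a) ^ r) * ycoeff r i j) * fps_X ^ r"
    unfolding ymap_const mult.assoc fps_X_power_commute by (simp flip: mult.assoc)
  finally show "fps_nth (ygenser (fps_const (fps_exp (of_int a)) * fps_X) i j) r = fps_nth (jB (lseries a i j)) r"
    by (simp add: jB_def lseries_nth)
qed

lemma fps_dvd_one: "fps_nth f 0 dvd 1 \<Longrightarrow> f dvd 1" for f :: "'a::comm_ring_1 fps"
proof -
  assume "fps_nth f 0 dvd 1"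
  then obtain y where "fps_nth f 0 * y = 1" by (metis dvdE)
  then show ?thesis using fps_right_inverse[of f y] by (metis dvdI)
qed

text \<open>Divisibility of \<open>x^r - y^r\<close> by \<open>x - y\<close>, applied to all
  coefficients at once.\<close>

lemma ygenser_lip:
  "\<exists>s. ygenser (fps_const x * c) i j - ygenser (fps_const y * c) i j
     = (yZ (fps_const (x - y)) * s :: 'n::{finite,linorder} h_yangian fps fps)"
proof -
  interpret m: calg "ymap :: complex fps fps \<Rightarrow> 'n h_yangian fps" by (rule calg_ymap)
  have "\<exists>t. x ^ r - y ^ r = (x - y) * t" for r
    using poly_diff_dvd[of x y "monom 1 r"] unfolding dvd_def by (simp add: poly_monom)
  then obtain t where t: "\<And>r. x ^ r - y ^ r = (x - y) * t r" by metis
  have "ymap ((fps_const x * c) ^ r) - ymap ((fps_const y * c) ^ r)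
      = (ymap (fps_const (x - y)) * ymap (fps_const (t r) * c ^ r) :: 'n h_yangian fps)" for r
  proof -
    have "(fps_const x * c) ^ r - (fps_const y * c) ^ r = fps_const (x ^ r - y ^ r) * c ^ r"
      by (simp add: power_mult_distrib fps_const_power left_diff_distrib flip: fps_const_sub)
    then show ?thesis
      unfolding t by (simp add: mult.assoc flip: m.e_diff m.e_mult fps_const_mult)
  qed
  then have "ygenser (fps_const x * c) i j - ygenser (fps_const y * c) i j
      = yZ (fps_const (x - y)) * Abs_fps (\<lambda>r. ymap (fps_const (t r) * c ^ r) * fps_const (ycoeff r i j))"
    by (intro fps_ext) (simp add: ygenser_def yZ_def mult.assoc flip: left_diff_distrib)
  then show ?thesis ..
qed

lemma rll_setting_yangian:
  "rll_setting (yZ :: complex fps fps \<Rightarrow> 'n::{finite,linorder} h_yangian fps fps) qD sD ygenser"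
proof (intro rll_setting.intro rll_setting_axioms.intro)
  show "calg (yZ :: complex fps fps \<Rightarrow> 'n h_yangian fps fps)" by (rule calg_yZ)
  show "dalg (\<lambda>c. yZ (fps_const c) :: 'n h_yangian fps fps)"
    unfolding yZ_def ymap_const by (intro dalg_fps_const dalg_yscalar)
qed (rule qD_sD rll_ygenser ygenser_lip)+

text \<open>Covers both substitutions: \<open>j\<close> is \<open>jA\<close> with
  \<open>C = 1\<close>, or \<open>jB\<close> with \<open>C = w\<close>. The idempotent is replaced
  by \<open>F \<tau>\<close> at the cost of the scalars \<open>r\<close> and \<open>p\<close> on the
  two sides.\<close>

lemma ltab_hom:
  fixes T :: "nat \<times> nat \<Rightarrow> nat"
  assumes "partition_of lam m" and j: "rhom j" "\<And>c. j (fps_const c) = fps_const (fps_const c)"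
    and yj: "\<And>a i k. ygenser (fps_const (fps_exp (of_int a)) * C) i k = j (lseries a i k)"
    and E: "\<And>x y :: 'n list. length x = m \<Longrightarrow> length y = m \<Longrightarrow> r * fusion_idempotent lam T x y = p * ent (F * tF) x y"
  defines "S \<equiv> (\<lambda>c. yZ (fps_const c))"
  shows "S r * j (ltab lam T :: 'n::{finite,linorder} h_yangian fps) = S p * trm m (op_hecke.lprod m ygenser 0
      (map (\<lambda>k. fps_const (fps_exp (of_int (tab_cont lam T k))) * C) [1..<Suc m]) * map_op S (diag_op m dval * F * tF))"
proof -
  interpret j: rhom j by (rule j)
  interpret S: calg S unfolding S_def yZ_def ymap_const by (intro calg_fps_const calg_yscalar)
  interpret S: rhom S by (rule S.rhom)
  have r: "rhom (\<lambda>c. fps_const (yscalar c) :: 'n h_yangian fps)"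
    by (rule calg.rhom[OF calg_fps_const[OF calg_yscalar]])
  have jS: "map_op j (map_op (\<lambda>c. fps_const (yscalar c)) X) = map_op S X" for X :: "('n, complex fps) op"
    by (rule op_eqI) (simp only: j.ent_map rhom.ent_map[OF r] S.ent_map j(2), simp only: S_def yZ_def ymap_const)
  have jtrm: "j (trm m X) = trm m (map_op j X)" for X :: "('n, 'n h_yangian fps) op"
    by (simp add: trm_def j.sum j.ent_map)
  have oh: "op_hecke (yZ :: complex fps fps \<Rightarrow> 'n h_yangian fps fps) (fps_const qD) (fps_const sD)"
    using calg_yZ qD_sD by (simp add: op_hecke_def op_hecke_axioms_def)
  define L where "L = (op_hecke.lprod m ygenser 0
      (map (\<lambda>k. fps_const (fps_exp (of_int (tab_cont lam T k))) * C) [1..<Suc m]) :: ('n, 'n h_yangian fps fps) op)"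
  have L: "map_op j (prod_list (map (\<lambda>k. lop m (k - 1) (lseries (tab_cont lam T k))) [1..<Suc m])) = L"
    unfolding L_def lprod_eq_prod_list[OF oh] j.map_op_prod_list map_map o_def j.map_lop yj ..
  have sc: "X * scal (S c) = scal (S c) * X" for X :: "('n, 'n h_yangian fps fps) op" and c
    by (rule op_eqI) (simp add: ent_scal_mult ent_mult_scal S.e_central[of "ent X _ _"])
  have sc1: "X * scal c = scal c * X" for X :: "('n, complex fps) op" and c
    by (rule op_eqI) (simp add: ent_scal_mult ent_mult_scal mult.commute)
  have pull: "S c * trm m (L * map_op S (diag_op m dval * X)) = trm m (L * map_op S (diag_op m dval * (scal c * X)))" for c X
  proof -
    have "diag_op m dval * (scal c * X) = scal c * (diag_op m dval * X)"
      unfolding mult.assoc[symmetric] sc1 ..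
    then have "L * map_op S (diag_op m dval * (scal c * X)) = L * scal (S c) * map_op S (diag_op m dval * X)"
      by (simp only: S.map_mult S.map_scal mult.assoc)
    also have "\<dots> = scal (S c) * (L * map_op S (diag_op m dval * X))" unfolding sc by (simp only: mult.assoc)
    finally show ?thesis by (simp only: trm_scal)
  qed
  have E': "tmat_of m (scal r * Op (fusion_idempotent lam T)) = tmat_of m (scal p * (F * tF))"
    by (intro ext) (simp add: tmat_of_def ent_scal_mult ent_Op E)
  have cong: "trm m (L * map_op S (D * X)) = trm m (L * map_op S (D * Y))" if "tmat_of m X = tmat_of m Y" for D X Y
    unfolding trm_tmat_of tmat_of_mult[symmetric] S.map_tmat_of[symmetric] that ..
  have "j (ltab lam T) = trm m (L * map_op S (diag_op m dval * Op (fusion_idempotent lam T)))"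
    unfolding ltab_trm[OF assms(1)] jtrm j.map_mult L jS ..
  then have "S r * j (ltab lam T) = S p * trm m (L * map_op S (diag_op m dval * (F * tF)))"
    using pull[of r] pull[of p] cong[OF E'] by simp
  then show ?thesis by (simp only: L_def mult.assoc)
qed

lemma ltab_zero:
  assumes "partition_of lam m" "(fusion_idempotent lam T :: ('n::{finite,linorder}, complex fps) tmat) = (\<lambda>x y. 0)"
  shows "(ltab lam T :: 'n h_yangian fps) = 0"
proof -
  interpret r: rhom "\<lambda>c. fps_const (yscalar c) :: 'n h_yangian fps"
    by (rule calg.rhom[OF calg_fps_const[OF calg_yscalar]])
  have "Op (\<lambda>x y. 0) = (0 :: ('n, complex fps) op)" by (rule op_eqI) (simp add: ent_Op ent_zero)
  moreover have "map_op (\<lambda>c. fps_const (yscalar c)) 0 = (0 :: ('n, 'n h_yangian fps) op)"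
    by (rule op_eqI) (simp add: r.ent_map ent_zero r.zero)
  ultimately show ?thesis unfolding ltab_trm[OF assms(1)] assms(2) by (simp add: trm_def ent_zero)
qed

lemma ltab_coeff_commute:
  assumes "partition_of lam m" "standard_tableau lam \<Lambda>" "partition_of mu n" "standard_tableau mu \<Gamma>"
  shows "fps_nth (ltab lam \<Lambda> :: 'n::{finite,linorder} h_yangian fps) r * fps_nth (ltab mu \<Gamma>) s
    = fps_nth (ltab mu \<Gamma>) s * fps_nth (ltab lam \<Lambda>) r"
proof -
  let ?A = "ltab lam \<Lambda> :: 'n h_yangian fps" and ?B = "ltab mu \<Gamma> :: 'n h_yangian fps"
  define as bs where "as = map (\<lambda>k. fps_exp (of_int (tab_cont lam \<Lambda> k)) :: complex fps) [1..<Suc m]"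
    and "bs = map (\<lambda>k. fps_exp (of_int (tab_cont mu \<Gamma> k)) :: complex fps) [1..<Suc n]"
  interpret R: rll_setting "yZ :: complex fps fps \<Rightarrow> 'n h_yangian fps fps" qD sD ygenser dval m n
    by (rule rll_setting_yangian)
  have "jA ?A * jB ?B = jB ?B * jA ?A"
  proof (cases "?A = 0 \<or> ?B = 0")
    case True
    then show ?thesis by (auto simp: rhom.zero[OF rhom_jA] rhom.zero[OF rhom_jB])
  next
    case False
    then have "(fusion_idempotent lam \<Lambda> :: ('n, complex fps) tmat) \<noteq> (\<lambda>x y. 0)"
      "(fusion_idempotent mu \<Gamma> :: ('n, complex fps) tmat) \<noteq> (\<lambda>x y. 0)"
      using ltab_zero[OF assms(1)] ltab_zero[OF assms(3)] by blast+
    note nz = this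
    obtain F tF p u k1 k2 where F: "R.fusD m as F" "u \<noteq> 0" "k2 \<noteq> 0" "scal k1 * (F * tF * F) = scal k2 * F"
      "\<forall>x y :: 'n list. length x = m \<longrightarrow> length y = m \<longrightarrow> u * fusion_idempotent lam \<Lambda> x y = p * ent (F * tF) x y"
      using fusion_idempotent_fus[OF assms(1,2), where ?'n = 'n] nz(1) unfolding R.fusD_def as_def by (elim disjE) blast+
    obtain G tG p' u' k3 k4 where G: "R.fusD n bs G" "u' \<noteq> 0" "k4 \<noteq> 0" "scal k3 * (G * tG * G) = scal k4 * G"
      "\<forall>x y :: 'n list. length x = n \<longrightarrow> length y = n \<longrightarrow> u' * fusion_idempotent mu \<Gamma> x y = p' * ent (G * tG) x y"
      using fusion_idempotent_fus[OF assms(3,4), where ?'n = 'n] nz(2) unfolding R.fusD_def bs_def by (elim disjE) blast+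
    let ?tA = "trm m (op_hecke.lprod m ygenser 0 (R.param 1 as) * R.mS (diag_op m dval * F * tF))"
      and ?tB = "trm n (op_hecke.lprod n ygenser 0 (R.param fps_X bs) * R.mS (diag_op n dval * G * tG))"
    have A: "yZ (fps_const u) * jA ?A = yZ (fps_const p) * ?tA"
      unfolding R.param_def as_def map_map o_def
      by (rule ltab_hom[OF assms(1) rhom_jA j_const(1) ygenser_jA]) (use F(5) in blast)
    have B: "yZ (fps_const u') * jB ?B = yZ (fps_const p') * ?tB"
      unfolding R.param_def bs_def map_map o_def
      by (rule ltab_hom[OF assms(3) rhom_jB j_const(2) ygenser_jB]) (use G(5) in blast)
    have "?tA * ?tB = ?tB * ?tA"
    proof (rule R.traces_commute[OF _ _ F(1) _ G(1) _ _ F(4,3) G(4,3)])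
      show "R.cancels 1" by (simp add: R.cancels_def R.e_one)
      \<comment> \<open>Multiplication by \<open>w\<close> shifts the inner coefficients, so it is
        injective although \<open>w\<close> is no unit.\<close>
      show "R.cancels fps_X"
        unfolding R.cancels_def
      proof (intro allI impI fps_ext)
        fix f :: "'n h_yangian fps fps" and i k assume "yZ fps_X * f = 0"
        then have "fps_nth (fps_nth (yZ fps_X * f) i) (Suc k) = 0" by simp
        then show "fps_nth (fps_nth f i) k = fps_nth (fps_nth 0 i) k" by (simp add: yZ_def ymap_X)
      qed
      show "length as = m" "length bs = n" by (simp_all add: as_def bs_def)
      show "R.O.H.delta b a dvd 1" if "a \<in> set (R.param 1 as)" "b \<in> set (R.param fps_X bs)" for a b
      proof (rule fps_dvd_one)
        from that obtain x y where xy: "a = fps_const x" "x \<in> set as" "b = fps_const y * fps_X"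
          by (auto simp: R.param_def)
        obtain c where c: "x = fps_exp c" using xy(2) by (auto simp: as_def)
        \<comment> \<open>Since \<open>b\<close> is a multiple of \<open>w\<close>, only
          \<open>- a^2\<close> survives at \<open>w = 0\<close>, and \<open>a\<close> is an
          exponential.\<close>
        have "fps_nth (R.O.H.delta b a) 0 * (- (fps_exp (- c))\<^sup>2) = (x * fps_exp (- c))\<^sup>2"
          by (simp add: R.O.H.delta_def xy power2_eq_square algebra_simps)
        also have "\<dots> = 1" unfolding c by (simp flip: fps_exp_add_mult)
        finally show "fps_nth (R.O.H.delta b a) 0 dvd 1" by (metis dvdI)
      qed
    qed
    then have AB: "(yZ (fps_const u) * jA ?A) * (yZ (fps_const u') * jB ?B) = (yZ (fps_const u') * jB ?B) * (yZ (fps_const u) * jA ?A)"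
      unfolding A B unfolding R.S.sm_def[symmetric] by (simp add: R.S.sm_simps mult.commute[of p p'])
    \<comment> \<open>The traces agree with the series up to the constants \<open>u\<close> and
      \<open>u'\<close>, which are nonzero and cancel because the h-Yangian is torsion-free.\<close>
    have "R.S.sm (u * u') (jA ?A * jB ?B) = R.S.sm (u * u') (jB ?B * jA ?A)"
      using AB unfolding R.S.sm_def[symmetric] by (simp add: R.S.sm_simps mult.commute[of u u'])
    then show ?thesis by (rule R.S.sm_cancel) (use F G in simp)
  qed
  then show ?thesis using coeff_jA_jB(1)[of ?A ?B r s] coeff_jA_jB(2)[of ?B ?A r s] by simp
qed

theorem proposition7p5:
  fixes lam mu :: "nat list"
    and m n :: nat
    and \<Lambda> \<Gamma> :: "nat \<times> nat \<Rightarrow> nat"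
  assumes "CARD('n::{finite,linorder}) \<ge> 2"
    and "m \<ge> 1" and "partition_of lam m" and "standard_tableau lam \<Lambda>"
    and "n \<ge> 1" and "partition_of mu n" and "standard_tableau mu \<Gamma>"
  shows "(\<forall>r s. fps_nth (ltab lam \<Lambda> :: 'n h_yangian fps) r * fps_nth (ltab mu \<Gamma>) s
              = fps_nth (ltab mu \<Gamma>) s * fps_nth (ltab lam \<Lambda>) r)
       \<and> in_z1 (ltab lam \<Lambda> :: 'n h_yangian fps) * in_z2 (ltab mu \<Gamma>)
         = in_z2 (ltab mu \<Gamma>) * in_z1 (ltab lam \<Lambda>)"
proof (intro conjI allI)
  let ?A = "ltab lam \<Lambda> :: 'n h_yangian fps" and ?B = "ltab mu \<Gamma> :: 'n h_yangian fps"
  have comm: "fps_nth ?A r * fps_nth ?B s = fps_nth ?B s * fps_nth ?A r" for r s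
    by (rule ltab_coeff_commute) (rule assms)+
  then show "fps_nth ?A r * fps_nth ?B s = fps_nth ?B s * fps_nth ?A r" for r s .
  show "in_z1 ?A * in_z2 ?B = in_z2 ?B * in_z1 ?A"
    by (intro fps_ext) (simp add: in_z1_def in_z2_def comm)
qed

end
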